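(* Let $T$ be large, $\tfrac12<\sigma<1$, and let $J\le(\log T)^{\sigma/2}$ be a positive integer. Let $s_1,\dots,s_J$ be complex numbers such that $$\tfrac12<\sigma=\min_j\mathrm{Re}(s_j)\le\max_j\mathrm{Re}(s_j)<1\quad\text{and}\quad\max_j|\mathrm{Im}(s_j)|<T^{(\sigma-\frac12)/4}.$$ Then $\mathcal D_T(s_1,\dots,s_J)\ll J^2/(\log T)^\sigma$, where $$\mathcal D_T(s_1,\dots,s_J)=\sup_{(\mathcal R_1,\dots,\mathcal R_J)}\Big|\frac1T\mathrm{meas}\{t\in[T,2T]:\log\zeta(s_j+it)\in\mathcal R_j\ \forall j\le J\}-\mathbb P\big(\log\zeta(s_j,X)\in\mathcal R_j\ \forall j\le J\big)\Big|,$$ the supremum being over all $J$-tuples of rectangles $\mathcal R_j\subset\mathbb C$ with sides parallel to the coordinate axes.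
   Context: $\zeta$ is the Riemann zeta function; for $\mathrm{Re}(s)>1/2$, $\log\zeta(s)$ is defined by continuous variation along the horizontal line from $+\infty$ (where it equals $\sum_n\Lambda(n)n^{-s}/\log n$). Let $\{X(p)\}_p$, indexed by the primes, be independent random variables uniformly distributed on the unit circle, and $\log\zeta(s,X)=-\sum_p\log(1-X(p)p^{-s})$ (principal branches), which converges almost surely for $\mathrm{Re}(s)>1/2$. meas is Lebesgue measure. *)

theory Defs
  imports
    "HOL-Complex_Analysis.Complex_Analysis"
    "HOL-Probability.Probability"
    "HOL-Number_Theory.Number_Theory"
begin

section \<open>The Riemann zeta function\<close>

text \<open>
  The half-plane on which the continuation is characterised contains every point at which
  \<open>zeta\<close> is used below.  It is connected after removal of the point 1, so the
  two conditions determine \<open>zeta\<close> there; values elsewhere are unspecified.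
\<close>

definition is_zeta :: "(complex \<Rightarrow> complex) \<Rightarrow> bool" where
  "is_zeta f \<longleftrightarrow> f holomorphic_on ({s. 0 < Re s} - {1}) \<and>
     (\<forall>s. 1 < Re s \<longrightarrow> (\<lambda>n. of_nat (Suc n) powr (- s)) sums f s)"

definition zeta :: "complex \<Rightarrow> complex" where
  "zeta = (SOME f. is_zeta f)"

text \<open>
  Such a continuation exists: compare the term \<open>n powr (- s)\<close> with the integral of
  \<open>x powr (- s)\<close> over \<open>[n, n + 1]\<close>.
\<close>

definition zeta_term :: "nat \<Rightarrow> complex \<Rightarrow> complex" where
  "zeta_term n s = of_nat (Suc n) powr (- s)
     - (of_nat (Suc (Suc n)) powr (1 - s) - of_nat (Suc n) powr (1 - s)) / (1 - s)"

lemma zeta_term_bound: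
  assumes "0 < Re s" "s \<noteq> 1"
  shows "norm (zeta_term n s) \<le> norm s * real (Suc n) powr (- Re s - 1)"
proof -
  define a b :: complex where "a = of_nat (Suc n)" and "b = of_nat (Suc (Suc n))"
  define S where "S = closed_segment a b"
  define B where "B = norm s * real (Suc n) powr (- Re s - 1)"
  have ba: "b - a = 1" by (simp add: a_def b_def)
  have S: "\<exists>x. z = of_real x \<and> real (Suc n) \<le> x \<and> x \<le> real (Suc n) + 1" if "z \<in> S" for z
  proof -
    have "\<exists>u. 0 \<le> u \<and> u \<le> 1 \<and> z = (1 - u) *\<^sub>R a + u *\<^sub>R b"
      using that unfolding S_def in_segment by metis
    then obtain u where u: "0 \<le> u" "u \<le> 1" "z = (1 - u) *\<^sub>R a + u *\<^sub>R b"
      by (elim exE conjE)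
    have "z = a + u *\<^sub>R (b - a)"
      unfolding u(3) by (simp add: scaleR_left_diff_distrib scaleR_right_diff_distrib)
    also have "\<dots> = of_real (real (Suc n) + u)"
      unfolding ba by (simp add: a_def scaleR_conv_of_real)
    finally show ?thesis using u(1,2) by (intro exI[of _ "real (Suc n) + u"]) auto
  qed
  have pos: "z \<notin> \<real>\<^sub>\<le>\<^sub>0" "z \<noteq> 0" if "z \<in> S" for z
    using S[OF that] by (auto simp: complex_nonpos_Reals_iff)
  have cv: "convex S" "a \<in> S" "b \<in> S" by (auto simp: S_def)
  have seg: "norm (z - a) \<le> 1" if "z \<in> S" for z
    using that segment_bound1[of z a b] ba by (auto simp: S_def norm_minus_commute)
  have 1: "norm (z powr (- s) - a powr (- s)) \<le> B" if z: "z \<in> S" for z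
  proof -
    have "norm (z powr (- s) - a powr (- s)) \<le> B * norm (z - a)"
    proof (rule field_differentiable_bound[OF cv(1) _ _ z cv(2)])
      fix w assume w: "w \<in> S"
      show "((\<lambda>w. w powr (- s)) has_field_derivative (- s) * w powr (- s - 1)) (at w within S)"
        using pos[OF w] by (auto intro!: derivative_eq_intros)
      obtain x where x: "w = of_real x" "real (Suc n) \<le> x" using S[OF w] by blast
      have "norm (w powr (- s - 1)) = x powr (- Re s - 1)"
        using x by (simp add: norm_powr_real_powr)
      also have "\<dots> \<le> real (Suc n) powr (- Re s - 1)"
        using x assms by (intro powr_mono2') auto
      finally show "norm ((- s) * w powr (- s - 1)) \<le> B"
        unfolding B_def norm_mult norm_minus_cancel by (rule mult_left_mono) simp
    qed
    also have "\<dots> \<le> B * 1"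
      using seg[OF z] by (intro mult_left_mono) (auto simp: B_def)
    finally show ?thesis by simp
  qed
  define \<phi> where "\<phi> = (\<lambda>z. z * a powr (- s) - z powr (1 - s) / (1 - s))"
  have "norm (\<phi> b - \<phi> a) \<le> B * norm (b - a)"
  proof (rule field_differentiable_bound[OF cv(1) _ _ cv(3) cv(2)])
    fix w assume w: "w \<in> S"
    show "(\<phi> has_field_derivative a powr (- s) - w powr (- s)) (at w within S)"
    proof -
      have "((\<lambda>z. z powr (1 - s)) has_field_derivative (1 - s) * w powr (1 - s - 1)) (at w within S)"
        using pos[OF w] by (auto intro!: derivative_eq_intros)
      from DERIV_cdivide[OF this, of "1 - s"]
      have "((\<lambda>z. z powr (1 - s) / (1 - s)) has_field_derivative w powr (- s)) (at w within S)"
        using assms by simp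
      from DERIV_diff[OF DERIV_cmult_right[OF DERIV_ident] this] show ?thesis
        unfolding \<phi>_def by simp
    qed
    show "norm (a powr (- s) - w powr (- s)) \<le> B"
      using 1[OF w] by (simp add: norm_minus_commute)
  qed
  moreover have "\<phi> b - \<phi> a = zeta_term n s"
  proof -
    have "\<phi> b - \<phi> a = (b - a) * a powr (- s) - (b powr (1 - s) - a powr (1 - s)) / (1 - s)"
      by (simp add: \<phi>_def algebra_simps diff_divide_distrib)
    then show ?thesis unfolding ba by (simp add: zeta_term_def a_def b_def)
  qed
  ultimately show ?thesis by (simp add: ba B_def)
qed

lemma summable_zeta_bound:
  assumes "0 < r"
  shows "summable (\<lambda>n. c * real (Suc n) powr (- r - 1))"
proof -
  have "summable (\<lambda>n. real n powr (- r - 1))" using assms by (subst summable_real_powr_iff) auto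
  then have "summable (\<lambda>n. real (Suc n) powr (- r - 1))" by (subst summable_Suc_iff)
  then show ?thesis by (rule summable_mult)
qed

lemma zeta_exists: "\<exists>f. is_zeta f"
proof -
  define S :: "complex set" where "S = {s. 0 < Re s} - {1}"
  define g where "g = (\<lambda>s. \<Sum>n. zeta_term n s)"
  have oS: "open S" unfolding S_def by (intro open_Diff open_halfspace_Re_gt) auto
  have smb: "summable (\<lambda>n. zeta_term n s)" if "s \<in> S" for s
  proof (rule summable_comparison_test'[where N = 0])
    show "summable (\<lambda>n. norm s * real (Suc n) powr (- Re s - 1))"
      using that by (intro summable_zeta_bound) (auto simp: S_def)
    show "norm (zeta_term n s) \<le> norm s * real (Suc n) powr (- Re s - 1)" for n
      using that by (intro zeta_term_bound) (auto simp: S_def)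
  qed
  have "g holomorphic_on S"
  proof (rule holomorphic_uniform_sequence[OF oS])
    show "(\<lambda>s. \<Sum>i<n. zeta_term i s) holomorphic_on S" for n
      unfolding zeta_term_def S_def by (intro holomorphic_intros) auto
    fix x assume x: "x \<in> S"
    then obtain d0 where d0: "d0 > 0" "cball x d0 \<subseteq> S"
      using oS open_contains_cball by blast
    define d where "d = min d0 (Re x / 2)"
    have d: "d > 0" "cball x d \<subseteq> S" using d0 x by (auto simp: d_def S_def)
    have r: "Re x / 2 > 0" using x by (auto simp: S_def)
    have "uniform_limit (cball x d) (\<lambda>n s. \<Sum>i<n. zeta_term i s) g sequentially"
      unfolding g_def
    proof (rule Weierstrass_m_test)
      show "summable (\<lambda>n. (norm x + d) * real (Suc n) powr (- (Re x / 2) - 1))"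
        using r by (rule summable_zeta_bound)
      fix n s assume s: "s \<in> cball x d"
      then have sS: "0 < Re s" "s \<noteq> 1" using d by (auto simp: S_def)
      have ns: "norm s \<le> norm x + d"
        using s norm_triangle_ineq2[of s x] by (auto simp: dist_norm norm_minus_commute)
      have "Re x - Re s \<le> d"
        using s complex_Re_le_cmod[of "x - s"] by (auto simp: dist_norm)
      then have rs: "Re x / 2 \<le> Re s" by (simp add: d_def min_def split: if_splits)
      have "norm (zeta_term n s) \<le> norm s * real (Suc n) powr (- Re s - 1)"
        using sS by (rule zeta_term_bound)
      also have "\<dots> \<le> (norm x + d) * real (Suc n) powr (- (Re x / 2) - 1)"
        using ns rs d by (intro mult_mono powr_mono) auto
      finally show "norm (zeta_term n s) \<le> (norm x + d) * real (Suc n) powr (- (Re x / 2) - 1)" .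
    qed
    with d show "\<exists>d>0. cball x d \<subseteq> S \<and>
        uniform_limit (cball x d) (\<lambda>n s. \<Sum>i<n. zeta_term i s) g sequentially" by blast
  qed
  then have hol: "(\<lambda>s. g s - 1 / (1 - s)) holomorphic_on S"
    by (intro holomorphic_intros) (auto simp: S_def)
  have "(\<lambda>n. of_nat (Suc n) powr (- s)) sums (g s - 1 / (1 - s))" if s: "1 < Re s" for s
  proof -
    have sS: "s \<in> S" "1 - s \<noteq> 0" using s by (auto simp: S_def)
    define h :: "nat \<Rightarrow> complex" where "h = (\<lambda>n. of_nat (Suc n) powr (1 - s) / (1 - s))"
    have "(\<lambda>n. real (Suc n) powr (1 - Re s)) \<longlonglongrightarrow> 0"
    proof (rule tendsto_neg_powr)
      show "1 - Re s < 0" using s by simp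
      show "filterlim (\<lambda>n. real (Suc n)) at_top sequentially"
        by (rule filterlim_compose[OF filterlim_real_sequentially filterlim_Suc])
    qed
    moreover have "norm ((of_nat (Suc n) :: complex) powr (1 - s)) = real (Suc n) powr (1 - Re s)" for n
      using norm_powr_real_powr[of "of_nat (Suc n)" "1 - s"] by simp
    ultimately have "(\<lambda>n. (of_nat (Suc n) :: complex) powr (1 - s)) \<longlonglongrightarrow> 0"
      by (subst tendsto_norm_zero_iff[symmetric]) simp
    from tendsto_divide[OF this tendsto_const[of "1 - s"]] have "h \<longlonglongrightarrow> 0"
      using sS by (simp add: h_def)
    then have "(\<lambda>n. h (Suc n) - h n) sums (0 - h 0)" by (rule telescope_sums)
    moreover have "(\<lambda>n. zeta_term n s) sums g s"
      unfolding g_def using smb[OF sS(1)] by (rule summable_sums)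
    ultimately have "(\<lambda>n. zeta_term n s + (h (Suc n) - h n)) sums (g s + (0 - h 0))"
      by (intro sums_add)
    then show ?thesis by (simp add: zeta_term_def h_def diff_divide_distrib)
  qed
  with hol show ?thesis unfolding is_zeta_def S_def by blast
qed

lemma is_zeta_zeta: "is_zeta zeta"
  unfolding zeta_def using zeta_exists by (rule someI_ex)


section \<open>The logarithm of zeta\<close>

text \<open>
  \<open>L\<close> is the continuous branch of \<open>log zeta\<close> along the horizontal ray from \<open>s\<close> to \<open>+\<infinity>\<close>
  that agrees with the Dirichlet series where the real part exceeds 1 (the terms of index 0 and 1
  vanish because \<open>mangoldt\<close> does).  No such \<open>L\<close> exists if a zero, or the pole, lies on the ray.
\<close>

definition is_log_zeta :: "complex \<Rightarrow> complex \<Rightarrow> bool" where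
  "is_log_zeta s w \<longleftrightarrow> (\<exists>L. continuous_on {Re s..} L \<and>
     (\<forall>x\<ge>Re s. exp (L x) = zeta (Complex x (Im s))) \<and>
     (\<forall>x\<ge>Re s. 1 < x \<longrightarrow>
        (\<lambda>n. mangoldt n * of_nat n powr (- Complex x (Im s)) / of_real (ln (real n))) sums L x) \<and>
     L (Re s) = w)"

text \<open>
  Where \<open>log zeta\<close> is undefined, the value is unspecified; for \<open>Re s > 1/2\<close> this concerns
  only finitely many \<open>t \<in> [T, 2T]\<close> in \<open>log_zeta (s + \<i> * t)\<close>, a null set.
\<close>

definition log_zeta :: "complex \<Rightarrow> complex" where
  "log_zeta s = (THE w. is_log_zeta s w)"


section \<open>The random model\<close>

definition uniform_circle :: "complex measure" where
  "uniform_circle = distr (uniform_measure lborel {0..2 * pi}) borel cis"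

text \<open>
  The sum runs over the primes in increasing order (for \<open>1/2 < Re s \<le> 1\<close> it does not converge
  absolutely); \<open>suminf\<close> is unspecified on the null set where it diverges.
\<close>

definition log_zeta_random :: "complex \<Rightarrow> (nat \<Rightarrow> 'a \<Rightarrow> complex) \<Rightarrow> 'a \<Rightarrow> complex" where
  "log_zeta_random s X \<omega> =
     - (\<Sum>p. if prime p then Ln (1 - X p \<omega> * of_nat p powr (- s)) else 0)"


section \<open>The discrepancy\<close>

text \<open>Any of the sides may be included or excluded.\<close>

definition rectangle :: "complex set \<Rightarrow> bool" where
  "rectangle R \<longleftrightarrow> (\<exists>A B. is_interval A \<and> bounded A \<and> is_interval B \<and> bounded B \<and>
     R = {z. Re z \<in> A \<and> Im z \<in> B})"

definition discrepancy ::
    "'a measure \<Rightarrow> (nat \<Rightarrow> 'a \<Rightarrow> complex) \<Rightarrow> real \<Rightarrow> nat \<Rightarrow> (nat \<Rightarrow> complex) \<Rightarrow> real" where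
  "discrepancy M X T J s =
     (SUP R \<in> {R :: nat \<Rightarrow> complex set. \<forall>j\<in>{1..J}. rectangle (R j)}.
        \<bar>1 / T * measure lebesgue {t \<in> {T..2 * T}. \<forall>j\<in>{1..J}. log_zeta (s j + \<i> * of_real t) \<in> R j}
         - measure M {\<omega> \<in> space M. \<forall>j\<in>{1..J}. log_zeta_random (s j) X \<omega> \<in> R j}\<bar>)"

end

theory Submission
  imports Defs "HOL-Real_Asymp.Real_Asymp"
begin

text \<open>
  Put \<open>L = ln T\<close> and let \<open>Y\<close> be a fixed large power of \<open>L\<close>.  Outside a set of \<open>t\<close> of relative measure
  \<open>O(J / L)\<close>, \<open>zeta\<close> times its Euler factors up to \<open>Y\<close> is within \<open>O(1 / L)\<close> of 1 to the right of \<open>s\<^sub>j + \<i> t\<close>: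
  replace \<open>zeta\<close> by a sum of length about \<open>3 T\<close>, truncate the product to integers with few prime factors,
  and bound the remaining Dirichlet polynomials in mean square.  Hence \<open>log_zeta\<close> is close to a short prime
  sum \<open>D\<close>; in the random model the same holds by subgaussian tails.
  The joint characteristic functions of the two prime sums agree up to \<open>exp (- c L / ln L)\<close> for frequencies
  of total size \<open>c L powr \<sigma>\<close>, by comparing high moments, and the random one decays in each variable.
  Smoothing the rectangles at the scale \<open>J / L powr \<sigma>\<close> with a Jackson kernel, each of the \<open>2 J\<close> coordinates
  costs \<open>O(J / L powr \<sigma>)\<close>.
\<close>

text \<open>The frequency limit comes from moments. As \<open>Y\<close> is a power of
  \<open>L\<close>, the \<open>2 k\<close>-th power of a prime sum has length at most a fixed power
  of \<open>Y ^ k\<close>, so its mean over \<open>t\<close> follows the random model only for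
  \<open>k\<close> up to a small multiple of \<open>L / ln L\<close>. For coefficients of size at
  most \<open>U * p powr -\<sigma>\<close>, splitting the primes at \<open>L\<close> bounds the
  logarithm of the exponential moment by a multiple of \<open>(U * L powr (1 - \<sigma>) + (U + U^2)
  * L powr (1 - 2 * \<sigma>)) / ln L\<close>. This stays below \<open>k\<close> when
  \<open>U\<close> is a small multiple of \<open>L powr \<sigma>\<close>. The \<open>J\<close>
  points share this budget, hence the scale \<open>J / L powr \<sigma>\<close> for each coordinate
  and the total \<open>J^2 / L powr \<sigma>\<close>. The range of \<open>J\<close> keeps the number
  of frequencies, a fixed power of \<open>L\<close> raised to \<open>2 * J\<close>, negligible
  against \<open>exp (\<kappa> * L / ln L)\<close>. Zeros of zeta are excluded implicitly: where
  zeta times its small Euler factors stays close to 1 along a ray, zeta has no zero on that ray, and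
  the branch of the logarithm is explicit there.\<close>

section \<open>Uniform measures on an interval and on the circle\<close>

lemma integral_uniform_interval:
  fixes f :: "real \<Rightarrow> 'b :: {banach, second_countable_topology}"
  assumes "a < b" and [measurable]: "f \<in> borel_measurable borel"
  shows "integral\<^sup>L (uniform_measure lborel {a..b}) f
    = (1 / (b - a)) *\<^sub>R (\<integral>x. indicator {a..b} x *\<^sub>R f x \<partial>lborel)"
proof -
  have "uniform_measure lborel {a..b}
      = density lborel (\<lambda>x. ennreal (indicator {a..b} x / (b - a)))"
    unfolding uniform_measure_def using assms(1)
    by (intro density_cong) (auto simp: divide_ennreal[symmetric] split: split_indicator)
  then have "integral\<^sup>L (uniform_measure lborel {a..b}) f
      = (\<integral>x. (indicator {a..b} x / (b - a)) *\<^sub>R f x \<partial>lborel)"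
    using assms(1) by (simp add: integral_density)
  also have "... = (\<integral>x. (1 / (b - a)) *\<^sub>R (indicator {a..b} x *\<^sub>R f x) \<partial>lborel)"
    by (intro Bochner_Integration.integral_cong) (auto split: split_indicator)
  also have "... = (1 / (b - a)) *\<^sub>R (\<integral>x. indicator {a..b} x *\<^sub>R f x \<partial>lborel)"
    by (rule integral_scaleR_right)
  finally show ?thesis .
qed

lemma borel_measurable_cis [measurable]: "cis \<in> borel_measurable borel"
  by (intro borel_measurable_continuous_onI continuous_intros)

lemma integral_cis_Icc:
  assumes "a \<le> b" "w \<noteq> 0"
  shows "(\<integral>x. indicator {a..b} x *\<^sub>R cis (w * x) \<partial>lborel) = (cis (w * b) - cis (w * a)) / (\<i> * w)"
proof -
  have "(\<integral>x. indicator {a..b} x *\<^sub>R cis (w * x) \<partial>lborel)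
      = cis (w * b) / (\<i> * w) - cis (w * a) / (\<i> * w)"
  proof (rule integral_FTC_Icc)
    fix x
    have "((\<lambda>z. exp (\<i> * w * z) / (\<i> * w)) has_field_derivative exp (\<i> * w * x)) (at (of_real x))"
      using assms(2) by (auto intro!: derivative_eq_intros)
    from has_vector_derivative_real_field[OF this, of "{a..b}"]
    show "((\<lambda>x. cis (w * x) / (\<i> * w)) has_vector_derivative cis (w * x)) (at x within {a..b})"
      by (simp add: cis_conv_exp mult.assoc)
  qed (use assms in \<open>auto intro!: continuous_intros\<close>)
  then show ?thesis by (simp add: diff_divide_distrib)
qed

lemma norm_uniform_cis_le:
  assumes "a < b" "w \<noteq> 0"
  shows "norm (integral\<^sup>L (uniform_measure lborel {a..b}) (\<lambda>x. cis (w * x))) \<le> 2 / ((b - a) * \<bar>w\<bar>)"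
proof -
  have "norm (cis (w * b) - cis (w * a)) \<le> 2"
    using norm_triangle_ineq4[of "cis (w*b)" "cis (w*a)"] by simp
  then show ?thesis using assms
    by (subst integral_uniform_interval)
       (simp_all add: integral_cis_Icc norm_divide norm_mult frac_le divide_right_mono)
qed

lemma uniform_circle_power:
  assumes "0 < m"
  shows "integral\<^sup>L uniform_circle (\<lambda>z. z ^ m) = 0"
proof -
  have "integral\<^sup>L uniform_circle (\<lambda>z. z ^ m)
      = integral\<^sup>L (uniform_measure lborel {0..2*pi}) (\<lambda>x. cis (real m * x))"
    unfolding uniform_circle_def by (subst integral_distr) (auto simp: Complex.DeMoivre)
  also have "... = 0" using assms
    by (subst integral_uniform_interval)
       (auto simp: integral_cis_Icc cis_multiple_2pi mult.commute[of _ "2*pi"])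
  finally show ?thesis .
qed

lemma AE_uniform_circle: "AE z in uniform_circle. norm z = 1"
  unfolding uniform_circle_def by (subst AE_distr_iff) auto

section \<open>Completely multiplicative functions and the random model\<close>

text \<open>The completely multiplicative function with prescribed values at the primes. It treats
  \<open>n powr (- \<i> * t)\<close> and the random multiplicative function by one
  formalism.\<close>

definition mext :: "(nat \<Rightarrow> complex) \<Rightarrow> nat \<Rightarrow> complex" where
  "mext f n = (\<Prod>p\<in>prime_factors n. f p ^ multiplicity p n)"

lemma mext_superset:
  assumes "finite P" "prime_factors n \<subseteq> P" "\<And>p. p \<in> P \<Longrightarrow> prime p"
  shows "mext f n = (\<Prod>p\<in>P. f p ^ multiplicity p n)"
  unfolding mext_def using assms
  by (intro prod.mono_neutral_left)
     (auto simp: prime_factors_multiplicity)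

lemma mext_mult:
  assumes "0 < m" "0 < n"
  shows "mext f (m * n) = mext f m * mext f n"
proof -
  let ?P = "prime_factors (m * n)"
  have P: "prime_factors m \<subseteq> ?P" "prime_factors n \<subseteq> ?P"
    using assms by (auto simp: prime_factors_product)
  have "mext f m * mext f n = (\<Prod>p\<in>?P. f p ^ multiplicity p m * f p ^ multiplicity p n)"
    using P by (subst (1 2) mext_superset[of ?P]) (auto simp: prod.distrib)
  also have "... = mext f (m * n)"
    unfolding mext_def using assms
    by (intro prod.cong) (auto simp: prime_elem_multiplicity_mult_distrib power_add in_prime_factors_iff)
  finally show ?thesis by simp
qed

lemma mext_1 [simp]: "mext f 1 = 1" "mext f (Suc 0) = 1" by (simp_all add: mext_def)

lemma mext_prime_power: "prime p \<Longrightarrow> mext f (p ^ k) = f p ^ k"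
proof (induction k)
  case (Suc k)
  have "mext f p = f p" using Suc.prems by (simp add: mext_def prime_factorization_prime)
  then show ?case using Suc by (simp add: mext_mult prime_gt_0_nat)
qed auto

lemma mext_eq_powr:
  assumes "0 < n"
  shows "mext (\<lambda>p. of_nat p powr w) n = of_nat n powr w"
  using assms
proof (induction n rule: prime_divisors_induct)
  case (factor p x)
  then have px: "0 < p" "0 < x" by (auto simp: prime_gt_0_nat)
  have "mext (\<lambda>p. of_nat p powr w) p = of_nat p powr w"
    using mext_prime_power[OF factor.hyps, of _ 1] by simp
  then show ?case using factor px
    by (simp add: mext_mult powr_times_real del: of_nat_mult)
       (simp add: powr_times_real)
qed (auto simp: mext_def)

lemma norm_mext:
  assumes "\<And>p. prime p \<Longrightarrow> norm (f p) = 1"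
  shows "norm (mext f n) = 1"
  unfolding mext_def using assms by (simp add: prod_norm[symmetric] norm_power in_prime_factors_iff)

lemma multiplicity_inj_nat:
  fixes m n :: nat
  assumes "0 < m" "0 < n" "\<And>p. prime p \<Longrightarrow> multiplicity p m = multiplicity p n"
  shows "m = n"
  using assms multiplicity_eq_nat[of m n] by auto

lemma borel_measurable_cnj [measurable]: "cnj \<in> borel_measurable borel"
  by (intro borel_measurable_continuous_onI continuous_intros)

text \<open>Independence, modulus 1 and vanishing positive moments are the properties of the uniform
  distribution on which the argument rests. The modulus is 1 at every sample point, not just almost
  surely, so that boundedness can be used pointwise.\<close>

locale rmodel = prob_space M for M :: "'a measure" +
  fixes X :: "nat \<Rightarrow> 'a \<Rightarrow> complex"
  assumes indep_X: "indep_vars (\<lambda>_. borel) X {p. prime p}"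
    and norm_X: "prime p \<Longrightarrow> norm (X p w) = 1"
    and expect_X: "prime p \<Longrightarrow> 0 < m \<Longrightarrow> expectation (\<lambda>w. X p w ^ m) = 0"
begin

abbreviation Xs :: "'a \<Rightarrow> nat \<Rightarrow> complex" where "Xs w \<equiv> \<lambda>p. X p w"

lemma measurable_X [measurable]: "prime p \<Longrightarrow> X p \<in> borel_measurable M"
  using indep_X by (auto simp: indep_vars_def)

text \<open>On the unit circle the conjugate is the inverse, so the common power cancels and only a
  positive power of \<open>X p\<close> or of its conjugate remains.\<close>

lemma expect_X_power:
  assumes "prime p"
  shows "expectation (\<lambda>w. X p w ^ a * cnj (X p w) ^ b) = (if a = b then 1 else 0)"
proof -
  have *: "X p w * cnj (X p w) = 1" for w
    using norm_X[OF assms, of w] by (simp add: complex_norm_square[symmetric])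
  consider "a = b" | "b < a" | "a < b" by linarith
  then show ?thesis
  proof cases
    case 1
    have "X p w ^ a * cnj (X p w) ^ b = 1" for w
      unfolding 1 power_mult_distrib[symmetric] * by simp
    then show ?thesis using 1 by (simp add: prob_space)
  next
    case 2
    have "X p w ^ a * cnj (X p w) ^ b = X p w ^ (a - b)" for w
    proof -
      have "X p w ^ a = X p w ^ (a - b) * X p w ^ b" using 2 by (simp flip: power_add)
      then have "X p w ^ a * cnj (X p w) ^ b = X p w ^ (a - b) * (X p w * cnj (X p w)) ^ b"
        by (simp add: power_mult_distrib)
      then show ?thesis by (simp add: *)
    qed
    then show ?thesis using 2 assms expect_X[of p "a - b"] by simp
  next
    case 3
    have "X p w ^ a * cnj (X p w) ^ b = cnj (X p w ^ (b - a))" for w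
    proof -
      have "cnj (X p w) ^ b = cnj (X p w) ^ (b - a) * cnj (X p w) ^ a" using 3 by (simp flip: power_add)
      then have "X p w ^ a * cnj (X p w) ^ b = cnj (X p w) ^ (b - a) * (X p w * cnj (X p w)) ^ a"
        by (simp add: power_mult_distrib)
      then show ?thesis by (simp add: *)
    qed
    then show ?thesis using 3 assms expect_X[of p "b - a"] by (simp del: complex_cnj_power)
  qed
qed

text \<open>Orthogonality of the random multiplicative function. Independence factors the
  expectation over the primes dividing \<open>m * n\<close>, and a factor vanishes as soon as the
  multiplicities differ; unique factorisation does the rest.\<close>

lemma expect_mext:
  assumes "0 < m" "0 < n"
  shows "expectation (\<lambda>w. mext (Xs w) m * cnj (mext (Xs w) n)) = (if m = n then 1 else 0)"
proof -
  define P where "P = prime_factors (m * n)"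
  have P: "finite P" "prime_factors m \<subseteq> P" "prime_factors n \<subseteq> P" "\<And>p. p \<in> P \<Longrightarrow> prime p"
    using assms by (auto simp: prime_factors_product P_def)
  define f where "f p w = X p w ^ multiplicity p m * cnj (X p w) ^ multiplicity p n" for p w
  have "expectation (\<lambda>w. mext (Xs w) m * cnj (mext (Xs w) n)) = expectation (\<lambda>w. \<Prod>p\<in>P. f p w)"
    unfolding f_def using P by (simp add: mext_superset[of P] prod.distrib)
  also have "... = (\<Prod>p\<in>P. expectation (f p))"
  proof (rule indep_vars_lebesgue_integral)
    have "indep_vars (\<lambda>_. borel) X P" using P(4) by (intro indep_vars_subset[OF indep_X]) auto
    then show "indep_vars (\<lambda>_. borel) f P"
      unfolding f_def by (rule indep_vars_compose2) measurable
    fix p assume p: "p \<in> P"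
    then have [measurable]: "X p \<in> borel_measurable M" using P by auto
    show "integrable M (f p)"
      unfolding f_def using norm_X[OF P(4)[OF p]]
      by (intro integrable_const_bound[where B = 1]) (auto simp: norm_mult norm_power)
  qed (use P in auto)
  also have "... = (\<Prod>p\<in>P. if multiplicity p m = multiplicity p n then 1 else 0)"
    unfolding f_def using P by (intro prod.cong) (auto simp: expect_X_power)
  also have "... = (if m = n then 1 else 0)"
  proof (cases "m = n")
    case False
    then obtain p where p: "prime p" "multiplicity p m \<noteq> multiplicity p n"
      using multiplicity_inj_nat[OF assms] by blast
    then have "p \<in> P" unfolding P_def
      using assms by (auto simp: prime_factors_multiplicity prime_elem_multiplicity_mult_distrib)
    then show ?thesis using False p P by (auto simp: prod_zero_iff)
  qed auto
  finally show ?thesis .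
qed

end

section \<open>Polynomials in the values at primes and their conjugates\<close>

text \<open>\<open>N\<close> bounds the integers that occur and \<open>B\<close> the sum of the
  absolute values of the coefficients; both multiply under products. As a predicate on functions of
  \<open>\<xi>\<close>, it lets the same \<open>F\<close> be evaluated at \<open>tchar t\<close> and
  at a sample point. The conjugate factor is there so that real parts and absolute squares stay in
  the class.\<close>

inductive gpoly :: "nat \<Rightarrow> real \<Rightarrow> ((nat \<Rightarrow> complex) \<Rightarrow> complex) \<Rightarrow> bool" where
  gpoly_mono: "1 \<le> m \<Longrightarrow> m \<le> N \<Longrightarrow> 1 \<le> n \<Longrightarrow> n \<le> N \<Longrightarrow> norm c \<le> B \<Longrightarrow>
     gpoly N B (\<lambda>\<xi>. c * (mext \<xi> m * cnj (mext \<xi> n)))"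
| gpoly_add: "gpoly N B F \<Longrightarrow> gpoly N B' G \<Longrightarrow> gpoly N (B + B') (\<lambda>\<xi>. F \<xi> + G \<xi>)"

lemma gpoly_pos: "gpoly N B F \<Longrightarrow> 0 \<le> B \<and> 1 \<le> N"
  by (induction rule: gpoly.induct) (auto intro: order_trans[OF norm_ge_zero])

lemma gpoly_const: "1 \<le> N \<Longrightarrow> norm c \<le> B \<Longrightarrow> gpoly N B (\<lambda>_. c)"
  using gpoly_mono[of 1 N 1 c B] by simp

lemma gpoly_mext: "1 \<le> n \<Longrightarrow> n \<le> N \<Longrightarrow> norm c \<le> B \<Longrightarrow> gpoly N B (\<lambda>\<xi>. c * mext \<xi> n)"
  using gpoly_mono[of n N 1 c B] by simp

lemma gpoly_weaken: "gpoly N B F \<Longrightarrow> N \<le> N' \<Longrightarrow> B \<le> B' \<Longrightarrow> gpoly N' B' F"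
proof (induction arbitrary: B' rule: gpoly.induct)
  case (gpoly_mono m N n c B)
  then show ?case by (intro gpoly.gpoly_mono) auto
next
  case (gpoly_add N B1 F B2 G)
  then show ?case using gpoly.gpoly_add[of N' B1 F "B' - B1" G] by simp
qed

lemma gpoly_cnj: "gpoly N B F \<Longrightarrow> gpoly N B (\<lambda>\<xi>. cnj (F \<xi>))"
proof (induction rule: gpoly.induct)
  case (gpoly_mono m N n c B)
  then show ?case using gpoly.gpoly_mono[of n N m "cnj c" B] by (simp add: mult_ac)
next
  case (gpoly_add N B1 F B2 G)
  then show ?case using gpoly.gpoly_add by simp
qed

lemma gpoly_mult: "gpoly N B F \<Longrightarrow> gpoly N' B' G \<Longrightarrow> gpoly (N * N') (B * B') (\<lambda>\<xi>. F \<xi> * G \<xi>)"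
proof (induction rule: gpoly.induct)
  case (gpoly_mono m N n c B)
  note 1 = this
  from 1(6) show ?case
  proof (induction rule: gpoly.induct)
    case (gpoly_mono m' N' n' c' B')
    have "norm (c * c') \<le> B * B'"
      using 1 gpoly_mono unfolding norm_mult by (intro mult_mono) (auto intro: order_trans[OF norm_ge_zero])
    then have "gpoly (N * N') (B * B') (\<lambda>\<xi>. c * c' * (mext \<xi> (m * m') * cnj (mext \<xi> (n * n'))))"
      using 1 gpoly_mono by (intro gpoly.gpoly_mono mult_le_mono) auto
    then show ?case using 1 gpoly_mono by (simp add: mext_mult mult_ac)
  next
    case (gpoly_add N B1 F B2 G)
    then show ?case using gpoly.gpoly_add by (fastforce simp: algebra_simps)
  qed
next
  case (gpoly_add N B1 F B2 G)
  then show ?case using gpoly.gpoly_add by (fastforce simp: algebra_simps)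
qed

lemma gpoly_power: "gpoly N B F \<Longrightarrow> gpoly (N ^ i) (B ^ i) (\<lambda>\<xi>. F \<xi> ^ i)"
  by (induction i) (auto intro: gpoly_mult gpoly_const)

lemma gpoly_sum:
  assumes "finite A" "1 \<le> N" "\<And>i. i \<in> A \<Longrightarrow> gpoly N (B i) (F i)"
  shows "gpoly N (\<Sum>i\<in>A. B i) (\<lambda>\<xi>. \<Sum>i\<in>A. F i \<xi>)"
  using assms by (induction rule: finite_induct) (auto intro: gpoly_add gpoly_const)

text \<open>Half the sum with the conjugate, which keeps the coefficient bound
  \<open>B\<close>.\<close>

lemma gpoly_Re:
  assumes "gpoly N B F"
  shows "gpoly N B (\<lambda>\<xi>. of_real (Re (F \<xi>)))"
proof -
  have N: "1 \<le> N" using gpoly_pos[OF assms] by simp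
  have "gpoly N (1/2 * (B + B)) (\<lambda>\<xi>. 1/2 * (F \<xi> + cnj (F \<xi>)))"
    using gpoly_mult[OF gpoly_const[of 1 "1/2" "1/2"] gpoly_add[OF assms gpoly_cnj[OF assms]]] N
    by simp
  moreover have "(\<lambda>\<xi>. 1/2 * (F \<xi> + cnj (F \<xi>))) = (\<lambda>\<xi>. of_real (Re (F \<xi>)))"
    by (auto simp: complex_add_cnj)
  ultimately show ?thesis by simp
qed

lemma gpoly_measurable:
  assumes "gpoly N B F" "\<And>p. prime p \<Longrightarrow> X p \<in> borel_measurable M"
  shows "(\<lambda>w. F (\<lambda>p. X p w)) \<in> borel_measurable M"
  using assms
proof (induction rule: gpoly.induct)
  case (gpoly_mono m N n c B)
  have "(\<lambda>w. mext (\<lambda>p. X p w) k) \<in> borel_measurable M" for k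
    unfolding mext_def using gpoly_mono by (intro borel_measurable_prod borel_measurable_power) auto
  note [measurable] = this[of m] this[of n]
  show ?case by measurable
qed auto

lemma gpoly_bound:
  assumes "gpoly N B F" "\<And>p. prime p \<Longrightarrow> norm (\<xi> p) = 1"
  shows "norm (F \<xi>) \<le> B"
  using assms
  by (induction rule: gpoly.induct)
     (auto simp: norm_mult norm_mext intro: order_trans[OF norm_triangle_ineq] add_mono)

section \<open>Means over t against expectations\<close>

definition umeas :: "real \<Rightarrow> real \<Rightarrow> real measure" where "umeas a b = uniform_measure lborel {a..b}"

abbreviation tmeas :: "real \<Rightarrow> real measure" where "tmeas T \<equiv> umeas T (2 * T)"

definition tchar :: "real \<Rightarrow> nat \<Rightarrow> complex" where
  "tchar t p = cis (- t * ln (real p))"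

lemma prob_space_umeas: "a < b \<Longrightarrow> prob_space (umeas a b)"
  unfolding umeas_def by (intro prob_space_uniform_measure) auto

lemma prob_space_tmeas: "0 < T \<Longrightarrow> prob_space (tmeas T)"
  by (rule prob_space_umeas) simp

lemma sets_umeas [simp, measurable_cong]: "sets (umeas a b) = sets borel"
  by (simp add: umeas_def)

lemma space_umeas [simp]: "space (umeas a b) = UNIV"
  by (simp add: umeas_def)

lemma tchar_measurable [measurable]: "(\<lambda>t. tchar t p) \<in> borel_measurable (tmeas T)"
  unfolding tchar_def by measurable

lemma norm_tchar [simp]: "norm (tchar t p) = 1"
  by (simp add: tchar_def)

lemma powr_conv_cis: "0 < n \<Longrightarrow> of_nat n powr (- \<i> * of_real t) = cis (- t * ln (real n))"
  by (simp add: powr_def cis_conv_exp mult_ac Ln_of_nat)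

lemma mext_tchar:
  assumes "0 < n"
  shows "mext (tchar t) n = cis (- t * ln (real n))"
proof -
  have "mext (tchar t) n = mext (\<lambda>p. of_nat p powr (- \<i> * of_real t)) n"
    unfolding mext_def tchar_def
    by (intro prod.cong) (auto simp: powr_conv_cis[simplified] prime_gt_0_nat in_prime_factors_iff)
  then show ?thesis using assms by (simp only: mext_eq_powr powr_conv_cis)
qed

text \<open>From \<open>ln (a / b) \<le> a / b - 1\<close>. The distance of \<open>m\<close> and
  \<open>n\<close> is kept in the numerator because the mean value estimate later sums its
  inverses.\<close>

lemma ln_diff_nat_ge:
  fixes m n N :: nat
  assumes "1 \<le> m" "m \<le> N" "1 \<le> n" "n \<le> N" "m \<noteq> n"
  shows "\<bar>real m - real n\<bar> / real N \<le> \<bar>ln (real n) - ln (real m)\<bar>"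
proof -
  have *: "(real b - real a) / real N \<le> ln (real b) - ln (real a)" if "1 \<le> a" "a < b" "b \<le> N" for a b :: nat
  proof -
    have "ln (real a / real b) \<le> real a / real b - 1" using that by (intro ln_le_minus_one) auto
    also have "... = - ((real b - real a) / real b)" using that by (simp add: field_simps)
    finally have "(real b - real a) / real b \<le> ln (real b) - ln (real a)"
      using that by (simp add: ln_div)
    moreover have "(real b - real a) / real N \<le> (real b - real a) / real b"
      using that by (intro divide_left_mono) auto
    ultimately show ?thesis by linarith
  qed
  show ?thesis using *[of m n] *[of n m] assms by (cases "m < n") auto
qed

text \<open>Approximate orthogonality: for \<open>m \<noteq> n\<close> the integrand oscillates with
  frequency at least \<open>1 / N\<close>, so its mean over an interval of length \<open>T\<close>
  is at most \<open>2 * N / T\<close>.\<close>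

lemma expect_tchar:
  fixes m n N :: nat
  assumes "0 < T" "1 \<le> m" "m \<le> N" "1 \<le> n" "n \<le> N"
  shows "norm (integral\<^sup>L (tmeas T) (\<lambda>t. mext (tchar t) m * cnj (mext (tchar t) n))
     - (if m = n then 1 else 0)) \<le> 2 * N / T"
proof -
  interpret prob_space "tmeas T" using assms by (intro prob_space_tmeas)
  have *: "mext (tchar t) m * cnj (mext (tchar t) n)
     = cis ((ln (real n) - ln (real m)) * t)" for t
    using assms by (simp add: mext_tchar cis_cnj cis_mult algebra_simps)
  show ?thesis
  proof (cases "m = n")
    case True
    then show ?thesis using assms prob_space unfolding * by (simp del: space_umeas)
  next
    case False
    define w where "w = ln (real n) - ln (real m)"
    have N: "0 < real N" using assms by auto
    have "1 / real N \<le> \<bar>real m - real n\<bar> / real N" using False by (intro divide_right_mono) auto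
    then have w: "1 / real N \<le> \<bar>w\<bar>" using ln_diff_nat_ge[of m N n] assms False by (simp add: w_def)
    have w0: "w \<noteq> 0" using w N by (auto simp: field_simps)
    have "norm (integral\<^sup>L (tmeas T) (\<lambda>t. cis (w * t))) \<le> 2 / ((2*T - T) * \<bar>w\<bar>)"
      unfolding umeas_def by (rule norm_uniform_cis_le) (use assms w0 in auto)
    also have "... \<le> 2 / ((2 * T - T) * (1 / real N))"
      using assms w N by (intro divide_left_mono mult_left_mono mult_pos_pos) auto
    also have "... = 2 * N / T" using assms by simp
    finally show ?thesis using False by (simp add: * w_def)
  qed
qed

lemma norm_integral_le:
  fixes f :: "'a \<Rightarrow> 'b::{banach,second_countable_topology}"
  assumes "integrable M f" "integrable M g" "\<And>x. x \<in> space M \<Longrightarrow> norm (f x) \<le> g x"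
  shows "norm (\<integral>x. f x \<partial>M) \<le> (\<integral>x. g x \<partial>M)"
  using order_trans[OF integral_norm_bound integral_mono[of M "\<lambda>x. norm (f x)" g]] assms by auto

context rmodel begin

text \<open>On a monomial one side is exactly orthogonal and the other is so up to
  \<open>2 * N / T\<close>; the errors add up with the coefficients.\<close>

lemma gpoly_compare:
  assumes "gpoly N B F" "0 < T"
  shows "norm (integral\<^sup>L (tmeas T) (\<lambda>t. F (tchar t)) - expectation (\<lambda>w. F (Xs w)))
     \<le> B * (2 * N / T)"
  using assms
proof (induction rule: gpoly.induct)
  case (gpoly_mono m N n c B)
  have B: "0 \<le> B" using gpoly_mono(5) norm_ge_zero order_trans by blast
  have mn: "0 < m" "0 < n" using gpoly_mono by auto
  have "norm (c * (integral\<^sup>L (tmeas T) (\<lambda>t. mext (tchar t) m * cnj (mext (tchar t) n))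
     - (if m = n then 1 else 0))) \<le> B * (2 * N / T)"
    unfolding norm_mult using gpoly_mono B by (intro mult_mono expect_tchar) auto
  then show ?case by (simp add: expect_mext[OF mn] algebra_simps)
next
  case (gpoly_add N B1 F B2 G)
  interpret T: prob_space "tmeas T" using gpoly_add by (intro prob_space_tmeas)
  have 1: "integrable M (\<lambda>w. H (Xs w))" if "gpoly N B H" for B H
    using that gpoly_bound[OF that] norm_X
    by (intro integrable_const_bound[where B = B] gpoly_measurable[OF that]) auto
  have 2: "integrable (tmeas T) (\<lambda>w. H (tchar w))" if "gpoly N B H" for B H
    using that gpoly_bound[OF that]
    by (intro T.integrable_const_bound[where B = B] gpoly_measurable[OF that]) auto
  show ?case
    using gpoly_add 1[OF gpoly_add(1)] 2[OF gpoly_add(1)] 1[OF gpoly_add(2)] 2[OF gpoly_add(2)]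
      norm_diff_triangle_ineq[of "integral\<^sup>L (tmeas T) (\<lambda>t. F (tchar t))"
        "integral\<^sup>L (tmeas T) (\<lambda>t. G (tchar t))" "expectation (\<lambda>w. F (Xs w))"
        "expectation (\<lambda>w. G (Xs w))"]
    by (simp add: distrib_right add_divide_distrib)
qed

text \<open>Taylor expansion to order \<open>2 * k - 1\<close>. The remainder is an even power,
  hence without absolute values, so its mean is again a moment that the comparison of polynomials
  covers. Moments up to order \<open>2 * k\<close> therefore determine the characteristic function
  up to the \<open>2 * k\<close>-th moment over \<open>fact (2 * k)\<close>.\<close>

lemma iexp_compare:
  assumes D: "gpoly N B D" and "0 < T" "1 \<le> B" "0 < k"
  shows "norm (integral\<^sup>L (tmeas T) (\<lambda>t. iexp (Re (D (tchar t))))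
       - expectation (\<lambda>w. iexp (Re (D (Xs w)))))
     \<le> 2 * expectation (\<lambda>w. Re (D (Xs w)) ^ (2 * k)) / fact (2 * k)
       + (2 * k + 1) * (2 * (B * N) ^ (2 * k) / T)"
proof -
  interpret T: prob_space "tmeas T" using assms by (intro prob_space_tmeas)
  define R :: "(nat \<Rightarrow> complex) \<Rightarrow> complex" where "R \<xi> = of_real (Re (D \<xi>))" for \<xi>
  \<comment> \<open>The comparison error for the highest power that occurs; it dominates those for
    the lower powers because \<open>B * N\<close> is at least 1.\<close>
  define \<epsilon> where "\<epsilon> = 2 * (B * N) ^ (2 * k) / T"
  have N: "1 \<le> N" using gpoly_pos[OF D] by simp
  have BN: "1 \<le> B * N" using mult_mono[of 1 B 1 "real N"] assms N by simp
  have Rg: "gpoly N B R" unfolding R_def by (rule gpoly_Re[OF D])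
  note Rp = gpoly_power[OF Rg]
  define S where "S \<xi> = (\<Sum>i\<le>2*k-1. (\<i> * R \<xi>) ^ i / fact i)" for \<xi>
  have cmp: "norm ((LINT t|tmeas T. R (tchar t) ^ i) - expectation (\<lambda>w. R (Xs w) ^ i)) \<le> \<epsilon>"
    if "i \<le> 2 * k" for i
  proof -
    have "norm ((LINT t|tmeas T. R (tchar t) ^ i) - expectation (\<lambda>w. R (Xs w) ^ i))
       \<le> B ^ i * (2 * real (N ^ i) / T)"
      by (rule gpoly_compare[OF Rp \<open>0 < T\<close>])
    also have "... = 2 * (B * N) ^ i / T" by (simp add: power_mult_distrib)
    also have "... \<le> \<epsilon>" unfolding \<epsilon>_def
      using that BN assms by (intro divide_right_mono mult_left_mono power_increasing) auto
    finally show ?thesis .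
  qed
  have int: "integrable M (\<lambda>w. R (Xs w) ^ i)" for i
    using gpoly_bound[OF Rp] norm_X
    by (intro integrable_const_bound[where B = "B ^ i"] gpoly_measurable[OF Rp]) auto
  have intT: "integrable (tmeas T) (\<lambda>t. R (tchar t) ^ i)" for i
    using gpoly_bound[OF Rp]
    by (intro T.integrable_const_bound[where B = "B ^ i"] gpoly_measurable[OF Rp]) auto
  have [measurable]: "(\<lambda>w. Re (D (Xs w))) \<in> borel_measurable M"
    "(\<lambda>t. Re (D (tchar t))) \<in> borel_measurable (tmeas T)"
    using gpoly_measurable[OF D, of X M] gpoly_measurable[OF D, of "\<lambda>p t. tchar t p" "tmeas T"] by auto
  have Sx: "norm (iexp (Re (D \<xi>)) - S \<xi>) \<le> Re (R \<xi> ^ (2*k)) / fact (2 * k)" for \<xi>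
  proof -
    have "Suc (2 * k - 1) = 2 * k" using assms by simp
    then show ?thesis
      using iexp_approx1[of "Re (D \<xi>)" "2 * k - 1"]
      by (simp add: S_def R_def power_even_abs flip: of_real_power)
  qed
  have SM: "expectation (\<lambda>w. S (Xs w)) = (\<Sum>i\<le>2*k-1. \<i> ^ i / fact i * expectation (\<lambda>w. R (Xs w) ^ i))"
    using int by (simp add: S_def power_mult_distrib)
  have ST: "(LINT t|tmeas T. S (tchar t)) = (\<Sum>i\<le>2*k-1. \<i> ^ i / fact i * (LINT t|tmeas T. R (tchar t) ^ i))"
    using intT by (simp add: S_def power_mult_distrib)
  have iS: "integrable M (\<lambda>w. S (Xs w))" "integrable (tmeas T) (\<lambda>t. S (tchar t))"
    using int intT by (auto simp: S_def power_mult_distrib)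
  have \<epsilon>0: "0 \<le> \<epsilon>" using assms by (auto simp: \<epsilon>_def)
  have "norm ((LINT t|tmeas T. S (tchar t)) - expectation (\<lambda>w. S (Xs w)))
     \<le> (\<Sum>i\<le>2*k-1. norm (\<i> ^ i / fact i * ((LINT t|tmeas T. R (tchar t) ^ i) - expectation (\<lambda>w. R (Xs w) ^ i))))"
    unfolding SM ST sum_subtractf[symmetric] right_diff_distrib[symmetric] by (rule norm_sum)
  also have "... \<le> (\<Sum>i\<le>2*k-1. 1 * \<epsilon>)"
    unfolding norm_mult using \<epsilon>0
    by (intro sum_mono mult_mono cmp) (auto simp: norm_divide norm_power)
  also have "... = 2 * k * \<epsilon>" using assms by (simp add: of_nat_diff)
  finally have A: "norm ((LINT t|tmeas T. S (tchar t)) - expectation (\<lambda>w. S (Xs w))) \<le> 2 * k * \<epsilon>" .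
  let ?E = "expectation (\<lambda>w. Re (R (Xs w) ^ (2 * k)))"
  have B: "norm (expectation (\<lambda>w. iexp (Re (D (Xs w)))) - expectation (\<lambda>w. S (Xs w)))
     \<le> ?E / fact (2 * k)"
  proof -
    have i: "integrable M (\<lambda>w. iexp (Re (D (Xs w))))"
      by (intro integrable_const_bound[where B = 1]) auto
    have "norm (expectation (\<lambda>w. iexp (Re (D (Xs w)))) - expectation (\<lambda>w. S (Xs w)))
      = norm (expectation (\<lambda>w. iexp (Re (D (Xs w))) - S (Xs w)))"
      using i iS by simp
    also have "... \<le> expectation (\<lambda>w. Re (R (Xs w) ^ (2*k)) / fact (2 * k))"
      using i iS int by (intro norm_integral_le Sx) auto
    finally show ?thesis by simp
  qed
  have "norm ((LINT t|tmeas T. iexp (Re (D (tchar t)))) - (LINT t|tmeas T. S (tchar t)))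
     \<le> (LINT t|tmeas T. Re (R (tchar t) ^ (2*k))) / fact (2 * k)"
  proof -
    have i: "integrable (tmeas T) (\<lambda>t. iexp (Re (D (tchar t))))"
      by (intro T.integrable_const_bound[where B = 1]) auto
    have "norm ((LINT t|tmeas T. iexp (Re (D (tchar t)))) - (LINT t|tmeas T. S (tchar t)))
      = norm ((LINT t|tmeas T. iexp (Re (D (tchar t))) - S (tchar t)))"
      using i iS by simp
    also have "... \<le> (LINT t|tmeas T. Re (R (tchar t) ^ (2*k)) / fact (2 * k))"
      using i iS intT by (intro norm_integral_le Sx) auto
    finally show ?thesis by simp
  qed
  \<comment> \<open>The remainder over \<open>t\<close> is exchanged for the random one, since
    moment bounds are available in the random model only.\<close>
  also have "... \<le> (?E + \<epsilon>) / fact (2 * k)"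
  proof (intro divide_right_mono)
    have "Re ((LINT t|tmeas T. R (tchar t) ^ (2*k)) - expectation (\<lambda>w. R (Xs w) ^ (2*k))) \<le> \<epsilon>"
      using order_trans[OF complex_Re_le_cmod cmp[of "2 * k"]] by simp
    then show "(LINT t|tmeas T. Re (R (tchar t) ^ (2*k))) \<le> ?E + \<epsilon>"
      using int[of "2*k"] intT[of "2*k"] by simp
  qed auto
  also have "... \<le> ?E / fact (2 * k) + \<epsilon>"
    using divide_left_mono[OF fact_ge_1[of "2 * k", where ?'a = real] \<epsilon>0]
    by (simp add: add_divide_distrib)
  finally have C: "norm ((LINT t|tmeas T. iexp (Re (D (tchar t)))) - (LINT t|tmeas T. S (tchar t)))
     \<le> ?E / fact (2 * k) + \<epsilon>" .
  have tri: "norm (a - b) \<le> norm (a - c) + norm (c - d) + norm (b - d)" for a b c d :: complex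
    using norm_triangle_ineq[of "a - c" "c - b"] norm_triangle_ineq[of "c - d" "d - b"]
    by (simp add: norm_minus_commute)
  have "norm (integral\<^sup>L (tmeas T) (\<lambda>t. iexp (Re (D (tchar t))))
       - expectation (\<lambda>w. iexp (Re (D (Xs w)))))
    \<le> 2 * ?E / fact (2 * k) + (2 * k + 1) * \<epsilon>"
    using A B C by (intro order_trans[OF tri[of _ _ "(LINT t|tmeas T. S (tchar t))" "expectation (\<lambda>w. S (Xs w))"]]) (simp add: algebra_simps)
  then show ?thesis by (simp add: R_def \<epsilon>_def add.commute flip: of_real_power)
qed

end

section \<open>Chebyshev bounds\<close>

definition psi :: "nat \<Rightarrow> real" where "psi n = (\<Sum>d=1..n. mangoldt d)"

lemma psi_mono: "m \<le> n \<Longrightarrow> psi m \<le> psi n"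
  unfolding psi_def by (intro sum_mono2) (auto simp: mangoldt_nonneg)

text \<open>Legendre's formula. Passing from \<open>n\<close> to \<open>n + 1\<close> adds
  \<open>ln (n + 1)\<close>, the sum of \<open>mangoldt\<close> over the divisors of
  \<open>n + 1\<close>, and these are exactly the \<open>d\<close> for which the quotient
  grows.\<close>

lemma ln_fact_eq_mangoldt: "ln (fact n) = (\<Sum>d=1..n. mangoldt d * real (n div d))"
proof (induction n)
  case (Suc n)
  have "ln (fact (Suc n)) = ln (real (Suc n)) + ln (fact n)"
    by (simp add: ln_mult)
  also have "ln (real (Suc n)) = (\<Sum>d | d dvd Suc n. mangoldt d :: real)"
    by (subst mangoldt_sum) auto
  also have "... = (\<Sum>d=1..Suc n. if d dvd Suc n then mangoldt d else 0)"
  proof -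
    have "{d. d dvd Suc n} = {d\<in>{1..Suc n}. d dvd Suc n}"
      by (auto dest: dvd_imp_le intro: Nat.gr0I simp: Suc_le_eq)
    then show ?thesis by (simp only: sum.inter_filter finite_atLeastAtMost)
  qed
  also have "ln (fact n) = (\<Sum>d=1..Suc n. mangoldt d * real (n div d))"
    unfolding Suc.IH by (intro sum.mono_neutral_left) auto
  also have "(\<Sum>d=1..Suc n. if d dvd Suc n then mangoldt d else 0) + (\<Sum>d=1..Suc n. mangoldt d * real (n div d))
     = (\<Sum>d=1..Suc n. mangoldt d * real (Suc n div d))"
    unfolding sum.distrib[symmetric]
  proof (intro sum.cong refl)
    fix d assume d: "d \<in> {1..Suc n}"
    have "Suc n div d = (if d dvd Suc n then Suc (n div d) else n div d)"
      using d by (simp add: div_Suc dvd_eq_mod_eq_0)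
    then show "(if d dvd Suc n then mangoldt d else 0) + mangoldt d * real (n div d) = mangoldt d * real (Suc n div d)"
      by (auto simp: algebra_simps)
  qed
  finally show ?case .
qed auto

lemma ln_central_binomial:
  "ln (real ((2 * n) choose n)) = (\<Sum>d=1..2*n. mangoldt d * (real (2 * n div d) - 2 * real (n div d)))"
proof -
  have "real ((2 * n) choose n) = fact (2 * n) / (fact n * fact n)"
    by (subst binomial_fact) (auto simp: mult_2)
  then have "ln (real ((2 * n) choose n)) = ln (fact (2 * n)) - 2 * ln (fact n)"
    by (simp add: ln_div ln_mult)
  also have "ln (fact n) = (\<Sum>d=1..2*n. mangoldt d * real (n div d))"
    unfolding ln_fact_eq_mangoldt by (intro sum.mono_neutral_left) auto
  also have "ln (fact (2 * n)) - 2 * ... = (\<Sum>d=1..2*n. mangoldt d * (real (2 * n div d) - 2 * real (n div d)))"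
    unfolding ln_fact_eq_mangoldt by (simp add: sum_subtractf[symmetric] sum_distrib_left algebra_simps)
  finally show ?thesis .
qed

text \<open>Chebyshev's observation: the weights in the central binomial coefficient are 0 or 1,
  which compares it with \<open>psi\<close> from both sides.\<close>

lemma double_div_bounds:
  fixes n d :: nat
  shows "0 \<le> real (2 * n div d) - 2 * real (n div d)" "real (2 * n div d) - 2 * real (n div d) \<le> 1"
proof -
  have "2 * (n div d) \<le> 2 * n div d" "2 * n div d \<le> 2 * (n div d) + 1"
  proof -
    show "2 * (n div d) \<le> 2 * n div d"
      using div_mult2_eq by (cases "d = 0") (auto simp: less_eq_div_iff_mult_less_eq algebra_simps)
    show "2 * n div d \<le> 2 * (n div d) + 1"
    proof (cases "d = 0")
      case False
      have "n mod d < d" using False by simp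
      then have "2 * n < d * (2 * (n div d) + 2)"
        using mult_div_mod_eq[of d n] distrib_left[of d "2 * (n div d)" 2] by linarith
      then have "2 * n div d < 2 * (n div d) + 2" using False by (simp add: less_mult_imp_div_less mult.commute)
      then show ?thesis by simp
    qed auto
  qed
  then have "real (2 * (n div d)) \<le> real (2 * n div d)" "real (2 * n div d) \<le> real (2 * (n div d) + 1)"
    by (simp_all only: of_nat_le_iff)
  then show "0 \<le> real (2 * n div d) - 2 * real (n div d)" "real (2 * n div d) - 2 * real (n div d) \<le> 1"
    by auto
qed

lemma psi_double_ge: "ln (real ((2 * n) choose n)) \<le> psi (2 * n)"
  unfolding ln_central_binomial psi_def
  by (intro sum_mono mult_left_le) (auto simp: double_div_bounds mangoldt_nonneg)

text \<open>For \<open>n < d \<le> 2 * n\<close> the weight of \<open>d\<close> in the central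
  binomial coefficient is exactly 1, and that coefficient is at most \<open>4 ^ n\<close>.\<close>

lemma psi_double_diff: "psi (2 * n) - psi n \<le> n * ln 4"
proof -
  have "psi (2 * n) - psi n = (\<Sum>d\<in>{n<..2*n}. mangoldt d)"
  proof -
    have "{1..2*n} = {1..n} \<union> {n<..2*n}" by auto
    then have "psi (2 * n) = psi n + (\<Sum>d\<in>{n<..2*n}. mangoldt d)"
      unfolding psi_def by (simp only:) (subst sum.union_disjoint, auto)
    then show ?thesis by simp
  qed
  also have "... = (\<Sum>d\<in>{n<..2*n}. mangoldt d * (real (2 * n div d) - 2 * real (n div d)))"
  proof (intro sum.cong refl)
    fix d assume d: "d \<in> {n<..2*n}"
    then have "n div d = 0" by simp
    moreover have "2 * n div d = 1"
      by (rule div_nat_eqI) (use d in auto)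
    ultimately show "mangoldt d = (mangoldt d :: real) * (real (2 * n div d) - 2 * real (n div d))" by simp
  qed
  also have "... \<le> (\<Sum>d=1..2*n. mangoldt d * (real (2 * n div d) - 2 * real (n div d)))"
    by (intro sum_mono2 mult_nonneg_nonneg mangoldt_nonneg double_div_bounds) auto
  also have "... = ln (real ((2 * n) choose n))" by (rule ln_central_binomial[symmetric])
  also have "... \<le> ln (4 ^ n)"
  proof -
    have "(2 * n) choose n \<le> 2 ^ (2 * n)" by (rule binomial_le_pow2)
    then have "real ((2 * n) choose n) \<le> real (2 ^ (2 * n))" by (simp only: of_nat_le_iff)
    then show ?thesis by (intro ln_mono) (auto simp: power_mult zero_less_binomial)
  qed
  also have "... = n * ln 4" by (simp add: ln_realpow)
  finally show ?thesis .
qed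

lemma ln_4_less: "ln 4 < (3/2 :: real)"
proof -
  have "ln (4::real) = 2 * ln 2" using ln_realpow[of 2 2] by simp
  then show ?thesis using ln2_le_25_over_36 by simp
qed

lemma psi_power2_le: "psi (2 ^ k) \<le> 2 ^ k * ln 4"
proof (induction k)
  case (Suc k)
  have "psi (2 ^ Suc k) \<le> psi (2 ^ k) + 2 ^ k * ln 4" using psi_double_diff[of "2 ^ k"] by simp
  also have "... \<le> 2 ^ k * ln 4 + 2 ^ k * ln 4" using Suc by simp
  finally show ?case by simp
qed (simp add: psi_def)

text \<open>Rounding up to a power of 2 costs a factor 2, and twice \<open>ln 4\<close> is below
  3.\<close>

lemma psi_le: "psi n \<le> 3 * real n"
proof (cases "n = 0")
  case False
  define k where "k = floor_log n"
  have k: "2 ^ k \<le> n" "n < 2 ^ Suc k" using False floor_log_exp2_le[of n] floor_log_exp2_gt[of n] by (auto simp: k_def)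
  have "psi n \<le> psi (2 ^ Suc k)" using k by (intro psi_mono) auto
  also have "... \<le> 2 ^ Suc k * ln 4" by (rule psi_power2_le)
  also have "... \<le> 2 ^ Suc k * (3/2)" using ln_4_less by (intro mult_left_mono) auto
  also have "... = 3 * real (2 ^ k)" by simp
  also have "real (2 ^ k) \<le> real n" by (simp only: of_nat_le_iff k)
  finally show ?thesis by simp
qed (simp add: psi_def)

text \<open>The central binomial coefficient is the largest of \<open>2 * m + 1\<close> terms with
  sum \<open>4 ^ m\<close>. The factor 8 leaves room for the logarithm of \<open>2 * m + 1\<close>
  and for rounding \<open>n\<close> down to an even number.\<close>

lemma psi_ge: "4 \<le> n \<Longrightarrow> real n \<le> 8 * psi n"
proof -
  assume n: "4 \<le> n"
  define m where "m = n div 2"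
  have m: "2 * m \<le> n" "n \<le> 2 * m + 1" "2 \<le> m" using n by (auto simp: m_def)
  have "(2 * m + 1) * real ((2 * m) choose m) \<ge> 4 ^ m"
  proof -
    have "real (2 ^ (2 * m)) = (\<Sum>k\<le>2*m. real ((2 * m) choose k))"
      by (simp only: choose_row_sum[symmetric] of_nat_sum)
    also have "... \<le> (\<Sum>k\<le>2*m. real ((2 * m) choose m))"
      by (intro sum_mono) (auto simp: binomial_maximum')
    finally show ?thesis by (simp add: power_mult)
  qed
  then have "ln (4 ^ m) \<le> ln ((2 * m + 1) * real ((2 * m) choose m))"
    by (intro ln_mono) auto
  also have "... = ln (2 * m + 1) + ln (real ((2 * m) choose m))"
    by (subst ln_mult) auto
  also have "... \<le> ln (2 * m + 1) + psi n"
    using psi_double_ge[of m] psi_mono[OF m(1)] by simp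
  finally have 1: "m * ln 4 - ln (2 * real m + 1) \<le> psi n" by (simp add: ln_realpow add.commute)
  \<comment> \<open>The tangent of the logarithm at 5, the smallest value of
    \<open>2 * m + 1\<close>.\<close>
  have "ln ((2 * real m + 1) / 5) \<le> (2 * real m + 1) / 5 - 1" by (intro ln_le_minus_one) auto
  then have "5 * ln (2 * real m + 1) \<le> 2 * real m + 5 * ln 5 - 4" by (simp add: ln_div field_simps)
  moreover have "ln 5 \<le> (2::real)"
  proof -
    have "5/2 \<le> (exp 1 :: real)" using exp_lower_Taylor_quadratic[of "1::real"] by simp
    from mult_mono[OF this this] have "(5::real) \<le> exp 1 * exp 1" by simp
    also have "... = exp (2::real)" by (simp flip: exp_add)
    finally show ?thesis using ln_mono[of 5 "exp (2::real)"] by simp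
  qed
  moreover have "4 * real m \<le> 3 * (real m * ln 4)"
  proof -
    have "4 \<le> 3 * ln (4::real)" using ln2_ge_two_thirds ln_realpow[of 2 2] by simp
    from mult_left_mono[OF this, of "real m"] show ?thesis by simp
  qed
  ultimately have "14 * real m \<le> 15 * psi n + 18"
    using 1 by argo
  moreover have "real n \<le> 2 * real m + 1" "2 \<le> real m" using m by linarith+
  ultimately show ?thesis by argo
qed

section \<open>Sums over primes\<close>

text \<open>Half-open, so that adjacent ranges can be glued without overlap; \<open>a = 0\<close>
  gives all primes up to \<open>b\<close>.\<close>

definition primes_in :: "real \<Rightarrow> real \<Rightarrow> nat set" where
  "primes_in a b = {p. prime p \<and> a < real p \<and> real p \<le> b}"

lemma finite_primes_in [simp]: "finite (primes_in a b)"
  by (rule finite_subset[of _ "{..nat \<lfloor>b\<rfloor>}"]) (auto simp: primes_in_def le_nat_floor)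

lemma sum_ln_primes_le:
  assumes "0 \<le> b"
  shows "(\<Sum>p\<in>primes_in a b. ln (real p)) \<le> 3 * b"
proof -
  have "(\<Sum>p\<in>primes_in a b. ln (real p)) = (\<Sum>p\<in>primes_in a b. mangoldt p)"
    by (intro sum.cong) (auto simp: primes_in_def)
  also have "... \<le> psi (nat \<lfloor>b\<rfloor>)"
    unfolding psi_def
    by (intro sum_mono2) (auto simp: primes_in_def le_nat_floor mangoldt_nonneg Suc_le_eq prime_gt_0_nat)
  also have "... \<le> 3 * real (nat \<lfloor>b\<rfloor>)" by (rule psi_le)
  also have "... \<le> 3 * b" using assms by simp
  finally show ?thesis .
qed

text \<open>On a block from \<open>x\<close> to \<open>2 * x\<close> the inequality
  \<open>1 \<le> ln p / ln x\<close> brings in the Chebyshev bound and with it a factor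
  \<open>1 / ln x\<close>, which is at most \<open>1 / ln w\<close>. The blocks form a geometric
  series, left unsummed because its ratio may lie on either side of 1.\<close>

lemma sum_primes_dyadic:
  assumes "1 < w" "0 \<le> \<alpha>"
  shows "(\<Sum>p\<in>primes_in w (2 ^ k * w). real p powr (- \<alpha>))
    \<le> 6 / ln w * w powr (1 - \<alpha>) * (\<Sum>i<k. (2 powr (1 - \<alpha>)) ^ i)"
proof (induction k)
  case 0
  have "primes_in w w = {}" by (auto simp: primes_in_def)
  then show ?case by simp
next
  case (Suc k)
  define x where "x = 2 ^ k * w"
  have x: "w \<le> x" "1 < x" using assms mult_right_mono[of 1 "2 ^ k" w] by (auto simp: x_def intro: less_le_trans)
  have "primes_in w (2 ^ Suc k * w) = primes_in w x \<union> primes_in x (2 * x)"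
    using x by (auto simp: primes_in_def x_def)
  moreover have "primes_in w x \<inter> primes_in x (2 * x) = {}" by (auto simp: primes_in_def)
  ultimately have eq: "(\<Sum>p\<in>primes_in w (2 ^ Suc k * w). real p powr (- \<alpha>))
    = (\<Sum>p\<in>primes_in w x. real p powr (- \<alpha>)) + (\<Sum>p\<in>primes_in x (2*x). real p powr (- \<alpha>))"
    by (simp add: sum.union_disjoint)
  have "(\<Sum>p\<in>primes_in x (2*x). real p powr (- \<alpha>)) \<le> (\<Sum>p\<in>primes_in x (2*x). x powr (- \<alpha>) * (ln (real p) / ln x))"
  proof (intro sum_mono)
    fix p assume "p \<in> primes_in x (2 * x)"
    then have p: "x < real p" by (simp add: primes_in_def)
    have "real p powr (- \<alpha>) \<le> x powr (- \<alpha>) * 1" using powr_mono2'[of "-\<alpha>" x "real p"] p x assms by simp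
    also have "x powr (- \<alpha>) * 1 \<le> x powr (- \<alpha>) * (ln (real p) / ln x)"
      using p x by (intro mult_left_mono) auto
    finally show "real p powr (- \<alpha>) \<le> x powr (- \<alpha>) * (ln (real p) / ln x)" .
  qed
  also have "... = x powr (- \<alpha>) / ln x * (\<Sum>p\<in>primes_in x (2*x). ln (real p))"
    by (simp add: sum_distrib_left)
  also have "... \<le> x powr (- \<alpha>) / ln x * (3 * (2 * x))"
    using x by (intro mult_left_mono sum_ln_primes_le) auto
  also have "... = 6 / ln x * x powr (1 - \<alpha>)"
    using x by (simp add: powr_diff powr_minus field_simps)
  also have "... \<le> 6 / ln w * x powr (1 - \<alpha>)"
    using x assms by (intro mult_right_mono divide_left_mono mult_pos_pos) auto
  also have "x powr (1 - \<alpha>) = (2 powr (1 - \<alpha>)) ^ k * w powr (1 - \<alpha>)"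
    using assms by (simp add: x_def powr_mult powr_power powr_realpow[symmetric] powr_powr mult.commute)
  finally show ?case using Suc unfolding eq x_def[symmetric] by (simp add: algebra_simps)
qed

text \<open>The ratio of the dyadic series is below 1, so the first block dominates. The factor
  \<open>1 / ln z\<close>, absent from the sum over all integers, is what matches the moment order
  \<open>L / ln L\<close> later.\<close>

lemma sum_primes_tail:
  assumes "1 < \<beta>" "1 < z"
  shows "(\<Sum>p\<in>primes_in z y. real p powr (- \<beta>)) \<le> 6 / (1 - 2 powr (1 - \<beta>)) * z powr (1 - \<beta>) / ln z"
proof -
  have r: "2 powr (1 - \<beta>) < (1::real)" using assms by (simp add: powr_less_one)
  obtain k where k: "y / z < 2 ^ k" using real_arch_pow[of 2 "y / z"] by auto
  have "(\<Sum>p\<in>primes_in z y. real p powr (- \<beta>)) \<le> (\<Sum>p\<in>primes_in z (2 ^ k * z). real p powr (- \<beta>))"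
    using k assms by (intro sum_mono2 finite_primes_in) (auto simp: primes_in_def field_simps)
  also have "... \<le> 6 / ln z * z powr (1 - \<beta>) * (\<Sum>i<k. (2 powr (1 - \<beta>)) ^ i)"
    using assms by (intro sum_primes_dyadic) auto
  also have "... \<le> 6 / ln z * z powr (1 - \<beta>) * (1 / (1 - 2 powr (1 - \<beta>)))"
  proof (intro mult_left_mono)
    have "(\<Sum>i<k. (2 powr (1 - \<beta>)) ^ i) \<le> (\<Sum>i. (2 powr (1 - \<beta>)) ^ i)"
      using r by (intro sum_le_suminf summable_geometric) auto
    then show "(\<Sum>i<k. (2 powr (1 - \<beta>)) ^ i) \<le> 1 / (1 - 2 powr (1 - \<beta>))"
      using r by (simp add: suminf_geometric)
  qed (use assms in auto)
  finally show ?thesis by (simp add: field_simps)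
qed

lemma sum_powr_le:
  assumes "0 \<le> \<alpha>" "\<alpha> < 1"
  shows "(\<Sum>n=1..N. real n powr (- \<alpha>)) \<le> real N powr (1 - \<alpha>) / (1 - \<alpha>)"
proof (induction N)
  case (Suc N)
  have "real (Suc N) powr (- \<alpha>) \<le> (real (Suc N) powr (1 - \<alpha>) - real N powr (1 - \<alpha>)) / (1 - \<alpha>)"
  proof (cases "N = 0")
    case False
    have "\<exists>z. real N < z \<and> z < real (Suc N) \<and> real (Suc N) powr (1 - \<alpha>) - real N powr (1 - \<alpha>)
       = (real (Suc N) - real N) * ((1 - \<alpha>) * z powr (- \<alpha>))"
    proof (rule MVT2)
      fix x assume "real N \<le> x"
      then have "0 < x" using False by (auto simp: less_le_trans)
      then show "((\<lambda>x. x powr (1 - \<alpha>)) has_real_derivative (1 - \<alpha>) * x powr (- \<alpha>)) (at x)"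
        using has_real_derivative_powr[of x "1 - \<alpha>"] by simp
    qed auto
    then obtain z where z: "real N < z" "z < real (Suc N)"
      "real (Suc N) powr (1 - \<alpha>) - real N powr (1 - \<alpha>) = (1 - \<alpha>) * z powr (- \<alpha>)" by auto
    have "real (Suc N) powr (- \<alpha>) \<le> z powr (- \<alpha>)" using z False assms by (intro powr_mono2') auto
    then show ?thesis using assms unfolding z(3) by simp
  qed (use assms in \<open>simp add: field_simps\<close>)
  then show ?case using Suc by (simp add: diff_divide_distrib)
qed simp

lemma sum_primes_head:
  assumes "0 \<le> \<alpha>" "\<alpha> < 1"
  shows "\<exists>C>0. \<forall>z\<ge>2. (\<Sum>p\<in>primes_in 0 z. real p powr (- \<alpha>)) \<le> C * z powr (1 - \<alpha>) / ln z"
proof -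
  define q where "q = 2 powr (1 - \<alpha>)"
  have q: "1 < q" using assms by (simp add: q_def)
  define C where "C = 2 / (1 - \<alpha>) ^ 2 + 12 * q / (q - 1)"
  have "(\<Sum>p\<in>primes_in 0 z. real p powr (- \<alpha>)) \<le> C * z powr (1 - \<alpha>) / ln z" if z: "2 \<le> z" for z
  proof -
    define w where "w = sqrt z"
    have w: "1 < w" "w * w = z" "ln w = ln z / 2" "w \<le> z" using z by (auto simp: w_def ln_sqrt intro!: real_le_lsqrt self_le_power)
    obtain k0 where "z / w < 2 ^ k0" using real_arch_pow[of 2 "z / w"] by auto
    \<comment> \<open>The least number of doublings that covers \<open>z\<close> overshoots by at
      most a factor 2.\<close>
    define k where "k = (LEAST k. z / w \<le> 2 ^ k)"
    have k1: "z / w \<le> 2 ^ k" unfolding k_def by (rule LeastI[of _ k0]) (use \<open>z / w < 2 ^ k0\<close> in auto)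
    have k2: "2 ^ k \<le> 2 * (z / w)"
    proof (cases k)
      case 0 then show ?thesis using w by (simp add: field_simps)
    next
      case (Suc j)
      then have "\<not> z / w \<le> 2 ^ j" using not_less_Least[of j "\<lambda>k. z / w \<le> 2 ^ k"] by (simp add: k_def)
      then show ?thesis using Suc by simp
    qed
    have "z \<le> 2 ^ k * w" using k1 w by (simp add: field_simps)
    then have "primes_in 0 z \<subseteq> primes_in 0 w \<union> primes_in w (2 ^ k * w)"
      by (auto simp: primes_in_def)
    then have "(\<Sum>p\<in>primes_in 0 z. real p powr (- \<alpha>)) \<le> (\<Sum>p\<in>primes_in 0 w \<union> primes_in w (2 ^ k * w). real p powr (- \<alpha>))"
      by (intro sum_mono2) auto
    also have "... = (\<Sum>p\<in>primes_in 0 w. real p powr (- \<alpha>)) + (\<Sum>p\<in>primes_in w (2 ^ k * w). real p powr (- \<alpha>))"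
      by (intro sum.union_disjoint finite_primes_in) (auto simp: primes_in_def)
    also have "(\<Sum>p\<in>primes_in 0 w. real p powr (- \<alpha>)) \<le> (\<Sum>n=1..nat \<lfloor>w\<rfloor>. real n powr (- \<alpha>))"
      by (intro sum_mono2) (auto simp: primes_in_def le_nat_floor Suc_le_eq)
    also have "... \<le> real (nat \<lfloor>w\<rfloor>) powr (1 - \<alpha>) / (1 - \<alpha>)" by (rule sum_powr_le[OF assms])
    also have "... \<le> w powr (1 - \<alpha>) / (1 - \<alpha>)"
      using assms w by (intro divide_right_mono powr_mono2) auto
    also have "... \<le> 2 / (1 - \<alpha>) ^ 2 * z powr (1 - \<alpha>) / ln z"
    proof -
      \<comment> \<open>The integers below \<open>w = sqrt z\<close> contribute about
        \<open>w powr (1 - \<alpha>)\<close>, the square root of the main term; the bound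
        \<open>ln u \<le> u - 1\<close> at \<open>u = w powr (1 - \<alpha>)\<close> turns this
        saving into the logarithm required.\<close>
      have "(1 - \<alpha>) * ln w \<le> w powr (1 - \<alpha>)"
        using ln_le_minus_one[of "w powr (1 - \<alpha>)"] w(1) by (simp add: ln_powr)
      then have "w powr (1 - \<alpha>) * ((1 - \<alpha>) * ln w) \<le> w powr (1 - \<alpha>) * w powr (1 - \<alpha>)"
        by (intro mult_left_mono) auto
      also have "... = z powr (1 - \<alpha>)" using w by (simp flip: powr_mult)
      finally have "w powr (1 - \<alpha>) \<le> z powr (1 - \<alpha>) / ((1 - \<alpha>) * ln w)"
        using assms w(1) by (simp add: pos_le_divide_eq)
      then have "w powr (1 - \<alpha>) / (1 - \<alpha>) \<le> z powr (1 - \<alpha>) / ((1 - \<alpha>) * ln w) / (1 - \<alpha>)"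
        using assms by (intro divide_right_mono) auto
      also have "... = 2 / (1 - \<alpha>) ^ 2 * z powr (1 - \<alpha>) / ln z"
        unfolding w(3) by (simp add: power2_eq_square mult_ac)
      finally show ?thesis .
    qed
    finally have *: "(\<Sum>p\<in>primes_in 0 z. real p powr (- \<alpha>)) \<le> 2 / (1 - \<alpha>) ^ 2 * z powr (1 - \<alpha>) / ln z
      + (\<Sum>p\<in>primes_in w (2 ^ k * w). real p powr (- \<alpha>))" by simp
    have "(\<Sum>p\<in>primes_in w (2 ^ k * w). real p powr (- \<alpha>)) \<le> 6 / ln w * w powr (1 - \<alpha>) * (\<Sum>i<k. q ^ i)"
      unfolding q_def using w assms by (intro sum_primes_dyadic) auto
    also have "... \<le> 6 / ln w * w powr (1 - \<alpha>) * ((2 * (z / w)) powr (1 - \<alpha>) / (q - 1))"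
    proof (intro mult_left_mono)
      have "(\<Sum>i<k. q ^ i) \<le> q ^ k / (q - 1)"
        using q by (simp add: geometric_sum divide_right_mono)
      also have "q ^ k = (2 ^ k) powr (1 - \<alpha>)"
        by (simp add: q_def powr_power powr_realpow[symmetric] powr_powr mult.commute)
      also have "(2 ^ k) powr (1 - \<alpha>) / (q - 1) \<le> (2 * (z / w)) powr (1 - \<alpha>) / (q - 1)"
        using k2 assms q by (intro divide_right_mono powr_mono2) auto
      finally show "(\<Sum>i<k. q ^ i) \<le> (2 * (z / w)) powr (1 - \<alpha>) / (q - 1)" .
    qed (use w in auto)
    also have "... = 12 * q / (q - 1) * z powr (1 - \<alpha>) / ln z"
    proof -
      have "ln z = 2 * ln w" using w by simp
      then show ?thesis using w(1) q z by (simp add: powr_mult powr_divide q_def)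
    qed
    finally show ?thesis using * by (simp add: C_def distrib_right add_divide_distrib)
  qed
  moreover have "C > 0" using q assms by (auto simp: C_def intro!: add_pos_pos)
  ultimately show ?thesis by blast
qed

text \<open>A proper prime power up to \<open>N\<close> has base at most \<open>sqrt N\<close> and
  exponent at most \<open>log 2 N\<close>, and its weight is at most \<open>ln N\<close>.\<close>

lemma nonprime_primepow_sum:
  fixes N :: nat
  shows
  "(\<Sum>d | d \<in> {1..N} \<and> \<not> prime d. mangoldt d) \<le> (sqrt N + 1) * (log 2 N + 1) * ln N"
proof (cases "N = 0")
  case False
  let ?Q = "{d \<in> {1..N}. primepow d \<and> \<not> prime d}"
  let ?R = "{..nat \<lfloor>sqrt N\<rfloor>} \<times> {..floor_log N}"
  have sub: "?Q \<subseteq> (\<lambda>(p, m). p ^ m) ` ?R"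
  proof
    fix d assume d: "d \<in> ?Q"
    then obtain p m where pm: "prime p" "0 < m" "d = p ^ m" by (auto simp: primepow_def)
    have "m \<noteq> 1" using d pm by auto
    then have m: "2 \<le> m" using pm by linarith
    have "p ^ 2 \<le> p ^ m" using m pm by (intro power_increasing) (auto simp: prime_ge_Suc_0_nat)
    then have "real (p ^ 2) \<le> real N" using d pm by (simp only: of_nat_le_iff) auto
    then have "real p \<le> sqrt N" by (intro real_le_rsqrt) simp
    then have 1: "p \<le> nat \<lfloor>sqrt N\<rfloor>" by (simp add: le_nat_floor)
    have "2 ^ m \<le> p ^ m" using pm by (intro power_mono) (auto simp: prime_ge_2_nat)
    also have "p ^ m \<le> N" using d pm by auto
    finally have "2 ^ m \<le> N" .
    then have "floor_log (2 ^ m) \<le> floor_log N" by (rule floor_log_le_iff)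
    then have "m \<le> floor_log N" by simp
    with 1 pm show "d \<in> (\<lambda>(p, m). p ^ m) ` ?R" by auto
  qed
  have "real (floor_log N) \<le> log 2 N"
  proof -
    have "real (2 ^ floor_log N) \<le> real N" using floor_log_exp2_le[of N] False by (simp only: of_nat_le_iff)
    then show ?thesis using False by (simp add: le_log_iff powr_realpow)
  qed
  have "card ?Q \<le> (nat \<lfloor>sqrt N\<rfloor> + 1) * (floor_log N + 1)"
    using card_mono[OF _ sub] card_image_le[of ?R "\<lambda>(p, m). p ^ m"] by (simp add: card_cartesian_product)
  then have "real (card ?Q) \<le> real ((nat \<lfloor>sqrt N\<rfloor> + 1) * (floor_log N + 1))"
    by (rule of_nat_mono)
  moreover have "... = (real (nat \<lfloor>sqrt N\<rfloor>) + 1) * (real (floor_log N) + 1)"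
    by (simp only: of_nat_mult of_nat_add of_nat_1)
  moreover have "... \<le> (sqrt N + 1) * (log 2 N + 1)"
    using \<open>real (floor_log N) \<le> log 2 N\<close> by (intro mult_mono) auto
  ultimately have card: "real (card ?Q) \<le> (sqrt N + 1) * (log 2 N + 1)" by linarith
  have "(\<Sum>d | d \<in> {1..N} \<and> \<not> prime d. mangoldt d) = (\<Sum>d\<in>?Q. mangoldt d :: real)"
    by (intro sum.mono_neutral_right) (auto simp: mangoldt_def)
  also have "... \<le> (\<Sum>d\<in>?Q. ln N)"
  proof (intro sum_mono)
    fix d assume "d \<in> ?Q"
    then have "mangoldt d \<le> ln (real d)" "ln (real d) \<le> ln N" by (auto intro!: mangoldt_le)
    then show "mangoldt d \<le> ln (real N)" by linarith
  qed
  also have "... = real (card ?Q) * ln N" by simp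
  also have "... \<le> (sqrt N + 1) * (log 2 N + 1) * ln N"
    using card False by (intro mult_right_mono) auto
  finally show ?thesis .
qed simp

lemma sum_Un_le:
  fixes f :: "'b \<Rightarrow> real"
  assumes "finite A" "finite B" "\<And>x. x \<in> A \<union> B \<Longrightarrow> 0 \<le> f x"
  shows "sum f (A \<union> B) \<le> sum f A + sum f B"
  using sum.union_inter[of A B f] assms sum_nonneg[of "A \<inter> B" f] by auto

text \<open>The lower Chebyshev bound gives \<open>psi (40 * x)\<close> about \<open>5 * x\<close>,
  of which the integers up to \<open>x\<close> take at most \<open>3 * x\<close> and the proper
  prime powers at most \<open>x\<close>. The factor 40 is chosen to exceed
  \<open>8 * (3 + 1)\<close>. The weak count \<open>sqrt x\<close> suffices for the decay of the
  characteristic function.\<close>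

lemma many_primes: "\<forall>\<^sub>F x in at_top. sqrt x \<le> real (card (primes_in x (40 * x)))"
proof -
  have "\<forall>\<^sub>F x::real in at_top. (sqrt (40 * x) + 1) * (log 2 (40 * x) + 1) * ln (40 * x) \<le> x"
    by real_asymp
  moreover have "\<forall>\<^sub>F x::real in at_top. sqrt x * ln (40 * x) \<le> x - 1"
    by real_asymp
  ultimately show ?thesis using eventually_ge_at_top[of 1]
  proof eventually_elim
    case (elim x)
    define N where "N = nat \<lfloor>40 * x\<rfloor>"
    have N: "real N \<le> 40 * x" "40 * x - 1 \<le> real N" "4 \<le> N" using elim by (auto simp: N_def) linarith+
    let ?m = "nat \<lfloor>x\<rfloor>"
    have mN: "?m \<le> N" unfolding N_def using elim by (intro nat_mono floor_mono) auto
    have "psi N \<le> psi ?m + (\<Sum>d | d \<in> {1..N} \<and> \<not> prime d. mangoldt d) + (\<Sum>d\<in>primes_in x (40 * x). mangoldt d)"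
    proof -
      have sub: "{1..N} \<subseteq> {1..?m} \<union> {d. d \<in> {1..N} \<and> \<not> prime d} \<union> primes_in x (40 * x)"
      proof
        fix d assume d: "d \<in> {1..N}"
        have "real d \<le> 40 * x" using d N by (auto intro: order_trans)
        moreover have "x < real d" if "\<not> d \<le> ?m" using that by (simp add: le_nat_floor not_le) (meson le_nat_floor not_le)
        ultimately show "d \<in> {1..?m} \<union> {d. d \<in> {1..N} \<and> \<not> prime d} \<union> primes_in x (40 * x)"
          using d by (auto simp: primes_in_def)
      qed
      have "psi N \<le> (\<Sum>d\<in>{1..?m} \<union> {d. d \<in> {1..N} \<and> \<not> prime d} \<union> primes_in x (40 * x). mangoldt d)"
        unfolding psi_def by (rule sum_mono2[OF _ sub]) (auto simp: mangoldt_nonneg)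
      also have "... \<le> (\<Sum>d\<in>{1..?m} \<union> {d. d \<in> {1..N} \<and> \<not> prime d}. mangoldt d) + (\<Sum>d\<in>primes_in x (40 * x). mangoldt d)"
        by (intro sum_Un_le) (auto simp: mangoldt_nonneg)
      also have "(\<Sum>d\<in>{1..?m} \<union> {d. d \<in> {1..N} \<and> \<not> prime d}. mangoldt d :: real) \<le> (\<Sum>d\<in>{1..?m}. mangoldt d) + (\<Sum>d | d \<in> {1..N} \<and> \<not> prime d. mangoldt d)"
        by (intro sum_Un_le) (auto simp: mangoldt_nonneg)
      finally show ?thesis by (simp add: psi_def)
    qed
    moreover have "psi ?m \<le> 3 * x" using psi_le[of ?m] elim by (auto intro: order_trans)
    moreover have "real N \<le> 8 * psi N" using N by (intro psi_ge)
    moreover have "(\<Sum>d | d \<in> {1..N} \<and> \<not> prime d. mangoldt d) \<le> x"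
    proof -
      have "(\<Sum>d | d \<in> {1..N} \<and> \<not> prime d. mangoldt d) \<le> (sqrt N + 1) * (log 2 N + 1) * ln N"
        by (rule nonprime_primepow_sum)
      also have "... \<le> (sqrt (40 * x) + 1) * (log 2 (40 * x) + 1) * ln (40 * x)"
        using N elim by (intro mult_mono add_mono) auto
      finally show ?thesis using elim by simp
    qed
    moreover have "(\<Sum>d\<in>primes_in x (40 * x). mangoldt d) \<le> (\<Sum>d\<in>primes_in x (40 * x). ln (40 * x))"
      using elim by (intro sum_mono) (auto simp: primes_in_def)
    ultimately have "sqrt x * ln (40 * x) \<le> real (card (primes_in x (40 * x))) * ln (40 * x)"
      using N elim unfolding sum_constant by linarith
    then show ?case using elim by (subst (asm) mult_le_cancel_right_pos) auto
  qed
qed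

section \<open>Exponential moments of random prime sums\<close>

text \<open>Made for taking expectations: for \<open>y\<close> of mean zero the linear term drops
  out and only \<open>exp (y^2)\<close> remains.\<close>

lemma exp_le_add_exp_square: "exp y \<le> y + exp (y^2)" for y :: real
proof -
  have sq: "1 + y^2 \<le> exp (y^2)" by (rule exp_ge_add_one_self)
  consider "1 < y" | "0 \<le> y" "y \<le> 1" | "-1 \<le> y" "y < 0" | "y < -1" by linarith
  then show ?thesis
  proof cases
    case 1
    then have "y \<le> y^2" by (simp add: power2_eq_square)
    then have "exp y \<le> exp (y^2)" by simp
    then show ?thesis using 1 by linarith
  next
    case 2
    then show ?thesis using exp_bound[of y] sq by linarith
  next
    case 3
    have "0 < 1 - y" using 3 by simp
    moreover have "exp (- y) \<ge> 1 - y" using exp_ge_add_one_self[of "- y"] by simp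
    ultimately have "exp y \<le> 1 / (1 - y)" by (simp add: exp_minus field_simps)
    also have "... \<le> 1 + y + y^2"
    proof -
      have "y ^ 3 \<le> 0" using 3 by (simp add: power3_eq_cube mult_le_0_iff)
      then have "1 \<le> (1 + y + y^2) * (1 - y)" by (simp add: algebra_simps power2_eq_square power3_eq_cube)
      then show ?thesis using 3 by (simp add: divide_le_eq)
    qed
    finally show ?thesis using sq by linarith
  next
    case 4
    then have "exp y \<le> 1" by simp
    moreover have "1 * (- y) \<le> (- y) * (- y)" using 4 by (intro mult_right_mono) auto
    then have "- y \<le> y^2" by (simp add: power2_eq_square)
    ultimately show ?thesis using sq by linarith
  qed
qed

lemma sum_geom_le:
  fixes r :: real
  assumes "0 \<le> r" "r \<le> 3/4" "A \<subseteq> {k..}" "finite A"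
  shows "(\<Sum>m\<in>A. r ^ m) \<le> 4 * r ^ k"
proof -
  have "(\<Sum>m\<in>A. r ^ m) = (\<Sum>m\<in>(\<lambda>m. m - k) ` A. r ^ (m + k))"
  proof (subst sum.reindex)
    show "inj_on (\<lambda>m. m - k) A" using assms(3) by (auto simp: inj_on_def subset_eq eq_diff_iff)
  qed (use assms(3) in \<open>auto intro!: sum.cong\<close>)
  also have "... = r ^ k * (\<Sum>m\<in>(\<lambda>m. m - k) ` A. r ^ m)"
    by (simp add: power_add sum_distrib_left mult.commute)
  finally have *: "(\<Sum>m\<in>A. r ^ m) = r ^ k * (\<Sum>m\<in>(\<lambda>m. m - k) ` A. r ^ m)" .
  have "(\<Sum>m\<in>(\<lambda>m. m - k) ` A. r ^ m) \<le> (\<Sum>m. r ^ m)"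
    using assms by (intro sum_le_suminf summable_geometric) auto
  also have "... = 1 / (1 - r)" using assms by (intro suminf_geometric) auto
  also have "... \<le> 4" using assms by (simp add: field_simps)
  finally show ?thesis unfolding * using assms by (subst mult.commute) (intro mult_right_mono; simp)
qed

text \<open>The worst case is \<open>p = 2\<close> and \<open>\<sigma> = 1/2\<close>. The ratio
  \<open>3/4\<close> produces the factor \<open>4 = 1 / (1 - 3/4)\<close> in the geometric series
  over powers of one prime.\<close>

lemma prime_powr_le:
  assumes "prime p" "1/2 \<le> \<sigma>"
  shows "real p powr (- \<sigma>) \<le> 3/4"
proof -
  have "real p powr (- \<sigma>) \<le> 2 powr (- \<sigma>)"
    using assms prime_ge_2_nat[of p] by (intro powr_mono2') auto
  also have "... \<le> 2 powr (- (1/2))" using assms by (intro powr_mono) auto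
  also have "... = 1 / sqrt 2" by (simp add: powr_minus powr_half_sqrt inverse_eq_divide)
  also have "... \<le> 3/4"
  proof -
    have "4/3 \<le> sqrt 2" by (rule real_le_rsqrt) (simp add: power2_eq_square)
    then show ?thesis by (simp add: field_simps)
  qed
  finally show ?thesis .
qed

definition ppow :: "nat \<Rightarrow> nat \<Rightarrow> nat set" where
  "ppow Y p = {m. 1 \<le> m \<and> p ^ m \<le> Y}"

lemma finite_ppow: "prime p \<Longrightarrow> finite (ppow Y p)"
proof (rule finite_subset[of _ "{..Y}"])
  assume "prime p"
  then have "m \<le> p ^ m" for m
    using self_le_power[of p m] less_exp[of m] power_mono[of 2 p m] prime_ge_2_nat[of p] by linarith
  then show "ppow Y p \<subseteq> {..Y}" by (auto simp: ppow_def intro: order_trans)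
qed auto

text \<open>Cutting at \<open>p ^ m \<le> Y\<close> rather than at \<open>p \<le> Y\<close> keeps
  the length of the sum at most \<open>Y\<close>. With \<open>b = zc s\<close> this is the Dirichlet
  series of the logarithm of zeta, cut at \<open>Y\<close> and twisted by
  \<open>\<xi>\<close>.\<close>

definition Dpoly :: "(nat \<Rightarrow> nat \<Rightarrow> complex) \<Rightarrow> nat \<Rightarrow> (nat \<Rightarrow> complex) \<Rightarrow> complex" where
  "Dpoly b Y \<xi> = (\<Sum>p\<in>primes_in 0 Y. \<Sum>m\<in>ppow Y p. b p m * \<xi> p ^ m)"

lemma primes_inD: "p \<in> primes_in a b \<Longrightarrow> prime p" by (simp add: primes_in_def)

lemma gpoly_Dpoly:
  assumes "1 \<le> Y"
  shows "gpoly Y (\<Sum>p\<in>primes_in 0 Y. \<Sum>m\<in>ppow Y p. norm (b p m)) (Dpoly b Y)"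
  unfolding Dpoly_def[abs_def]
proof (intro gpoly_sum)
  fix p m assume p: "p \<in> primes_in 0 Y" "m \<in> ppow Y p"
  then have pr: "prime p" by (auto dest: primes_inD)
  have "gpoly Y (norm (b p m)) (\<lambda>\<xi>. b p m * mext \<xi> (p ^ m))"
    using p pr by (intro gpoly_mext) (auto simp: ppow_def Suc_le_eq prime_gt_0_nat)
  then show "gpoly Y (norm (b p m)) (\<lambda>\<xi>. b p m * \<xi> p ^ m)"
    using pr by (simp add: mext_prime_power)
qed (use assms finite_ppow primes_inD in auto)

context rmodel begin

text \<open>Stated over a general field because it serves both real exponential moments and complex
  characteristic functions.\<close>

lemma expect_exp_sum:
  fixes G :: "nat \<Rightarrow> complex \<Rightarrow> 'b::{real_normed_field, banach, second_countable_topology}"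
  assumes "finite P" "\<And>p. p \<in> P \<Longrightarrow> prime p"
    and [measurable]: "\<And>p. p \<in> P \<Longrightarrow> G p \<in> borel_measurable borel"
    and bd: "\<And>p z. p \<in> P \<Longrightarrow> norm z = 1 \<Longrightarrow> norm (G p z) \<le> B p"
  shows "expectation (\<lambda>w. exp (\<Sum>p\<in>P. G p (X p w))) = (\<Prod>p\<in>P. expectation (\<lambda>w. exp (G p (X p w))))"
proof -
  have [measurable]: "exp \<in> borel_measurable (borel :: 'b measure)"
    by (intro borel_measurable_continuous_onI continuous_intros)
  have "expectation (\<lambda>w. \<Prod>p\<in>P. exp (G p (X p w))) = (\<Prod>p\<in>P. expectation (\<lambda>w. exp (G p (X p w))))"
  proof (rule indep_vars_lebesgue_integral)
    have "indep_vars (\<lambda>_. borel) X P" using assms(2) by (intro indep_vars_subset[OF indep_X]) auto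
    then show "indep_vars (\<lambda>_. borel) (\<lambda>p w. exp (G p (X p w))) P"
      by (rule indep_vars_compose2) measurable
    fix p assume p: "p \<in> P"
    then have [measurable]: "X p \<in> borel_measurable M" "G p \<in> borel_measurable borel" using assms by auto
    show "integrable M (\<lambda>w. exp (G p (X p w)))"
    proof (rule integrable_const_bound[where B = "exp (B p)"])
      show "AE w in M. norm (exp (G p (X p w))) \<le> exp (B p)"
        using bd[OF p norm_X] assms(2)[OF p] by (auto intro!: order_trans[OF norm_exp])
    qed measurable
  qed fact
  then show ?thesis using assms(1) by (simp add: exp_sum)
qed

lemma integrable_bounded_X:
  fixes G :: "complex \<Rightarrow> 'b::{banach, second_countable_topology}"
  assumes "prime p" "G \<in> borel_measurable borel" "\<And>z. norm z = 1 \<Longrightarrow> norm (G z) \<le> B"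
  shows "integrable M (\<lambda>w. G (X p w))"
proof -
  note [measurable] = assms(2) measurable_X[OF assms(1)]
  show ?thesis using assms norm_X by (intro integrable_const_bound[where B = B]) auto
qed

lemma expect_Re_X:
  assumes "prime p"
  shows "expectation (\<lambda>w. Re (c * X p w)) = 0"
proof -
  have "integrable M (\<lambda>w. c * X p w)"
    using assms by (intro integrable_bounded_X[where B = "norm c"]) (auto simp: norm_mult)
  then have "expectation (\<lambda>w. Re (c * X p w)) = Re (expectation (\<lambda>w. c * X p w))" by (rule integral_Re)
  also have "... = 0" using expect_X[OF assms, of 1] by simp
  finally show ?thesis .
qed

lemma expect_exp_linear:
  assumes "prime p"
  shows "expectation (\<lambda>w. exp (Re (c * X p w))) \<le> exp ((norm c)^2)"
proof -
  have bd: "\<bar>Re (c * z)\<bar> \<le> norm c" if "norm z = 1" for z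
    using abs_Re_le_cmod[of "c * z"] that by (simp add: norm_mult)
  have i1: "integrable M (\<lambda>w. Re (c * X p w))"
    using assms bd by (intro integrable_bounded_X[where B = "norm c"]) auto
  have i2: "integrable M (\<lambda>w. exp (Re (c * X p w)))"
    using assms bd by (intro integrable_bounded_X[where B = "exp (norm c)"]) (auto dest!: bd)
  have "expectation (\<lambda>w. exp (Re (c * X p w))) \<le> expectation (\<lambda>w. Re (c * X p w) + exp ((norm c)^2))"
  proof (intro integral_mono i2)
    fix w
    have "(Re (c * X p w))^2 \<le> (norm c)^2"
      using bd[OF norm_X[OF assms, of w]] by (simp add: abs_le_square_iff[symmetric])
    then show "exp (Re (c * X p w)) \<le> Re (c * X p w) + exp ((norm c)^2)"
      using exp_le_add_exp_square[of "Re (c * X p w)"] by (smt (verit) exp_le_cancel_iff)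
  qed (use i1 in auto)
  also have "... = exp ((norm c)^2)" using i1 expect_Re_X[OF assms] by (simp add: prob_space)
  finally show ?thesis .
qed

lemma expect_exp_sum_linear:
  assumes "finite P" "\<And>p. p \<in> P \<Longrightarrow> prime p"
  shows "expectation (\<lambda>w. exp (Re (\<Sum>p\<in>P. c p * X p w))) \<le> exp (\<Sum>p\<in>P. (norm (c p))^2)"
proof -
  have "expectation (\<lambda>w. exp (\<Sum>p\<in>P. Re (c p * X p w))) = (\<Prod>p\<in>P. expectation (\<lambda>w. exp (Re (c p * X p w))))"
  proof (rule expect_exp_sum[where B = "\<lambda>p. norm (c p)"])
    fix p z assume "norm (z :: complex) = 1"
    then show "norm (Re (c p * z)) \<le> norm (c p)" using abs_Re_le_cmod[of "c p * z"] by (simp add: norm_mult)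
  qed (use assms in auto)
  also have "... \<le> (\<Prod>p\<in>P. exp ((norm (c p))^2))"
    using assms by (intro prod_mono conjI expect_exp_linear) (auto intro!: integral_nonneg)
  finally show ?thesis using assms(1) by (simp add: exp_sum Re_sum)
qed

text \<open>Chernoff's method in four directions: a complex number of modulus at least
  \<open>\<delta>\<close> has one of plus or minus its real or imaginary part at least
  \<open>\<delta> / 2\<close>. The choice \<open>l = \<delta> / (4 * V)\<close> minimises
  \<open>l^2 * V - l * \<delta> / 2\<close>, with minimum
  \<open>- \<delta>^2 / (16 * V)\<close>.\<close>

lemma subgaussian_tail:
  assumes "finite P" "\<And>p. p \<in> P \<Longrightarrow> prime p" "(\<Sum>p\<in>P. (norm (c p))^2) \<le> V" "0 < V" "0 \<le> \<delta>"
  shows "prob {w \<in> space M. \<delta> \<le> norm (\<Sum>p\<in>P. c p * X p w)} \<le> 4 * exp (- \<delta>\<^sup>2 / (16 * V))"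
proof -
  define S where "S w = (\<Sum>p\<in>P. c p * X p w)" for w
  have [measurable]: "S \<in> borel_measurable M" unfolding S_def using assms(2) by measurable
  define l where "l = \<delta> / (4 * V)"
  have l: "0 \<le> l" using assms by (simp add: l_def)
  define f where "f d w = exp (Re (\<Sum>p\<in>P. (of_real l * d * c p) * X p w) - l * \<delta> / 2)" for d w
  have fS: "f d w = exp (l * Re (d * S w) - l * \<delta> / 2)" for d w
  proof -
    have "(\<Sum>p\<in>P. (of_real l * d * c p) * X p w) = of_real l * (d * S w)"
      by (simp add: S_def sum_distrib_left mult_ac)
    then show ?thesis by (simp add: f_def)
  qed
  let ?D = "{1, -1, \<i>, -\<i>} :: complex set"
  have nS: "norm (S w) \<le> (\<Sum>p\<in>P. norm (c p))" for w
    unfolding S_def using assms(2) norm_X by (intro order_trans[OF norm_sum] sum_mono) (auto simp: norm_mult)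
  have int: "integrable M (f d)" if d: "d \<in> ?D" for d
  proof (rule integrable_const_bound[where B = "exp (l * (\<Sum>p\<in>P. norm (c p)) - l * \<delta> / 2)"])
    have "Re (d * S w) \<le> (\<Sum>p\<in>P. norm (c p))" for w
      using order_trans[OF complex_Re_le_cmod[of "d * S w"]] nS[of w] d by (auto simp: norm_mult)
    then show "AE w in M. norm (f d w) \<le> exp (l * (\<Sum>p\<in>P. norm (c p)) - l * \<delta> / 2)"
      using l by (intro AE_I2) (auto simp: fS intro!: mult_left_mono)
    show "f d \<in> borel_measurable M" unfolding fS[abs_def] by measurable
  qed
  have E: "expectation (f d) \<le> exp (- \<delta>\<^sup>2 / (16 * V))" if d: "d \<in> ?D" for d
  proof -
    have "expectation (f d) = expectation (\<lambda>w. exp (Re (\<Sum>p\<in>P. (of_real l * d * c p) * X p w))) * exp (- (l * \<delta> / 2))"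
    proof -
      have "f d = (\<lambda>w. exp (Re (\<Sum>p\<in>P. (of_real l * d * c p) * X p w)) * exp (- (l * \<delta> / 2)))"
        unfolding f_def exp_add[symmetric] by (rule ext) simp
      then show ?thesis by (simp only: integral_mult_left_zero)
    qed
    also have "... \<le> exp (\<Sum>p\<in>P. (norm (of_real l * d * c p))^2) * exp (- (l * \<delta> / 2))"
      using assms by (intro mult_right_mono expect_exp_sum_linear) auto
    also have "(\<Sum>p\<in>P. (norm (of_real l * d * c p))^2) = l^2 * (\<Sum>p\<in>P. (norm (c p))^2)"
      using d by (auto simp: norm_mult sum_distrib_left power_mult_distrib)
    also have "exp (l^2 * (\<Sum>p\<in>P. (norm (c p))^2)) * exp (- (l * \<delta> / 2)) \<le> exp (l^2 * V) * exp (- (l * \<delta> / 2))"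
      using assms by (intro mult_right_mono) (auto intro!: mult_left_mono)
    also have "... = exp (- \<delta>\<^sup>2 / (16 * V))"
      unfolding exp_add[symmetric] using assms by (simp add: l_def field_simps power2_eq_square)
    finally show ?thesis .
  qed
  have int0: "integrable M (indicat_real {w \<in> space M. \<delta> \<le> norm (S w)})"
    by (intro integrable_const_bound[where B = 1]) auto
  have "prob {w \<in> space M. \<delta> \<le> norm (S w)} = expectation (indicator {w \<in> space M. \<delta> \<le> norm (S w)})"
    by simp
  also have "... \<le> expectation (\<lambda>w. f 1 w + f (-1) w + f \<i> w + f (-\<i>) w)"
  proof (intro integral_mono)
    fix w
    show "indicator {w \<in> space M. \<delta> \<le> norm (S w)} w \<le> f 1 w + f (-1) w + f \<i> w + f (-\<i>) w"
    proof (cases "\<delta> \<le> norm (S w)")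
      case True
      have pos: "0 < f d w" for d by (simp add: f_def)
      have "norm (S w) \<le> \<bar>Re (S w)\<bar> + \<bar>Im (S w)\<bar>" by (rule cmod_le)
      then have "\<delta> / 2 \<le> Re (S w) \<or> \<delta> / 2 \<le> - Re (S w) \<or> \<delta> / 2 \<le> Im (S w) \<or> \<delta> / 2 \<le> - Im (S w)"
        using True by argo
      then obtain d where d: "d \<in> ?D" "\<delta> / 2 \<le> Re (d * S w)" by force
      have "l * (\<delta> / 2) \<le> l * Re (d * S w)" using d l by (intro mult_left_mono)
      then have "1 \<le> f d w" by (simp add: fS)
      then show ?thesis using d(1) pos[of 1] pos[of "-1"] pos[of \<i>] pos[of "-\<i>"] by (auto simp: indicator_def)
    qed (simp add: f_def)
  qed (use int int0 in \<open>auto intro!: Bochner_Integration.integrable_add\<close>)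
  also have "... = expectation (f 1) + expectation (f (-1)) + expectation (f \<i>) + expectation (f (-\<i>))"
    using int by simp
  also have "... \<le> 4 * exp (- \<delta>\<^sup>2 / (16 * V))"
    using E[of 1] E[of "-1"] E[of \<i>] E[of "-\<i>"] by simp
  finally show ?thesis unfolding S_def .
qed

text \<open>The primes are split at a free parameter \<open>z\<close>. Up to \<open>z\<close> the
  factor of a prime is bounded by its size. Beyond \<open>z\<close> the linear term has mean zero
  and contributes only its square, which is the \<open>U^2\<close>; the higher powers of the prime
  contribute the \<open>4 * U\<close>.\<close>

lemma expect_exp_Dpoly:
  assumes b: "\<And>p m. prime p \<Longrightarrow> 1 \<le> m \<Longrightarrow> norm (b p m) \<le> U * real p powr (- (real m * \<sigma>))"
    and "1/2 \<le> \<sigma>" "0 \<le> U"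
  shows "expectation (\<lambda>w. exp (Re (Dpoly b Y (Xs w))))
    \<le> exp (4 * U * (\<Sum>p\<in>primes_in 0 z. real p powr (- \<sigma>)) + (4 * U + U^2) * (\<Sum>p\<in>primes_in z Y. real p powr (- (2 * \<sigma>))))"
proof -
  let ?P = "primes_in 0 Y" and ?a = "\<lambda>p. real p powr (- \<sigma>)" and ?b = "\<lambda>p. real p powr (- (2 * \<sigma>))"
  define G where "G p x = (\<Sum>m\<in>ppow Y p. b p m * x ^ m)" for p x
  let ?e = "\<lambda>p. expectation (\<lambda>w. exp (Re (G p (X p w))))"
  have pw: "real p powr (- (real m * \<sigma>)) = ?a p ^ m" if "prime p" for p m
    using prime_gt_0_nat[OF that] by (simp add: powr_power mult.commute)
  have part: "norm (\<Sum>m\<in>A. b p m * x ^ m) \<le> 4 * U * ?a p ^ k"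
    if "prime p" "A \<subseteq> {k..}" "1 \<le> k" "finite A" "norm x = 1" for p k A x
  proof -
    have "norm (\<Sum>m\<in>A. b p m * x ^ m) \<le> (\<Sum>m\<in>A. U * ?a p ^ m)"
    proof (intro sum_norm_le)
      fix m assume "m \<in> A"
      then have "1 \<le> m" using that by auto
      then show "norm (b p m * x ^ m) \<le> U * ?a p ^ m"
        using b[OF \<open>prime p\<close> \<open>1 \<le> m\<close>] that by (simp add: norm_mult norm_power pw[OF \<open>prime p\<close>])
    qed
    also have "... = U * (\<Sum>m\<in>A. ?a p ^ m)" by (simp add: sum_distrib_left)
    also have "... \<le> U * (4 * ?a p ^ k)"
      using that assms prime_powr_le[of p \<sigma>] by (intro mult_left_mono sum_geom_le) auto
    finally show ?thesis by simp
  qed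
  have Gb: "norm (G p x) \<le> 4 * U * ?a p" if "prime p" "norm x = 1" for p x
    using part[of p "ppow Y p" 1 x] that finite_ppow by (auto simp: G_def ppow_def)
  have "expectation (\<lambda>w. exp (\<Sum>p\<in>?P. Re (G p (X p w)))) = (\<Prod>p\<in>?P. ?e p)"
  proof (rule expect_exp_sum[where B = "\<lambda>p. 4 * U * ?a p"])
    fix p z assume "p \<in> ?P" "norm (z::complex) = 1"
    then show "norm (Re (G p z)) \<le> 4 * U * ?a p"
      using Gb[of p z] abs_Re_le_cmod[of "G p z"] by (auto dest!: primes_inD)
  qed (auto dest: primes_inD simp: G_def)
  also have "... \<le> (\<Prod>p\<in>?P. if real p \<le> z then exp (4 * U * ?a p) else exp ((4 * U + U^2) * ?b p))"
  proof (intro prod_mono conjI)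
    fix p assume "p \<in> ?P"
    then have p: "prime p" "p \<le> Y" by (auto simp: primes_in_def)
    have int: "integrable M (\<lambda>w. exp (Re (G p (X p w))))"
    proof (rule integrable_bounded_X[OF p(1), where B = "exp (4 * U * ?a p)"])
      show "(\<lambda>z. exp (Re (G p z))) \<in> borel_measurable borel" by (simp add: G_def)
    next
      fix z :: complex assume "norm z = 1"
      from Gb[OF p(1) this] show "norm (exp (Re (G p z))) \<le> exp (4 * U * ?a p)"
        using complex_Re_le_cmod[of "G p z"] by simp
    qed
    show "0 \<le> ?e p" by (intro Bochner_Integration.integral_nonneg) auto
    show "?e p \<le> (if real p \<le> z then exp (4 * U * ?a p) else exp ((4 * U + U^2) * ?b p))"
    proof (cases "real p \<le> z")
      case True
      have "?e p \<le> expectation (\<lambda>_. exp (4 * U * ?a p))"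
        using Gb[OF p(1) norm_X[OF p(1)]] order_trans[OF complex_Re_le_cmod]
        by (intro integral_mono int) auto
      then show ?thesis using True by (simp add: prob_space)
    next
      case False
      have split: "G p x = b p 1 * x + (\<Sum>m\<in>ppow Y p - {1}. b p m * x ^ m)" for x
        unfolding G_def using p finite_ppow[OF p(1)]
        by (subst sum.remove[of _ 1]) (auto simp: ppow_def)
      have sub: "ppow Y p - {1} \<subseteq> {2..}"
      proof
        fix m assume "m \<in> ppow Y p - {1}"
        then have "1 \<le> m" "m \<noteq> 1" by (auto simp: ppow_def)
        then show "m \<in> {2..}" by simp
      qed
      have rest: "norm (\<Sum>m\<in>ppow Y p - {1}. b p m * x ^ m) \<le> 4 * U * ?b p" if "norm x = 1" for x
        using part[OF p(1) sub _ _ that] finite_ppow[OF p(1)] pw[OF p(1), of 2] by simp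
      have "?e p \<le> expectation (\<lambda>w. exp (Re (b p 1 * X p w)) * exp (4 * U * ?b p))"
      proof (intro integral_mono int)
        show "integrable M (\<lambda>w. exp (Re (b p 1 * X p w)) * exp (4 * U * ?b p))"
        proof (intro integrable_mult_left integrable_bounded_X[OF p(1), where B = "exp (norm (b p 1))"])
          fix z :: complex assume "norm z = 1"
          then show "norm (exp (Re (b p 1 * z))) \<le> exp (norm (b p 1))"
            using complex_Re_le_cmod[of "b p 1 * z"] by (simp add: norm_mult)
        qed measurable
        fix w
        show "exp (Re (G p (X p w))) \<le> exp (Re (b p 1 * X p w)) * exp (4 * U * ?b p)"
          unfolding exp_add[symmetric] exp_le_cancel_iff split
          using order_trans[OF complex_Re_le_cmod rest[OF norm_X[OF p(1), of w]]] by simp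
      qed
      also have "... = expectation (\<lambda>w. exp (Re (b p 1 * X p w))) * exp (4 * U * ?b p)" by simp
      also have "... \<le> exp ((norm (b p 1))^2) * exp (4 * U * ?b p)"
        by (intro mult_right_mono expect_exp_linear p) auto
      also have "... \<le> exp (U^2 * ?b p) * exp (4 * U * ?b p)"
      proof -
        have "(norm (b p 1))^2 \<le> (U * ?a p)^2"
          using b[OF p(1), of 1] by (intro power_mono) auto
        also have "... = U^2 * ?b p"
          using pw[OF p(1), of 2] by (simp add: power_mult_distrib)
        finally show ?thesis by simp
      qed
      also have "... = exp ((4 * U + U^2) * ?b p)"
        by (simp add: exp_add[symmetric] algebra_simps)
      finally show ?thesis using False by simp
    qed
  qed
  also have "... = exp (\<Sum>p\<in>?P. if real p \<le> z then 4 * U * ?a p else (4 * U + U^2) * ?b p)"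
    by (simp add: exp_sum if_distrib)
  also have "(\<Sum>p\<in>?P. if real p \<le> z then 4 * U * ?a p else (4 * U + U^2) * ?b p)
     = (\<Sum>p\<in>?P \<inter> {p. real p \<le> z}. 4 * U * ?a p) + (\<Sum>p\<in>?P \<inter> - {p. real p \<le> z}. (4 * U + U^2) * ?b p)"
    by (rule sum.If_cases) simp
  also have "(\<Sum>p\<in>?P \<inter> {p. real p \<le> z}. 4 * U * ?a p) \<le> (\<Sum>p\<in>primes_in 0 z. 4 * U * ?a p)"
    using assms by (intro sum_mono2 finite_primes_in) (auto simp: primes_in_def)
  also have "(\<Sum>p\<in>?P \<inter> - {p. real p \<le> z}. (4 * U + U^2) * ?b p) \<le> (\<Sum>p\<in>primes_in z Y. (4 * U + U^2) * ?b p)"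
    using assms by (intro sum_mono2 finite_primes_in) (auto simp: primes_in_def)
  finally show ?thesis
    by (simp add: Dpoly_def G_def Re_sum sum_distrib_left)
qed

lemma expect_Re_X_square:
  assumes "prime p"
  shows "expectation (\<lambda>w. (Re (c * X p w))^2) = (norm c)^2 / 2"
proof -
  have *: "(Re z)^2 = ((norm z)^2 + Re (z^2)) / 2" for z
    by (simp add: cmod_power2) (simp add: power2_eq_square)
  have i: "integrable M (\<lambda>w. (c * X p w)^2)"
    using assms by (intro integrable_bounded_X[where B = "(norm c)^2"]) (auto simp: norm_mult norm_power)
  have "expectation (\<lambda>w. (c * X p w)^2) = 0"
    using expect_X[OF assms, of 2] by (simp add: power_mult_distrib)
  then have 0: "expectation (\<lambda>w. Re ((c * X p w)^2)) = 0" using integral_Re[OF i] by simp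
  have "expectation (\<lambda>w. (Re (c * X p w))^2) = expectation (\<lambda>w. ((norm c)^2 + Re ((c * X p w)^2)) / 2)"
    by (intro Bochner_Integration.integral_cong refl) (simp only: *, simp add: norm_mult norm_X[OF assms])
  also have "... = ((norm c)^2 + expectation (\<lambda>w. Re ((c * X p w)^2))) / 2"
    using integrable_Re[OF i] by (simp only: integral_divide_zero Bochner_Integration.integral_add integrable_const lebesgue_integral_const prob_space) simp
  finally show ?thesis by (simp add: 0)
qed

text \<open>Second order Taylor expansion: the linear term has mean zero and the quadratic one has
  mean \<open>(norm c)^2 / 4\<close>. The cubic remainder is at most \<open>(norm c)^2 / 6\<close>
  for \<open>norm c \<le> 1\<close>, which leaves \<open>1/4 - 1/6 = 1/12\<close>.\<close>

lemma iexp_linear_bound: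
  assumes "prime p" "norm c \<le> 1"
  shows "norm (expectation (\<lambda>w. iexp (Re (c * X p w)))) \<le> 1 - (norm c)^2 / 12"
proof -
  let ?y = "\<lambda>w. Re (c * X p w)"
  have bd: "\<bar>Re (c * z)\<bar> \<le> norm c" if "norm z = 1" for z
    using abs_Re_le_cmod[of "c * z"] that by (simp add: norm_mult)
  have i1: "integrable M ?y"
    using assms bd by (intro integrable_bounded_X[where B = "norm c"]) auto
  have i2: "integrable M (\<lambda>w. (?y w)^2)"
    using assms bd by (intro integrable_bounded_X[where B = "(norm c)^2"]) (auto intro!: power_mono simp: abs_le_square_iff[symmetric])
  have i3: "integrable M (\<lambda>w. iexp (?y w))"
    using assms by (intro integrable_bounded_X[where B = 1]) auto
  define g where "g w = 1 - (?y w)^2 / 2" for w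
  define y where "y w = ?y w" for w
  have ig: "integrable M g" "integrable M y" unfolding g_def[abs_def] y_def[abs_def] using i1 i2 by auto
  have Eg: "expectation g = 1 - (norm c)^2 / 4" "expectation y = 0"
    unfolding g_def[abs_def] y_def[abs_def] using i2 expect_Re_X[OF assms(1), of c] expect_Re_X_square[OF assms(1), of c]
    by (auto simp: prob_space simp del: times_complex.sel)
  let ?T = "\<lambda>w. of_real (g w) + \<i> * of_real (y w) :: complex"
  have iT: "integrable M ?T" using ig by auto
  have ET: "expectation ?T = of_real (1 - (norm c)^2 / 4)"
    using ig by (simp add: Eg)
  have "norm (expectation (\<lambda>w. iexp (?y w) - ?T w)) \<le> expectation (\<lambda>_. norm c ^ 3 / 6)"
  proof (intro norm_integral_le)
    fix w
    have "norm (iexp (?y w) - (\<Sum>k\<le>2. (\<i> * of_real (?y w)) ^ k / fact k)) \<le> \<bar>?y w\<bar> ^ 3 / 6"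
      using iexp_approx1[of "?y w" 2] by (simp add: eval_nat_numeral)
    also have "(\<Sum>k\<le>2. (\<i> * of_real (?y w)) ^ k / fact k) = ?T w"
      by (simp add: eval_nat_numeral power2_eq_square g_def y_def field_simps del: times_complex.sel)
    also have "\<bar>?y w\<bar> ^ 3 / 6 \<le> norm c ^ 3 / 6"
      using bd[OF norm_X[OF assms(1)]] by (intro divide_right_mono power_mono) auto
    finally show "norm (iexp (?y w) - ?T w) \<le> norm c ^ 3 / 6" .
  qed (use i3 iT in auto)
  then have 1: "norm (expectation (\<lambda>w. iexp (?y w)) - of_real (1 - (norm c)^2 / 4)) \<le> norm c ^ 3 / 6"
    using i3 iT ET by (simp add: prob_space del: times_complex.sel)
  have "norm c ^ 3 \<le> (norm c)^2"
    using assms power_decreasing[of 2 3 "norm c"] by simp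
  moreover have "(norm c)^2 \<le> 1" using assms power_le_one[of "norm c" 2] by simp
  moreover have "norm (expectation (\<lambda>w. iexp (?y w))) \<le> norm (complex_of_real (1 - (norm c)^2 / 4)) + norm (expectation (\<lambda>w. iexp (?y w)) - of_real (1 - (norm c)^2 / 4))"
    by (rule norm_triangle_sub)
  ultimately show ?thesis using 1 unfolding norm_of_real by linarith
qed

end

section \<open>Decay of the characteristic function in one variable\<close>

definition zc :: "complex \<Rightarrow> nat \<Rightarrow> nat \<Rightarrow> complex" where
  "zc s p m = of_nat p powr (- (of_nat m * s)) / of_nat m"

lemma norm_nat_powr: "0 < n \<Longrightarrow> norm (of_nat n powr z :: complex) = real n powr Re z"
  by (simp add: norm_powr_real_powr)

lemma zc_eq_power:
  assumes "prime p"
  shows "zc s p m = (of_nat p powr (- s)) ^ m / of_nat m"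
  using prime_gt_0_nat[OF assms] by (simp add: zc_def powr_def exp_of_nat_mult[symmetric] mult_ac)

lemma norm_zc_le:
  assumes "prime p" "1 \<le> m" "\<sigma> \<le> Re s"
  shows "norm (zc s p m) \<le> real p powr (- (real m * \<sigma>))"
proof -
  have p: "1 \<le> real p" "0 < p" using prime_gt_0_nat[OF assms(1)] by auto
  have "norm (zc s p m) = real p powr (- (real m * Re s)) / real m"
    using p by (simp add: zc_def norm_divide norm_nat_powr)
  also have "... \<le> real p powr (- (real m * Re s)) / 1"
    using assms by (intro divide_left_mono) auto
  also have "... \<le> real p powr (- (real m * \<sigma>))"
    using p assms by (simp, intro powr_mono) (auto intro: mult_left_mono)
  finally show ?thesis .
qed

lemma norm_iexp_diff_le: "norm (iexp x - iexp y) \<le> \<bar>x - y\<bar>"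
proof -
  have "iexp x - iexp y = iexp y * (iexp (x - y) - 1)"
    by (simp add: algebra_simps flip: exp_add)
  then have "norm (iexp x - iexp y) = norm (iexp (x - y) - 1)" by (simp add: norm_mult)
  also have "... \<le> \<bar>x - y\<bar>" using iexp_approx1[of "x - y" 0] by simp
  finally show ?thesis .
qed

context rmodel begin

text \<open>By independence the characteristic function is a product over primes. A prime with
  \<open>p powr Re s\<close> comparable to the size of \<open>u\<close> gives a factor bounded away
  from 1, and there are enough of them for a decay like \<open>exp (- c * sqrt u)\<close>; of this
  only a bound summable over an arithmetic progression of frequencies is kept. The unit
  \<open>w\<close> selects the real or the imaginary part.\<close>

lemma char_decay:
  "\<exists>C>0. \<forall>Y u s w. norm w = 1 \<longrightarrow> 1/2 \<le> Re s \<longrightarrow> Re s \<le> 1 \<longrightarrow> 40 * u^2 \<le> real Y \<longrightarrow>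
     norm (expectation (\<lambda>\<omega>. iexp (u * Re (w * Dpoly (zc s) Y (Xs \<omega>))))) \<le> C / (1 + u^2)"
proof -
  obtain x0 where x0: "\<And>x. x0 \<le> x \<Longrightarrow> sqrt x \<le> real (card (primes_in x (40 * x)))"
    using many_primes by (auto simp: eventually_at_top_linorder)
  have "\<forall>\<^sub>F x::real in at_top. exp (- sqrt x / 38400) \<le> 1 / (1 + x^2)" by real_asymp
  then obtain x1 where x1: "\<And>x. x1 \<le> x \<Longrightarrow> exp (- sqrt x / 38400) \<le> 1 / (1 + x^2)"
    by (auto simp: eventually_at_top_linorder)
  \<comment> \<open>The value 3840 is \<open>40 * 96\<close>: it makes the higher powers of a prime
    small against its linear term. Below \<open>u0\<close> the trivial bound 1 is used, which fixes
    the final constant.\<close>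
  define u0 where "u0 = max 3840 (max x0 x1)"
  have "norm (expectation (\<lambda>\<omega>. iexp (u * Re (w * Dpoly (zc s) Y (Xs \<omega>))))) \<le> (1 + u0^2) / (1 + u^2)"
    if w: "norm w = 1" and s: "1/2 \<le> Re s" "Re s \<le> 1" and Y: "40 * u^2 \<le> real Y" for Y u s w
  proof -
    define G where "G p x = \<i> * of_real (u * Re (w * (\<Sum>m\<in>ppow Y p. zc s p m * x ^ m)))" for p x
    let ?e = "\<lambda>p. expectation (\<lambda>\<omega>. exp (G p (X p \<omega>)))"
    have [measurable]: "G p \<in> borel_measurable borel" for p unfolding G_def by measurable
    have nG: "norm (exp (G p x)) = 1" for p x unfolding G_def by (rule norm_exp_i_times)
    have le1: "norm (?e p) \<le> 1" if "prime p" for p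
    proof -
      have "norm (?e p) \<le> expectation (\<lambda>\<omega>. 1)"
        using that by (intro norm_integral_le integrable_bounded_X[where B = 1])
          (auto simp: nG simp del: norm_exp_eq_Re)
      then show ?thesis by (simp add: prob_space)
    qed
    have eq: "expectation (\<lambda>\<omega>. iexp (u * Re (w * Dpoly (zc s) Y (Xs \<omega>))))
       = (\<Prod>p\<in>primes_in 0 Y. ?e p)"
    proof -
      have "expectation (\<lambda>\<omega>. exp (\<Sum>p\<in>primes_in 0 Y. G p (X p \<omega>))) = (\<Prod>p\<in>primes_in 0 Y. ?e p)"
      proof (rule expect_exp_sum[where B = "\<lambda>p. \<bar>u\<bar> * (\<Sum>m\<in>ppow Y p. norm (zc s p m))"])
        fix p x assume "norm (x :: complex) = 1"
        then have "norm (\<Sum>m\<in>ppow Y p. zc s p m * x ^ m) \<le> (\<Sum>m\<in>ppow Y p. norm (zc s p m))"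
          by (intro sum_norm_le) (simp add: norm_mult norm_power)
        then have "\<bar>Re (w * (\<Sum>m\<in>ppow Y p. zc s p m * x ^ m))\<bar> \<le> (\<Sum>m\<in>ppow Y p. norm (zc s p m))"
          by (intro order_trans[OF abs_Re_le_cmod]) (simp add: norm_mult w)
        then show "norm (G p x) \<le> \<bar>u\<bar> * (\<Sum>m\<in>ppow Y p. norm (zc s p m))"
          unfolding G_def norm_mult norm_of_real by (simp add: abs_mult mult_left_mono del: times_complex.sel)
      qed (auto dest: primes_inD)
      moreover have "(\<Sum>p\<in>primes_in 0 Y. G p (X p \<omega>)) = \<i> * of_real (u * Re (w * Dpoly (zc s) Y (Xs \<omega>)))" for \<omega>
        unfolding G_def Dpoly_def by (simp only: sum_distrib_left Re_sum of_real_sum)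
      ultimately show ?thesis by simp
    qed
    show ?thesis
    proof (cases "u0 \<le> \<bar>u\<bar>")
      case False
      have "norm (\<Prod>p\<in>primes_in 0 Y. ?e p) \<le> 1"
        unfolding prod_norm[symmetric] by (intro prod_le_1) (auto intro: le1 dest: primes_inD)
      also have "1 \<le> (1 + u0^2) / (1 + u^2)"
        using False by (subst pos_le_divide_eq) (auto simp: add_pos_nonneg abs_le_square_iff[symmetric])
      finally show ?thesis unfolding eq .
    next
      case True
      define v where "v = \<bar>u\<bar>"
      have v: "3840 \<le> v" "x0 \<le> v" "x1 \<le> v" using True by (auto simp: u0_def v_def)
      define a where "a = Re s"
      have a: "1/2 \<le> a" "a \<le> 1" using s by (auto simp: a_def)
      \<comment> \<open>Chosen so that \<open>p powr - a\<close> lies between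
        \<open>1 / (40 * v)\<close> and \<open>1 / v\<close> for the primes from \<open>P\<close> to
        \<open>40 * P\<close>. As \<open>a \<ge> 1/2\<close>, \<open>P\<close> is at most
        \<open>v^2\<close>, whence the assumption \<open>40 * u^2 \<le> Y\<close>.\<close>
      define P where "P = v powr (1 / a)"
      have P1: "v \<le> P"
        using v a powr_mono[of 1 "1/a" v] by (simp add: P_def)
      have P2: "P \<le> v^2"
        using v a powr_mono[of "1/a" 2 v] by (simp add: P_def divide_le_eq)
      have Pa: "P powr a = v" using v a by (simp add: P_def powr_powr)
      let ?Q = "primes_in P (40 * P)"
      have "40 * P \<le> real Y" using P2 Y by (simp add: v_def)
      then have Q: "?Q \<subseteq> primes_in 0 Y" using P1 v by (auto simp: primes_in_def)
      have fac: "norm (?e p) \<le> exp (- (1 / 38400))" if p: "p \<in> ?Q" for p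
      proof -
        have pr: "prime p" "P < real p" "real p \<le> 40 * P" "p \<le> Y"
          using p Q by (auto simp: primes_in_def)
        have pp: "0 < p" "1 \<le> real p" using prime_gt_0_nat[OF pr(1)] by auto
        define r where "r = real p powr (- a)"
        have r1: "r \<le> 1 / v"
        proof -
          have "P powr a \<le> real p powr a" using pr P1 v a by (intro powr_mono2) auto
          then have "v \<le> real p powr a" using Pa by simp
          then show ?thesis using v pp by (simp add: r_def powr_minus field_simps)
        qed
        have r2: "1 / (40 * v) \<le> r"
        proof -
          have "real p powr a \<le> (40 * P) powr a" using pr a by (intro powr_mono2) auto
          also have "... = 40 powr a * v" using P1 v Pa by (simp add: powr_mult)
          also have "... \<le> 40 powr 1 * v" using v a by (intro mult_right_mono powr_mono) auto
          finally have "real p powr a \<le> 40 * v" by simp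
          then show ?thesis using v pp by (simp add: r_def powr_minus field_simps)
        qed
        define \<rho> where "\<rho> = v * r"
        have \<rho>: "1 / 40 \<le> \<rho>" "\<rho> \<le> 1" "0 \<le> \<rho>" using r1 r2 v by (auto simp: \<rho>_def field_simps r_def)
        define c where "c = of_real u * w * zc s p 1"
        have nc: "norm c = \<rho>" using pp by (simp add: c_def zc_def norm_mult w norm_nat_powr \<rho>_def r_def a_def v_def)
        have sub: "ppow Y p - {1} \<subseteq> {2..}"
        proof
          fix m assume "m \<in> ppow Y p - {1}"
          then have "1 \<le> m" "m \<noteq> 1" by (auto simp: ppow_def)
          then show "m \<in> {2..}" by simp
        qed
        have rest: "norm (\<Sum>m\<in>ppow Y p - {1}. zc s p m * x ^ m) \<le> 4 * r^2" if "norm x = 1" for x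
        proof -
          have "norm (\<Sum>m\<in>ppow Y p - {1}. zc s p m * x ^ m) \<le> (\<Sum>m\<in>ppow Y p - {1}. r ^ m)"
          proof (intro sum_norm_le)
            fix m assume "m \<in> ppow Y p - {1}"
            then have "1 \<le> m" by (auto simp: ppow_def)
            from norm_zc_le[OF pr(1) this, of a s] show "norm (zc s p m * x ^ m) \<le> r ^ m"
              using that pp by (simp add: norm_mult norm_power r_def powr_power a_def mult.commute)
          qed
          also have "... \<le> 4 * r ^ 2"
            using sub prime_powr_le[OF pr(1) a(1)] finite_ppow[OF pr(1)]
            by (intro sum_geom_le) (auto simp: r_def)
          finally show ?thesis .
        qed
        have split: "(\<Sum>m\<in>ppow Y p. zc s p m * x ^ m) = zc s p 1 * x + (\<Sum>m\<in>ppow Y p - {1}. zc s p m * x ^ m)" for x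
          using pr finite_ppow[OF pr(1)] by (subst sum.remove[of _ 1]) (auto simp: ppow_def)
        have diff: "norm (exp (G p x) - iexp (Re (c * x))) \<le> v * (4 * r^2)" if x: "norm x = 1" for x
        proof -
          have "norm (exp (G p x) - iexp (Re (c * x))) \<le> \<bar>u * Re (w * (\<Sum>m\<in>ppow Y p. zc s p m * x ^ m)) - Re (c * x)\<bar>"
            unfolding G_def by (rule norm_iexp_diff_le)
          also have "u * Re (w * (\<Sum>m\<in>ppow Y p. zc s p m * x ^ m)) - Re (c * x) = Re (of_real u * w * (\<Sum>m\<in>ppow Y p - {1}. zc s p m * x ^ m))"
          proof -
            have "u * Re z = Re (of_real u * z)" for z by simp
            then show ?thesis unfolding split c_def by (simp only: minus_complex.sel(1)[symmetric]) (simp add: algebra_simps)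
          qed
          also have "\<bar>...\<bar> \<le> norm (of_real u * w * (\<Sum>m\<in>ppow Y p - {1}. zc s p m * x ^ m))"
            by (rule abs_Re_le_cmod)
          also have "... \<le> v * (4 * r^2)"
            unfolding norm_mult using rest[OF x] by (simp add: w v_def mult_left_mono)
          finally show ?thesis .
        qed
        have i1: "integrable M (\<lambda>\<omega>. exp (G p (X p \<omega>)))"
          using pr by (intro integrable_bounded_X[where B = 1]) (auto simp: nG simp del: norm_exp_eq_Re)
        have i2: "integrable M (\<lambda>\<omega>. iexp (Re (c * X p \<omega>)))"
          using pr by (intro integrable_bounded_X[where B = 1]) auto
        have "norm (?e p - expectation (\<lambda>\<omega>. iexp (Re (c * X p \<omega>))))
           = norm (expectation (\<lambda>\<omega>. exp (G p (X p \<omega>)) - iexp (Re (c * X p \<omega>))))"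
          using i1 i2 by (simp del: times_complex.sel)
        also have "... \<le> expectation (\<lambda>\<omega>. v * (4 * r^2))"
          using i1 i2 diff[OF norm_X[OF pr(1)]] by (intro norm_integral_le) auto
        also have "... = 4 * \<rho> * r" by (simp add: prob_space \<rho>_def power2_eq_square)
        also have "... \<le> 4 * \<rho> * (\<rho> / 96)"
        proof -
          have "1 / v \<le> 1 / 3840" using v by (intro divide_left_mono) auto
          then have "r \<le> 1 / 3840" using r1 by linarith
          then have "r \<le> \<rho> / 96" using \<rho> by argo
          then show ?thesis using \<rho> by (intro mult_left_mono) auto
        qed
        finally have "norm (?e p - expectation (\<lambda>\<omega>. iexp (Re (c * X p \<omega>)))) \<le> \<rho>^2 / 24"
          by (simp add: power2_eq_square)
        moreover have "norm (expectation (\<lambda>\<omega>. iexp (Re (c * X p \<omega>)))) \<le> 1 - \<rho>^2 / 12"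
          using iexp_linear_bound[OF pr(1), of c] \<rho> nc by simp
        moreover have "norm (?e p) \<le> norm (expectation (\<lambda>\<omega>. iexp (Re (c * X p \<omega>))))
          + norm (?e p - expectation (\<lambda>\<omega>. iexp (Re (c * X p \<omega>))))"
          by (rule norm_triangle_sub)
        moreover have "(1 / 40)^2 \<le> \<rho>^2" using \<rho> by (intro power_mono) auto
        \<comment> \<open>The gain \<open>\<rho>^2 / 12\<close> minus the loss
          \<open>\<rho>^2 / 24\<close> at the smallest value \<open>\<rho> = 1/40\<close> is
          \<open>1 / 38400\<close>.\<close>
        ultimately have "norm (?e p) \<le> 1 + (- (1 / 38400))"
          by (simp add: power2_eq_square)
        also have "... \<le> exp (- (1 / 38400))" by (rule exp_ge_add_one_self)
        finally show ?thesis .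
      qed
      have "norm (\<Prod>p\<in>primes_in 0 Y. ?e p)
        \<le> (\<Prod>p\<in>primes_in 0 Y. if p \<in> ?Q then exp (- (1 / 38400)) else 1)"
        unfolding prod_norm[symmetric] by (intro prod_mono) (auto intro: le1 fac dest: primes_inD)
      also have "... = (\<Prod>p\<in>?Q. exp (- (1 / 38400)))"
        using Q by (subst prod.inter_restrict[symmetric]) (auto simp: Int_absorb1)
      also have "... = exp (- real (card ?Q) / 38400)"
        by (simp add: exp_of_nat_mult[symmetric])
      also have "... \<le> exp (- sqrt v / 38400)"
      proof -
        have "sqrt v \<le> sqrt P" using P1 by simp
        also have "... \<le> real (card ?Q)" using P1 v by (intro x0) auto
        finally show ?thesis by simp
      qed
      also have "... \<le> 1 / (1 + v^2)" using v by (intro x1)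
      also have "... \<le> (1 + u0^2) / (1 + u^2)"
        unfolding v_def power2_abs by (intro divide_right_mono) auto
      finally show ?thesis unfolding eq .
    qed
  qed
  moreover have "0 < 1 + u0^2" by (simp add: add_pos_nonneg)
  ultimately show ?thesis by blast
qed

end

section \<open>Truncated Euler products and prime power sums\<close>

lemma sum_powr_tail_le:
  assumes "1 < \<beta>" "1 \<le> N"
  shows "(\<Sum>n=N..K. real n powr (- \<beta>)) \<le> \<beta> / (\<beta> - 1) * real N powr (1 - \<beta>)"
proof -
  have step: "real (Suc n) powr (- \<beta>) \<le> (real n powr (1 - \<beta>) - real (Suc n) powr (1 - \<beta>)) / (\<beta> - 1)" if "1 \<le> n" for n
  proof -
    have "\<exists>z. real n < z \<and> z < real (Suc n) \<and> real (Suc n) powr (1 - \<beta>) - real n powr (1 - \<beta>)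
       = (real (Suc n) - real n) * ((1 - \<beta>) * z powr (- \<beta>))"
    proof (rule MVT2)
      fix x assume "real n \<le> x"
      then have "0 < x" using that by (auto simp: less_le_trans)
      then show "((\<lambda>x. x powr (1 - \<beta>)) has_real_derivative (1 - \<beta>) * x powr (- \<beta>)) (at x)"
        using has_real_derivative_powr[of x "1 - \<beta>"] by simp
    qed auto
    then obtain z where z: "real n < z" "z < real (Suc n)"
      "real (Suc n) powr (1 - \<beta>) - real n powr (1 - \<beta>) = (1 - \<beta>) * z powr (- \<beta>)" by auto
    have "real (Suc n) powr (- \<beta>) \<le> z powr (- \<beta>)" using z that assms by (intro powr_mono2') auto
    also have "... = (real n powr (1 - \<beta>) - real (Suc n) powr (1 - \<beta>)) / (\<beta> - 1)"
    proof -
      have "real n powr (1 - \<beta>) - real (Suc n) powr (1 - \<beta>) = (\<beta> - 1) * z powr (- \<beta>)"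
        using z(3) by (simp add: algebra_simps)
      then show ?thesis using assms by simp
    qed
    finally show ?thesis .
  qed
  have "(\<Sum>n=N..N + k. real n powr (- \<beta>)) \<le> real N powr (- \<beta>) + (real N powr (1 - \<beta>) - real (N + k) powr (1 - \<beta>)) / (\<beta> - 1)" for k
  proof (induction k)
    case (Suc k)
    have "(\<Sum>n=N..N + Suc k. real n powr (- \<beta>)) = (\<Sum>n=N..N + k. real n powr (- \<beta>)) + real (Suc (N + k)) powr (- \<beta>)"
      by simp
    then show ?case using Suc step[of "N + k"] assms by (simp add: diff_divide_distrib)
  qed simp
  note * = this
  have "(\<Sum>n=N..K. real n powr (- \<beta>)) \<le> (\<Sum>n=N..N + K. real n powr (- \<beta>))"
    by (intro sum_mono2) auto
  also have "... \<le> real N powr (- \<beta>) + real N powr (1 - \<beta>) / (\<beta> - 1)"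
    using *[of K] assms by (simp add: diff_divide_distrib) (smt (verit) divide_nonneg_pos powr_ge_zero)
  also have "real N powr (- \<beta>) \<le> real N powr (1 - \<beta>)" using assms by (intro powr_mono) auto
  also have "real N powr (1 - \<beta>) + real N powr (1 - \<beta>) / (\<beta> - 1) = \<beta> / (\<beta> - 1) * real N powr (1 - \<beta>)"
    using assms by (simp add: field_simps)
  finally show ?thesis by simp
qed

lemma sum_primes_powr_le:
  assumes "1 < \<beta>" "0 \<le> x"
  shows "(\<Sum>p\<in>primes_in x y. real p powr (- \<beta>)) \<le> \<beta> / (\<beta> - 1) * max 1 x powr (1 - \<beta>)"
proof -
  define N where "N = nat \<lceil>max 1 x\<rceil>"
  have N: "1 \<le> N" "max 1 x \<le> real N" by (auto simp: N_def le_nat_iff)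
  have "(\<Sum>p\<in>primes_in x y. real p powr (- \<beta>)) \<le> (\<Sum>n=N..nat \<lfloor>y\<rfloor>. real n powr (- \<beta>))"
  proof (intro sum_mono2)
    show "primes_in x y \<subseteq> {N..nat \<lfloor>y\<rfloor>}"
    proof
      fix p assume p: "p \<in> primes_in x y"
      then have "1 \<le> real p" "x \<le> real p" by (auto simp: primes_in_def Suc_le_eq prime_gt_0_nat)
      then have "max 1 x \<le> real p" by simp
      then have "N \<le> p" unfolding N_def by (simp add: nat_le_iff ceiling_le_iff)
      then show "p \<in> {N..nat \<lfloor>y\<rfloor>}" using p by (auto simp: primes_in_def le_nat_floor)
    qed
  qed auto
  also have "... \<le> \<beta> / (\<beta> - 1) * real N powr (1 - \<beta>)" using assms N by (intro sum_powr_tail_le)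
  also have "... \<le> \<beta> / (\<beta> - 1) * max 1 x powr (1 - \<beta>)"
    using assms N by (intro mult_left_mono powr_mono2') auto
  finally show ?thesis .
qed

text \<open>Only powers \<open>p ^ m > Y\<close> with \<open>p \<le> Y\<close> are missing, so
  \<open>m \<ge> 2\<close>. With \<open>\<delta> = (2 * \<sigma> - 1) / 4\<close>, a part
  \<open>p powr (- m * \<delta>)\<close> of each term is at most \<open>Y powr - \<delta>\<close>,
  and the rest is at most \<open>p powr (- 2 * (\<sigma> - \<delta>))\<close>, whose exponent has
  size \<open>\<sigma> + 1/2\<close> and is therefore summable over the primes.\<close>

lemma euler_log_truncate:
  assumes \<sigma>: "1/2 < \<sigma>" "\<sigma> \<le> Re s" and \<xi>: "\<And>p. prime p \<Longrightarrow> norm (\<xi> p) = 1" and "1 \<le> Y"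
  shows "norm ((\<Sum>p\<in>primes_in 0 Y. - Ln (1 - \<xi> p * of_nat p powr (- s))) - Dpoly (zc s) Y \<xi>)
    \<le> 4 * ((\<sigma> + 1/2) / (\<sigma> - 1/2)) * real Y powr (- ((2 * \<sigma> - 1) / 4))"
proof -
  define \<delta> where "\<delta> = (2 * \<sigma> - 1) / 4"
  have \<delta>: "0 < \<delta>" "2 * (\<sigma> - \<delta>) = \<sigma> + 1/2" "\<delta> < \<sigma>" using \<sigma> by (auto simp: \<delta>_def field_simps)
  have each: "norm (- Ln (1 - \<xi> p * of_nat p powr (- s)) - (\<Sum>m\<in>ppow Y p. zc s p m * \<xi> p ^ m))
      \<le> 4 * real Y powr (- \<delta>) * real p powr (- (\<sigma> + 1/2))" if p: "p \<in> primes_in 0 Y" for p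
  proof -
    have pr: "prime p" "p \<le> Y" using p by (auto simp: primes_in_def)
    have pp: "0 < p" "2 \<le> p" using prime_gt_0_nat[OF pr(1)] prime_ge_2_nat[OF pr(1)] by auto
    define z where "z = \<xi> p * of_nat p powr (- s)"
    define r where "r = real p powr (- \<sigma>)"
    have r: "0 \<le> r" "r \<le> 3/4" using prime_powr_le[OF pr(1), of \<sigma>] \<sigma> by (auto simp: r_def)
    have zr: "norm z \<le> r"
      using pp \<sigma> \<xi>[OF pr(1)] by (simp add: z_def norm_mult norm_nat_powr r_def powr_mono)
    have "\<exists>m. Y < p ^ m" using pp by (intro exI[of _ Y]) (meson less_exp less_le_trans power_mono zero_le)
    define L where "L = (LEAST m. Y < p ^ m)"
    have L: "Y < p ^ L" unfolding L_def using \<open>\<exists>m. Y < p ^ m\<close> by (rule LeastI_ex)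
    have Lm: "p ^ m \<le> Y \<longleftrightarrow> m < L" for m
    proof
      assume "p ^ m \<le> Y"
      show "m < L"
      proof (rule ccontr)
        assume "\<not> m < L"
        then have "p ^ L \<le> p ^ m" using pp by (intro power_increasing) auto
        then show False using L \<open>p ^ m \<le> Y\<close> by simp
      qed
    next
      assume "m < L"
      then show "p ^ m \<le> Y" using not_less_Least[of m "\<lambda>m. Y < p ^ m"] by (simp add: L_def)
    qed
    have L2: "2 \<le> L" using Lm[of 1] pr by simp
    have pw: "ppow Y p = {1..<L}" by (auto simp: ppow_def Lm)
    have "norm (- z) < 1" using zr r by simp
    from sums_minus[OF Ln_series'[OF this]] have s1: "(\<lambda>n. z ^ n / of_nat n) sums (- Ln (1 - z))" by simp
    from sums_split_initial_segment[OF this, of L]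
    have s2: "(\<lambda>n. z ^ (n + L) / of_nat (n + L)) sums (- Ln (1 - z) - (\<Sum>i<L. z ^ i / of_nat i))" .
    have s3: "(\<Sum>i<L. z ^ i / of_nat i) = (\<Sum>m\<in>ppow Y p. zc s p m * \<xi> p ^ m)"
    proof -
      have "(\<Sum>i<L. z ^ i / of_nat i) = (\<Sum>i\<in>{1..<L}. z ^ i / of_nat i)"
        using L2 by (intro sum.mono_neutral_right) (auto simp: Suc_le_eq)
      then show ?thesis unfolding pw
        by (simp add: zc_eq_power[OF pr(1)] z_def power_mult_distrib mult.commute)
    qed
    have g: "(\<lambda>n. r ^ L * r ^ n) sums (r ^ L * (1 / (1 - r)))"
      using r by (intro sums_mult geometric_sums) auto
    have "norm (- Ln (1 - z) - (\<Sum>m\<in>ppow Y p. zc s p m * \<xi> p ^ m)) \<le> r ^ L * (1 / (1 - r))"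
    proof (rule norm_sums_le[OF s2[unfolded s3] g])
      fix n
      have "norm (z ^ (n + L) / of_nat (n + L)) \<le> norm z ^ (n + L) / 1"
        unfolding norm_divide norm_power using L2 by (intro divide_left_mono) (auto simp del: of_nat_add)
      also have "... \<le> r ^ (n + L)" using zr by (simp add: power_mono)
      finally show "norm (z ^ (n + L) / of_nat (n + L)) \<le> r ^ L * r ^ n" by (simp add: power_add mult.commute)
    qed
    also have "... \<le> r ^ L * 4" using r by (intro mult_left_mono) (auto simp: field_simps)
    also have "r ^ L = real (p ^ L) powr (- \<delta>) * (real p powr (- (\<sigma> - \<delta>))) ^ L"
      using pp by (simp add: r_def powr_power powr_realpow[symmetric] powr_powr flip: powr_add) (simp add: algebra_simps)
    also have "... \<le> real Y powr (- \<delta>) * (real p powr (- (\<sigma> - \<delta>))) ^ 2"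
    proof (intro mult_mono)
      show "real (p ^ L) powr (- \<delta>) \<le> real Y powr (- \<delta>)"
        using L \<delta> assms(4) less_imp_le[OF L] by (intro powr_mono2') (auto simp del: of_nat_power)
      show "(real p powr (- (\<sigma> - \<delta>))) ^ L \<le> (real p powr (- (\<sigma> - \<delta>))) ^ 2"
        using L2 pp \<delta> by (intro power_decreasing) (auto simp: powr_le_one_le powr_mono[of _ 0 "real p", simplified])
    qed auto
    also have "(real p powr (- (\<sigma> - \<delta>))) ^ 2 = real p powr (- (\<sigma> + 1/2))"
    proof -
      have "- (\<sigma> - \<delta>) * 2 = - (\<sigma> + 1/2)" using \<delta>(2) by simp
      moreover have "(real p powr (- (\<sigma> - \<delta>))) ^ 2 = real p powr (- (\<sigma> - \<delta>) * 2)"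
        using pp by (subst powr_power) (auto simp: algebra_simps)
      ultimately show ?thesis by (simp only:)
    qed
    finally show ?thesis by (simp add: z_def mult_ac)
  qed
  have "norm ((\<Sum>p\<in>primes_in 0 Y. - Ln (1 - \<xi> p * of_nat p powr (- s))) - Dpoly (zc s) Y \<xi>)
     \<le> (\<Sum>p\<in>primes_in 0 Y. 4 * real Y powr (- \<delta>) * real p powr (- (\<sigma> + 1/2)))"
    unfolding Dpoly_def sum_subtractf[symmetric] by (intro sum_norm_le each)
  also have "... = 4 * real Y powr (- \<delta>) * (\<Sum>p\<in>primes_in 0 Y. real p powr (- (\<sigma> + 1/2)))"
    by (simp add: sum_distrib_left)
  also have "... \<le> 4 * real Y powr (- \<delta>) * ((\<sigma> + 1/2) / (\<sigma> + 1/2 - 1) * max 1 0 powr (1 - (\<sigma> + 1/2)))"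
    using \<sigma> by (intro mult_left_mono sum_primes_powr_le) auto
  also have "... = 4 * ((\<sigma> + 1/2) / (\<sigma> - 1/2)) * real Y powr (- \<delta>)"
    by (simp only: mult.assoc mult.commute[of "real Y powr (- \<delta>)"]) simp
  finally show ?thesis unfolding \<delta>_def .
qed

definition euler_log :: "complex \<Rightarrow> real \<Rightarrow> (nat \<Rightarrow> complex) \<Rightarrow> complex" where
  "euler_log s y \<xi> = (\<Sum>p\<in>primes_in 0 y. - Ln (1 - \<xi> p * of_nat p powr (- s)))"

lemma Ln_linear_bound:
  assumes "prime p" "1/2 \<le> \<sigma>" "\<sigma> \<le> Re s" "norm z = 1"
  shows "norm (- Ln (1 - z * of_nat p powr (- s)) - z * of_nat p powr (- s)) \<le> 4 * real p powr (- (2 * \<sigma>))"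
proof -
  have pp: "0 < p" "1 \<le> real p" using prime_gt_0_nat[OF assms(1)] by auto
  define w where "w = - (z * of_nat p powr (- s))"
  have w: "norm w \<le> real p powr (- \<sigma>)"
    using pp assms by (simp add: w_def norm_mult norm_nat_powr powr_mono)
  then have w1: "norm w \<le> 3/4" using prime_powr_le[OF assms(1,2)] by simp
  have "norm (- Ln (1 - z * of_nat p powr (- s)) - z * of_nat p powr (- s)) = norm (ln (1 + w) - w)"
    by (simp add: w_def norm_minus_commute add.commute)
  also have "... \<le> (norm w)^2 / (1 - norm w)" using w1 by (intro Ln_approx_linear) auto
  also have "... \<le> (norm w)^2 / (1/4)" using w1 by (intro divide_left_mono) auto
  also have "(norm w)^2 \<le> (real p powr (- \<sigma>))^2" using w by (intro power_mono) auto
  also have "(real p powr (- \<sigma>))^2 / (1/4) = 4 * real p powr (- (2 * \<sigma>))"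
    using pp by (simp add: powr_power mult.commute)
  finally show ?thesis by (simp add: divide_right_mono)
qed

section \<open>The random logarithm and its approximation by a short sum\<close>

lemma measurable_log_zeta_random:
  assumes X: "\<And>p. prime p \<Longrightarrow> X p \<in> borel_measurable M"
  shows "log_zeta_random s X \<in> borel_measurable M"
proof -
  have [measurable]: "(\<lambda>w. if prime p then Ln (1 - X p w * of_nat p powr (- s)) else 0) \<in> borel_measurable M" for p
    by (cases "prime p") (auto intro!: measurable_compose[OF _ Ln_measurable] borel_measurable_diff borel_measurable_times X)
  show ?thesis unfolding log_zeta_random_def[abs_def] by measurable
qed

context rmodel begin

lemma prime_sum_block:
  assumes \<sigma>: "1/2 < \<sigma>" "\<sigma> \<le> Re s" and x: "1 \<le> x" and "0 \<le> \<eta>"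
  shows "prob {w \<in> space M. \<eta> \<le> norm (\<Sum>p\<in>primes_in x y. X p w * of_nat p powr (- s))}
    \<le> 4 * exp (- \<eta>\<^sup>2 / (16 * (2 * \<sigma> / (2 * \<sigma> - 1) * x powr (1 - 2 * \<sigma>))))"
proof -
  have "(\<Sum>p\<in>primes_in x y. (norm (of_nat p powr (- s) :: complex))^2) \<le> (\<Sum>p\<in>primes_in x y. real p powr (- (2 * \<sigma>)))"
  proof (intro sum_mono)
    fix p assume "p \<in> primes_in x y"
    then have "prime p" by (rule primes_inD)
    then have p: "0 < p" "1 \<le> real p" using prime_gt_0_nat[of p] by auto
    have "(norm (of_nat p powr (- s) :: complex))^2 = real p powr (- (2 * Re s))"
      using p by (simp add: norm_nat_powr powr_power mult.commute)
    also have "... \<le> real p powr (- (2 * \<sigma>))" using p \<sigma> by (intro powr_mono) auto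
    finally show "(norm (of_nat p powr (- s) :: complex))^2 \<le> real p powr (- (2 * \<sigma>))" .
  qed
  also have "... \<le> 2 * \<sigma> / (2 * \<sigma> - 1) * max 1 x powr (1 - 2 * \<sigma>)"
    using \<sigma> x by (intro sum_primes_powr_le) auto
  also have "max 1 x = x" using x by simp
  finally have V: "(\<Sum>p\<in>primes_in x y. (norm (of_nat p powr (- s) :: complex))^2) \<le> 2 * \<sigma> / (2 * \<sigma> - 1) * x powr (1 - 2 * \<sigma>)" .
  have "0 < 2 * \<sigma> / (2 * \<sigma> - 1) * x powr (1 - 2 * \<sigma>)"
    using \<sigma> x by (intro mult_pos_pos divide_pos_pos) auto
  from subgaussian_tail[OF finite_primes_in _ V this assms(4)] show ?thesis
    by (simp add: primes_inD mult.commute)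
qed

lemma measurable_prime_sum [measurable]:
  "(\<lambda>w. \<Sum>p\<in>primes_in x y. X p w * c p) \<in> borel_measurable M"
  by (intro borel_measurable_sum borel_measurable_times measurable_X) (auto dest: primes_inD)

text \<open>In a dyadic block the partial sums move by more than
  \<open>(2 ^ k) powr - \<delta>\<close> with a probability so small that a union bound over all
  endpoints of the block is still summable. Borel-Cantelli then makes the block sums decay
  geometrically.\<close>

lemma AE_prime_sum_convergent:
  assumes \<sigma>: "1/2 < Re s"
  shows "AE w in M. convergent (\<lambda>n. \<Sum>p\<in>primes_in 0 (real n). X p w * of_nat p powr (- s))"
proof -
  define \<sigma> where "\<sigma> = Re s"
  define \<delta> where "\<delta> = (2 * \<sigma> - 1) / 4"
  have \<delta>: "0 < \<delta>" using assms by (auto simp: \<delta>_def \<sigma>_def)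
  define c where "c = 1 / (16 * (2 * \<sigma> / (2 * \<sigma> - 1)))"
  have c: "0 < c" using assms by (simp add: c_def \<sigma>_def)
  define S where "S n w = (\<Sum>p\<in>primes_in 0 (real n). X p w * of_nat p powr (- s))" for n w
  define B where "B k n = {w \<in> space M. (2 ^ k) powr (- \<delta>) \<le> norm (\<Sum>p\<in>primes_in (2 ^ k) (real n). X p w * of_nat p powr (- s))}" for k n :: nat
  define A where "A k = (\<Union>n\<in>{2^k..2^Suc k}. B k n)" for k
  have [measurable]: "B k n \<in> sets M" for k n unfolding B_def by measurable
  have [measurable]: "A k \<in> sets M" for k unfolding A_def by measurable
  have PB: "prob (B k n) \<le> 4 * exp (- (c * (2 ^ k) powr (2 * \<delta>)))" for k n
  proof -
    have "prob (B k n) \<le> 4 * exp (- ((2 ^ k) powr (- \<delta>))\<^sup>2 / (16 * (2 * \<sigma> / (2 * \<sigma> - 1) * (2 ^ k) powr (1 - 2 * \<sigma>))))"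
      unfolding B_def using assms by (intro prime_sum_block) (auto simp: \<sigma>_def)
    also have "- ((2 ^ k) powr (- \<delta>))\<^sup>2 / (16 * (2 * \<sigma> / (2 * \<sigma> - 1) * (2 ^ k) powr (1 - 2 * \<sigma>)))
        = - (c * (((2 ^ k) powr (- \<delta>))^2 / (2 ^ k) powr (1 - 2 * \<sigma>)))"
      by (simp add: c_def mult_ac)
    also have "((2 ^ k) powr (- \<delta>))^2 / (2 ^ k :: real) powr (1 - 2 * \<sigma>) = (2 ^ k) powr (2 * \<delta>)"
    proof -
      have "((2 ^ k :: real) powr (- \<delta>))^2 = (2 ^ k) powr (- (2 * \<delta>))" by (simp add: powr_power mult.commute)
      then show ?thesis by (simp add: powr_diff[symmetric] \<delta>_def) (simp add: field_simps)
    qed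
    finally show ?thesis .
  qed
  have PA: "prob (A k) \<le> (2 ^ k + 1) * (4 * exp (- (c * (2 ^ k) powr (2 * \<delta>))))" for k
  proof -
    have "prob (A k) \<le> (\<Sum>n\<in>{2^k..2^Suc k}. prob (B k n))"
      unfolding A_def by (intro finite_measure_subadditive_finite) auto
    also have "... \<le> (\<Sum>n\<in>{2^k..2^Suc k::nat}. 4 * exp (- (c * (2 ^ k) powr (2 * \<delta>))))"
      by (intro sum_mono PB)
    also have "... = (2 ^ k + 1) * (4 * exp (- (c * (2 ^ k) powr (2 * \<delta>))))" by (simp add: add.commute)
    finally show ?thesis .
  qed
  have "\<forall>\<^sub>F x::real in at_top. (x + 1) * (4 * exp (- (c * x powr (2 * \<delta>)))) \<le> 1 / x"
    using c \<delta> by real_asymp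
  moreover have "filterlim (\<lambda>k::nat. (2::real) ^ k) at_top sequentially" by real_asymp
  ultimately have "\<forall>\<^sub>F k in sequentially. (2 ^ k + 1) * (4 * exp (- (c * (2 ^ k) powr (2 * \<delta>)))) \<le> 1 / 2 ^ k"
    by (rule eventually_compose_filterlim)
  then have "\<forall>\<^sub>F k in sequentially. norm (prob (A k)) \<le> (1/2) ^ k"
    by eventually_elim (use PA in \<open>auto intro: order_trans simp: power_divide\<close>)
  then have "summable (\<lambda>k. prob (A k))"
    by (rule summable_comparison_test_ev) (intro summable_geometric, simp)
  then have "AE w in M. \<forall>\<^sub>F k in sequentially. w \<in> space M - A k"
    by (intro borel_cantelli_AE1) (auto simp: emeasure_eq_measure)
  then show ?thesis
  proof eventually_elim
    case (elim w)
    define r where "r = (2::real) powr (- \<delta>)"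
    have r: "0 \<le> r" "r < 1" using \<delta> by (auto simp: r_def powr_less_one)
    have rk: "(2 ^ k) powr (- \<delta>) = r ^ k" for k :: nat
      by (simp add: r_def powr_power powr_realpow[symmetric] powr_powr mult.commute)
    obtain k0 where k0: "\<And>k. k0 \<le> k \<Longrightarrow> w \<in> space M - A k" using elim by (auto simp: eventually_sequentially)
    have blk: "norm (S n w - S (2 ^ k) w) \<le> r ^ k" if "k0 \<le> k" "2 ^ k \<le> n" "n \<le> 2 ^ Suc k" for k n
    proof -
      have "w \<notin> B k n" "w \<in> space M" using k0[OF that(1)] that by (auto simp: A_def)
      then have "norm (\<Sum>p\<in>primes_in (2 ^ k) (real n). X p w * of_nat p powr (- s)) \<le> r ^ k"
        by (auto simp: B_def rk)
      also have "(\<Sum>p\<in>primes_in (2 ^ k) (real n). X p w * of_nat p powr (- s)) = S n w - S (2 ^ k) w"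
      proof -
        have "(2::real) ^ k \<le> real n" using that(2) by (metis of_nat_le_iff of_nat_numeral of_nat_power)
        then have "primes_in 0 (real n) = primes_in 0 (real (2 ^ k)) \<union> primes_in (2 ^ k) (real n)"
          by (auto simp: primes_in_def)
        moreover have "primes_in 0 (real (2 ^ k)) \<inter> primes_in (2 ^ k) (real n) = {}" by (auto simp: primes_in_def)
        ultimately show ?thesis unfolding S_def by (simp add: sum.union_disjoint)
      qed
      finally show ?thesis .
    qed
    have "summable (\<lambda>k. S (2 ^ Suc k) w - S (2 ^ k) w)"
    proof (rule summable_comparison_test'[where N = k0])
      show "summable (\<lambda>k. r ^ k)" using r by (intro summable_geometric) auto
      show "norm (S (2 ^ Suc k) w - S (2 ^ k) w) \<le> r ^ k" if "k0 \<le> k" for k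
        using blk[OF that, of "2 ^ Suc k"] by simp
    qed
    then obtain L where "(\<lambda>k. S (2 ^ Suc k) w - S (2 ^ k) w) sums L" by (auto simp: summable_def)
    then have "(\<lambda>n. (\<Sum>k<n. S (2 ^ Suc k) w - S (2 ^ k) w) + S (2 ^ 0) w) \<longlonglongrightarrow> L + S (2 ^ 0) w"
      unfolding sums_def by (intro tendsto_add tendsto_const)
    moreover have "(\<Sum>k<n. S (2 ^ Suc k) w - S (2 ^ k) w) + S (2 ^ 0) w = S (2 ^ n) w" for n
      by (subst sum_lessThan_telescope) simp
    ultimately have T: "(\<lambda>n. S (2 ^ n) w) \<longlonglongrightarrow> L + S (2 ^ 0) w" by simp
    \<comment> \<open>The estimate inside a block carries convergence from the powers of 2 over to
      all \<open>n\<close>.\<close>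
    have fl: "filterlim floor_log at_top sequentially"
    proof (subst filterlim_at_top, safe)
      fix Z :: nat
      have "Z \<le> floor_log n" if "2 ^ Z \<le> n" for n
        using floor_log_le_iff[OF that] by simp
      then show "\<forall>\<^sub>F n in sequentially. Z \<le> floor_log n"
        by (auto simp: eventually_sequentially)
    qed
    have "(\<lambda>n. S n w - S (2 ^ floor_log n) w) \<longlonglongrightarrow> 0"
    proof (rule Lim_null_comparison)
      show "\<forall>\<^sub>F n in sequentially. norm (S n w - S (2 ^ floor_log n) w) \<le> r ^ floor_log n"
        using filterlim_at_top[THEN iffD1, OF fl, rule_format, of k0] eventually_gt_at_top[of 0]
      proof eventually_elim
        case (elim n)
        then show ?case
          using floor_log_exp2_le[of n] floor_log_exp2_gt[of n] by (intro blk) auto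
      qed
      show "(\<lambda>n. r ^ floor_log n) \<longlonglongrightarrow> 0"
        using filterlim_compose[OF LIMSEQ_power_zero fl, of r] r by simp
    qed
    from tendsto_add[OF this filterlim_compose[OF T fl]]
    have "(\<lambda>n. S n w) \<longlonglongrightarrow> L + S (2 ^ 0) w" by simp
    then show ?case unfolding S_def by (auto simp: convergent_def)
  qed
qed

text \<open>Each logarithm differs from its linear term by an absolutely summable amount, so
  convergence reduces to the linear prime sum. The definition sums over all naturals and the Euler
  product over primes up to \<open>n\<close>, which accounts for the index shifts.\<close>

lemma AE_euler_log_convergent:
  assumes "1/2 < Re s"
  shows "AE w in M. (\<lambda>n. euler_log s (real n) (Xs w)) \<longlonglongrightarrow> log_zeta_random s X w"
  using AE_prime_sum_convergent[OF assms]
proof eventually_elim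
  case (elim w)
  define f where "f p = (if prime p then Ln (1 - X p w * of_nat p powr (- s)) else 0)" for p
  define g where "g p = (if prime p then X p w * of_nat p powr (- s) else 0)" for p
  have part: "(\<Sum>p<n. if prime p then h p else 0) = (\<Sum>p\<in>primes_in 0 (real (n - 1)). h p)" for n and h :: "nat \<Rightarrow> complex"
  proof -
    have "p \<in> {..<n} \<and> prime p \<longleftrightarrow> p \<in> primes_in 0 (real (n - 1))" for p
      using prime_gt_0_nat[of p] by (auto simp: primes_in_def)
    then have "{p \<in> {..<n}. prime p} = primes_in 0 (real (n - 1))" by blast
    then show ?thesis by (simp only: sum.inter_filter[symmetric, OF finite_lessThan])
  qed
  have "(\<lambda>n. \<Sum>p<Suc n. g p) = (\<lambda>n. \<Sum>p\<in>primes_in 0 (real n). X p w * of_nat p powr (- s))"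
    unfolding g_def part by simp
  then have "convergent (\<lambda>n. \<Sum>p<Suc n. g p)" using elim by simp
  then have "convergent (\<lambda>n. \<Sum>p<n. g p)" by (rule convergent_Suc_iff[THEN iffD1])
  then have g: "summable g" by (simp add: summable_iff_convergent)
  have "summable (\<lambda>p. f p + g p)"
  proof (rule summable_comparison_test'[where N = 0])
    show "summable (\<lambda>n. 4 * real n powr (- (2 * Re s)))"
      using assms by (intro summable_mult) (simp add: summable_real_powr_iff)
    show "norm (f p + g p) \<le> 4 * real p powr (- (2 * Re s))" for p
    proof (cases "prime p")
      case True
      have "norm (f p + g p) = norm (- Ln (1 - X p w * of_nat p powr (- s)) - X p w * of_nat p powr (- s))"
        using True by (simp add: f_def g_def norm_minus_commute) (metis minus_add_distrib norm_minus_cancel add_uminus_conv_diff uminus_add_conv_diff)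
      then show ?thesis using Ln_linear_bound[OF True _ order_refl norm_X[OF True, of w], of s] assms by simp
    qed (simp add: f_def g_def)
  qed
  from summable_diff[OF this g] have "summable f" by simp
  then have "(\<lambda>n. \<Sum>p<n. f p) \<longlonglongrightarrow> suminf f" by (rule summable_LIMSEQ)
  then have "(\<lambda>n. - (\<Sum>p<Suc n. f p)) \<longlonglongrightarrow> - suminf f" by (intro tendsto_minus LIMSEQ_Suc)
  moreover have "- (\<Sum>p<Suc n. f p) = euler_log s (real n) (Xs w)" for n
    unfolding f_def part euler_log_def by (simp add: sum_negf)
  ultimately show ?case by (simp add: log_zeta_random_def f_def[abs_def])
qed

text \<open>Fatou's lemma for sets: almost all of \<open>B\<close> lies in the limit inferior of the
  \<open>A n\<close>.\<close>

lemma prob_le_of_AE_eventually: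
  assumes [measurable]: "B \<in> sets M" "\<And>n. A n \<in> sets M"
    and ae: "AE w in M. w \<in> B \<longrightarrow> (\<forall>\<^sub>F n in sequentially. w \<in> A n)"
    and K: "\<And>n. prob (A n) \<le> K"
  shows "prob B \<le> K"
proof -
  define I where "I N = (\<Inter>n\<in>{N..}. A n)" for N
  have [measurable]: "I N \<in> sets M" for N unfolding I_def by measurable
  have "incseq I" unfolding I_def by (intro monoI) auto
  then have "(\<lambda>N. prob (I N)) \<longlonglongrightarrow> prob (\<Union>N. I N)"
    by (intro finite_Lim_measure_incseq) auto
  moreover have "prob (I N) \<le> K" for N
    using K[of N] finite_measure_mono[of "I N" "A N"] by (force simp: I_def)
  ultimately have "prob (\<Union>N. I N) \<le> K" by (intro LIMSEQ_le_const2) auto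
  moreover have "prob B \<le> prob (\<Union>N. I N)"
  proof (rule finite_measure_mono_AE)
    show "AE w in M. w \<in> B \<longrightarrow> w \<in> (\<Union>N. I N)"
      using ae by eventually_elim (auto simp: I_def eventually_sequentially)
  qed measurable
  ultimately show ?thesis by simp
qed

lemma euler_log_measurable [measurable]: "(\<lambda>w. euler_log s y (Xs w)) \<in> borel_measurable M"
  unfolding euler_log_def
proof (intro borel_measurable_sum borel_measurable_uminus)
  fix p assume "p \<in> primes_in 0 y"
  then have [measurable]: "X p \<in> borel_measurable M" by (intro measurable_X) (auto dest: primes_inD)
  show "(\<lambda>w. Ln (1 - X p w * of_nat p powr (- s))) \<in> borel_measurable M" by measurable
qed

lemmas log_zeta_random_measurable [measurable] = measurable_log_zeta_random[OF measurable_X]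

text \<open>Beyond \<open>Y\<close> there remain the quadratic parts of the logarithms, which are
  small deterministically, and the linear prime sum, which is subgaussian. The tail bound is uniform
  in the upper end \<open>n\<close> of the prime sum and is carried to the limit by
  \<open>prob_le_of_AE_eventually\<close>.\<close>

lemma random_approximation:
  assumes \<sigma>: "1/2 < \<sigma>"
  shows "\<exists>C>0. \<exists>c>0. \<forall>Y s. 1 \<le> Y \<longrightarrow> \<sigma> \<le> Re s \<longrightarrow>
    prob {w \<in> space M. C * real Y powr (- ((2 * \<sigma> - 1) / 4)) \<le> norm (log_zeta_random s X w - Dpoly (zc s) Y (Xs w))}
      \<le> 4 * exp (- (c * real Y powr ((2 * \<sigma> - 1) / 2)))"
proof -
  define \<delta> where "\<delta> = (2 * \<sigma> - 1) / 4"
  have \<delta>: "0 < \<delta>" "(2 * \<sigma> - 1) / 2 = 2 * \<delta>" using assms by (auto simp: \<delta>_def)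
  define C1 where "C1 = 4 * ((\<sigma> + 1/2) / (\<sigma> - 1/2))"
  define C2 where "C2 = 4 * (2 * \<sigma> / (2 * \<sigma> - 1))"
  have C12: "0 < C1" "0 < C2" using \<sigma> by (auto simp: C1_def C2_def)
  define c where "c = 1 / (16 * (2 * \<sigma> / (2 * \<sigma> - 1)))"
  have c: "0 < c" using assms by (simp add: c_def)
  \<comment> \<open>\<open>C1\<close> pays for the missing prime powers and \<open>C2\<close> for
    the quadratic parts beyond \<open>Y\<close>. One unit covers the distance of a late Euler
    product from the limit, and the last one remains for the linear prime sum.\<close>
  have "prob {w \<in> space M. (C1 + C2 + 2) * real Y powr (- \<delta>) \<le> norm (log_zeta_random s X w - Dpoly (zc s) Y (Xs w))}
      \<le> 4 * exp (- (c * real Y powr (2 * \<delta>)))" if Y: "1 \<le> Y" and s: "\<sigma> \<le> Re s" for Y s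
  proof (rule prob_le_of_AE_eventually)
    define A where "A n = {w \<in> space M. real Y powr (- \<delta>) \<le> norm (\<Sum>p\<in>primes_in (real Y) (real n). X p w * of_nat p powr (- s))}" for n :: nat
    have [measurable]: "(\<lambda>w. Dpoly (zc s) Y (Xs w)) \<in> borel_measurable M"
      using gpoly_measurable[OF gpoly_Dpoly[OF Y]] measurable_X by blast
    show "{w \<in> space M. (C1 + C2 + 2) * real Y powr (- \<delta>) \<le> norm (log_zeta_random s X w - Dpoly (zc s) Y (Xs w))} \<in> sets M"
      by measurable
    show "A n \<in> sets M" for n unfolding A_def by measurable
    show "prob (A n) \<le> 4 * exp (- (c * real Y powr (2 * \<delta>)))" for n
    proof -
      have "prob (A n) \<le> 4 * exp (- (real Y powr (- \<delta>))\<^sup>2 / (16 * (2 * \<sigma> / (2 * \<sigma> - 1) * real Y powr (1 - 2 * \<sigma>))))"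
        unfolding A_def using assms s Y by (intro prime_sum_block) auto
      also have "- (real Y powr (- \<delta>))\<^sup>2 / (16 * (2 * \<sigma> / (2 * \<sigma> - 1) * real Y powr (1 - 2 * \<sigma>)))
          = - (c * ((real Y powr (- \<delta>))^2 / real Y powr (1 - 2 * \<sigma>)))"
        by (simp add: c_def mult_ac)
      also have "(real Y powr (- \<delta>))^2 / real Y powr (1 - 2 * \<sigma>) = real Y powr (2 * \<delta>)"
      proof -
        have "(real Y powr (- \<delta>))^2 = real Y powr (- (2 * \<delta>))" using Y by (simp add: powr_power mult.commute)
        then show ?thesis by (simp add: powr_diff[symmetric] \<delta>_def) (simp add: field_simps)
      qed
      finally show ?thesis .
    qed
    have Yd: "0 < real Y powr (- \<delta>)" using Y by simp
    show "AE w in M. w \<in> {w \<in> space M. (C1 + C2 + 2) * real Y powr (- \<delta>) \<le> norm (log_zeta_random s X w - Dpoly (zc s) Y (Xs w))}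
       \<longrightarrow> (\<forall>\<^sub>F n in sequentially. w \<in> A n)"
    proof -
      have "1/2 < Re s" using s \<sigma> by simp
      from AE_euler_log_convergent[OF this] show ?thesis
      proof (eventually_elim, intro impI)
      fix w assume w2: "(\<lambda>n. euler_log s (real n) (Xs w)) \<longlonglongrightarrow> log_zeta_random s X w"
        and "w \<in> {w \<in> space M. (C1 + C2 + 2) * real Y powr (- \<delta>) \<le> norm (log_zeta_random s X w - Dpoly (zc s) Y (Xs w))}"
      then have big: "(C1 + C2 + 2) * real Y powr (- \<delta>) \<le> norm (log_zeta_random s X w - Dpoly (zc s) Y (Xs w))"
        and w: "w \<in> space M" by auto
      have "\<forall>\<^sub>F n in sequentially. dist (euler_log s (real n) (Xs w)) (log_zeta_random s X w) < real Y powr (- \<delta>)"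
        using w2 Yd by (rule tendstoD)
      then show "\<forall>\<^sub>F n in sequentially. w \<in> A n"
        using eventually_ge_at_top[of Y]
      proof eventually_elim
        case (elim n)
        let ?E = "\<lambda>y. euler_log s y (Xs w)"
        let ?S = "\<Sum>p\<in>primes_in (real Y) (real n). X p w * of_nat p powr (- s)"
        have "primes_in 0 (real n) = primes_in 0 Y \<union> primes_in (real Y) (real n)"
          using elim by (auto simp: primes_in_def)
        moreover have "primes_in 0 Y \<inter> primes_in (real Y) (real n) = {}" by (auto simp: primes_in_def)
        ultimately have "?E (real n) - ?E (real Y) - ?S = (\<Sum>p\<in>primes_in (real Y) (real n). - Ln (1 - X p w * of_nat p powr (- s)) - X p w * of_nat p powr (- s))"
          unfolding euler_log_def by (simp add: sum.union_disjoint sum_subtractf)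
        also have "norm ... \<le> (\<Sum>p\<in>primes_in (real Y) (real n). 4 * real p powr (- (2 * \<sigma>)))"
          using s \<sigma> norm_X by (intro sum_norm_le Ln_linear_bound) (auto dest: primes_inD)
        also have "... = 4 * (\<Sum>p\<in>primes_in (real Y) (real n). real p powr (- (2 * \<sigma>)))" by (simp add: sum_distrib_left)
        also have "... \<le> 4 * (2 * \<sigma> / (2 * \<sigma> - 1) * max 1 (real Y) powr (1 - 2 * \<sigma>))"
          using \<sigma> by (intro mult_left_mono sum_primes_powr_le) auto
        also have "... = C2 * real Y powr (1 - 2 * \<sigma>)" using Y by (simp add: C2_def max_def)
        also have "... \<le> C2 * real Y powr (- \<delta>)"
          using C12 Y \<sigma> by (intro mult_left_mono powr_mono) (auto simp: \<delta>_def field_simps)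
        finally have 1: "norm (?E (real n) - ?E (real Y) - ?S) \<le> C2 * real Y powr (- \<delta>)" .
        have 2: "norm (?E (real Y) - Dpoly (zc s) Y (Xs w)) \<le> C1 * real Y powr (- \<delta>)"
          unfolding euler_log_def C1_def \<delta>_def using s \<sigma> Y norm_X by (intro euler_log_truncate) auto
        have 3: "norm (?E (real n) - log_zeta_random s X w) < real Y powr (- \<delta>)" using elim by (simp add: dist_norm)
        have tri: "norm (l - d) \<le> norm (en - l) + norm (en - ey - ss) + norm (ey - d) + norm ss" for l d en ey ss :: complex
        proof -
          have "norm (l - d) = norm (- (en - l) + (en - ey - ss) + (ey - d) + ss)" by simp
          also have "... \<le> norm (- (en - l) + (en - ey - ss) + (ey - d)) + norm ss" by (rule norm_triangle_ineq)
          also have "... \<le> norm (- (en - l) + (en - ey - ss)) + norm (ey - d) + norm ss"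
            by (intro add_right_mono norm_triangle_ineq)
          also have "... \<le> norm (- (en - l)) + norm (en - ey - ss) + norm (ey - d) + norm ss"
            by (intro add_right_mono norm_triangle_ineq)
          finally show ?thesis unfolding norm_minus_cancel .
        qed
        have "(C1 + C2 + 2) * real Y powr (- \<delta>) \<le> real Y powr (- \<delta>) + C2 * real Y powr (- \<delta>) + C1 * real Y powr (- \<delta>) + norm ?S"
          using big tri[of "log_zeta_random s X w" "Dpoly (zc s) Y (Xs w)" "?E (real n)" "?E (real Y)" ?S] 1 2 3
          by linarith
        then show ?case using w by (simp add: A_def algebra_simps)
      qed
    qed
    qed
  qed
  then show ?thesis unfolding \<delta>(2) unfolding \<delta>_def[symmetric] using C12 c
    by (intro exI[of _ "C1 + C2 + 2"] conjI exI[of _ c] allI impI) auto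
qed

end

section \<open>Trigonometric polynomials, Fejer and Jackson kernels\<close>

definition ee :: "real \<Rightarrow> complex" where "ee y = cis (2 * pi * y)"

lemma ee_add: "ee (x + y) = ee x * ee y" by (simp add: ee_def cis_mult algebra_simps)
lemma ee_0 [simp]: "ee 0 = 1" by (simp add: ee_def)
lemma norm_ee [simp]: "norm (ee y) = 1" by (simp add: ee_def)
lemma ee_of_nat_mult: "ee (of_nat j * y) = ee y ^ j" by (simp add: ee_def Complex.DeMoivre mult_ac)
lemma cnj_ee: "cnj (ee y) = ee (- y)" by (simp add: ee_def cis_cnj)
lemma ee_of_int [simp]: "ee (of_int k) = 1"
  unfolding ee_def by (rule cis_multiple_2pi) (simp add: Ints_of_int)

lemma norm_ee_minus_1: "norm (ee y - 1) = 2 * \<bar>sin (pi * y)\<bar>"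
proof -
  have "ee y - 1 = cis (pi * y) * (cis (pi * y) - cis (- (pi * y)))"
    by (simp add: ee_def cis_mult algebra_simps)
  also have "cis (pi * y) - cis (- (pi * y)) = 2 * \<i> * sin (pi * y)" by (simp add: complex_eq_iff)
  finally show ?thesis by (simp add: norm_mult)
qed

definition dker :: "nat \<Rightarrow> real \<Rightarrow> complex" where "dker n y = (\<Sum>j<n. ee (real j * y))"

text \<open>Summing the geometric series; written as a product, so that integer \<open>y\<close> is
  included.\<close>

lemma norm_dker_sin: "norm (dker n y) * \<bar>sin (pi * y)\<bar> = \<bar>sin (pi * (n * y))\<bar>"
proof -
  have "dker n y * (ee y - 1) = ee (n * y) - 1"
    unfolding dker_def ee_of_nat_mult by (metis mult.commute power_diff_1_eq)
  then have "norm (dker n y) * norm (ee y - 1) = norm (ee (n * y) - 1)" by (metis norm_mult)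
  then show ?thesis unfolding norm_ee_minus_1 by simp
qed

text \<open>Concavity gives \<open>2 * y\<close> up to \<open>1/2\<close>, and reflection extends a
  weaker bound to \<open>3/4\<close>. That range holds the differences of a point in
  \<open>[-1/4, 1/4]\<close> and a grid point in \<open>[-1/2, 1/2]\<close>.\<close>

lemma abs_sin_pi_ge:
  assumes "\<bar>y\<bar> \<le> 3/4"
  shows "\<bar>y\<bar> / 2 \<le> \<bar>sin (pi * y)\<bar>"
proof -
  have half: "2 * y \<le> sin (pi * y)" if "0 \<le> y" "y \<le> 1/2" for y
  proof -
    have "concave_on {0..pi} sin"
      by (rule f''_le0_imp_concave[where f' = cos and f'' = "\<lambda>x. - sin x"]) (auto intro!: derivative_eq_intros sin_ge_zero)
    from concave_onD[OF this, of "2 * y" 0 "pi / 2"] that show ?thesis by (simp add: algebra_simps)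
  qed
  have pos: "y / 2 \<le> sin (pi * y)" if "0 \<le> y" "y \<le> 3/4" for y
  proof (cases "y \<le> 1/2")
    case True
    then show ?thesis using half[of y] that by simp
  next
    case False
    have "sin (pi * y) = sin (pi * (1 - y))" by (simp add: right_diff_distrib sin_diff)
    then show ?thesis using half[of "1 - y"] False that by simp
  qed
  show ?thesis
    using pos[of y] pos[of "- y"] assms by (cases "0 \<le> y") auto
qed

lemma norm_dker_decay:
  assumes "\<bar>y\<bar> \<le> 3/4" "y \<noteq> 0"
  shows "norm (dker n y) \<le> 2 / \<bar>y\<bar>"
proof -
  have "norm (dker n y) * (\<bar>y\<bar> / 2) \<le> norm (dker n y) * \<bar>sin (pi * y)\<bar>"
    using abs_sin_pi_ge[OF assms(1)] by (intro mult_left_mono) auto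
  also have "... \<le> 1" unfolding norm_dker_sin by simp
  finally show ?thesis using assms by (simp add: field_simps)
qed

text \<open>\<open>A\<close> bounds each coefficient, not their sum. A kernel of height about 1 and
  width \<open>1 / n\<close> has coefficients of size \<open>1 / n\<close>; together with the decay
  of the characteristic function this makes its expectation small.\<close>

definition trigpoly :: "nat \<Rightarrow> real \<Rightarrow> (real \<Rightarrow> complex) \<Rightarrow> bool" where
  "trigpoly N A g \<longleftrightarrow> (\<exists>c. (\<forall>m. norm (c m) \<le> A) \<and> (\<forall>y. g y = (\<Sum>m\<in>{-int N..int N}. c m * ee (of_int m * y))))"

lemma trigpolyI:
  assumes "finite I" "\<And>i. i \<in> I \<Longrightarrow> \<bar>f i\<bar> \<le> int N" "\<And>m. (\<Sum>i\<in>{i\<in>I. f i = m}. norm (a i)) \<le> A"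
    "\<And>y. g y = (\<Sum>i\<in>I. a i * ee (of_int (f i) * y))"
  shows "trigpoly N A g"
  unfolding trigpoly_def
proof (intro exI conjI allI)
  fix m show "norm (\<Sum>i\<in>{i\<in>I. f i = m}. a i) \<le> A"
    by (rule order_trans[OF norm_sum assms(3)])
next
  fix y
  have "(\<Sum>m\<in>{-int N..int N}. \<Sum>i\<in>{i\<in>I. f i = m}. a i * ee (of_int (f i) * y)) = (\<Sum>i\<in>I. a i * ee (of_int (f i) * y))"
  proof (rule sum.group[OF assms(1)])
    show "f ` I \<subseteq> {- int N..int N}" using assms(2) by (force simp: abs_le_iff)
  qed auto
  then show "g y = (\<Sum>m\<in>{- int N..int N}. (\<Sum>i\<in>{i\<in>I. f i = m}. a i) * ee (of_int m * y))"
    unfolding assms(4) sum_distrib_right by simp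
qed

lemma trigpoly_add:
  assumes "trigpoly N A f" "trigpoly N B g"
  shows "trigpoly N (A + B) (\<lambda>y. f y + g y)"
proof -
  obtain c d where "\<forall>m. norm (c m) \<le> A" "\<forall>y. f y = (\<Sum>m\<in>{-int N..int N}. c m * ee (of_int m * y))"
    "\<forall>m. norm (d m) \<le> B" "\<forall>y. g y = (\<Sum>m\<in>{-int N..int N}. d m * ee (of_int m * y))"
    using assms unfolding trigpoly_def by blast
  then show ?thesis unfolding trigpoly_def
    by (intro exI[of _ "\<lambda>m. c m + d m"]) (auto simp: distrib_right sum.distrib intro: norm_triangle_mono)
qed

lemma trigpoly_cmult:
  assumes "trigpoly N A f"
  shows "trigpoly N (norm k * A) (\<lambda>y. k * f y)"
proof -
  obtain c where "\<forall>m. norm (c m) \<le> A" "\<forall>y. f y = (\<Sum>m\<in>{-int N..int N}. c m * ee (of_int m * y))"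
    using assms unfolding trigpoly_def by blast
  then show ?thesis unfolding trigpoly_def
    by (intro exI[of _ "\<lambda>m. k * c m"]) (auto simp: norm_mult sum_distrib_left mult.assoc intro: mult_left_mono)
qed

lemma trigpoly_shift:
  assumes "trigpoly N A f"
  shows "trigpoly N A (\<lambda>y. f (y + b))"
proof -
  obtain c where "\<forall>m. norm (c m) \<le> A" "\<forall>y. f y = (\<Sum>m\<in>{-int N..int N}. c m * ee (of_int m * y))"
    using assms unfolding trigpoly_def by blast
  then show ?thesis unfolding trigpoly_def
    by (intro exI[of _ "\<lambda>m. c m * ee (of_int m * b)"]) (auto simp: norm_mult distrib_left ee_add mult_ac)
qed

lemma trigpoly_sum:
  assumes "finite S" "\<And>k. k \<in> S \<Longrightarrow> trigpoly N (A k) (f k)"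
  shows "trigpoly N (\<Sum>k\<in>S. A k) (\<lambda>y. \<Sum>k\<in>S. f k y)"
  using assms
proof (induction rule: finite_induct)
  case empty
  show ?case unfolding trigpoly_def by (intro exI[of _ "\<lambda>_. 0"]) auto
qed (auto intro: trigpoly_add)

text \<open>The Fejer kernel, scaled to the value 1 at 0 for positive \<open>n\<close>; its
  coefficients are then at most \<open>1 / n\<close>.\<close>

definition fej :: "nat \<Rightarrow> real \<Rightarrow> real" where "fej n y = (norm (dker n y))^2 / (real n)^2"

lemma dker_sq: "of_real ((norm (dker n y))^2) = (\<Sum>(j, l)\<in>{..<n} \<times> {..<n}. ee (of_int (int j - int l) * y))"
proof -
  have "of_real ((norm (dker n y))^2) = dker n y * cnj (dker n y)" by (rule complex_norm_square)
  also have "... = (\<Sum>j<n. \<Sum>l<n. ee (real j * y) * ee (- (real l * y)))"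
    by (simp add: dker_def cnj_ee sum_product)
  also have "... = (\<Sum>j<n. \<Sum>l<n. ee (of_int (int j - int l) * y))"
    by (intro sum.cong refl) (simp add: ee_add[symmetric] left_diff_distrib)
  finally show ?thesis by (simp add: sum.cartesian_product)
qed

lemma trigpoly_fej:
  assumes "0 < n"
  shows "trigpoly n (1 / n) (\<lambda>y. of_real (fej n y))"
proof (rule trigpolyI[where I = "{..<n} \<times> {..<n}" and f = "\<lambda>(j, l). int j - int l" and a = "\<lambda>_. 1 / (of_nat n)^2"])
  fix m
  let ?S = "{i \<in> {..<n} \<times> {..<n}. (case i of (j, l) \<Rightarrow> int j - int l) = m}"
  have "inj_on fst ?S"
    by (auto simp: inj_on_def)
  moreover have "fst ` ?S \<subseteq> {..<n}" by auto
  ultimately have "card ?S \<le> n"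
    using card_inj_on_le[of fst _ "{..<n}"] by auto
  then have "real (card ?S) * (1 / (real n)^2) \<le> real n * (1 / (real n)^2)"
    by (intro mult_right_mono) auto
  also have "real n * (1 / (real n)^2) = 1 / n" using assms by (simp add: power2_eq_square)
  finally show "(\<Sum>i | i \<in> {..<n} \<times> {..<n} \<and> (case i of (j, l) \<Rightarrow> int j - int l) = m. norm (1 / (complex_of_nat n)^2)) \<le> 1 / n"
    by (simp add: norm_divide norm_power)
next
  fix y
  show "of_real (fej n y) = (\<Sum>i\<in>{..<n} \<times> {..<n}. 1 / (of_nat n)^2 * ee (of_int (case i of (j, l) \<Rightarrow> int j - int l) * y))"
    unfolding sum_distrib_left[symmetric] fej_def of_real_divide dker_sq by (simp add: case_prod_unfold)
qed auto

text \<open>The Jackson kernel before normalisation. The fourth power makes the weight beyond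
  distance \<open>\<delta>\<close> fall at least like the inverse square of
  \<open>n * \<delta>\<close>, which a majorant of Fejer type can dominate; the square of the
  Dirichlet kernel would give only the first power.\<close>

definition jac :: "nat \<Rightarrow> real \<Rightarrow> real" where "jac n y = norm (dker n y) ^ 4"

lemma jac_eq: "of_real (jac n y) = (\<Sum>((j, l), (j', l'))\<in>({..<n} \<times> {..<n}) \<times> ({..<n} \<times> {..<n}). ee (of_int (int j - int l + (int j' - int l')) * y))"
proof -
  have "of_real (jac n y) = of_real ((norm (dker n y))^2) * (of_real ((norm (dker n y))^2) :: complex)"
    by (simp add: jac_def flip: of_real_mult power_add)
  also have "... = (\<Sum>u\<in>{..<n} \<times> {..<n}. \<Sum>v\<in>{..<n} \<times> {..<n}. (case u of (j, l) \<Rightarrow> ee (of_int (int j - int l) * y)) * (case v of (j, l) \<Rightarrow> ee (of_int (int j - int l) * y)))"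
    unfolding dker_sq by (rule sum_product)
  also have "... = (\<Sum>u\<in>{..<n} \<times> {..<n}. \<Sum>v\<in>{..<n} \<times> {..<n}. case (u, v) of ((j, l), (j', l')) \<Rightarrow> ee (of_int (int j - int l + (int j' - int l')) * y))"
    by (intro sum.cong refl) (auto simp: ee_add[symmetric] algebra_simps split: prod.splits)
  finally show ?thesis unfolding sum.cartesian_product by (simp add: case_prod_unfold)
qed

text \<open>For a fixed frequency three of the four indices determine the last, so at most
  \<open>n ^ 3\<close> quadruples occur.\<close>

lemma trigpoly_jac: "trigpoly (2 * n) (real (n ^ 3)) (\<lambda>y. of_real (jac n y))"
proof -
  let ?I = "({..<n} \<times> {..<n}) \<times> ({..<n} \<times> {..<n})"
  let ?f = "\<lambda>((j, l), (j', l')). int j - int l + (int j' - int l')"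
  show ?thesis
  proof (rule trigpolyI[where I = ?I and f = ?f and a = "\<lambda>_. 1"])
    fix m
    let ?S = "{i \<in> ?I. ?f i = m}"
    have "inj_on (\<lambda>((j, l), (j', l')). ((j, l), j')) ?S" by (auto simp: inj_on_def)
    moreover have "(\<lambda>((j, l), (j', l')). ((j, l), j')) ` ?S \<subseteq> ({..<n} \<times> {..<n}) \<times> {..<n}" by force
    ultimately have "card ?S \<le> card (({..<n} \<times> {..<n}) \<times> {..<n})"
      by (rule card_inj_on_le) auto
    then have "card ?S \<le> n ^ 3" by (simp add: power3_eq_cube)
    then have "real (card ?S) \<le> real (n ^ 3)" by (rule of_nat_mono)
    then show "(\<Sum>i\<in>?S. norm (1 :: complex)) \<le> real (n ^ 3)" by simp
  qed (auto simp: jac_eq case_prod_unfold)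
qed

lemma sum_ee_grid:
  assumes "0 < \<bar>m\<bar>" "\<bar>m\<bar> < int Q"
  shows "(\<Sum>k\<in>{a..<a + int Q}. ee (of_int m * (y - of_int k / real Q))) = 0"
proof -
  have Q: "0 < Q" using assms by auto
  let ?r = "ee (- of_int m / real Q)"
  have "(\<Sum>k\<in>{a..<a + int Q}. ee (of_int m * (y - of_int k / real Q))) = (\<Sum>i<Q. ee (of_int m * (y - of_int (a + int i) / real Q)))"
    by (rule sum.reindex_bij_witness[of _ "\<lambda>i. a + int i" "\<lambda>k. nat (k - a)"]) auto
  also have "... = (\<Sum>i<Q. ee (of_int m * (y - of_int a / real Q)) * ?r ^ i)"
  proof (intro sum.cong refl)
    fix i
    have "of_int m * (y - of_int (a + int i) / real Q) = of_int m * (y - of_int a / real Q) + real i * (- of_int m / real Q)"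
      by (simp add: field_simps add_divide_distrib)
    then show "ee (of_int m * (y - of_int (a + int i) / real Q)) = ee (of_int m * (y - of_int a / real Q)) * ?r ^ i"
      by (simp only: ee_add ee_of_nat_mult)
  qed
  also have "... = ee (of_int m * (y - of_int a / real Q)) * (\<Sum>i<Q. ?r ^ i)" by (simp add: sum_distrib_left)
  also have "(\<Sum>i<Q. ?r ^ i) = 0"
  proof -
    have "?r ^ Q = ee (of_int (- m))" unfolding ee_of_nat_mult[symmetric] using Q by simp
    then have "?r ^ Q = 1" by (simp only: ee_of_int)
    moreover have "?r \<noteq> 1"
    proof
      assume "?r = 1"
      then have "sin (pi * (- of_int m / real Q)) = 0" using norm_ee_minus_1[of "- of_int m / real Q"] by simp
      then obtain i :: int where "pi * (- of_int m / real Q) = of_int i * pi" using sin_zero_iff_int2 by blast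
      then have "pi * (- of_int m / real Q - of_int i) = 0" by (simp add: algebra_simps)
      then have "- of_int m / real Q = of_int i" by simp
      then have "- of_int m = of_int i * real Q" using Q by (simp add: field_simps)
      then have "of_int (- m) = (of_int (i * int Q) :: real)" by simp
      then have "- m = i * int Q" by (simp only: of_int_eq_iff)
      then have "int Q dvd m" by (metis dvd_minus_iff dvd_triv_right)
      then show False using assms dvd_imp_le_int[of m "int Q"] by auto
    qed
    ultimately show ?thesis by (simp add: geometric_sum)
  qed
  finally show ?thesis by simp
qed

text \<open>With more grid points than the degree there is no aliasing: only the constant
  coefficient survives, and it does not see the shift.\<close>

lemma trigpoly_grid_const:
  assumes "trigpoly N A g" "N < Q"
  shows "(\<Sum>k\<in>{a..<a + int Q}. g (y - of_int k / real Q)) = (\<Sum>k\<in>{a..<a + int Q}. g (- of_int k / real Q))"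
proof -
  obtain c where c: "\<forall>y. g y = (\<Sum>m\<in>{-int N..int N}. c m * ee (of_int m * y))"
    using assms unfolding trigpoly_def by blast
  have "(\<Sum>k\<in>{a..<a + int Q}. g (y - of_int k / real Q)) = of_nat Q * c 0" for y
  proof -
    have "(\<Sum>k\<in>{a..<a + int Q}. g (y - of_int k / real Q)) = (\<Sum>m\<in>{-int N..int N}. c m * (\<Sum>k\<in>{a..<a + int Q}. ee (of_int m * (y - of_int k / real Q))))"
      unfolding c[rule_format] sum_distrib_left by (rule sum.swap)
    also have "... = (\<Sum>m\<in>{-int N..int N}. if m = 0 then of_nat Q * c 0 else 0)"
      using assms(2) by (intro sum.cong refl) (auto simp: sum_ee_grid)
    finally show ?thesis by simp
  qed
  from this[of y] this[of 0] show ?thesis by simp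
qed

lemma sum_inverse_square_le:
  fixes z :: real
  assumes "finite A" "\<And>k. k \<in> A \<Longrightarrow> 4 \<le> z - of_int k"
  shows "(\<Sum>k\<in>A. 1 / (z - of_int k)^2) \<le> 1/2"
proof -
  define f where "f k = nat (\<lfloor>z\<rfloor> - k)" for k
  have f: "4 \<le> f k" "real (f k) \<le> z - of_int k" if "k \<in> A" for k
  proof -
    have "4 \<le> \<lfloor>z\<rfloor> - k" using assms(2)[OF that] by (simp add: le_floor_iff le_diff_eq)
    then show "4 \<le> f k" "real (f k) \<le> z - of_int k" by (auto simp: f_def)
  qed
  have inj: "inj_on f A"
  proof (rule inj_onI)
    fix x y assume xy: "x \<in> A" "y \<in> A" "f x = f y"
    have "0 < f x" "0 < f y" using f(1)[OF xy(1)] f(1)[OF xy(2)] by auto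
    then show "x = y" using xy(3) by (auto simp: f_def)
  qed
  have "(\<Sum>k\<in>A. 1 / (z - of_int k)^2) \<le> (\<Sum>k\<in>A. real (f k) powr (- 2))"
  proof (intro sum_mono)
    fix k assume k: "k \<in> A"
    have "1 / (z - of_int k)^2 \<le> 1 / (real (f k))^2"
      using f[OF k] by (intro divide_left_mono power_mono mult_pos_pos zero_less_power) auto
    also have "... = real (f k) powr (- 2)" using f[OF k] by (simp add: powr_minus powr_numeral inverse_eq_divide)
    finally show "1 / (z - of_int k)^2 \<le> real (f k) powr (- 2)" .
  qed
  also have "... = (\<Sum>i\<in>f ` A. real i powr (- 2))" using inj by (simp add: sum.reindex)
  also have "... \<le> (\<Sum>i=4..Max (insert 0 (f ` A)). real i powr (- 2))"
    using f(1) assms(1) by (intro sum_mono2) auto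
  also have "... \<le> 2 / (2 - 1) * real 4 powr (1 - 2)" by (rule sum_powr_tail_le) auto
  also have "... = 1/2" by (simp add: powr_minus)
  finally show ?thesis .
qed

section \<open>Smoothed indicators of intervals and their majorants\<close>

abbreviation grid :: "nat \<Rightarrow> int set" where "grid n \<equiv> {- 2 * int n..<2 * int n}"

abbreviation gpt :: "nat \<Rightarrow> int \<Rightarrow> real" where "gpt n k \<equiv> of_int k / (4 * real n)"

definition jn :: "nat \<Rightarrow> real" where "jn n = (\<Sum>k\<in>grid n. jac n (gpt n k))"

definition wker :: "nat \<Rightarrow> real \<Rightarrow> real" where "wker n y = jac n y / jn n"

lemma jac_nonneg: "0 \<le> jac n y" by (simp add: jac_def)

lemma jn_ge:
  assumes "0 < n"
  shows "real n ^ 4 \<le> jn n"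
proof -
  have "jac n (of_int 0 / (4 * real n)) \<le> jn n"
    unfolding jn_def using assms by (intro member_le_sum) (auto simp: jac_nonneg)
  moreover have "jac n 0 = real n ^ 4" by (simp add: jac_def dker_def)
  ultimately show ?thesis by simp
qed

lemma wker_nonneg: "0 < n \<Longrightarrow> 0 \<le> wker n y"
  unfolding wker_def jn_def by (intro divide_nonneg_nonneg sum_nonneg jac_nonneg)

lemma wker_sum:
  assumes "0 < n"
  shows "(\<Sum>k\<in>grid n. wker n (y - gpt n k)) = 1"
proof -
  have jn0: "0 < jn n" using jn_ge[OF assms] assms by (auto intro: less_le_trans[of 0 "real n ^ 4"])
  have *: "jac n (- y) = jac n y" for y
  proof -
    have "dker n (- y) = cnj (dker n y)" by (simp add: dker_def cnj_ee)
    then show ?thesis by (simp add: jac_def)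
  qed
  have "complex_of_real (\<Sum>k\<in>grid n. jac n (y - gpt n k)) = of_real (jn n)"
    using trigpoly_grid_const[OF trigpoly_jac[of n], where Q = "4 * n" and a = "-2 * int n" and y = y] assms
    by (simp add: jn_def *)
  then have "(\<Sum>k\<in>grid n. jac n (y - gpt n k)) = jn n"
    by (simp only: of_real_eq_iff)
  then show ?thesis using jn0 by (simp add: wker_def sum_divide_distrib[symmetric])
qed

lemma wker_decay:
  assumes "0 < n" "\<bar>y\<bar> \<le> 3/4" "y \<noteq> 0"
  shows "wker n y \<le> 16 / (real n * y) ^ 4"
proof -
  have "jac n y \<le> (2 / \<bar>y\<bar>) ^ 4"
    unfolding jac_def using norm_dker_decay[OF assms(2,3)] by (intro power_mono) auto
  then have "wker n y \<le> (2 / \<bar>y\<bar>) ^ 4 / real n ^ 4"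
    unfolding wker_def using jn_ge[OF assms(1)] assms(1) by (intro frac_le) auto
  also have "... = 16 / (real n * y) ^ 4" by (simp add: power_divide power_mult_distrib mult_ac)
  finally show ?thesis .
qed

text \<open>A trigonometric majorant of the smoothing error near an endpoint. The Fejer kernel alone
  has zeros; the translate by \<open>1 / (2 * n)\<close> fills them, because the numerators become a
  squared sine and a squared cosine. The factor makes the sum at least 1 within distance
  \<open>1 / n\<close> and at least \<open>128 / (n * y)^2\<close> beyond.\<close>

definition mker :: "nat \<Rightarrow> real \<Rightarrow> real" where
  "mker n y = 300 * pi^2 * (fej n y + fej n (y + 1 / (2 * real n)))"

lemma fej_ge: "0 < n \<Longrightarrow> (sin (pi * (n * y)))^2 \<le> (pi * (n * y))^2 * fej n y"
proof -
  assume n: "0 < n"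
  have "\<bar>sin (pi * (n * y))\<bar> \<le> norm (dker n y) * (pi * \<bar>y\<bar>)"
    unfolding norm_dker_sin[symmetric] using abs_sin_x_le_abs_x[of "pi * y"]
    by (intro mult_left_mono) (auto simp: abs_mult)
  then have "\<bar>sin (pi * (n * y))\<bar>^2 \<le> (norm (dker n y) * (pi * \<bar>y\<bar>))^2" by (intro power_mono) auto
  also have "... = (pi * (n * y))^2 * fej n y" using n by (simp add: fej_def power_mult_distrib)
  finally show ?thesis by simp
qed

lemma fej_nonneg: "0 \<le> fej n y" by (simp add: fej_def)

lemma mker_nonneg: "0 \<le> mker n y" by (simp add: mker_def fej_nonneg)

lemma mker_ge:
  assumes "0 < n"
  shows "300 \<le> (real n * \<bar>y\<bar> + 1/2)^2 * mker n y"
proof -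
  define t where "t = pi * (real n * \<bar>y\<bar> + 1/2)"
  have t: "0 \<le> t" by (simp add: t_def)
  let ?y = "y + 1 / (2 * real n)"
  have ny: "real n * ?y = real n * y + 1/2" using assms by (simp add: field_simps)
  have "(sin (pi * (n * y)))^2 \<le> (pi * (n * y))^2 * fej n y" by (rule fej_ge[OF assms])
  also have "... \<le> t^2 * fej n y"
  proof (intro mult_right_mono fej_nonneg)
    have "\<bar>pi * (n * y)\<bar> \<le> t" by (simp add: t_def abs_mult)
    then show "(pi * (n * y))^2 \<le> t^2" using t by (simp add: abs_le_square_iff[symmetric])
  qed
  finally have 1: "(sin (pi * (n * y)))^2 \<le> t^2 * fej n y" .
  have "(cos (pi * (n * y)))^2 = (sin (pi * (n * ?y)))^2"
    unfolding ny by (simp add: distrib_left sin_add)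
  also have "... \<le> (pi * (n * ?y))^2 * fej n ?y" by (rule fej_ge[OF assms])
  also have "... \<le> t^2 * fej n ?y"
  proof (intro mult_right_mono fej_nonneg)
    have "\<bar>real n * y + 1/2\<bar> \<le> real n * \<bar>y\<bar> + 1/2"
      using abs_triangle_ineq[of "real n * y" "1/2"] by (simp add: abs_mult)
    then have "\<bar>pi * (n * ?y)\<bar> \<le> t" unfolding ny by (simp add: t_def abs_mult)
    then show "(pi * (n * ?y))^2 \<le> t^2" using t by (simp add: abs_le_square_iff[symmetric])
  qed
  finally have "(cos (pi * (n * y)))^2 \<le> t^2 * fej n ?y" .
  with 1 have "(sin (pi * (n * y)))^2 + (cos (pi * (n * y)))^2 \<le> t^2 * (fej n y + fej n ?y)"
    unfolding distrib_left by (rule add_mono)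
  then have "1 \<le> t^2 * (fej n y + fej n ?y)" by simp
  then have "300 \<le> 300 * (t^2 * (fej n y + fej n ?y))" by linarith
  also have "... = (real n * \<bar>y\<bar> + 1/2)^2 * mker n y"
    unfolding t_def mker_def power_mult_distrib by (simp only: mult_ac)
  finally show ?thesis .
qed

lemma mker_ge_near:
  assumes "0 < n" "real n * \<bar>y\<bar> \<le> 1"
  shows "1 \<le> mker n y"
proof -
  have "300 \<le> (real n * \<bar>y\<bar> + 1/2)^2 * mker n y" by (rule mker_ge[OF assms(1)])
  also have "... \<le> (3/2)^2 * mker n y"
    using assms by (intro mult_right_mono power_mono mker_nonneg) auto
  finally show ?thesis by (simp add: power2_eq_square)
qed

lemma mker_ge_far:
  assumes "0 < n" "1 \<le> real n * \<bar>y\<bar>"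
  shows "128 / (real n * y)^2 \<le> mker n y"
proof -
  have "300 \<le> (real n * \<bar>y\<bar> + 1/2)^2 * mker n y" by (rule mker_ge[OF assms(1)])
  also have "... \<le> (3/2 * (real n * \<bar>y\<bar>))^2 * mker n y"
  proof (intro mult_right_mono power_mono mker_nonneg)
    show "real n * \<bar>y\<bar> + 1/2 \<le> 3/2 * (real n * \<bar>y\<bar>)" using assms(2) by linarith
  qed simp
  also have "... = 9/4 * ((real n * y)^2 * mker n y)"
    by (simp add: power_mult_distrib power2_eq_square)
  finally have "128 \<le> (real n * y)^2 * mker n y" by (simp add: mult.commute)
  moreover have "0 < (real n * y)^2" using assms by auto
  ultimately show ?thesis by (simp add: divide_le_eq mult.commute)
qed

lemma mker_even_bound:
  assumes "0 < n" "r \<le> 1" "1 \<le> real n * \<bar>y\<bar> \<Longrightarrow> r \<le> 128 / (real n * y)^2"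
  shows "r \<le> mker n y"
  using mker_ge_near[of n y] mker_ge_far[of n y] assms by (cases "real n * \<bar>y\<bar> \<le> 1") auto

text \<open>The weight of grid points on one side of \<open>x\<close>, at distance at least
  \<open>\<delta>\<close>; the sign \<open>e\<close> chooses the side. Within \<open>1 / n\<close>
  the total weight 1 is used. Beyond, two of the four powers in the decay are frozen at
  \<open>\<delta>\<close> and the other two are summed over the grid.\<close>

lemma wker_side_sum:
  assumes n: "0 < n" and A: "finite A" "A \<subseteq> grid n" and sg: "\<bar>e\<bar> = (1::int)"
    and d: "0 \<le> \<delta>" "\<And>k. k \<in> A \<Longrightarrow> \<delta> \<le> of_int e * (x - gpt n k)"
    and x: "\<bar>x\<bar> \<le> 1/4" and y: "\<bar>y\<bar> = \<delta>"
  shows "(\<Sum>k\<in>A. wker n (x - gpt n k)) \<le> mker n y"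
proof (rule mker_even_bound[OF n])
  have "(\<Sum>k\<in>A. wker n (x - gpt n k)) \<le> (\<Sum>k\<in>grid n. wker n (x - gpt n k))"
    using A n by (intro sum_mono2 wker_nonneg) auto
  then show "(\<Sum>k\<in>A. wker n (x - gpt n k)) \<le> 1" using wker_sum[OF n] by simp
next
  assume "1 \<le> real n * \<bar>y\<bar>"
  then have nd: "1 \<le> real n * \<delta>" using y by simp
  then have d0: "0 < \<delta>" using d(1) by (cases "\<delta> = 0") auto
  define z where "z = of_int e * (4 * real n * x)"
  have ee1: "of_int e * of_int e = (1::real)" using sg by (metis abs_mult_self_eq mult.right_neutral of_int_1 of_int_mult)
  have zk: "z - of_int (e * k) = 4 * real n * (of_int e * (x - gpt n k))" for k
    using n by (simp add: z_def algebra_simps)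
  have ge: "4 * (real n * \<delta>) \<le> z - of_int (e * k)" if "k \<in> A" for k
    unfolding zk using d(2)[OF that] n by simp
  have e0: "e \<noteq> 0" using sg by auto
  have "(\<Sum>k\<in>A. wker n (x - gpt n k)) \<le> (\<Sum>k\<in>A. 256 / (real n * y)^2 * (1 / (z - of_int (e * k))^2))"
  proof (intro sum_mono)
    fix k assume k: "k \<in> A"
    define u where "u = x - gpt n k"
    define v where "v = z - of_int (e * k)"
    have v: "4 * (real n * \<delta>) \<le> v" "0 < v" using ge[OF k] nd by (auto simp: v_def)
    have vu: "v = 4 * (real n * (of_int e * u))" unfolding v_def zk u_def by simp
    have v2: "v^2 = 16 * (real n * u)^2"
      unfolding vu using ee1 by (simp add: power2_eq_square algebra_simps)
    have u0: "u \<noteq> 0" using v vu by auto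
    have "\<bar>gpt n k\<bar> \<le> 1/2"
    proof -
      have "k \<in> grid n" using k A by blast
      then have "\<bar>k\<bar> \<le> 2 * int n" by auto
      then have "\<bar>real_of_int k\<bar> \<le> 2 * real n" by linarith
      then show ?thesis using n by (simp add: abs_divide field_simps)
    qed
    then have "\<bar>u\<bar> \<le> 3/4" unfolding u_def using x abs_triangle_ineq4[of x "gpt n k"] by linarith
    then have "wker n u \<le> 16 / (real n * u) ^ 4" using u0 n by (intro wker_decay)
    also have "(real n * u) ^ 4 = (v^2 / 16) * (v^2 / 16)" unfolding v2 by (simp add: power2_eq_square power4_eq_xxxx)
    also have "16 / ((v^2 / 16) * (v^2 / 16)) = 4096 / v^2 * (1 / v^2)" by simp
    also have "... \<le> 4096 / (4 * (real n * \<delta>))^2 * (1 / v^2)"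
      using v nd n d0 by (intro mult_right_mono divide_left_mono power_mono mult_pos_pos zero_less_power) auto
    also have "4096 / (4 * (real n * \<delta>))^2 = 256 / (real n * y)^2"
      using y by (simp add: power_mult_distrib flip: y)
    finally show "wker n (x - gpt n k) \<le> 256 / (real n * y)^2 * (1 / (z - of_int (e * k))^2)"
      unfolding u_def v_def .
  qed
  also have "... = 256 / (real n * y)^2 * (\<Sum>k\<in>(\<lambda>k. e * k) ` A. 1 / (z - of_int k)^2)"
    using e0 by (subst sum.reindex) (auto simp: inj_on_def sum_distrib_left)
  also have "... \<le> 256 / (real n * y)^2 * (1/2)"
    using A ge nd by (intro mult_left_mono sum_inverse_square_le) force+
  finally show "(\<Sum>k\<in>A. wker n (x - gpt n k)) \<le> 128 / (real n * y)^2" by simp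
qed

text \<open>The indicator of a set \<open>S\<close> is averaged with the Jackson kernel over the grid of mesh \<open>1 / (4 n)\<close>.
  The kernel has degree below \<open>4 n\<close>, so that the total weight is exactly 1 at every point.\<close>

definition smooth :: "nat \<Rightarrow> real set \<Rightarrow> real \<Rightarrow> real" where
  "smooth n S x = (\<Sum>k\<in>{k\<in>grid n. gpt n k \<in> S}. wker n (x - gpt n k))"

lemma smooth_bounds:
  assumes "0 < n"
  shows "0 \<le> smooth n S x" "smooth n S x \<le> 1"
proof -
  show "0 \<le> smooth n S x" unfolding smooth_def by (intro sum_nonneg wker_nonneg assms)
  have "smooth n S x \<le> (\<Sum>k\<in>grid n. wker n (x - gpt n k))"
    unfolding smooth_def by (intro sum_mono2 wker_nonneg assms) auto
  then show "smooth n S x \<le> 1" using wker_sum[OF assms] by simp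
qed

lemma trigpoly_smooth:
  assumes "0 < n"
  shows "trigpoly (2 * n) 4 (\<lambda>x. of_real (smooth n S x))"
proof -
  let ?K = "{k\<in>grid n. gpt n k \<in> S}"
  have "trigpoly (2 * n) (\<Sum>k\<in>?K. 1 / n) (\<lambda>x. \<Sum>k\<in>?K. of_real (wker n (x - gpt n k)))"
  proof (rule trigpoly_sum)
    fix k
    have j: "0 < jn n" using jn_ge[OF assms] assms by (auto intro: less_le_trans[of 0 "real n ^ 4"])
    have "trigpoly (2 * n) (norm (1 / complex_of_real (jn n)) * real (n ^ 3)) (\<lambda>y. 1 / of_real (jn n) * of_real (jac n y))"
      by (rule trigpoly_cmult[OF trigpoly_jac])
    also have "(\<lambda>y. 1 / of_real (jn n) * of_real (jac n y) :: complex) = (\<lambda>y. of_real (wker n y))"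
      by (simp add: wker_def)
    finally have w: "trigpoly (2 * n) (norm (1 / complex_of_real (jn n)) * real (n ^ 3)) (\<lambda>y. of_real (wker n y))" .
    have "norm (1 / complex_of_real (jn n)) * real (n ^ 3) \<le> 1 / real n ^ 4 * real (n ^ 3)"
      using j jn_ge[OF assms] assms by (intro mult_right_mono) (auto simp: norm_divide intro!: divide_left_mono)
    also have "... = 1 / n" using assms by (simp add: power_eq_if)
    finally have le: "norm (1 / complex_of_real (jn n)) * real (n ^ 3) \<le> 1 / n" .
    from w le have "trigpoly (2 * n) (1 / n) (\<lambda>y. of_real (wker n y))"
      unfolding trigpoly_def using order_trans by blast
    from trigpoly_shift[OF this, of "- (gpt n k)"]
    show "trigpoly (2 * n) (1 / n) (\<lambda>x. of_real (wker n (x - gpt n k)))" by simp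
  qed (rule finite_subset[of _ "grid n"], auto)
  moreover have "(\<Sum>k\<in>?K. 1 / real n) \<le> 4"
  proof -
    have "card ?K \<le> card (grid n)" by (intro card_mono) auto
    then have "card ?K \<le> 4 * n" by simp
    then have "real (card ?K) \<le> real (4 * n)" by (rule of_nat_mono)
    then show ?thesis using assms by (simp add: divide_le_eq)
  qed
  ultimately show ?thesis unfolding smooth_def of_real_sum trigpoly_def using order_trans by blast
qed

lemma trigpoly_mker:
  assumes "0 < n"
  shows "trigpoly n (600 * pi^2 / n) (\<lambda>y. of_real (mker n y))"
proof -
  have "trigpoly n (1 / n + 1 / n) (\<lambda>y. of_real (fej n y) + of_real (fej n (y + 1 / (2 * real n))))"
    using assms by (intro trigpoly_add trigpoly_fej trigpoly_shift[of n "1/n" "\<lambda>y. of_real (fej n y)"])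
  from trigpoly_cmult[OF this, of "of_real (300 * pi^2)"]
  show ?thesis by (simp add: mker_def norm_mult norm_power distrib_left mult.assoc)
qed

lemma interval_Inf_Sup:
  fixes S :: "real set"
  assumes "S \<subseteq> {a..b}" "y \<in> S"
  shows "Inf S \<le> y" "y \<le> Sup S"
  using assms by (auto intro!: cInf_lower cSup_upper intro: bdd_below_mono bdd_above_mono)

lemma interval_between:
  fixes S :: "real set"
  assumes S: "is_interval S" "S \<noteq> {}" and lt: "Inf S < y" "y < Sup S"
  shows "y \<in> S"
proof -
  obtain u where u: "u \<in> S" "u < y" using cInf_lessD[OF S(2) lt(1)] by blast
  obtain v where v: "v \<in> S" "y < v" using less_cSupD[OF S(2) lt(2)] by blast
  show ?thesis using mem_is_interval_1_I[OF S(1) u(1) v(1)] u v by auto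
qed

lemma smooth_approx:
  assumes n: "0 < n" and S: "is_interval S" "S \<subseteq> {-1/4..1/4}" "S \<noteq> {}" and x: "\<bar>x\<bar> \<le> 1/4"
  shows "\<bar>indicator S x - smooth n S x\<bar> \<le> mker n (x - Inf S) + mker n (x - Sup S)"
proof -
  let ?G = "grid n"
  let ?w = "\<lambda>k. wker n (x - gpt n k)"
  let ?l = "{k\<in>?G. gpt n k \<le> Inf S}" and ?r = "{k\<in>?G. Sup S \<le> gpt n k}"
  let ?in = "{k\<in>?G. gpt n k \<in> S}"
  note inf = interval_Inf_Sup[OF S(2)] and between = interval_between[OF S(1,3)]
  have fin: "finite {k\<in>?G. Q k}" for Q by (rule finite_subset[of _ ?G], blast, simp)
  show ?thesis
  proof (cases "x \<in> S")
    case True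
    have "1 - smooth n S x = (\<Sum>k\<in>?G - ?in. ?w k)"
    proof -
      have "sum ?w ?G = sum ?w (?G - ?in) + sum ?w ?in" by (rule sum.subset_diff) auto
      then show ?thesis using wker_sum[OF n, of x] unfolding smooth_def by linarith
    qed
    also have "... \<le> (\<Sum>k\<in>?l \<union> ?r. ?w k)"
    proof (intro sum_mono2 wker_nonneg n)
      show "?G - ?in \<subseteq> ?l \<union> ?r"
      proof
        fix k assume k: "k \<in> ?G - ?in"
        then have "\<not> (Inf S < gpt n k \<and> gpt n k < Sup S)"
          using between by blast
        then show "k \<in> ?l \<union> ?r"
          using k by (auto simp: not_less)
      qed
      show "finite (?l \<union> ?r)"
        by (intro finite_UnI fin)
    qed
    also have "... \<le> (\<Sum>k\<in>?l. ?w k) + (\<Sum>k\<in>?r. ?w k)"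
      by (intro sum_Un_le wker_nonneg n fin)
    also have "... \<le> mker n (x - Inf S) + mker n (x - Sup S)"
    proof (intro add_mono)
      show "(\<Sum>k\<in>?l. ?w k) \<le> mker n (x - Inf S)"
        using inf[OF True] x n by (intro fin wker_side_sum[where e = 1 and \<delta> = "x - Inf S"]) auto
      show "(\<Sum>k\<in>?r. ?w k) \<le> mker n (x - Sup S)"
        using inf[OF True] x n by (intro fin wker_side_sum[where e = "-1" and \<delta> = "Sup S - x"]) auto
    qed
    finally show ?thesis using True smooth_bounds[OF n, of S x] by simp
  next
    case False
    have "\<not> (Inf S < x \<and> x < Sup S)" using between False by blast
    then consider "x \<le> Inf S" | "Sup S \<le> x" by linarith
    then have "smooth n S x \<le> mker n (x - Inf S) + mker n (x - Sup S)"
    proof cases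
      case 1
      have "smooth n S x \<le> mker n (x - Inf S)"
        unfolding smooth_def using 1 x n inf
        by (intro fin wker_side_sum[where e = "-1" and \<delta> = "Inf S - x"]) auto
      then show ?thesis using mker_nonneg[of n "x - Sup S"] by linarith
    next
      case 2
      have "smooth n S x \<le> mker n (x - Sup S)"
        unfolding smooth_def using 2 x n inf
        by (intro fin wker_side_sum[where e = 1 and \<delta> = "x - Sup S"]) auto
      then show ?thesis using mker_nonneg[of n "x - Inf S"] by linarith
    qed
    then show ?thesis using False smooth_bounds[OF n, of S x] by simp
  qed
qed

text \<open>If only one of \<open>v\<close> and \<open>x\<close> belongs to \<open>S\<close>, an
  endpoint lies within \<open>1 / n\<close> of \<open>x\<close>, where the majorant is at least 1.
  This absorbs the error of replacing the true values by the prime sums.\<close>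

lemma smooth_approx_near:
  assumes n: "0 < n" and S: "is_interval S" "S \<subseteq> {-1/4..1/4}" and x: "\<bar>x\<bar> \<le> 1/4" and v: "real n * \<bar>v - x\<bar> \<le> 1"
  shows "\<bar>indicator S v - smooth n S x\<bar> \<le> 2 * (mker n (x - Inf S) + mker n (x - Sup S))"
proof (cases "S = {}")
  case True
  then show ?thesis using mker_nonneg[of n "x - Inf S"] mker_nonneg[of n "x - Sup S"] by (simp add: smooth_def)
next
  case False
  note inf = interval_Inf_Sup[OF S(2)] and between = interval_between[OF S(1) False]
  have "\<bar>indicator S v - indicator S x\<bar> \<le> mker n (x - Inf S) + mker n (x - Sup S)"
  proof (cases "(v \<in> S) = (x \<in> S)")
    case True
    then show ?thesis using mker_nonneg[of n "x - Inf S"] mker_nonneg[of n "x - Sup S"] by (simp add: indicator_def)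
  next
    case False
    have "\<bar>x - Inf S\<bar> \<le> \<bar>v - x\<bar> \<or> \<bar>x - Sup S\<bar> \<le> \<bar>v - x\<bar>"
    proof (cases "x \<in> S")
      case True
      then have "\<not> (Inf S < v \<and> v < Sup S)" using False between by blast
      then show ?thesis using inf[OF True] by linarith
    next
      case xn: False
      then have "\<not> (Inf S < x \<and> x < Sup S)" "v \<in> S" using False between by blast+
      then show ?thesis using inf[OF \<open>v \<in> S\<close>] by linarith
    qed
    then have "real n * \<bar>x - Inf S\<bar> \<le> real n * \<bar>v - x\<bar> \<or> real n * \<bar>x - Sup S\<bar> \<le> real n * \<bar>v - x\<bar>"
      by (auto intro: mult_left_mono)
    then have "1 \<le> mker n (x - Inf S) \<or> 1 \<le> mker n (x - Sup S)"
      using mker_ge_near[OF n] v order_trans by blast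
    then have "1 \<le> mker n (x - Inf S) + mker n (x - Sup S)"
      using mker_nonneg[of n "x - Inf S"] mker_nonneg[of n "x - Sup S"] by linarith
    then show ?thesis by (auto simp: indicator_def)
  qed
  moreover have "indicator S v - smooth n S x = (indicator S v - indicator S x) + (indicator S x - smooth n S x)"
    by simp
  then have "\<bar>indicator S v - smooth n S x\<bar> \<le> \<bar>indicator S v - indicator S x\<bar> + \<bar>indicator S x - smooth n S x\<bar>"
    by (metis abs_triangle_ineq)
  ultimately show ?thesis using smooth_approx[OF n S False x] unfolding distrib_left by linarith
qed

section \<open>Comparing the probabilities of rectangles\<close>

text \<open>About \<open>P\<close> terms are bounded by 1, and beyond them a term is at most
  \<open>(P / m)^2\<close>.\<close>

lemma sum_inverse_quadratic_le:
  assumes "1 \<le> P"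
  shows "(\<Sum>m\<in>{-int N..int N}. 1 / (1 + (2 * pi * of_int m / P)^2)) \<le> 9 * P"
proof -
  define f where "f m = 1 / (1 + (2 * pi * real m / P)^2)" for m :: nat
  define K where "K = nat \<lceil>P\<rceil>"
  have K: "P \<le> real K" "real K \<le> P + 1" "1 \<le> K" using assms by (auto simp: K_def) linarith+
  have f1: "f m \<le> 1" "0 \<le> f m" for m by (auto simp: f_def add_pos_nonneg)
  have f2: "f m \<le> P^2 * real m powr (-2)" if "1 \<le> m" for m
  proof -
    have "(1 * (real m / P))^2 \<le> ((2 * pi) * (real m / P))^2"
      using assms pi_ge_two by (intro power_mono mult_right_mono) auto
    then have "(real m / P)^2 \<le> 1 + (2 * pi * real m / P)^2" by (simp add: mult.assoc)
    then have "f m \<le> 1 / (real m / P)^2"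
      unfolding f_def using that assms by (intro divide_left_mono mult_pos_pos add_pos_nonneg) auto
    also have "... = P^2 * real m powr (-2)"
      using that by (simp add: power_divide powr_minus powr_numeral field_simps)
    finally show ?thesis .
  qed
  have "(\<Sum>m=1..N. f m) \<le> (\<Sum>m\<in>{1..K} \<union> {K..N}. f m)" using f1 by (intro sum_mono2) auto
  also have "... \<le> (\<Sum>m\<in>{1..K}. f m) + (\<Sum>m\<in>{K..N}. f m)" using f1 by (intro sum_Un_le) auto
  also have "(\<Sum>m\<in>{1..K}. f m) \<le> (\<Sum>m\<in>{1..K}. 1)" using f1 by (intro sum_mono)
  also have "(\<Sum>m\<in>{1..K}. 1) = real K" by simp
  also have "(\<Sum>m\<in>{K..N}. f m) \<le> (\<Sum>m\<in>{K..N}. P^2 * real m powr (-2))"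
    using f2 K by (intro sum_mono) auto
  also have "... = P^2 * (\<Sum>m\<in>{K..N}. real m powr (-2))" by (simp add: sum_distrib_left)
  also have "... \<le> P^2 * (2 / (2 - 1) * real K powr (1 - 2))"
    using K by (intro mult_left_mono sum_powr_tail_le) auto
  also have "... \<le> P^2 * (2 * P powr (-1))"
  proof -
    have "P powr (-1) \<ge> real K powr (1 - 2)" using powr_mono2'[of "-1" P "real K"] K assms by simp
    then show ?thesis by (intro mult_left_mono) auto
  qed
  also have "... = 2 * P" using assms by (simp add: powr_minus power2_eq_square)
  finally have s: "(\<Sum>m=1..N. f m) \<le> 3 * P + 1" using K by simp
  have "(\<Sum>m\<in>{-int N..int N}. 1 / (1 + (2 * pi * of_int m / P)^2)) = (\<Sum>m\<in>{-int N..int N}. f (nat \<bar>m\<bar>))"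
    by (intro sum.cong refl) (simp add: f_def power_mult_distrib power_divide)
  also have "... \<le> (\<Sum>m\<in>{0} \<union> ({1..int N} \<union> {-int N..-1}). f (nat \<bar>m\<bar>))" using f1 by (intro sum_mono2) auto
  also have "... = f 0 + ((\<Sum>m\<in>{1..int N}. f (nat \<bar>m\<bar>)) + (\<Sum>m\<in>{-int N..-1}. f (nat \<bar>m\<bar>)))"
    by (subst sum.union_disjoint, simp, simp, force, subst sum.union_disjoint) auto
  also have "(\<Sum>m\<in>{1..int N}. f (nat \<bar>m\<bar>)) = (\<Sum>m=1..N. f m)"
    by (rule sum.reindex_bij_witness[of _ int nat]) auto
  also have "(\<Sum>m\<in>{-int N..-1}. f (nat \<bar>m\<bar>)) = (\<Sum>m=1..N. f m)"
    by (rule sum.reindex_bij_witness[of _ "\<lambda>i. - int i" "\<lambda>i. nat (- i)"]) auto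
  also have "f 0 = 1" by (simp add: f_def)
  finally show ?thesis using s assms by (simp add: algebra_simps)
qed

lemma ee_conv_iexp: "ee (of_int m * (x / P)) = iexp (2 * pi * of_int m / P * x)"
  by (simp add: ee_def cis_conv_exp mult_ac)

lemma trigpolyE:
  assumes "trigpoly N A g"
  obtains c where "\<And>m. norm (c m) \<le> A" "\<And>y. g y = (\<Sum>m\<in>{-int N..int N}. c m * ee (of_int m * y))"
  using assms unfolding trigpoly_def by blast

context prob_space begin

lemma integrable_iexp:
  assumes [measurable]: "Z \<in> borel_measurable M"
  shows "integrable M (\<lambda>w. iexp (Z w))"
  by (intro integrable_const_bound[where B = 1]) auto

lemma integrable_unit:
  assumes [measurable]: "f \<in> borel_measurable M" and "\<And>w. 0 \<le> f w" "\<And>w. f w \<le> (B::real)"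
  shows "integrable M f"
  using assms(2,3) by (intro integrable_const_bound[where B = B]) (auto simp: abs_of_nonneg)

lemma expect_trigpoly:
  assumes c: "\<And>y. g y = (\<Sum>m\<in>{-int N..int N}. c m * ee (of_int m * y))" and Z: "Z \<in> borel_measurable M"
  shows "expectation (\<lambda>w. g (Z w / P)) = (\<Sum>m\<in>{-int N..int N}. c m * expectation (\<lambda>w. iexp (2 * pi * of_int m / P * Z w)))"
    "integrable M (\<lambda>w. g (Z w / P))"
proof -
  note [measurable] = Z
  have "integrable M (\<lambda>w. iexp (2 * pi * of_int m / P * Z w))" for m by (rule integrable_iexp) measurable
  then show "expectation (\<lambda>w. g (Z w / P)) = (\<Sum>m\<in>{-int N..int N}. c m * expectation (\<lambda>w. iexp (2 * pi * of_int m / P * Z w)))"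
    "integrable M (\<lambda>w. g (Z w / P))"
    unfolding c ee_conv_iexp by auto
qed

lemma measurable_of_trigpoly:
  fixes g :: "real \<Rightarrow> real"
  assumes "trigpoly N A (\<lambda>y. of_real (g y))" "Z \<in> borel_measurable M"
  shows "(\<lambda>w. g (Z w / P)) \<in> borel_measurable M"
proof -
  obtain c where c: "\<And>y. of_real (g y) = (\<Sum>m\<in>{-int N..int N}. c m * ee (of_int m * y))"
    using trigpolyE[OF assms(1)] by metis
  have "(\<lambda>w. complex_of_real (g (Z w / P))) \<in> borel_measurable M"
    using expect_trigpoly(2)[OF c assms(2)] by (rule borel_measurable_integrable)
  note [measurable] = this
  have "(\<lambda>w. Re (of_real (g (Z w / P)))) \<in> borel_measurable M" by measurable
  then show ?thesis by simp
qed

lemma smoothing: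
  fixes Z W :: "'k \<Rightarrow> 'a \<Rightarrow> real"
  assumes K: "finite K" and Z: "\<And>k. k \<in> K \<Longrightarrow> Z k \<in> borel_measurable M"
    and n: "8 \<le> n" and P: "0 < P" and ZB: "\<And>k w. k \<in> K \<Longrightarrow> \<bar>Z k w\<bar> \<le> P / 8"
    and E: "E \<in> sets M" "\<And>w k. w \<in> space M - E \<Longrightarrow> k \<in> K \<Longrightarrow> \<bar>W k w - Z k w\<bar> \<le> P / n"
    and A: "{w \<in> space M. \<forall>k\<in>K. W k w \<in> S k} \<in> sets M"
    and S: "\<And>k. k \<in> K \<Longrightarrow> is_interval (S k)"
    and S': "\<And>k. S' k = {y. \<bar>y\<bar> \<le> 1/4 \<and> P * y \<in> S k}"
  shows "\<bar>prob {w \<in> space M. \<forall>k\<in>K. W k w \<in> S k} - expectation (\<lambda>w. \<Prod>k\<in>K. smooth n (S' k) (Z k w / P))\<bar>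
    \<le> prob E + (\<Sum>k\<in>K. 2 * (expectation (\<lambda>w. mker n (Z k w / P - Inf (S' k))) + expectation (\<lambda>w. mker n (Z k w / P - Sup (S' k)))))"
proof -
  have n0: "0 < n" using n by simp
  let ?A = "{w \<in> space M. \<forall>k\<in>K. W k w \<in> S k}"
  let ?H = "\<lambda>w. \<Prod>k\<in>K. smooth n (S' k) (Z k w / P)"
  let ?g = "\<lambda>k w. 2 * (mker n (Z k w / P - Inf (S' k)) + mker n (Z k w / P - Sup (S' k)))"
  have [measurable]: "(\<lambda>w. smooth n (S' k) (Z k w / P)) \<in> borel_measurable M" if "k \<in> K" for k
    by (rule measurable_of_trigpoly[OF trigpoly_smooth[OF n0] Z[OF that]])
  have tm: "trigpoly n (600 * pi^2 / n) (\<lambda>y. of_real (mker n (y - a)))" for a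
    using trigpoly_shift[OF trigpoly_mker[OF n0], of "- a"] by simp
  have im: "integrable M (\<lambda>w. mker n (Z k w / P - a))" if "k \<in> K" for k a
  proof -
    obtain c where "\<And>y. of_real (mker n (y - a)) = (\<Sum>m\<in>{-int n..int n}. c m * ee (of_int m * y))"
      using trigpolyE[OF tm[of a]] by metis
    from expect_trigpoly(2)[OF this Z[OF that], of P] show ?thesis
      using integrable_Re by fastforce
  qed
  have H01: "0 \<le> ?H w" "?H w \<le> 1" for w
    using smooth_bounds[OF n0] by (auto intro!: prod_nonneg prod_le_1)
  have iH: "integrable M ?H" by (intro integrable_unit[where B = 1] H01) measurable
  have iA: "integrable M (indicat_real ?A)" using A by (intro integrable_unit[where B = 1]) auto
  have iE: "integrable M (indicat_real E)" using E(1) by (intro integrable_unit[where B = 1]) auto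
  have ig: "integrable M (?g k)" if "k \<in> K" for k
    using im[OF that] by auto
  have pw: "norm (indicat_real ?A w - ?H w) \<le> indicat_real E w + (\<Sum>k\<in>K. ?g k w)" if w: "w \<in> space M" for w
  proof -
    have g0: "0 \<le> (\<Sum>k\<in>K. ?g k w)" by (intro sum_nonneg) (simp add: mker_nonneg)
    show ?thesis
    proof (cases "w \<in> E")
      case True
      have "norm (indicat_real ?A w - ?H w) \<le> 1" using H01[of w] by (auto simp: indicator_def)
      then show ?thesis using True g0 by simp
    next
      case False
      have "indicat_real ?A w = (\<Prod>k\<in>K. indicat_real (S' k) (W k w / P))"
      proof -
        have "W k w \<in> S k \<longleftrightarrow> W k w / P \<in> S' k" if "k \<in> K" for k
        proof -
          have "P / n \<le> P / 8" using n P by (intro divide_left_mono) auto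
          moreover have "\<bar>W k w - Z k w\<bar> \<le> P / n" using E(2)[OF _ that, of w] False w by blast
          ultimately have "\<bar>W k w\<bar> \<le> P / 8 + P / 8" using ZB[OF that, of w] by linarith
          then have "\<bar>W k w / P\<bar> \<le> 1/4" using P by (simp add: abs_divide divide_le_eq)
          then show ?thesis using P by (simp add: S')
        qed
        then show ?thesis using w K by (auto simp: indicator_def prod_zero_iff)
      qed
      then have "norm (indicat_real ?A w - ?H w) \<le> (\<Sum>k\<in>K. norm (indicat_real (S' k) (W k w / P) - smooth n (S' k) (Z k w / P)))"
        using smooth_bounds[OF n0] by (simp only:) (intro norm_prod_diff; auto simp: indicator_def)
      also have "... \<le> (\<Sum>k\<in>K. ?g k w)"
      proof (intro sum_mono)
        fix k assume k: "k \<in> K"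
        have "is_interval (S' k)" unfolding is_interval_1
        proof safe
          fix a b x assume ab: "a \<in> S' k" "b \<in> S' k" "a \<le> x" "x \<le> b"
          then have "P * a \<in> S k" "P * b \<in> S k" "P * a \<le> P * x" "P * x \<le> P * b" using P by (auto simp: S')
          then have "P * x \<in> S k" using mem_is_interval_1_I[OF S[OF k]] by blast
          then show "x \<in> S' k" using ab by (auto simp: S')
        qed
        moreover have "S' k \<subseteq> {-1/4..1/4}" by (auto simp: S')
        moreover have "\<bar>Z k w / P\<bar> \<le> 1/4" using ZB[OF k, of w] P by (simp add: abs_divide divide_le_eq)
        moreover have "real n * \<bar>W k w / P - Z k w / P\<bar> \<le> 1"
        proof -
          have "\<bar>W k w - Z k w\<bar> \<le> P / n" using E(2)[of w k] False w k by simp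
          then show ?thesis using P n0 by (simp add: diff_divide_distrib[symmetric] abs_divide field_simps)
        qed
        ultimately show "norm (indicat_real (S' k) (W k w / P) - smooth n (S' k) (Z k w / P)) \<le> ?g k w"
          unfolding real_norm_def by (intro smooth_approx_near n0)
      qed
      finally show ?thesis using False by simp
    qed
  qed
  have "\<bar>prob ?A - expectation ?H\<bar> = norm (expectation (\<lambda>w. indicat_real ?A w - ?H w))"
    using iA iH A by simp
  also have "... \<le> expectation (\<lambda>w. indicat_real E w + (\<Sum>k\<in>K. ?g k w))"
    using iA iH iE ig pw by (intro norm_integral_le) auto
  also have "... = prob E + (\<Sum>k\<in>K. expectation (?g k))"
    using iE ig E(1) by simp
  also have "(\<Sum>k\<in>K. expectation (?g k)) = (\<Sum>k\<in>K. 2 * (expectation (\<lambda>w. mker n (Z k w / P - Inf (S' k))) + expectation (\<lambda>w. mker n (Z k w / P - Sup (S' k)))))"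
    using im by (intro sum.cong refl) simp
  finally show ?thesis .
qed

end

text \<open>Products of smoothed indicators are trigonometric polynomials in many variables, so two
  random vectors with nearly equal characteristic functions are compared by finite sums only.\<close>

lemma rectangle_comparison:
  fixes Z1 W1 :: "'k \<Rightarrow> 'a \<Rightarrow> real" and Z2 W2 :: "'k \<Rightarrow> 'b \<Rightarrow> real"
    and n :: nat and \<eta> :: real
  assumes M1: "prob_space M1" and M2: "prob_space M2" and K: "finite K"
    and Z1: "\<And>k. k \<in> K \<Longrightarrow> Z1 k \<in> borel_measurable M1" and Z2: "\<And>k. k \<in> K \<Longrightarrow> Z2 k \<in> borel_measurable M2"
    and n: "8 \<le> n" and P: "1 \<le> P"
    and ZB1: "\<And>k w. k \<in> K \<Longrightarrow> \<bar>Z1 k w\<bar> \<le> P / 8" and ZB2: "\<And>k w. k \<in> K \<Longrightarrow> \<bar>Z2 k w\<bar> \<le> P / 8"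
    and E1: "E1 \<in> sets M1" "\<And>w k. w \<in> space M1 - E1 \<Longrightarrow> k \<in> K \<Longrightarrow> \<bar>W1 k w - Z1 k w\<bar> \<le> P / n"
    and E2: "E2 \<in> sets M2" "\<And>w k. w \<in> space M2 - E2 \<Longrightarrow> k \<in> K \<Longrightarrow> \<bar>W2 k w - Z2 k w\<bar> \<le> P / n"
    and A1: "{w \<in> space M1. \<forall>k\<in>K. W1 k w \<in> S k} \<in> sets M1"
    and A2: "{w \<in> space M2. \<forall>k\<in>K. W2 k w \<in> S k} \<in> sets M2"
    and S: "\<And>k. k \<in> K \<Longrightarrow> is_interval (S k)"
    and cf: "\<And>u. (\<And>k. k \<in> K \<Longrightarrow> \<bar>u k\<bar> \<le> 4 * pi * n / P) \<Longrightarrow>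
       norm (integral\<^sup>L M1 (\<lambda>w. iexp (\<Sum>k\<in>K. u k * Z1 k w)) - integral\<^sup>L M2 (\<lambda>w. iexp (\<Sum>k\<in>K. u k * Z2 k w))) \<le> \<eta>"
    and decay: "\<And>k u. k \<in> K \<Longrightarrow> \<bar>u\<bar> \<le> 4 * pi * n / P \<Longrightarrow> norm (integral\<^sup>L M2 (\<lambda>w. iexp (u * Z2 k w))) \<le> C / (1 + u^2)"
    and C: "0 \<le> C"
  shows "\<bar>measure M1 {w \<in> space M1. \<forall>k\<in>K. W1 k w \<in> S k} - measure M2 {w \<in> space M2. \<forall>k\<in>K. W2 k w \<in> S k}\<bar>
    \<le> measure M1 E1 + measure M2 E2 + card K * (600 * pi^2 * (72 * C * P / n + 12 * \<eta>)) + (4 * (4 * n + 1)) ^ card K * \<eta>"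
proof -
  interpret M1: prob_space M1 by fact
  interpret M2: prob_space M2 by fact
  have n0: "0 < n" and P0: "0 < P" using n P by auto
  have \<eta>: "0 \<le> \<eta>" using cf[of "\<lambda>_. 0"] n P by (auto intro: order_trans[OF norm_ge_zero])
  define S' where "S' k = {y. \<bar>y\<bar> \<le> 1/4 \<and> P * y \<in> S k}" for k
  have freq: "\<bar>2 * pi * of_int m / P\<bar> \<le> 4 * pi * n / P" if "m \<in> {-int (2 * n)..int (2 * n)}" for m
  proof -
    have "\<bar>real_of_int m\<bar> \<le> 2 * real n" using that by auto
    then have "2 * pi * \<bar>real_of_int m\<bar> / P \<le> 2 * pi * (2 * real n) / P"
      using P0 by (intro divide_right_mono mult_left_mono) auto
    then show ?thesis using P0 by (simp add: abs_mult abs_divide)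
  qed
  have mk2: "M2.expectation (\<lambda>w. mker n (Z2 k w / P - a)) \<le> 600 * pi^2 * (9 * C * P / n)"
    and mk1: "M1.expectation (\<lambda>w. mker n (Z1 k w / P - a)) \<le> 600 * pi^2 * (9 * C * P / n + 3 * \<eta>)" if k: "k \<in> K" for k a
  proof -
    obtain c where c: "\<And>m. norm (c m) \<le> 600 * pi^2 / n"
      "\<And>y. of_real (mker n (y + - a)) = (\<Sum>m\<in>{-int n..int n}. c m * ee (of_int m * y))"
      using trigpolyE[OF trigpoly_shift[OF trigpoly_mker[OF n0], of "- a"]] by metis
    have fr: "\<bar>2 * pi * of_int m / P\<bar> \<le> 4 * pi * n / P" if "m \<in> {-int n..int n}" for m
      using that by (intro freq) auto
    let ?\<phi>1 = "\<lambda>m. M1.expectation (\<lambda>w. iexp (2 * pi * of_int m / P * Z1 k w))"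
    let ?\<phi>2 = "\<lambda>m. M2.expectation (\<lambda>w. iexp (2 * pi * of_int m / P * Z2 k w))"
    have i1: "complex_of_real (M1.expectation (\<lambda>w. mker n (Z1 k w / P - a))) = (\<Sum>m\<in>{-int n..int n}. c m * ?\<phi>1 m)"
      using M1.expect_trigpoly(1)[OF c(2) Z1[OF k], of P] by (simp del: of_real_mult of_real_divide)
    have i2: "complex_of_real (M2.expectation (\<lambda>w. mker n (Z2 k w / P - a))) = (\<Sum>m\<in>{-int n..int n}. c m * ?\<phi>2 m)"
      using M2.expect_trigpoly(1)[OF c(2) Z2[OF k], of P] by (simp del: of_real_mult of_real_divide)
    have "norm (\<Sum>m\<in>{-int n..int n}. c m * ?\<phi>2 m) \<le> (\<Sum>m\<in>{-int n..int n}. 600 * pi^2 / n * (C * (1 / (1 + (2 * pi * of_int m / P)^2))))"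
    proof (intro sum_norm_le)
      fix m assume m: "m \<in> {-int n..int n}"
      show "norm (c m * ?\<phi>2 m) \<le> 600 * pi^2 / n * (C * (1 / (1 + (2 * pi * of_int m / P)^2)))"
        unfolding norm_mult using decay[OF k fr[OF m]] by (intro mult_mono c(1)) auto
    qed
    also have "... = 600 * pi^2 / n * (C * (\<Sum>m\<in>{-int n..int n}. 1 / (1 + (2 * pi * of_int m / P)^2)))"
      by (simp add: sum_distrib_left)
    also have "... \<le> 600 * pi^2 / n * (C * (9 * P))"
      using C P by (intro mult_left_mono sum_inverse_quadratic_le) auto
    finally have b2: "norm (\<Sum>m\<in>{-int n..int n}. c m * ?\<phi>2 m) \<le> 600 * pi^2 * (9 * C * P / n)" by (simp add: mult_ac)
    then show m2: "M2.expectation (\<lambda>w. mker n (Z2 k w / P - a)) \<le> 600 * pi^2 * (9 * C * P / n)"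
      unfolding i2[symmetric] norm_of_real by linarith
    have "norm (\<Sum>m\<in>{-int n..int n}. c m * (?\<phi>1 m - ?\<phi>2 m)) \<le> (\<Sum>m\<in>{-int n..int n}. 600 * pi^2 / n * \<eta>)"
    proof (intro sum_norm_le)
      fix m assume m: "m \<in> {-int n..int n}"
      \<comment> \<open>The characteristic function of one coordinate is the joint one at a
        frequency vector supported there.\<close>
      define u where "u j = (if j = k then 2 * pi * of_int m / P else 0)" for j
      have sK: "(\<Sum>j\<in>K. u j * z j) = 2 * pi * of_int m / P * z k" for z :: "'k \<Rightarrow> real"
      proof -
        have "(\<Sum>j\<in>K. u j * z j) = (\<Sum>j\<in>K. if j = k then 2 * pi * of_int m / P * z j else 0)"
          by (intro sum.cong) (auto simp: u_def)
        then show ?thesis using K k by simp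
      qed
      have "norm (M1.expectation (\<lambda>w. iexp (\<Sum>j\<in>K. u j * Z1 j w)) - M2.expectation (\<lambda>w. iexp (\<Sum>j\<in>K. u j * Z2 j w))) \<le> \<eta>"
        using fr[OF m] P0 by (intro cf) (auto simp: u_def)
      then have "norm (?\<phi>1 m - ?\<phi>2 m) \<le> \<eta>" unfolding sK .
      then show "norm (c m * (?\<phi>1 m - ?\<phi>2 m)) \<le> 600 * pi^2 / n * \<eta>"
        unfolding norm_mult by (intro mult_mono c(1)) auto
    qed
    also have "... = (2 * n + 1) * (600 * pi^2 / n * \<eta>)" by simp
    \<comment> \<open>The decay is known for the second vector only; for the first it is replaced by
      \<open>\<eta>\<close> at each of the \<open>2 * n + 1\<close> frequencies, against
      coefficients of size \<open>1 / n\<close>.\<close>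
    also have "... \<le> (3 * n) * (600 * pi^2 / n * \<eta>)" using \<eta> n by (intro mult_right_mono) auto
    also have "... = 600 * pi^2 * (3 * \<eta>)" using n0 by simp
    finally have "norm ((\<Sum>m\<in>{-int n..int n}. c m * ?\<phi>1 m) - (\<Sum>m\<in>{-int n..int n}. c m * ?\<phi>2 m)) \<le> 600 * pi^2 * (3 * \<eta>)"
      by (simp only: right_diff_distrib sum_subtractf)
    then have "\<bar>M1.expectation (\<lambda>w. mker n (Z1 k w / P - a)) - M2.expectation (\<lambda>w. mker n (Z2 k w / P - a))\<bar> \<le> 600 * pi^2 * (3 * \<eta>)"
      unfolding i1[symmetric] i2[symmetric] of_real_diff[symmetric] norm_of_real .
    then show "M1.expectation (\<lambda>w. mker n (Z1 k w / P - a)) \<le> 600 * pi^2 * (9 * C * P / n + 3 * \<eta>)"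
      using m2 by (simp only: distrib_left)
  qed
  have "\<exists>c. \<forall>k. (\<forall>m. norm (c k m) \<le> 4) \<and> (\<forall>y. of_real (smooth n (S' k) y) = (\<Sum>m\<in>{-int (2*n)..int (2*n)}. c k m * ee (of_int m * y)))"
    using trigpoly_smooth[OF n0] unfolding trigpoly_def by (intro choice) auto
  then obtain c where c: "\<And>k m. norm (c k m) \<le> 4"
      "\<And>k y. of_real (smooth n (S' k) y) = (\<Sum>m\<in>{-int (2*n)..int (2*n)}. c k m * ee (of_int m * y))"
    by metis
  let ?F = "PiE K (\<lambda>_. {-int (2*n)..int (2*n)})"
  let ?u = "\<lambda>f k. 2 * pi * of_int (f k) / P"
  have expand: "complex_of_real (\<Prod>k\<in>K. smooth n (S' k) (z k / P)) = (\<Sum>f\<in>?F. (\<Prod>k\<in>K. c k (f k)) * iexp (\<Sum>k\<in>K. ?u f k * z k))" for z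
  proof -
    have "complex_of_real (\<Prod>k\<in>K. smooth n (S' k) (z k / P)) = (\<Prod>k\<in>K. \<Sum>m\<in>{-int (2*n)..int (2*n)}. c k m * iexp (2 * pi * of_int m / P * z k))"
      unfolding of_real_prod c(2) ee_conv_iexp ..
    also have "... = (\<Sum>f\<in>?F. \<Prod>k\<in>K. c k (f k) * iexp (?u f k * z k))"
      by (rule prod_sum_PiE[OF K]) simp
    also have "... = (\<Sum>f\<in>?F. (\<Prod>k\<in>K. c k (f k)) * iexp (\<Sum>k\<in>K. ?u f k * z k))"
      using K by (simp add: prod.distrib exp_sum[symmetric] sum_distrib_left del: of_real_mult of_real_divide)
    finally show ?thesis .
  qed
  have finF: "finite ?F" using K by (intro finite_PiE) auto
  have H1: "complex_of_real (M1.expectation (\<lambda>w. \<Prod>k\<in>K. smooth n (S' k) (Z1 k w / P)))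
      = (\<Sum>f\<in>?F. (\<Prod>k\<in>K. c k (f k)) * M1.expectation (\<lambda>w. iexp (\<Sum>k\<in>K. ?u f k * Z1 k w)))"
  proof -
    have m: "(\<lambda>w. \<Sum>k\<in>K. ?u f k * Z1 k w) \<in> borel_measurable M1" for f using Z1 by measurable
    show ?thesis
      unfolding integral_complex_of_real[symmetric] expand
      using M1.integrable_iexp[OF m] by (subst Bochner_Integration.integral_sum) (auto simp del: of_real_mult of_real_divide of_real_sum)
  qed
  have H2: "complex_of_real (M2.expectation (\<lambda>w. \<Prod>k\<in>K. smooth n (S' k) (Z2 k w / P)))
      = (\<Sum>f\<in>?F. (\<Prod>k\<in>K. c k (f k)) * M2.expectation (\<lambda>w. iexp (\<Sum>k\<in>K. ?u f k * Z2 k w)))"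
  proof -
    have m: "(\<lambda>w. \<Sum>k\<in>K. ?u f k * Z2 k w) \<in> borel_measurable M2" for f using Z2 by measurable
    show ?thesis
      unfolding integral_complex_of_real[symmetric] expand
      using M2.integrable_iexp[OF m] by (subst Bochner_Integration.integral_sum) (auto simp del: of_real_mult of_real_divide of_real_sum)
  qed
  have "norm ((\<Sum>f\<in>?F. (\<Prod>k\<in>K. c k (f k)) * (M1.expectation (\<lambda>w. iexp (\<Sum>k\<in>K. ?u f k * Z1 k w)) - M2.expectation (\<lambda>w. iexp (\<Sum>k\<in>K. ?u f k * Z2 k w)))))
     \<le> (\<Sum>f\<in>?F. 4 ^ card K * \<eta>)"
  proof (intro sum_norm_le)
    fix f assume f: "f \<in> ?F"
    have "norm (\<Prod>k\<in>K. c k (f k)) \<le> (\<Prod>k\<in>K. 4)"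
      unfolding prod_norm[symmetric] using c(1) by (intro prod_mono) auto
    moreover have "norm (M1.expectation (\<lambda>w. iexp (\<Sum>k\<in>K. ?u f k * Z1 k w)) - M2.expectation (\<lambda>w. iexp (\<Sum>k\<in>K. ?u f k * Z2 k w))) \<le> \<eta>"
      using f by (intro cf freq) (auto simp: PiE_def Pi_def)
    ultimately show "norm ((\<Prod>k\<in>K. c k (f k)) * (M1.expectation (\<lambda>w. iexp (\<Sum>k\<in>K. ?u f k * Z1 k w)) - M2.expectation (\<lambda>w. iexp (\<Sum>k\<in>K. ?u f k * Z2 k w)))) \<le> 4 ^ card K * \<eta>"
      unfolding norm_mult by (intro mult_mono) auto
  qed
  \<comment> \<open>Per coordinate there are \<open>4 * n + 1\<close> frequencies, with coefficients
    at most 4.\<close>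
  also have "... = (4 * (4 * n + 1)) ^ card K * \<eta>"
    using K by (simp add: card_PiE) (simp add: algebra_simps flip: power_mult_distrib)
  finally have "norm (complex_of_real (M1.expectation (\<lambda>w. \<Prod>k\<in>K. smooth n (S' k) (Z1 k w / P))) - complex_of_real (M2.expectation (\<lambda>w. \<Prod>k\<in>K. smooth n (S' k) (Z2 k w / P))))
     \<le> (4 * (4 * n + 1)) ^ card K * \<eta>"
    unfolding H1 H2 by (simp only: right_diff_distrib sum_subtractf)
  then have H: "\<bar>M1.expectation (\<lambda>w. \<Prod>k\<in>K. smooth n (S' k) (Z1 k w / P)) - M2.expectation (\<lambda>w. \<Prod>k\<in>K. smooth n (S' k) (Z2 k w / P))\<bar>
     \<le> (4 * (4 * n + 1)) ^ card K * \<eta>"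
    unfolding of_real_diff[symmetric] norm_of_real .
  have s1: "\<bar>M1.prob {w \<in> space M1. \<forall>k\<in>K. W1 k w \<in> S k} - M1.expectation (\<lambda>w. \<Prod>k\<in>K. smooth n (S' k) (Z1 k w / P))\<bar>
    \<le> M1.prob E1 + card K * (600 * pi^2 * (36 * C * P / n + 12 * \<eta>))"
  proof (rule order_trans[OF M1.smoothing[OF K Z1 n P0 ZB1 E1 A1 S S'_def] add_left_mono])
    have "(\<Sum>k\<in>K. 2 * (M1.expectation (\<lambda>w. mker n (Z1 k w / P - Inf (S' k))) + M1.expectation (\<lambda>w. mker n (Z1 k w / P - Sup (S' k)))))
      \<le> (\<Sum>k\<in>K. 2 * (600 * pi^2 * (9 * C * P / n + 3 * \<eta>) + 600 * pi^2 * (9 * C * P / n + 3 * \<eta>)))"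
      by (intro sum_mono mult_left_mono add_mono mk1) auto
    then show "(\<Sum>k\<in>K. 2 * (M1.expectation (\<lambda>w. mker n (Z1 k w / P - Inf (S' k))) + M1.expectation (\<lambda>w. mker n (Z1 k w / P - Sup (S' k)))))
      \<le> card K * (600 * pi^2 * (36 * C * P / n + 12 * \<eta>))" by (simp add: algebra_simps)
  qed
  have s2: "\<bar>M2.prob {w \<in> space M2. \<forall>k\<in>K. W2 k w \<in> S k} - M2.expectation (\<lambda>w. \<Prod>k\<in>K. smooth n (S' k) (Z2 k w / P))\<bar>
    \<le> M2.prob E2 + card K * (600 * pi^2 * (36 * C * P / n))"
  proof (rule order_trans[OF M2.smoothing[OF K Z2 n P0 ZB2 E2 A2 S S'_def] add_left_mono])
    have "(\<Sum>k\<in>K. 2 * (M2.expectation (\<lambda>w. mker n (Z2 k w / P - Inf (S' k))) + M2.expectation (\<lambda>w. mker n (Z2 k w / P - Sup (S' k)))))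
      \<le> (\<Sum>k\<in>K. 2 * (600 * pi^2 * (9 * C * P / n) + 600 * pi^2 * (9 * C * P / n)))"
      by (intro sum_mono mult_left_mono add_mono mk2) auto
    then show "(\<Sum>k\<in>K. 2 * (M2.expectation (\<lambda>w. mker n (Z2 k w / P - Inf (S' k))) + M2.expectation (\<lambda>w. mker n (Z2 k w / P - Sup (S' k)))))
      \<le> card K * (600 * pi^2 * (36 * C * P / n))" by (simp add: algebra_simps)
  qed
  have "card K * (600 * pi^2 * (72 * C * P / n + 12 * \<eta>)) = card K * (600 * pi^2 * (36 * C * P / n + 12 * \<eta>)) + card K * (600 * pi^2 * (36 * C * P / n))"
    by (simp add: algebra_simps)
  then show ?thesis using s1 s2 H by linarith
qed

section \<open>Zeta by partial sums\<close>

definition zeta_dom :: "complex set" where "zeta_dom = {s. 0 < Re s} - {1}"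

lemma open_zeta_dom: "open zeta_dom"
  unfolding zeta_dom_def by (intro open_Diff open_halfspace_Re_gt) auto

lemma summable_zeta_term:
  assumes "s \<in> zeta_dom"
  shows "summable (\<lambda>n. zeta_term n s)"
proof (rule summable_comparison_test'[where N = 0])
  show "summable (\<lambda>n. norm s * real (Suc n) powr (- Re s - 1))"
    using assms by (intro summable_zeta_bound) (auto simp: zeta_dom_def)
  show "norm (zeta_term n s) \<le> norm s * real (Suc n) powr (- Re s - 1)" for n
    using assms by (intro zeta_term_bound) (auto simp: zeta_dom_def)
qed

lemma holomorphic_zeta_series: "(\<lambda>s. \<Sum>n. zeta_term n s) holomorphic_on zeta_dom"
proof (rule holomorphic_uniform_sequence[OF open_zeta_dom])
  show "(\<lambda>s. \<Sum>i<n. zeta_term i s) holomorphic_on zeta_dom" for n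
    unfolding zeta_term_def zeta_dom_def by (intro holomorphic_intros) auto
  fix x assume x: "x \<in> zeta_dom"
  obtain d0 where d0: "d0 > 0" "cball x d0 \<subseteq> zeta_dom"
    using x open_zeta_dom open_contains_cball by blast
  define d where "d = min d0 (Re x / 2)"
  have d: "d > 0" "cball x d \<subseteq> zeta_dom" using d0 x by (auto simp: d_def zeta_dom_def)
  have "uniform_limit (cball x d) (\<lambda>n s. \<Sum>i<n. zeta_term i s) (\<lambda>s. \<Sum>n. zeta_term n s) sequentially"
  proof (rule Weierstrass_m_test)
    show "summable (\<lambda>n. (norm x + d) * real (Suc n) powr (- (Re x / 2) - 1))"
      using x by (intro summable_zeta_bound) (auto simp: zeta_dom_def)
    fix n s assume s: "s \<in> cball x d"
    then have "s \<in> zeta_dom" using d by auto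
    then have "norm (zeta_term n s) \<le> norm s * real (Suc n) powr (- Re s - 1)"
      by (intro zeta_term_bound) (auto simp: zeta_dom_def)
    also have "... \<le> (norm x + d) * real (Suc n) powr (- (Re x / 2) - 1)"
    proof (intro mult_mono powr_mono)
      show "norm s \<le> norm x + d"
        using s norm_triangle_ineq2[of s x] by (auto simp: dist_norm norm_minus_commute)
      show "- Re s - 1 \<le> - (Re x / 2) - 1"
        using s complex_Re_le_cmod[of "x - s"] by (auto simp: dist_norm d_def)
    qed (use d in auto)
    finally show "norm (zeta_term n s) \<le> (norm x + d) * real (Suc n) powr (- (Re x / 2) - 1)" .
  qed
  with d show "\<exists>d>0. cball x d \<subseteq> zeta_dom \<and>
      uniform_limit (cball x d) (\<lambda>n s. \<Sum>i<n. zeta_term i s) (\<lambda>s. \<Sum>n. zeta_term n s) sequentially" by blast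
qed

lemma zeta_holomorphic: "zeta holomorphic_on zeta_dom"
  using is_zeta_zeta by (simp add: is_zeta_def zeta_dom_def)

lemma zeta_sums: "1 < Re s \<Longrightarrow> (\<lambda>n. of_nat (Suc n) powr (- s)) sums zeta s"
  using is_zeta_zeta by (simp add: is_zeta_def)

lemma connected_zeta_dom: "connected zeta_dom"
proof -
  have "connected ({s. 0 < Re s} - {1})"
    by (intro connected_open_delete open_halfspace_Re_gt convex_connected convex_halfspace_Re_gt) simp
  then show ?thesis by (simp add: zeta_dom_def)
qed

lemma zeta_partial_sum:
  "(\<Sum>n<M. zeta_term n s) = (\<Sum>n=1..M. of_nat n powr (- s)) - (of_nat (Suc M) powr (1 - s) - 1) / (1 - s)"
proof (induction M)
  case (Suc M)
  then show ?case by (simp add: zeta_term_def add_divide_distrib diff_divide_distrib)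
qed simp

text \<open>The definition fixes \<open>zeta\<close> through its continuation only. The explicit
  series agrees with it to the right of 1, and connectedness of the punctured half-plane spreads the
  identity.\<close>

lemma zeta_eq:
  assumes "s \<in> zeta_dom"
  shows "zeta s = (\<Sum>n. zeta_term n s) - 1 / (1 - s)"
proof -
  define f where "f s = zeta s - ((\<Sum>n. zeta_term n s) - 1 / (1 - s))" for s
  have hol: "f holomorphic_on zeta_dom"
    unfolding f_def by (intro holomorphic_intros zeta_holomorphic holomorphic_zeta_series) (auto simp: zeta_dom_def)
  have "f s = 0"
  proof (rule analytic_continuation_open[of "{s. 1 < Re s}" zeta_dom f "\<lambda>_. 0"])
    show "open {s. 1 < Re s}" by (rule open_halfspace_Re_gt)
    show "{s. 1 < Re s} \<noteq> {}" by (auto intro: exI[of _ 2])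
    show "{s. 1 < Re s} \<subseteq> zeta_dom" by (auto simp: zeta_dom_def)
    fix z assume "z \<in> {s. 1 < Re s}"
    then have z: "1 < Re z" "z \<in> zeta_dom" "1 - z \<noteq> 0" by (auto simp: zeta_dom_def)
    have "(\<lambda>M. \<Sum>n=1..M. of_nat n powr (- z)) \<longlonglongrightarrow> zeta z"
      using zeta_sums[OF z(1)] by (simp add: sums_def sum.atLeast1_atMost_eq)
    moreover have "(\<lambda>M. (of_nat (Suc M) :: complex) powr (1 - z)) \<longlonglongrightarrow> 0"
    proof (subst tendsto_norm_zero_iff[symmetric])
      have "(\<lambda>n. real (Suc n) powr (1 - Re z)) \<longlonglongrightarrow> 0"
        using z by (intro tendsto_neg_powr filterlim_compose[OF filterlim_real_sequentially filterlim_Suc]) auto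
      then show "(\<lambda>M. norm ((of_nat (Suc M) :: complex) powr (1 - z))) \<longlonglongrightarrow> 0"
        by (simp only: norm_nat_powr zero_less_Suc minus_complex.sel one_complex.sel)
    qed
    ultimately have "(\<lambda>M. (\<Sum>n=1..M. of_nat n powr (- z)) - (of_nat (Suc M) powr (1 - z) - 1) / (1 - z)) \<longlonglongrightarrow> zeta z - (0 - 1) / (1 - z)"
      using z(3) by (intro tendsto_diff tendsto_divide tendsto_const)
    then have "(\<lambda>M. \<Sum>n<M. zeta_term n z) \<longlonglongrightarrow> zeta z - (0 - 1) / (1 - z)"
      unfolding zeta_partial_sum .
    moreover have "(\<lambda>M. \<Sum>n<M. zeta_term n z) \<longlonglongrightarrow> (\<Sum>n. zeta_term n z)"
      by (intro summable_LIMSEQ summable_zeta_term z)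
    ultimately have "zeta z - (0 - 1) / (1 - z) = (\<Sum>n. zeta_term n z)" by (rule LIMSEQ_unique)
    then show "f z = 0" by (simp add: f_def algebra_simps)
  qed (use assms hol open_zeta_dom connected_zeta_dom in auto)
  then show ?thesis by (simp add: f_def)
qed

text \<open>A crude estimate with the factor \<open>norm s\<close>, meant for \<open>M\<close> much
  larger than \<open>norm s\<close>.\<close>

lemma zeta_partial_sum_error:
  assumes s: "s \<in> zeta_dom"
  shows "norm (zeta s - (\<Sum>n=1..M. of_nat n powr (- s)))
    \<le> real (Suc M) powr (1 - Re s) / norm (1 - s) + norm s * ((Re s + 1) / Re s * real (Suc M) powr (- Re s))"
proof -
  have x: "0 < Re s" using s by (simp add: zeta_dom_def)
  have "(\<Sum>n. zeta_term n s) = (\<Sum>n. zeta_term (n + M) s) + (\<Sum>n<M. zeta_term n s)"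
    by (rule suminf_split_initial_segment[OF summable_zeta_term[OF s]])
  then have "zeta s - (\<Sum>n=1..M. of_nat n powr (- s)) = (\<Sum>n. zeta_term (n + M) s) - of_nat (Suc M) powr (1 - s) / (1 - s)"
    using zeta_eq[OF s] unfolding zeta_partial_sum by (simp add: diff_divide_distrib)
  also have "norm ... \<le> norm (\<Sum>n. zeta_term (n + M) s) + norm (of_nat (Suc M) powr (1 - s) / (1 - s))"
    by (rule norm_triangle_ineq4)
  also have "norm (of_nat (Suc M) powr (1 - s) / (1 - s)) = real (Suc M) powr (1 - Re s) / norm (1 - s)"
    unfolding norm_divide norm_nat_powr[OF zero_less_Suc] by simp
  also have "norm (\<Sum>n. zeta_term (n + M) s) \<le> norm s * ((Re s + 1) / Re s * real (Suc M) powr (- Re s))"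
  proof -
    have sm: "summable (\<lambda>n. norm s * real (Suc (n + M)) powr (- Re s - 1))"
      using summable_ignore_initial_segment[OF summable_zeta_bound[OF x, of "norm s"], of M] by simp
    have le: "norm (zeta_term (n + M) s) \<le> norm s * real (Suc (n + M)) powr (- Re s - 1)" for n
      using s by (intro zeta_term_bound) (auto simp: zeta_dom_def)
    have "norm (\<Sum>n. zeta_term (n + M) s) \<le> (\<Sum>n. norm s * real (Suc (n + M)) powr (- Re s - 1))"
      using le sm by (rule norm_suminf_le)
    also have "... \<le> norm s * ((Re s + 1) / Re s * real (Suc M) powr (- Re s))"
    proof (rule suminf_le_const[OF sm])
      fix k
      have "(\<Sum>n<k. norm s * real (Suc (n + M)) powr (- Re s - 1)) = norm s * (\<Sum>n<k. real (Suc (n + M)) powr (- (Re s + 1)))"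
        by (simp add: sum_distrib_left)
      also have "(\<Sum>n<k. real (Suc (n + M)) powr (- (Re s + 1))) \<le> (\<Sum>n=Suc M..M + k. real n powr (- (Re s + 1)))"
      proof -
        have "(\<Sum>n<k. real (Suc (n + M)) powr (- (Re s + 1))) = (\<Sum>n\<in>(\<lambda>n. Suc (n + M)) ` {..<k}. real n powr (- (Re s + 1)))"
          by (subst sum.reindex) (auto simp: inj_on_def)
        also have "... \<le> (\<Sum>n=Suc M..M + k. real n powr (- (Re s + 1)))" by (intro sum_mono2) auto
        finally show ?thesis .
      qed
      also have "... \<le> (Re s + 1) / (Re s + 1 - 1) * real (Suc M) powr (1 - (Re s + 1))"
        using x by (intro sum_powr_tail_le) auto
      finally show "(\<Sum>n<k. norm s * real (Suc (n + M)) powr (- Re s - 1)) \<le> norm s * ((Re s + 1) / Re s * real (Suc M) powr (- Re s))"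
        by (simp add: mult_left_mono)
    qed
    finally show ?thesis .
  qed
  finally show ?thesis by simp
qed

lemma norm_exp_diff_le:
  assumes "Re a \<le> 0" "Re b \<le> 0"
  shows "norm (exp a - exp b :: complex) \<le> norm (a - b)"
proof -
  have "norm (exp a - exp b) \<le> 1 * norm (a - b)"
  proof (rule field_differentiable_bound[where S = "{z. Re z \<le> 0}" and f' = exp])
    show "convex {z. Re z \<le> 0}" by (rule convex_halfspace_Re_le)
    show "(exp has_field_derivative exp z) (at z within {z. Re z \<le> 0})" for z :: complex
      by (auto intro!: derivative_eq_intros)
  qed (use assms in auto)
  then show ?thesis by simp
qed

lemma ln_one_plus_inverse_bounds:
  assumes "1 \<le> (y::real)"
  shows "1 / (2 * y) \<le> ln (1 + 1 / y)" "ln (1 + 1 / y) \<le> 1 / y"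
proof -
  show "ln (1 + 1 / y) \<le> 1 / y" using assms by (intro ln_add_one_self_le_self) auto
  have "ln (1 / (1 + 1 / y)) \<le> 1 / (1 + 1 / y) - 1" using assms by (intro ln_le_minus_one) (auto simp: add_pos_pos)
  also have "... = - (1 / (y + 1))" using assms by (simp add: field_simps)
  also have "ln (1 / (1 + 1 / y)) = - ln (1 + 1 / y)" using assms ln_div[of 1 "1 + 1 / y"] by (simp add: add_pos_pos)
  finally have "1 / (y + 1) \<le> ln (1 + 1 / y)" by simp
  moreover have "1 / (2 * y) \<le> 1 / (y + 1)" using assms by (intro divide_left_mono) auto
  ultimately show "1 / (2 * y) \<le> ln (1 + 1 / y)" by linarith
qed

text \<open>Summation by parts with \<open>q n = n powr -s\<close>, written as \<open>q n = (q (n + 1) - q n) * w n\<close>.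
  For \<open>n\<close> above \<open>\<bar>Im s\<bar>\<close> the phase of \<open>q\<close> turns by at most 1 per step, so that \<open>w\<close> is
  bounded by \<open>n / \<bar>Im s\<bar>\<close> and has increments of size \<open>1 / \<bar>Im s\<bar>\<close>.\<close>

lemma sum_nat_powr_imaginary:
  fixes N M :: nat
  assumes \<sigma>: "1/2 \<le> \<sigma>" "\<sigma> < 1" and s: "\<sigma> \<le> Re s" "Re s \<le> 2" and \<tau>: "2 \<le> Im s" "Im s \<le> real N" and NM: "N \<le> M"
  shows "norm (\<Sum>n=N..<M. of_nat n powr (- s)) \<le> 20000 / (1 - \<sigma>) * real M powr (1 - \<sigma>) / Im s"
proof -
  define t where "t = Im s"
  have N: "2 \<le> N" using \<tau> by linarith
  define q where "q n = (of_nat n :: complex) powr (- s)" for n :: nat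
  define l where "l n = ln (1 + 1 / real n)" for n :: nat
  define \<rho> where "\<rho> n = exp (- s * of_real (l n))" for n :: nat
  define w where "w n = 1 / (\<rho> n - 1)" for n :: nat
  have qS: "q (Suc n) = q n * \<rho> n" if "N \<le> n" for n
  proof -
    have n: "0 < real n" using that N by simp
    have "real (Suc n) = real n * (1 + 1 / real n)" using n by (simp add: field_simps)
    then have "ln (real (Suc n)) = ln (real n) + l n" using n by (simp only: l_def) (subst ln_mult, auto simp: add_pos_pos)
    moreover have "q k = exp (- s * of_real (ln (real k)))" if "0 < k" for k
      using that by (simp add: q_def powr_def Ln_of_nat)
    ultimately show ?thesis using n by (simp add: \<rho>_def exp_add[symmetric] algebra_simps del: of_nat_Suc)
  qed
  have l: "1 / (2 * real n) \<le> l n" "l n \<le> 1 / real n" "0 \<le> l n" if "N \<le> n" for n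
    using ln_one_plus_inverse_bounds[of "real n"] that N unfolding l_def by (auto intro: order_trans[of 0 "1 / (2 * real n)"])
  \<comment> \<open>The imaginary part alone suffices: the phase lies between 0 and 1, where the
    sine is at least half its argument, and the modulus of \<open>\<rho> n\<close> is at least
    \<open>1/8\<close>.\<close>
  have \<rho>: "t / (32 * real n) \<le> norm (\<rho> n - 1)" if n: "N \<le> n" for n
  proof -
    have n0: "0 < real n" using n N by simp
    have t0: "0 < t" using \<tau> by (simp add: t_def)
    have tl: "t * l n \<le> 1" "0 \<le> t * l n" "t / (2 * real n) \<le> t * l n"
    proof -
      have "t * l n \<le> t * (1 / real n)" using l[OF n] t0 by (intro mult_left_mono) auto
      also have "... \<le> 1" using \<tau> n n0 by (simp add: t_def)
      finally show "t * l n \<le> 1" .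
      show "0 \<le> t * l n" using l[OF n] t0 by simp
      have "t * (1 / (2 * real n)) \<le> t * l n" using l[OF n] t0 by (intro mult_left_mono) auto
      then show "t / (2 * real n) \<le> t * l n" by simp
    qed
    have sin: "(t * l n) / 2 \<le> sin (t * l n)"
    proof -
      define \<phi> where "\<phi> = t * l n"
      show ?thesis
      proof (cases "\<phi> = 0")
        case False
        then have \<phi>: "0 < \<phi>" "\<phi> \<le> 1" using tl(1,2) unfolding \<phi>_def[symmetric] by simp_all
        obtain z where z: "0 < z" "z < \<phi>" "sin \<phi> - sin 0 = (\<phi> - 0) * cos z"
          using MVT2[of 0 \<phi> sin cos] \<phi> DERIV_sin by auto
        have "cos (pi / 3) \<le> cos z" using z \<phi> pi_gt3 by (intro cos_monotone_0_pi_le) auto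
        then have "\<phi> * (1/2) \<le> \<phi> * cos z" using \<phi> by (intro mult_left_mono) (auto simp: cos_60)
        then show ?thesis using z by (simp add: \<phi>_def)
      qed (simp add: \<phi>_def[symmetric])
    qed
    have e: "1/8 \<le> exp (- (Re s * l n))"
    proof -
      have "Re s * l n \<le> 2 * (1 / 2)"
      proof (intro mult_mono)
        have "1 / real n \<le> 1 / 2" using n N by (intro divide_left_mono) auto
        then show "l n \<le> 1 / 2" using l(2)[OF n] by linarith
      qed (use s l(3)[OF n] in auto)
      then have "exp (- 1) \<le> exp (- (Re s * l n))" by simp
      moreover have "1/8 \<le> exp (- 1 :: real)"
        using exp_le by (simp add: exp_minus field_simps)
      ultimately show ?thesis by linarith
    qed
    have "t / (32 * real n) = 1/8 * (t / (2 * real n) / 2)" by simp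
    also have "... \<le> exp (- (Re s * l n)) * sin (t * l n)"
      using e sin tl t0 n0 by (intro mult_mono) auto
    also have "... = - Im (\<rho> n - 1)" by (simp add: \<rho>_def Im_exp t_def)
    also have "... \<le> norm (\<rho> n - 1)" using abs_Im_le_cmod[of "\<rho> n - 1"] by linarith
    finally show ?thesis .
  qed
  have \<rho>1: "\<rho> n \<noteq> 1" if "N \<le> n" for n
  proof -
    have "0 < t / (32 * real n)" using \<tau> N that by (simp add: t_def)
    then show ?thesis using \<rho>[OF that] by auto
  qed
  have w: "norm (w n) \<le> 32 * real n / t" if "N \<le> n" for n
  proof -
    have "norm (w n) \<le> 1 / (t / (32 * real n))"
      unfolding w_def norm_divide norm_one using \<rho>[OF that] \<tau> N that
      by (intro divide_left_mono mult_pos_pos) (auto simp: t_def \<rho>1[OF that])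
    then show ?thesis by simp
  qed
  have ns: "norm s \<le> 2 * t" using cmod_le[of s] s \<sigma> \<tau> by (simp add: t_def)
  have dw: "norm (w (Suc n) - w n) \<le> 8192 / t" if n: "N \<le> n" for n
  proof -
    have n0: "1 \<le> real n" using n N by simp
    \<comment> \<open>Differences of inverses reduce to differences of \<open>\<rho>\<close>, that
      is, to second differences of the logarithm, which are at most \<open>1 / n^2\<close>.\<close>
    have "w (Suc n) - w n = (\<rho> n - \<rho> (Suc n)) * w n * w (Suc n)"
      using \<rho>1[OF n] \<rho>1[of "Suc n"] n by (simp add: w_def field_simps)
    then have "norm (w (Suc n) - w n) = norm (\<rho> n - \<rho> (Suc n)) * norm (w n) * norm (w (Suc n))" by (simp add: norm_mult)
    also have "... \<le> (2 * t * (1 / (real n)^2)) * (32 * real n / t) * (32 * real (Suc n) / t)"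
    proof (intro mult_mono w)
      have "norm (\<rho> n - \<rho> (Suc n)) \<le> norm (- s * of_real (l n) - (- s * of_real (l (Suc n))))"
        unfolding \<rho>_def using l(3)[of n] l(3)[of "Suc n"] n s \<sigma> by (intro norm_exp_diff_le) auto
      also have "... = norm (- s * of_real (l n - l (Suc n)))" by (simp add: algebra_simps)
      also have "... = norm s * \<bar>l n - l (Suc n)\<bar>" unfolding norm_mult norm_of_real by simp
      also have "... \<le> 2 * t * (1 / (real n)^2)"
      proof (intro mult_mono ns)
        have p1: "0 < 1 + 1 / real n" "0 < 1 + 1 / real (Suc n)" using n0 by (auto simp: add_pos_pos)
        have "l n - l (Suc n) = ln ((1 + 1 / real n) / (1 + 1 / real (Suc n)))"
          unfolding l_def using p1 by (simp add: ln_div)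
        also have "... \<le> (1 + 1 / real n) / (1 + 1 / real (Suc n)) - 1"
          using p1 by (intro ln_le_minus_one divide_pos_pos)
        also have "... = 1 / (real n * (real n + 2))"
        proof -
          have "(1 + 1 / x) / (1 + 1 / (1 + x)) - 1 = 1 / (x * (x + 2))" if "0 < x" for x :: real
          proof -
            have e: "1 + 1 / x = (1 + x) / x" "1 + 1 / (1 + x) = (x + 2) / (1 + x)" using that by (auto simp: field_simps)
            show ?thesis unfolding e using that by (simp add: diff_eq_eq divide_simps) (simp add: algebra_simps)
          qed
          then show ?thesis using n0 by simp
        qed
        also have "... \<le> 1 / (real n)^2" using n0 by (intro divide_left_mono) (auto simp: power2_eq_square)
        finally have "l n - l (Suc n) \<le> 1 / (real n)^2" .
        moreover have "l (Suc n) \<le> l n"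
        proof -
          have "1 / real (Suc n) \<le> 1 / real n" using n0 by (intro divide_left_mono) auto
          then show ?thesis unfolding l_def using p1 by (intro ln_mono) auto
        qed
        ultimately show "\<bar>l n - l (Suc n)\<bar> \<le> 1 / (real n)^2" by simp
      qed (use \<tau> in \<open>auto simp: t_def\<close>)
      finally show "norm (\<rho> n - \<rho> (Suc n)) \<le> 2 * t * (1 / (real n)^2)" .
    qed (use n \<tau> in \<open>auto simp: t_def\<close>)
    also have "... = 2048 / t * ((real n + 1) / real n)" using n0 \<tau> by (simp add: t_def power2_eq_square field_simps)
    also have "... \<le> 2048 / t * 4" using n0 \<tau> by (intro mult_left_mono) (auto simp: t_def field_simps)
    finally show ?thesis by simp
  qed
  have nq: "norm (q n) \<le> real n powr (- \<sigma>)" if "N \<le> n" for n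
    using that N s by (simp add: q_def norm_nat_powr powr_mono)
  have parts: "(\<Sum>n=N..<M. q n) = q M * w M - q N * w N - (\<Sum>n=N..<M. q (Suc n) * (w (Suc n) - w n))"
    using NM
  proof (induction M rule: dec_induct)
    case (step k)
    have "q k = (q (Suc k) - q k) * w k"
      using qS[OF step(1)] \<rho>1[OF step(1)] by (simp add: w_def field_simps)
    then have "q k = q (Suc k) * w k - q k * w k" by (simp add: left_diff_distrib)
    then show ?case using step by (simp add: algebra_simps)
  qed simp
  have M0: "0 < real M" using N NM by simp
  have qw: "norm (q n * w n) \<le> 32 * real M powr (1 - \<sigma>) / t" if "N \<le> n" "n \<le> M" for n
  proof -
    have "norm (q n * w n) \<le> real n powr (- \<sigma>) * (32 * real n / t)"
      unfolding norm_mult using nq[OF that(1)] w[OF that(1)] by (intro mult_mono) auto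
    also have "... = 32 * real n powr (1 - \<sigma>) / t"
      using that N by (simp add: powr_diff powr_minus field_simps)
    also have "... \<le> 32 * real M powr (1 - \<sigma>) / t"
      using that \<sigma> \<tau> by (intro divide_right_mono mult_left_mono powr_mono2) (auto simp: t_def)
    finally show ?thesis .
  qed
  have "norm (\<Sum>n=N..<M. q (Suc n) * (w (Suc n) - w n)) \<le> (\<Sum>n=N..<M. real (Suc n) powr (- \<sigma>) * (8192 / t))"
    unfolding norm_mult[symmetric]
  proof (intro sum_norm_le)
    fix n assume n: "n \<in> {N..<M}"
    show "norm (q (Suc n) * (w (Suc n) - w n)) \<le> real (Suc n) powr (- \<sigma>) * (8192 / t)"
      unfolding norm_mult using n nq[of "Suc n"] dw[of n] by (intro mult_mono) auto
  qed
  also have "... = 8192 / t * (\<Sum>n=N..<M. real (Suc n) powr (- \<sigma>))"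
    by (subst sum_distrib_right[symmetric]) (rule mult.commute)
  also have "(\<Sum>n=N..<M. real (Suc n) powr (- \<sigma>)) = (\<Sum>n\<in>Suc ` {N..<M}. real n powr (- \<sigma>))"
    by (subst sum.reindex) auto
  also have "8192 / t * ... \<le> 8192 / t * (\<Sum>n=1..M. real n powr (- \<sigma>))"
    using \<tau> by (intro mult_left_mono sum_mono2) (auto simp: t_def)
  also have "... \<le> 8192 / t * (real M powr (1 - \<sigma>) / (1 - \<sigma>))"
    using \<tau> \<sigma> by (intro mult_left_mono sum_powr_le) (auto simp: t_def)
  finally have S: "norm (\<Sum>n=N..<M. q (Suc n) * (w (Suc n) - w n)) \<le> 8192 / t * (real M powr (1 - \<sigma>) / (1 - \<sigma>))" .
  have "norm (\<Sum>n=N..<M. q n) \<le> norm (q M * w M) + norm (q N * w N) + norm (\<Sum>n=N..<M. q (Suc n) * (w (Suc n) - w n))"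
    unfolding parts by (intro order_trans[OF norm_triangle_ineq4] add_right_mono norm_triangle_ineq4)
  also have "... \<le> 32 * real M powr (1 - \<sigma>) / t + 32 * real M powr (1 - \<sigma>) / t + 8192 / t * (real M powr (1 - \<sigma>) / (1 - \<sigma>))"
    using qw[of M] qw[of N] NM S by (intro add_mono) auto
  also have "... = (64 + 8192 / (1 - \<sigma>)) * (real M powr (1 - \<sigma>) / t)" by (simp add: algebra_simps add_divide_distrib)
  also have "... \<le> 20000 / (1 - \<sigma>) * (real M powr (1 - \<sigma>) / t)"
  proof (intro mult_right_mono)
    have "1 \<le> 1 / (1 - \<sigma>)" using \<sigma> by (simp add: field_simps)
    then show "64 + 8192 / (1 - \<sigma>) \<le> 20000 / (1 - \<sigma>)" by (simp add: divide_inverse)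
  qed (use \<tau> in \<open>simp add: t_def\<close>)
  finally show ?thesis by (simp add: q_def t_def)
qed

text \<open>The crude estimate is applied at \<open>M = N^2\<close>, and summation by parts removes
  the terms from \<open>N\<close> on. As \<open>N\<close> is comparable to \<open>Im s\<close>, the
  choice \<open>N^2\<close> gives both errors the size
  \<open>N powr (1 - 2 * \<sigma>)\<close>.\<close>

lemma zeta_truncated:
  assumes \<sigma>: "1/2 \<le> \<sigma>" "\<sigma> < 1" and s: "\<sigma> \<le> Re s" "Re s \<le> 2" and \<tau>: "2 \<le> Im s" "Im s \<le> real N" "real N \<le> 8 * Im s"
  shows "norm (zeta s - (\<Sum>n=1..<N. of_nat n powr (- s))) \<le> 400000 / (1 - \<sigma>) * real N powr (1 - 2 * \<sigma>)"
proof -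
  define t where "t = Im s"
  define M where "M = N ^ 2"
  have N: "2 \<le> N" using \<tau> by linarith
  have NM: "N \<le> M" by (simp add: M_def power2_nat_le_imp_le self_le_power N)
  have M0: "0 < real M" using N NM by simp
  have MN: "real M = real N powr 2" using N by (simp add: M_def powr_numeral)
  have "(\<Sum>n=1..M. of_nat n powr (- s)) = (\<Sum>n=1..<N. of_nat n powr (- s)) + (\<Sum>n=N..<Suc M. of_nat n powr (- s))"
  proof -
    have "{1..M} = {1..<Suc M}" by auto
    then show ?thesis using N NM by (simp only:) (rule sum.atLeastLessThan_concat[symmetric], auto)
  qed
  then have "zeta s - (\<Sum>n=1..<N. of_nat n powr (- s)) = (zeta s - (\<Sum>n=1..M. of_nat n powr (- s))) + (\<Sum>n=N..<Suc M. of_nat n powr (- s))"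
    by simp
  also have "norm ... \<le> norm (zeta s - (\<Sum>n=1..M. of_nat n powr (- s))) + norm (\<Sum>n=N..<Suc M. of_nat n powr (- s))"
    by (rule norm_triangle_ineq)
  also have "... \<le> (real (Suc M) powr (1 - Re s) / norm (1 - s) + norm s * ((Re s + 1) / Re s * real (Suc M) powr (- Re s)))
     + 20000 / (1 - \<sigma>) * real (Suc M) powr (1 - \<sigma>) / t"
    unfolding t_def using assms NM
    by (intro add_mono zeta_partial_sum_error sum_nat_powr_imaginary) (auto simp: zeta_dom_def complex_eq_iff)
  finally have main: "norm (zeta s - (\<Sum>n=1..<N. of_nat n powr (- s))) \<le> real (Suc M) powr (1 - Re s) / norm (1 - s)
     + norm s * ((Re s + 1) / Re s * real (Suc M) powr (- Re s)) + 20000 / (1 - \<sigma>) * (real (Suc M) powr (1 - \<sigma>) / t)"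
    by simp
  have t0: "0 < t" using \<tau> by (simp add: t_def)
  have X: "real (Suc M) powr (1 - \<sigma>) / t \<le> 16 * real N powr (1 - 2 * \<sigma>)"
  proof -
    have "real (Suc M) powr (1 - \<sigma>) \<le> (2 * real M) powr (1 - \<sigma>)" using M0 \<sigma> N NM by (intro powr_mono2) auto
    also have "... = 2 powr (1 - \<sigma>) * real N powr (2 - 2 * \<sigma>)" unfolding powr_mult MN powr_powr by (simp add: algebra_simps)
    also have "... \<le> 2 powr 1 * real N powr (2 - 2 * \<sigma>)" using \<sigma> by (intro mult_right_mono powr_mono) auto
    also have "... = 2 * (real N powr (1 - 2 * \<sigma>) * real N)"
      using N powr_add[of "real N" "1 - 2 * \<sigma>" 1] by (simp add: algebra_simps)
    also have "... \<le> 2 * (real N powr (1 - 2 * \<sigma>) * (8 * t))" using \<tau> by (intro mult_left_mono) (auto simp: t_def)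
    finally show ?thesis using t0 by (simp add: divide_le_eq mult_ac)
  qed
  have 1: "real (Suc M) powr (1 - Re s) / norm (1 - s) \<le> real (Suc M) powr (1 - \<sigma>) / t"
    using \<tau> s abs_Im_le_cmod[of "1 - s"] by (intro frac_le powr_mono) (auto simp: t_def)
  have "norm s * ((Re s + 1) / Re s * real (Suc M) powr (- Re s)) \<le> 2 * t * (3 * real M powr (- \<sigma>))"
  proof (intro mult_mono)
    show "norm s \<le> 2 * t" using cmod_le[of s] s \<sigma> \<tau> by (simp add: t_def)
    show "(Re s + 1) / Re s \<le> 3" using s \<sigma> by (simp add: divide_le_eq)
    have "real (Suc M) powr (- Re s) \<le> real M powr (- Re s)" using M0 s \<sigma> by (intro powr_mono2') auto
    also have "... \<le> real M powr (- \<sigma>)" using M0 s N NM by (intro powr_mono) auto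
    finally show "real (Suc M) powr (- Re s) \<le> real M powr (- \<sigma>)" .
  qed (use s \<sigma> \<tau> in \<open>auto simp: t_def\<close>)
  also have "real M powr (- \<sigma>) = real N powr (- (2 * \<sigma>))" unfolding MN powr_powr by simp
  also have "2 * t * (3 * real N powr (- (2 * \<sigma>))) \<le> 2 * real N * (3 * real N powr (- (2 * \<sigma>)))"
    using \<tau> by (intro mult_right_mono mult_left_mono) (auto simp: t_def)
  also have "... = 6 * real N powr (1 - 2 * \<sigma>)" using N by (simp add: powr_diff powr_minus field_simps)
  finally have 2: "norm s * ((Re s + 1) / Re s * real (Suc M) powr (- Re s)) \<le> 6 * real N powr (1 - 2 * \<sigma>)" .
  have 3: "20000 / (1 - \<sigma>) * (real (Suc M) powr (1 - \<sigma>) / t) \<le> 20000 / (1 - \<sigma>) * (16 * real N powr (1 - 2 * \<sigma>))"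
    using X \<sigma> by (intro mult_left_mono) auto
  have "norm (zeta s - (\<Sum>n=1..<N. of_nat n powr (- s))) \<le> (22 + 320000 / (1 - \<sigma>)) * real N powr (1 - 2 * \<sigma>)"
    using main X 1 2 3 by (simp add: distrib_right)
  also have "... \<le> 400000 / (1 - \<sigma>) * real N powr (1 - 2 * \<sigma>)"
  proof (intro mult_right_mono)
    have "1 \<le> 1 / (1 - \<sigma>)" using \<sigma> by (simp add: field_simps)
    then show "22 + 320000 / (1 - \<sigma>) \<le> 400000 / (1 - \<sigma>)" by (simp add: divide_inverse)
  qed simp
  finally show ?thesis .
qed

section \<open>Removing small primes from the Dirichlet series\<close>

lemma infsum_norm_bound_finite:
  fixes f :: "'a \<Rightarrow> 'b::banach"
  assumes "\<And>F. finite F \<Longrightarrow> F \<subseteq> A \<Longrightarrow> norm (sum f F) \<le> B" "f summable_on A"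
  shows "norm (infsum f A) \<le> B"
proof -
  have "(sum f \<longlongrightarrow> infsum f A) (finite_subsets_at_top A)"
    using has_sum_infsum[OF assms(2)] by (simp add: has_sum_def)
  from tendsto_norm[OF this] show ?thesis
    by (rule tendsto_upperbound) (auto intro!: eventually_finite_subsets_at_top_weakI assms(1))
qed

lemma nat_powr_summable:
  assumes "1 < Re s"
  shows "(\<lambda>n. (of_nat n :: complex) powr (- s)) summable_on A"
proof -
  have "(\<lambda>n. real n powr (- Re s)) summable_on UNIV"
    using assms by (subst summable_on_UNIV_nonneg_real_iff) (auto simp: summable_real_powr_iff)
  moreover have "norm ((of_nat n :: complex) powr (- s)) = real n powr (- Re s)" for n
    by (cases "n = 0") (auto simp: norm_nat_powr)
  ultimately have "(\<lambda>n. norm ((of_nat n :: complex) powr (- s))) summable_on UNIV" by simp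
  then have "(\<lambda>n. norm ((of_nat n :: complex) powr (- s))) summable_on A"
    by (rule summable_on_subset_banach) auto
  then show ?thesis by (rule abs_summable_summable)
qed

text \<open>With unordered sums, sieving becomes a splitting of the index set.\<close>

lemma zeta_infsum:
  assumes "1 < Re s"
  shows "zeta s = (\<Sum>\<^sub>\<infinity>n\<in>{1..}. of_nat n powr (- s))"
proof -
  have "((\<lambda>n. of_nat n powr (- s)) has_sum (\<Sum>\<^sub>\<infinity>n. of_nat n powr (- s))) (UNIV :: nat set)"
    by (rule has_sum_infsum[OF nat_powr_summable[OF assms]])
  then have "(\<lambda>n. of_nat n powr (- s)) sums (\<Sum>\<^sub>\<infinity>n. of_nat n powr (- s))" by (rule has_sum_imp_sums)
  then have "(\<lambda>n. of_nat (Suc n) powr (- s)) sums (\<Sum>\<^sub>\<infinity>n. of_nat n powr (- s))" by (subst sums_Suc_iff) simp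
  then have "zeta s = (\<Sum>\<^sub>\<infinity>n. of_nat n powr (- s))" using zeta_sums[OF assms] sums_unique2 by blast
  also have "... = (\<Sum>\<^sub>\<infinity>n\<in>{1..}. of_nat n powr (- s))"
    by (rule infsum_cong_neutral) (auto simp: not_le)
  finally show ?thesis .
qed

definition rough :: "nat set \<Rightarrow> nat set" where "rough P = {n. 1 \<le> n \<and> (\<forall>p\<in>P. \<not> p dvd n)}"

text \<open>Multiplying by \<open>1 - q powr - s\<close> deletes the multiples of \<open>q\<close>:
  these are \<open>q\<close> times the numbers already free of the earlier primes.\<close>

lemma zeta_sieve:
  assumes "1 < Re s" "finite P" "\<And>p. p \<in> P \<Longrightarrow> prime p"
  shows "zeta s * (\<Prod>p\<in>P. 1 - of_nat p powr (- s)) = (\<Sum>\<^sub>\<infinity>n\<in>rough P. of_nat n powr (- s))"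
  using assms(2,3)
proof (induction rule: finite_induct)
  case empty
  show ?case using zeta_infsum[OF assms(1)] by (simp add: rough_def atLeast_def)
next
  case (insert q P)
  have q: "prime q" "0 < q" using insert.prems[of q] prime_gt_0_nat by auto
  have qP: "\<not> p dvd q" if "p \<in> P" for p
    using insert that by (metis insertCI primes_dvd_imp_eq)
  have split: "rough P = rough (insert q P) \<union> (\<lambda>m. q * m) ` rough P"
  proof (intro equalityI subsetI)
    fix n assume n: "n \<in> rough P"
    show "n \<in> rough (insert q P) \<union> (\<lambda>m. q * m) ` rough P"
    proof (cases "q dvd n")
      case True
      then obtain m where m: "n = q * m" by (elim dvdE)
      then have "m \<in> rough P" using n by (auto simp: rough_def intro: Nat.gr0I)
      then show ?thesis using m by blast
    qed (use n in \<open>auto simp: rough_def\<close>)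
  next
    fix n assume "n \<in> rough (insert q P) \<union> (\<lambda>m. q * m) ` rough P"
    then show "n \<in> rough P"
    proof
      assume "n \<in> (\<lambda>m. q * m) ` rough P"
      then obtain m where m: "n = q * m" "m \<in> rough P" by blast
      have "\<not> p dvd n" if "p \<in> P" for p
        using m qP[OF that] insert.prems[of p] that by (auto simp: prime_dvd_mult_iff rough_def)
      then show ?thesis using m q by (auto simp: rough_def)
    qed (auto simp: rough_def)
  qed
  have disj: "rough (insert q P) \<inter> (\<lambda>m. q * m) ` rough P = {}" by (auto simp: rough_def)
  have inj: "inj_on (\<lambda>m. q * m) (rough P)" using q by (auto simp: inj_on_def)
  let ?f = "\<lambda>n. (of_nat n :: complex) powr (- s)"
  note sm = nat_powr_summable[OF assms(1)]
  have "infsum ?f (rough P) = infsum ?f (rough (insert q P)) + infsum ?f ((\<lambda>m. q * m) ` rough P)"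
    by (subst split) (intro infsum_Un_disjoint sm disj)
  also have "infsum ?f ((\<lambda>m. q * m) ` rough P) = infsum (\<lambda>m. ?f q * ?f m) (rough P)"
    using infsum_reindex[OF inj, of ?f] by (simp add: o_def powr_times_real)
  also have "... = ?f q * infsum ?f (rough P)" by (rule infsum_cmult_right) (rule sm)
  finally have "infsum ?f (rough (insert q P)) = infsum ?f (rough P) * (1 - ?f q)" by (simp add: algebra_simps)
  then show ?case using insert by (simp add: mult_ac)
qed

definition sieved_zeta :: "nat \<Rightarrow> complex \<Rightarrow> complex" where
  "sieved_zeta Y s = zeta s * (\<Prod>p\<in>primes_in 0 Y. 1 - of_nat p powr (- s))"

text \<open>Apart from 1, every number without prime factors up to \<open>Y\<close> exceeds
  \<open>Y\<close>.\<close>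

lemma zeta_sieve_bound:
  assumes x: "1 < \<beta>" "\<beta> \<le> Re s" and Y: "1 \<le> Y"
  shows "norm (sieved_zeta Y s - 1) \<le> \<beta> / (\<beta> - 1) * real Y powr (1 - \<beta>)"
proof -
  let ?f = "\<lambda>n. (of_nat n :: complex) powr (- s)"
  let ?R = "rough (primes_in 0 Y)"
  have s1: "1 < Re s" using x by simp
  note sm = nat_powr_summable[OF s1]
  have R: "?R = {1} \<union> (?R - {1})" by (auto simp: rough_def primes_in_def dest: prime_gt_1_nat)
  have big: "Y < n" if n: "n \<in> ?R - {1}" for n
  proof -
    have "n \<noteq> 1" "1 \<le> n" using n by (auto simp: rough_def)
    then obtain p where p: "prime p" "p dvd n" using prime_factor_nat by blast
    then have "p \<notin> primes_in 0 Y" using n by (auto simp: rough_def)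
    then have "Y < p" using p prime_gt_0_nat[of p] by (auto simp: primes_in_def)
    moreover have "p \<le> n" using p \<open>1 \<le> n\<close> by (intro dvd_imp_le) auto
    ultimately show ?thesis by simp
  qed
  have "sieved_zeta Y s = infsum ?f ?R"
    unfolding sieved_zeta_def by (intro zeta_sieve s1) (auto dest: primes_inD)
  also have "... = infsum ?f {1} + infsum ?f (?R - {1})"
    by (subst R, rule infsum_Un_disjoint) (auto intro: sm)
  also have "infsum ?f {1} = 1" by simp
  finally have "norm (sieved_zeta Y s - 1) = norm (infsum ?f (?R - {1}))" by simp
  also have "... \<le> \<beta> / (\<beta> - 1) * real Y powr (1 - \<beta>)"
  proof (rule infsum_norm_bound_finite)
    fix F assume F: "finite F" "F \<subseteq> ?R - {1}"
    have "norm (sum ?f F) \<le> (\<Sum>n\<in>F. real n powr (- \<beta>))"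
    proof (intro sum_norm_le)
      fix n assume "n \<in> F"
      then have "1 \<le> n" using F by (auto simp: rough_def)
      then show "norm (?f n) \<le> real n powr (- \<beta>)" using x by (simp add: norm_nat_powr powr_mono)
    qed
    also have "... \<le> (\<Sum>n=Y..Max (insert 0 F). real n powr (- \<beta>))"
    proof (intro sum_mono2)
      show "F \<subseteq> {Y..Max (insert 0 F)}"
      proof
        fix n assume n: "n \<in> F"
        then have "Y < n" using F(2) big by blast
        then show "n \<in> {Y..Max (insert 0 F)}" using F(1) n by simp
      qed
    qed auto
    also have "... \<le> \<beta> / (\<beta> - 1) * real Y powr (1 - \<beta>)" by (intro sum_powr_tail_le x Y)
    finally show "norm (sum ?f F) \<le> \<beta> / (\<beta> - 1) * real Y powr (1 - \<beta>)" .
  qed (rule sm)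
  finally show ?thesis .
qed

section \<open>Branches of the logarithm of zeta\<close>

text \<open>Two logarithms differ by a continuous function with values in the multiples of
  \<open>2 * pi * \<i>\<close>, hence by a constant. A distance below \<open>2 * pi\<close> at one
  point makes that constant 0, so a rough numerical estimate is enough to identify a branch.\<close>

lemma continuous_log_unique:
  fixes f g :: "'a::topological_space \<Rightarrow> complex"
  assumes S: "connected S" and f: "continuous_on S f" and g: "continuous_on S g"
    and e: "\<And>x. x \<in> S \<Longrightarrow> exp (f x) = exp (g x)"
    and a: "a \<in> S" "norm (f a - g a) < 2 * pi" and x: "x \<in> S"
  shows "f x = g x"
proof -
  define D where "D x = f x - g x" for x
  have D1: "exp (D x) = 1" if "x \<in> S" for x using e[OF that] by (simp add: D_def exp_diff)
  have big: "2 * pi \<le> norm z" if e1: "exp z = 1" "z \<noteq> 0" for z :: complex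
  proof -
    obtain n :: int where n: "Re z = 0" "Im z = of_int (2 * n) * pi" using e1(1) unfolding exp_eq_1 by blast
    then have "n \<noteq> 0" using e1(2) by (auto simp: complex_eq_iff)
    then have "1 \<le> \<bar>real_of_int n\<bar>" by linarith
    then have "2 * pi * 1 \<le> 2 * pi * \<bar>real_of_int n\<bar>" by (intro mult_left_mono) auto
    also have "... = \<bar>Im z\<bar>" by (simp add: n abs_mult)
    also have "... \<le> norm z" by (rule abs_Im_le_cmod)
    finally show ?thesis by simp
  qed
  have "D constant_on S"
  proof (rule continuous_discrete_range_constant[OF S])
    show "continuous_on S D" unfolding D_def by (intro continuous_intros f g)
    fix x assume x: "x \<in> S"
    show "\<exists>e>0. \<forall>y. y \<in> S \<and> D y \<noteq> D x \<longrightarrow> e \<le> norm (D y - D x)"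
    proof (intro exI[of _ "2 * pi"] conjI allI impI)
      fix y assume "y \<in> S \<and> D y \<noteq> D x"
      then show "2 * pi \<le> norm (D y - D x)" using D1 x by (intro big) (auto simp: exp_diff)
    qed simp
  qed
  then have "D x = D a" using a x by (auto simp: constant_on_def)
  moreover have "D a = 0" using big[OF D1[OF a(1)]] a(2) by (auto simp: D_def)
  ultimately show ?thesis by (simp add: D_def)
qed

definition zlog_term :: "nat \<Rightarrow> complex \<Rightarrow> complex" where
  "zlog_term n s = mangoldt n * of_nat n powr (- s) / of_real (ln (real n))"

definition zlog :: "complex \<Rightarrow> complex" where "zlog s = (\<Sum>n. zlog_term n s)"

lemma norm_zlog_term_le: "norm (zlog_term n s) \<le> real n powr (- Re s)"
proof (cases "n \<le> 1")
  case True
  then have "n = 0 \<or> n = 1" by linarith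
  then show ?thesis by (auto simp: zlog_term_def)
next
  case False
  then have "mangoldt n \<le> ln (real n)" "0 < ln (real n)" by (auto intro!: mangoldt_le)
  then have "mangoldt n / ln (real n) \<le> 1" "0 \<le> mangoldt n / ln (real n)" by (auto simp: divide_le_eq mangoldt_nonneg)
  then have "mangoldt n / ln (real n) * real n powr (- Re s) \<le> 1 * real n powr (- Re s)" by (intro mult_right_mono) auto
  moreover have "norm (zlog_term n s) = mangoldt n / ln (real n) * real n powr (- Re s)"
    using False \<open>0 < ln (real n)\<close> by (simp add: zlog_term_def norm_mult norm_divide norm_nat_powr mangoldt_nonneg)
  ultimately show ?thesis by simp
qed

lemma zlog_sums:
  assumes "1 < Re s"
  shows "(\<lambda>n. zlog_term n s) sums zlog s"
  unfolding zlog_def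
proof (rule summable_sums, rule summable_comparison_test'[where N = 0])
  show "summable (\<lambda>n. real n powr (- Re s))" using assms by (simp add: summable_real_powr_iff)
qed (rule norm_zlog_term_le)

lemma zlog_holomorphic: "zlog holomorphic_on {s. 1 < Re s}"
proof (rule holomorphic_uniform_sequence[where f = "\<lambda>n s. \<Sum>i<n. zlog_term i s"])
  show "open {s. 1 < Re s}" by (rule open_halfspace_Re_gt)
  show "(\<lambda>s. \<Sum>i<n. zlog_term i s) holomorphic_on {s. 1 < Re s}" for n
  proof (intro holomorphic_on_sum)
    fix i show "(\<lambda>s. zlog_term i s) holomorphic_on {s. 1 < Re s}"
      by (cases "i \<le> 1") (auto simp: zlog_term_def le_Suc_eq intro!: holomorphic_intros)
  qed
  fix x assume x: "x \<in> {s. 1 < Re s}"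
  define d where "d = (Re x - 1) / 2"
  have d: "0 < d" using x by (simp add: d_def)
  have re: "1 + d \<le> Re s" if "s \<in> cball x d" for s
    using that complex_Re_le_cmod[of "x - s"] by (auto simp: dist_norm d_def field_simps)
  have "uniform_limit (cball x d) (\<lambda>n s. \<Sum>i<n. zlog_term i s) zlog sequentially"
    unfolding zlog_def[abs_def]
  proof (rule Weierstrass_m_test)
    show "summable (\<lambda>n. real n powr (- (1 + d)))" using d by (simp add: summable_real_powr_iff)
    fix n s assume s: "s \<in> cball x d"
    have "norm (zlog_term n s) \<le> real n powr (- Re s)" by (rule norm_zlog_term_le)
    also have "... \<le> real n powr (- (1 + d))" using re[OF s] by (cases "n = 0") (auto intro!: powr_mono)
    finally show "norm (zlog_term n s) \<le> real n powr (- (1 + d))" .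
  qed
  moreover have "cball x d \<subseteq> {s. 1 < Re s}" using re d by force
  ultimately show "\<exists>d>0. cball x d \<subseteq> {s. 1 < Re s} \<and> uniform_limit (cball x d) (\<lambda>n s. \<Sum>i<n. zlog_term i s) zlog sequentially"
    using d by blast
qed

text \<open>Regrouping by prime powers, each of which determines its base and exponent. It links the
  Dirichlet series in the definition of \<open>log_zeta\<close> to the prime power sums
  \<open>Dpoly\<close>.\<close>

lemma zlog_partial: "(\<Sum>n<Suc N. zlog_term n s) = Dpoly (zc s) N (\<lambda>_. 1)"
proof -
  let ?A = "SIGMA p:primes_in 0 (real N). ppow N p"
  have "(\<Sum>n<Suc N. zlog_term n s) = (\<Sum>n\<in>{n\<in>{..<Suc N}. primepow n}. zlog_term n s)"
    by (intro sum.mono_neutral_right) (auto simp: zlog_term_def mangoldt_def)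
  also have "{n\<in>{..<Suc N}. primepow n} = (\<lambda>(p, m). p ^ m) ` ?A"
  proof (intro equalityI subsetI)
    fix n assume "n \<in> {n\<in>{..<Suc N}. primepow n}"
    then obtain p m where pm: "prime p" "0 < m" "n = p ^ m" "p ^ m \<le> N" by (auto simp: primepow_def)
    have "p ^ 1 \<le> p ^ m" using pm by (intro power_increasing) (auto simp: prime_ge_Suc_0_nat)
    then have "(p, m) \<in> ?A" using pm by (auto simp: primes_in_def ppow_def prime_gt_0_nat)
    then show "n \<in> (\<lambda>(p, m). p ^ m) ` ?A" using pm by force
  next
    fix n assume "n \<in> (\<lambda>(p, m). p ^ m) ` ?A"
    then obtain p m where "n = p ^ m" "p ^ m \<le> N" "prime p" "0 < m" by (auto simp: primes_in_def ppow_def)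
    then show "n \<in> {n\<in>{..<Suc N}. primepow n}" by (auto simp: primepow_def)
  qed
  also have "(\<Sum>n\<in>(\<lambda>(p, m). p ^ m) ` ?A. zlog_term n s) = (\<Sum>(p, m)\<in>?A. zlog_term (p ^ m) s)"
  proof (subst sum.reindex)
    show "inj_on (\<lambda>(p, m). p ^ m) ?A"
      by (auto simp: inj_on_def primes_in_def ppow_def prime_power_inj'' dest: prime_power_inj'')
  qed (simp add: case_prod_unfold)
  also have "... = (\<Sum>p\<in>primes_in 0 (real N). \<Sum>m\<in>ppow N p. zlog_term (p ^ m) s)"
    by (rule sum.Sigma[symmetric]) (auto intro: finite_ppow dest: primes_inD)
  also have "... = Dpoly (zc s) N (\<lambda>_. 1)"
    unfolding Dpoly_def
  proof (intro sum.cong refl)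
    fix p m assume pm: "p \<in> primes_in 0 (real N)" "m \<in> ppow N p"
    then have p: "prime p" "0 < m" by (auto simp: primes_in_def ppow_def)
    have lp: "0 < ln (real p)" "0 < real p" using prime_gt_1_nat[OF p(1)] by auto
    have "(of_nat (p ^ m) :: complex) powr (- s) = of_nat p powr (- (of_nat m * s))"
      using lp by (simp add: powr_def Ln_of_nat ln_realpow algebra_simps del: of_nat_power) (simp add: ln_realpow flip: of_real_power)
    then show "zlog_term (p ^ m) s = zc s p m * 1 ^ m"
      using p lp by (simp add: zlog_term_def zc_def ln_realpow field_simps)
  qed
  finally show ?thesis .
qed

lemma euler_log_tendsto_zlog:
  assumes "1 < Re s"
  shows "(\<lambda>N. euler_log s (real N) (\<lambda>_. 1)) \<longlonglongrightarrow> zlog s"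
proof -
  have 1: "(\<lambda>N. Dpoly (zc s) N (\<lambda>_. 1)) \<longlonglongrightarrow> zlog s"
    using LIMSEQ_Suc[OF zlog_sums[OF assms, unfolded sums_def]] unfolding zlog_partial .
  have "(\<lambda>N. euler_log s (real N) (\<lambda>_. 1) - Dpoly (zc s) N (\<lambda>_. 1)) \<longlonglongrightarrow> 0"
  proof (rule Lim_null_comparison)
    show "\<forall>\<^sub>F N in sequentially. norm (euler_log s (real N) (\<lambda>_. 1) - Dpoly (zc s) N (\<lambda>_. 1)) \<le> 4 * ((1 + 1/2) / (1 - 1/2)) * real N powr (- ((2 * 1 - 1) / 4))"
      using eventually_ge_at_top[of 1]
    proof eventually_elim
      case (elim N)
      show ?case unfolding euler_log_def using elim assms by (intro euler_log_truncate) auto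
    qed
    show "(\<lambda>N. 4 * ((1 + 1/2) / (1 - 1/2)) * real N powr (- ((2 * 1 - 1) / 4))) \<longlonglongrightarrow> 0"
      by real_asymp
  qed
  from tendsto_add[OF this 1] show ?thesis by simp
qed

lemma prime_factor_nonzero:
  assumes "prime p" "0 < Re s"
  shows "1 - (of_nat p :: complex) powr (- s) \<noteq> 0"
proof -
  have "norm ((of_nat p :: complex) powr (- s)) < 1"
    using assms prime_gt_1_nat[OF assms(1)] by (simp add: norm_nat_powr powr_less_one)
  then show ?thesis by auto
qed

lemma exp_euler_log:
  assumes "0 < Re s"
  shows "exp (euler_log s y (\<lambda>_. 1)) = inverse (\<Prod>p\<in>primes_in 0 y. 1 - of_nat p powr (- s))"
proof -
  have "exp (euler_log s y (\<lambda>_. 1)) = (\<Prod>p\<in>primes_in 0 y. inverse (1 - of_nat p powr (- s)))"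
    unfolding euler_log_def exp_sum[OF finite_primes_in]
  proof (intro prod.cong refl)
    fix p assume "p \<in> primes_in 0 y"
    then show "exp (- Ln (1 - 1 * of_nat p powr (- s))) = inverse (1 - of_nat p powr (- s))"
      using prime_factor_nonzero[OF primes_inD assms] by (simp add: exp_minus)
  qed
  also have "... = inverse (\<Prod>p\<in>primes_in 0 y. 1 - of_nat p powr (- s))"
    by (rule prod_inversef[unfolded o_def])
  finally show ?thesis .
qed

text \<open>By the sieve bound zeta times the finite Euler product tends to 1, while the exponential
  of \<open>euler_log\<close> is the inverse of that product and tends to
  \<open>exp (zlog s)\<close>.\<close>

lemma exp_zlog:
  assumes "1 < Re s"
  shows "exp (zlog s) = zeta s"
proof -
  let ?P = "\<lambda>N. (\<Prod>p\<in>primes_in 0 (real N). 1 - (of_nat p :: complex) powr (- s))"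
  have nz: "?P N \<noteq> 0" for N
    using assms by (auto simp: prod_zero_iff dest!: primes_inD prime_factor_nonzero[of _ s])
  have 1: "(\<lambda>N. zeta s * ?P N - 1) \<longlonglongrightarrow> 0"
  proof (rule Lim_null_comparison)
    show "\<forall>\<^sub>F N in sequentially. norm (zeta s * ?P N - 1) \<le> Re s / (Re s - 1) * real N powr (1 - Re s)"
      using eventually_ge_at_top[of 1]
    proof eventually_elim
      case (elim N)
      show ?case unfolding sieved_zeta_def[symmetric] by (intro zeta_sieve_bound assms order_refl elim)
    qed
    have "(\<lambda>N. real N powr (1 - Re s)) \<longlonglongrightarrow> 0"
      using assms by (intro tendsto_neg_powr filterlim_real_sequentially) auto
    from tendsto_mult_right_zero[OF this] show "(\<lambda>N. Re s / (Re s - 1) * real N powr (1 - Re s)) \<longlonglongrightarrow> 0" .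
  qed
  have "(\<lambda>N. exp (euler_log s (real N) (\<lambda>_. 1))) \<longlonglongrightarrow> exp (zlog s)"
    by (intro tendsto_exp euler_log_tendsto_zlog assms)
  from tendsto_mult[OF tendsto_add[OF 1 tendsto_const[of 1]] this]
  have "(\<lambda>N. (zeta s * ?P N - 1 + 1) * exp (euler_log s (real N) (\<lambda>_. 1))) \<longlonglongrightarrow> (0 + 1) * exp (zlog s)" .
  moreover have "(zeta s * ?P N - 1 + 1) * exp (euler_log s (real N) (\<lambda>_. 1)) = zeta s" for N
    using assms nz[of N] by (simp add: exp_euler_log)
  ultimately have "(\<lambda>N::nat. zeta s) \<longlonglongrightarrow> exp (zlog s)" by (simp only: add_0 mult_1)
  then show ?thesis using LIMSEQ_unique tendsto_const by blast
qed

lemma zeta_nonzero: "1 < Re s \<Longrightarrow> zeta s \<noteq> 0"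
  by (simp add: exp_zlog[symmetric])

text \<open>Its purpose is to identify a branch: the bound 1 leaves ample room below
  \<open>2 * pi\<close>.\<close>

lemma zlog_tail:
  assumes s: "2 \<le> Re s" and Y: "10 \<le> Y"
  shows "norm (zlog s - euler_log s (real Y) (\<lambda>_. 1)) \<le> 1"
proof -
  have "(\<lambda>N. norm (euler_log s (real N) (\<lambda>_. 1) - euler_log s (real Y) (\<lambda>_. 1))) \<longlonglongrightarrow> norm (zlog s - euler_log s (real Y) (\<lambda>_. 1))"
    using s by (intro tendsto_intros euler_log_tendsto_zlog) auto
  moreover have "\<forall>\<^sub>F N in sequentially. norm (euler_log s (real N) (\<lambda>_. 1) - euler_log s (real Y) (\<lambda>_. 1)) \<le> 1"
    using eventually_ge_at_top[of Y]
  proof eventually_elim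
    case (elim N)
    have "primes_in 0 (real N) = primes_in 0 Y \<union> primes_in (real Y) (real N)"
      using elim by (auto simp: primes_in_def)
    moreover have "primes_in 0 Y \<inter> primes_in (real Y) (real N) = {}" by (auto simp: primes_in_def)
    ultimately have "euler_log s (real N) (\<lambda>_. 1) - euler_log s (real Y) (\<lambda>_. 1) = (\<Sum>p\<in>primes_in (real Y) (real N). - Ln (1 - 1 * of_nat p powr (- s)))"
      unfolding euler_log_def by (simp add: sum.union_disjoint)
    also have "norm ... \<le> (\<Sum>p\<in>primes_in (real Y) (real N). 5 * real p powr (- 2))"
    proof (intro sum_norm_le)
      fix p assume "p \<in> primes_in (real Y) (real N)"
      then have p: "prime p" "1 \<le> real p" "0 < p" by (auto simp: primes_in_def Suc_le_eq prime_gt_0_nat)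
      have "norm (- Ln (1 - 1 * of_nat p powr (- s)) - 1 * of_nat p powr (- s)) \<le> 4 * real p powr (- (2 * 2))"
        using s by (intro Ln_linear_bound p) auto
      also have "... \<le> 4 * real p powr (- 2)" using p by (intro mult_left_mono powr_mono) auto
      finally have "norm (- Ln (1 - 1 * of_nat p powr (- s))) \<le> norm (1 * of_nat p powr (- s) :: complex) + 4 * real p powr (- 2)"
        using norm_triangle_sub[of "- Ln (1 - 1 * of_nat p powr (- s))" "1 * of_nat p powr (- s)"] by linarith
      also have "norm (1 * of_nat p powr (- s) :: complex) \<le> real p powr (- 2)"
        using p s by (simp add: norm_nat_powr powr_mono del: powr_minus)
      finally show "norm (- Ln (1 - 1 * of_nat p powr (- s))) \<le> 5 * real p powr (- 2)" by simp
    qed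
    also have "... = 5 * (\<Sum>p\<in>primes_in (real Y) (real N). real p powr (- 2))" by (simp add: sum_distrib_left)
    also have "... \<le> 5 * (2 / (2 - 1) * max 1 (real Y) powr (1 - 2))" by (intro mult_left_mono sum_primes_powr_le) auto
    also have "... \<le> 1" using Y by (simp add: max_def powr_minus field_simps)
    finally show ?case .
  qed
  ultimately show ?thesis by (intro tendsto_upperbound) auto
qed

lemma zlog_Complex_continuous: "continuous_on {x. 1 < x} (\<lambda>x. zlog (Complex x \<tau>))"
proof -
  have "continuous_on ((\<lambda>x. Complex x \<tau>) ` {x. 1 < x}) zlog"
    by (rule continuous_on_subset[OF holomorphic_on_imp_continuous_on[OF zlog_holomorphic]]) auto
  then show ?thesis
    by (rule continuous_on_compose2) (auto simp: Complex_eq intro!: continuous_intros)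
qed

text \<open>The definite description needs uniqueness: two branches agree where the Dirichlet series
  prescribes them, and \<open>continuous_log_unique\<close> carries the agreement along the
  ray.\<close>

lemma log_zeta_eqI:
  assumes "continuous_on {Re s..} L" "\<And>x. Re s \<le> x \<Longrightarrow> exp (L x) = zeta (Complex x (Im s))"
    "\<And>x. Re s \<le> x \<Longrightarrow> 1 < x \<Longrightarrow> L x = zlog (Complex x (Im s))"
  shows "log_zeta s = L (Re s)"
  unfolding log_zeta_def
proof (rule the_equality)
  show "is_log_zeta s (L (Re s))"
    unfolding is_log_zeta_def
  proof (intro exI[of _ L] conjI allI impI)
    fix x assume x: "Re s \<le> x" "1 < x"
    show "(\<lambda>n. mangoldt n * of_nat n powr - Complex x (Im s) / complex_of_real (ln (real n))) sums L x"
      using zlog_sums[of "Complex x (Im s)"] x unfolding assms(3)[OF x] zlog_term_def by simp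
  qed (use assms in auto)
next
  fix w assume "is_log_zeta s w"
  then obtain K where K: "continuous_on {Re s..} K" "\<And>x. Re s \<le> x \<Longrightarrow> exp (K x) = zeta (Complex x (Im s))"
    "\<And>x. Re s \<le> x \<Longrightarrow> 1 < x \<Longrightarrow> (\<lambda>n. zlog_term n (Complex x (Im s))) sums K x" "K (Re s) = w"
    unfolding is_log_zeta_def zlog_term_def by blast
  define a where "a = max (Re s) 2"
  have "K a = zlog (Complex a (Im s))"
    using K(3)[of a] zlog_sums[of "Complex a (Im s)"] sums_unique2 by (force simp: a_def)
  also have "... = L a" using assms(3)[of a] by (simp add: a_def)
  finally have "K (Re s) = L (Re s)"
    using K assms(1,2) by (intro continuous_log_unique[of "{Re s..}" K L a]) (auto simp: a_def)
  then show "w = L (Re s)" using K by simp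
qed

text \<open>If \<open>sieved_zeta\<close> stays within \<open>1/2\<close> of 1 along the ray, its
  principal logarithm is continuous there and \<open>euler_log\<close> plus that logarithm is a
  branch of the logarithm of zeta.\<close>

lemma log_zeta_approx:
  assumes s: "0 < Re s" "Im s \<noteq> 0" and Y: "10 \<le> Y" and \<delta>: "\<delta> < 1/2"
    and close: "\<And>x. Re s \<le> x \<Longrightarrow> norm (sieved_zeta Y (Complex x (Im s)) - 1) \<le> \<delta>"
  shows "norm (log_zeta s - euler_log s (real Y) (\<lambda>_. 1)) \<le> 2 * \<delta>"
proof -
  let ?z = "\<lambda>x. Complex x (Im s)"
  define F where "F = sieved_zeta Y"
  define L where "L x = euler_log (?z x) (real Y) (\<lambda>_. 1) + Ln (F (?z x))" for x
  have F1: "norm (F (?z x) - 1) \<le> \<delta>" if "Re s \<le> x" for x using close[OF that] by (simp add: F_def)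
  have Fpos: "F (?z x) \<notin> \<real>\<^sub>\<le>\<^sub>0" if "Re s \<le> x" for x
  proof -
    have "Re (1 - F (?z x)) \<le> \<delta>"
      using order_trans[OF complex_Re_le_cmod F1[OF that, unfolded norm_minus_commute]] .
    then have "0 < Re (F (?z x))" using \<delta> by simp
    then show ?thesis by (auto simp: complex_nonpos_Reals_iff)
  qed
  have Ln1: "norm (Ln (F (?z x))) \<le> 2 * \<delta>" if "Re s \<le> x" for x
  proof -
    have "norm (Ln (1 + (F (?z x) - 1))) \<le> 2 * norm (F (?z x) - 1)"
      using F1[OF that] \<delta> by (intro norm_Ln_le) auto
    then show ?thesis using F1[OF that] by simp
  qed
  have cC: "continuous_on A (\<lambda>x. ?z x)" for A by (auto simp: Complex_eq intro!: continuous_intros)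
  have dom: "?z x \<in> zeta_dom" if "Re s \<le> x" for x
    using s that by (auto simp: zeta_dom_def complex_eq_iff)
  have cz: "continuous_on {Re s..} (\<lambda>x. zeta (?z x))"
    by (rule continuous_on_compose2[OF holomorphic_on_imp_continuous_on[OF zeta_holomorphic] cC]) (use dom in auto)
  have pos: "1 - of_nat p powr (- ?z x) \<notin> \<real>\<^sub>\<le>\<^sub>0" if "p \<in> primes_in 0 Y" "Re s \<le> x" for p x
  proof -
    have "norm ((of_nat p :: complex) powr (- ?z x)) < 1"
      using that s prime_gt_1_nat[of p] by (auto simp: norm_nat_powr powr_less_one dest!: primes_inD)
    then have "0 < Re (1 - of_nat p powr (- ?z x))"
      using complex_Re_le_cmod[of "of_nat p powr (- ?z x)"] by simp
    then show ?thesis by (auto simp: complex_nonpos_Reals_iff)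
  qed
  have cp: "continuous_on {Re s..} (\<lambda>x. (of_nat p :: complex) powr (- ?z x))" if "p \<in> primes_in 0 Y" for p
    using that by (intro continuous_on_powr_complex continuous_intros cC) (auto simp: complex_nonpos_Reals_iff primes_in_def)
  have cF: "continuous_on {Re s..} (\<lambda>x. F (?z x))"
    unfolding F_def sieved_zeta_def by (intro continuous_intros cz cp)
  have "log_zeta s = L (Re s)"
  proof (rule log_zeta_eqI)
    show cL: "continuous_on {Re s..} L"
      unfolding L_def euler_log_def using pos Fpos
      by (intro continuous_on_add continuous_on_sum continuous_on_minus continuous_on_Ln' cF continuous_on_diff continuous_on_const continuous_on_mult cp)
        auto
    show eL: "exp (L x) = zeta (?z x)" if "Re s \<le> x" for x
    proof -
      have "F (?z x) \<noteq> 0" using Fpos[OF that] by auto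
      then have "exp (L x) = inverse (\<Prod>p\<in>primes_in 0 Y. 1 - of_nat p powr (- ?z x)) * F (?z x)"
        using s that by (simp add: L_def exp_add exp_euler_log)
      moreover have "(\<Prod>p\<in>primes_in 0 Y. 1 - (of_nat p :: complex) powr (- ?z x)) \<noteq> 0"
        using \<open>F (?z x) \<noteq> 0\<close> by (auto simp: F_def sieved_zeta_def)
      ultimately show ?thesis by (simp add: F_def sieved_zeta_def)
    qed
    fix x assume x: "Re s \<le> x" "1 < x"
    \<comment> \<open>A reference point on the ray where the tail of the Euler product is small;
      there the two branches differ by at most \<open>2 * \<delta> + 1 < 2 * pi\<close>.\<close>
    define a where "a = max (Re s) 2"
    let ?S = "{max (Re s) 1..} - {1}"
    have S: "y \<in> ?S \<Longrightarrow> Re s \<le> y \<and> 1 < y" for y by auto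
    have conn: "connected {y. Re s \<le> y \<and> 1 < y}"
      by (intro is_interval_connected) (auto simp: is_interval_1)
    show "L x = zlog (?z x)"
    proof (rule continuous_log_unique[OF conn, where f = L and g = "\<lambda>x. zlog (?z x)" and a = a])
      show "continuous_on {y. Re s \<le> y \<and> 1 < y} L" by (rule continuous_on_subset[OF cL]) auto
      show "continuous_on {y. Re s \<le> y \<and> 1 < y} (\<lambda>x. zlog (?z x))"
        by (rule continuous_on_subset[OF zlog_Complex_continuous]) auto
      show "exp (L y) = exp (zlog (?z y))" if "y \<in> {y. Re s \<le> y \<and> 1 < y}" for y
        using that eL by (simp add: exp_zlog)
      have "norm (L a - zlog (?z a)) \<le> norm (Ln (F (?z a))) + norm (zlog (?z a) - euler_log (?z a) (real Y) (\<lambda>_. 1))"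
        unfolding L_def using norm_triangle_ineq4[of "Ln (F (?z a))" "zlog (?z a) - euler_log (?z a) (real Y) (\<lambda>_. 1)"]
        by (simp add: algebra_simps)
      also have "... \<le> 2 * \<delta> + 1" using Y by (intro add_mono Ln1 zlog_tail) (auto simp: a_def)
      also have "... < 2 * pi" using \<delta> pi_gt3 by simp
      finally show "norm (L a - zlog (?z a)) < 2 * pi" .
    qed (use x in \<open>auto simp: a_def\<close>)
  qed
  then have "norm (log_zeta s - euler_log s (real Y) (\<lambda>_. 1)) = norm (Ln (F (Complex (Re s) (Im s))))"
    by (simp add: L_def)
  then show ?thesis using Ln1[of "Re s"] by simp
qed

section \<open>Measurability of the events in t\<close>

text \<open>Zeros cannot lie to the right of 1, so they are confined to a compact rectangle;
  \<open>0 < a\<close> keeps it away from the pole.\<close>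

lemma zeta_ray_zeros_finite:
  assumes "0 < \<sigma>" "0 < a"
  shows "finite {\<tau>\<in>{a..b}. \<exists>x\<ge>\<sigma>. zeta (Complex x \<tau>) = 0}"
proof -
  define K where "K = cbox (Complex \<sigma> a) (Complex 1 b)"
  have KS: "K \<subseteq> zeta_dom"
    using assms by (auto simp: K_def zeta_dom_def cbox_complex_eq)
  have "finite {z\<in>K. zeta z = 0}"
  proof (cases "zeta constant_on zeta_dom")
    case True
    then have "zeta z = zeta 2" if "z \<in> K" for z
    proof -
      have "2 \<in> zeta_dom" by (simp add: zeta_dom_def)
      then show ?thesis using True that KS unfolding constant_on_def by (metis subsetD)
    qed
    moreover have "zeta 2 \<noteq> 0" by (intro zeta_nonzero) simp
    ultimately have "{z\<in>K. zeta z = 0} = {}" by auto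
    then show ?thesis by (simp only: finite.emptyI)
  next
    case False
    then show ?thesis
      by (intro holomorphic_compact_finite_zeros[OF zeta_holomorphic open_zeta_dom connected_zeta_dom _ KS]) (auto simp: K_def)
  qed
  then have "finite (Im ` {z\<in>K. zeta z = 0})" by (rule finite_imageI)
  moreover have "{\<tau>\<in>{a..b}. \<exists>x\<ge>\<sigma>. zeta (Complex x \<tau>) = 0} \<subseteq> Im ` {z\<in>K. zeta z = 0}"
  proof
    fix \<tau> assume "\<tau> \<in> {\<tau>\<in>{a..b}. \<exists>x\<ge>\<sigma>. zeta (Complex x \<tau>) = 0}"
    then obtain x where x: "a \<le> \<tau>" "\<tau> \<le> b" "\<sigma> \<le> x" "zeta (Complex x \<tau>) = 0" by auto
    then have "x \<le> 1" using zeta_nonzero[of "Complex x \<tau>"] by force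
    then have "Complex x \<tau> \<in> {z\<in>K. zeta z = 0}" using x by (auto simp: K_def cbox_complex_eq)
    then show "\<tau> \<in> Im ` {z\<in>K. zeta z = 0}" by (metis complex.sel(2) image_eqI)
  qed
  ultimately show ?thesis by (rule finite_subset[rotated])
qed

text \<open>The ray is not compact, but only its part up to real part \<open>max \<sigma> 2\<close>
  needs a uniform neighbourhood free of zeros, since there are none to the right of 1. On the
  resulting convex strip zeta has a holomorphic logarithm; normalised by \<open>zlog\<close>, it
  gives \<open>log_zeta\<close> at all nearby heights.\<close>

lemma log_zeta_isCont:
  assumes \<sigma>: "0 < \<sigma>" and \<tau>: "\<tau> \<noteq> 0" and nz: "\<And>x. \<sigma> \<le> x \<Longrightarrow> zeta (Complex x \<tau>) \<noteq> 0"
  shows "isCont (\<lambda>t. log_zeta (Complex \<sigma> t)) \<tau>"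
proof -
  define V where "V = {s\<in>zeta_dom. zeta s \<noteq> 0}"
  have "open (zeta_dom \<inter> zeta -` (- {0}))"
    by (rule continuous_open_preimage[OF holomorphic_on_imp_continuous_on[OF zeta_holomorphic] open_zeta_dom])
       (simp add: open_Compl)
  moreover have "zeta_dom \<inter> zeta -` (- {0}) = V" by (auto simp: V_def)
  ultimately have oV: "open V" by simp
  define K where "K = (\<lambda>x. Complex x \<tau>) ` {\<sigma>..max \<sigma> 2}"
  have "compact K"
    unfolding K_def by (intro compact_continuous_image) (auto simp: Complex_eq intro!: continuous_intros)
  moreover have "K \<subseteq> V" using \<sigma> \<tau> nz by (auto simp: K_def V_def zeta_dom_def complex_eq_iff)
  ultimately obtain e where e: "0 < e" "(\<Union>x\<in>K. ball x e) \<subseteq> V"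
    using compact_subset_open_imp_ball_epsilon_subset oV by blast
  define U where "U = {s. \<sigma> - e / 2 < Re s} \<inter> {s. Im s < \<tau> + e / 2} \<inter> {s. \<tau> - e / 2 < Im s}"
  have oU: "open U" unfolding U_def by (intro open_Int open_halfspace_Re_gt open_halfspace_Im_lt open_halfspace_Im_gt)
  have cU: "convex U" unfolding U_def
    by (intro convex_Int convex_halfspace_Re_gt convex_halfspace_Im_lt convex_halfspace_Im_gt)
  have UV: "s \<in> V" if s: "s \<in> U" for s
  proof (cases "Re s \<le> max \<sigma> 2")
    case True
    define x where "x = max \<sigma> (Re s)"
    have "dist (Complex x \<tau>) s \<le> \<bar>x - Re s\<bar> + \<bar>\<tau> - Im s\<bar>"
      using cmod_le[of "Complex x \<tau> - s"] by (simp add: dist_norm)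
    also have "... < e" using s by (auto simp: U_def x_def)
    finally have "s \<in> ball (Complex x \<tau>) e" by simp
    moreover have "Complex x \<tau> \<in> K" using True by (auto simp: K_def x_def)
    ultimately show ?thesis using e by blast
  next
    case False
    then have "1 < Re s" by simp
    then show ?thesis using zeta_nonzero[of s] by (auto simp: V_def zeta_dom_def)
  qed
  have "zeta holomorphic_on U"
    by (rule holomorphic_on_subset[OF zeta_holomorphic]) (use UV in \<open>auto simp: V_def\<close>)
  moreover have "contractible U" by (intro convex_imp_contractible cU)
  moreover have "zeta z \<noteq> 0" if "z \<in> U" for z using UV[OF that] by (simp add: V_def)
  ultimately obtain g where g: "g holomorphic_on U" "\<And>z. z \<in> U \<Longrightarrow> zeta z = exp (g z)"
    using contractible_imp_holomorphic_log[of zeta U] by blast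
  define a where "a = Complex (max \<sigma> 2) \<tau>"
  have a: "a \<in> U" "1 < Re a" using e by (auto simp: a_def U_def)
  define h where "h z = g z - (g a - zlog a)" for z
  have eh: "exp (h z) = zeta z" if "z \<in> U" for z
  proof -
    have "exp (g a - zlog a) = 1" using g(2)[OF a(1)] exp_zlog[OF a(2)] zeta_nonzero[OF a(2)] by (simp add: exp_diff)
    then show ?thesis using g(2)[OF that] by (simp add: h_def exp_diff)
  qed
  have ch: "continuous_on U h" unfolding h_def by (intro continuous_intros holomorphic_on_imp_continuous_on g)
  have hz: "h z = zlog z" if z: "z \<in> U" "1 < Re z" for z
  proof (rule continuous_log_unique[of "U \<inter> {s. 1 < Re s}" h zlog a])
    show "connected (U \<inter> {s. 1 < Re s})" by (intro convex_connected convex_Int cU convex_halfspace_Re_gt)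
    show "continuous_on (U \<inter> {s. 1 < Re s}) h" by (rule continuous_on_subset[OF ch]) auto
    show "continuous_on (U \<inter> {s. 1 < Re s}) zlog"
      by (rule continuous_on_subset[OF holomorphic_on_imp_continuous_on[OF zlog_holomorphic]]) auto
  qed (use z a eh in \<open>auto simp: exp_zlog h_def\<close>)
  have lz: "log_zeta (Complex \<sigma> t) = h (Complex \<sigma> t)" if t: "\<bar>t - \<tau>\<bar> < e / 2" for t
  proof -
    have inU: "Complex x t \<in> U" if "\<sigma> \<le> x" for x
    proof -
      have "t < \<tau> + e / 2" "\<tau> - e / 2 < t" using t by linarith+
      then show ?thesis using that e by (auto simp: U_def)
    qed
    have "log_zeta (Complex \<sigma> t) = (\<lambda>x. h (Complex x t)) (Re (Complex \<sigma> t))"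
    proof (rule log_zeta_eqI)
      show "continuous_on {Re (Complex \<sigma> t)..} (\<lambda>x. h (Complex x t))"
        by (rule continuous_on_compose2[OF ch]) (use inU in \<open>auto simp: Complex_eq intro!: continuous_intros\<close>)
    qed (use inU eh hz in auto)
    then show ?thesis by simp
  qed
  have "isCont (\<lambda>t. h (Complex \<sigma> t)) \<tau>"
  proof -
    have "isCont h (Complex \<sigma> \<tau>)"
    proof -
      have "Complex \<sigma> \<tau> \<in> U" using e by (simp add: U_def)
      then show ?thesis using continuous_on_eq_continuous_at[OF oU, of h] ch by blast
    qed
    then show ?thesis
      by (intro isCont_o2[of \<tau> "Complex \<sigma>" h]) (auto simp: Complex_eq[abs_def] intro!: continuous_intros)
  qed
  moreover have "\<forall>\<^sub>F t in nhds \<tau>. log_zeta (Complex \<sigma> t) = h (Complex \<sigma> t)"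
    using e by (intro eventually_nhds_metric[THEN iffD2] exI[of _ "e / 2"]) (auto simp: dist_real_def intro: lz)
  ultimately show ?thesis by (subst isCont_cong)
qed

lemma rectangle_borel:
  assumes "rectangle R"
  shows "R \<in> sets borel"
proof -
  obtain A B where AB: "is_interval A" "is_interval B" "R = {z. Re z \<in> A \<and> Im z \<in> B}"
    using assms unfolding rectangle_def by blast
  have [measurable]: "A \<in> sets borel" "B \<in> sets borel" using AB real_interval_borel_measurable by auto
  have "R = {z \<in> space borel. Re z \<in> A \<and> Im z \<in> B}" using AB by simp
  also have "... \<in> sets borel" by measurable
  finally show ?thesis .
qed

text \<open>Off finitely many \<open>t\<close> the functions are continuous. At those
  \<open>t\<close> the value of \<open>log_zeta\<close> is unspecified, but a finite set is Borel
  whatever part of it satisfies the condition.\<close>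

lemma log_zeta_set_borel:
  assumes T: "\<And>j. j \<in> J \<Longrightarrow> 0 < Re (s j)" "\<And>j. j \<in> J \<Longrightarrow> 0 < a + Im (s j)" and J: "finite J"
    and R: "\<And>j. j \<in> J \<Longrightarrow> rectangle (R j)"
  shows "{t \<in> {a..b}. \<forall>j\<in>J. log_zeta (s j + \<i> * of_real t) \<in> R j} \<in> sets borel"
proof -
  let ?l = "\<lambda>j t. log_zeta (s j + \<i> * of_real t)"
  define B where "B j = {t\<in>{a..b}. \<exists>x\<ge>Re (s j). zeta (Complex x (Im (s j) + t)) = 0}" for j
  have finB: "finite (B j)" if "j \<in> J" for j
  proof -
    have "finite ((\<lambda>t. Im (s j) + t) -` {\<tau>\<in>{a + Im (s j)..b + Im (s j)}. \<exists>x\<ge>Re (s j). zeta (Complex x \<tau>) = 0})"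
      using T that by (intro finite_vimageI zeta_ray_zeros_finite) (auto simp: inj_on_def)
    then show ?thesis by (rule finite_subset[rotated]) (auto simp: B_def)
  qed
  define F where "F = (\<Union>j\<in>J. B j)"
  have finF: "finite F" using finB J by (auto simp: F_def)
  define G where "G = {a..b} - F"
  have G: "G \<in> sets borel" unfolding G_def using finF by (intro sets.Diff borel_closed finite_imp_closed closed_atLeastAtMost)
  let ?A = "{t \<in> {a..b}. \<forall>j\<in>J. ?l j t \<in> R j}"
  have each: "{t \<in> G. ?l j t \<in> R j} \<in> sets borel" if j: "j \<in> J" for j
  proof -
    have "continuous_on G (?l j)"
    proof (intro continuous_at_imp_continuous_on ballI)
      fix t assume t: "t \<in> G"
      have "isCont (\<lambda>\<tau>. log_zeta (Complex (Re (s j)) \<tau>)) (Im (s j) + t)"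
      proof (rule log_zeta_isCont)
        show "0 < Re (s j)" using T j by auto
        show "Im (s j) + t \<noteq> 0" using T(2)[OF j] t by (auto simp: G_def)
        show "zeta (Complex x (Im (s j) + t)) \<noteq> 0" if "Re (s j) \<le> x" for x
          using t that j by (auto simp: G_def F_def B_def)
      qed
      then have "isCont (\<lambda>t. log_zeta (Complex (Re (s j)) (Im (s j) + t))) t"
        by (intro isCont_o2[of t "\<lambda>t. Im (s j) + t" "\<lambda>\<tau>. log_zeta (Complex (Re (s j)) \<tau>)"]) (auto intro!: continuous_intros)
      moreover have "Complex (Re (s j)) (Im (s j) + t) = s j + \<i> * of_real t" for t by (simp add: complex_eq_iff)
      ultimately show "isCont (?l j) t" by simp
    qed
    then have "?l j \<in> borel_measurable (restrict_space borel G)"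
      by (rule borel_measurable_continuous_on_restrict)
    from measurable_sets[OF this rectangle_borel[OF R[OF j]]]
    have "?l j -` R j \<inter> G \<in> sets (restrict_space borel G)" by (simp add: space_restrict_space)
    then have "?l j -` R j \<inter> G \<in> sets borel"
      using G by (subst (asm) sets_restrict_space_iff) auto
    also have "?l j -` R j \<inter> G = {t \<in> G. ?l j t \<in> R j}" by auto
    finally show ?thesis .
  qed
  have "{t \<in> G. \<forall>j\<in>J. ?l j t \<in> R j} \<in> sets borel"
  proof (cases "J = {}")
    case False
    have "(\<Inter>j\<in>J. {t \<in> G. ?l j t \<in> R j}) \<in> sets borel"
      using each J False by (intro sets.finite_INT) auto
    also have "(\<Inter>j\<in>J. {t \<in> G. ?l j t \<in> R j}) = {t \<in> G. \<forall>j\<in>J. ?l j t \<in> R j}"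
      using False by auto
    finally show ?thesis .
  qed (use G in simp)
  moreover have "finite (?A \<inter> F)" using finF by auto
  then have "?A \<inter> F \<in> sets borel" by (intro borel_closed finite_imp_closed)
  ultimately have "{t \<in> G. \<forall>j\<in>J. ?l j t \<in> R j} \<union> (?A \<inter> F) \<in> sets borel" by auto
  also have "{t \<in> G. \<forall>j\<in>J. ?l j t \<in> R j} \<union> (?A \<inter> F) = ?A" by (auto simp: G_def)
  finally show ?thesis .
qed

section \<open>Mean values of Dirichlet polynomials\<close>

lemma harmonic_sum_le:
  assumes "1 \<le> N"
  shows "(\<Sum>k=1..N. 1 / real k) \<le> 1 + ln (real N)"
  using assms
proof (induction N rule: dec_induct)
  case (step n)
  have n: "0 < real n" using step by simp
  have "ln (real n / real (Suc n)) \<le> real n / real (Suc n) - 1" using n by (intro ln_le_minus_one) auto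
  also have "... = - (1 / real (Suc n))" by (simp add: field_simps)
  finally have "1 / real (Suc n) \<le> ln (real (Suc n)) - ln (real n)" using n by (simp add: ln_div)
  then show ?case using step by simp
qed simp

lemma sum_inverse_diff_le:
  fixes n N :: nat
  assumes "1 \<le> N" "A \<subseteq> {1..N}" "n \<in> {1..N}"
  shows "(\<Sum>m\<in>A - {n}. 1 / \<bar>real m - real n\<bar>) \<le> 2 * (1 + ln (real N))"
proof -
  have "(\<Sum>m\<in>A - {n}. 1 / \<bar>real m - real n\<bar>) \<le> (\<Sum>m\<in>{1..<n} \<union> {n<..N}. 1 / \<bar>real m - real n\<bar>)"
    using assms by (intro sum_mono2) auto
  also have "... = (\<Sum>m\<in>{1..<n}. 1 / \<bar>real m - real n\<bar>) + (\<Sum>m\<in>{n<..N}. 1 / \<bar>real m - real n\<bar>)"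
    by (intro sum.union_disjoint) auto
  also have "(\<Sum>m\<in>{1..<n}. 1 / \<bar>real m - real n\<bar>) = (\<Sum>k\<in>{1..<n}. 1 / real k)"
    by (rule sum.reindex_bij_witness[of _ "\<lambda>k. n - k" "\<lambda>m. n - m"]) (auto simp: of_nat_diff)
  also have "... \<le> (\<Sum>k=1..N. 1 / real k)" using assms by (intro sum_mono2) auto
  also have "(\<Sum>m\<in>{n<..N}. 1 / \<bar>real m - real n\<bar>) = (\<Sum>k\<in>{1..N - n}. 1 / real k)"
    by (rule sum.reindex_bij_witness[of _ "\<lambda>k. n + k" "\<lambda>m. m - n"]) (auto simp: of_nat_diff)
  also have "... \<le> (\<Sum>k=1..N. 1 / real k)" by (intro sum_mono2) auto
  finally show ?thesis using harmonic_sum_le[OF assms(1)] by (simp add: add_mono)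
qed

definition mvc :: "real \<Rightarrow> real \<Rightarrow> nat \<Rightarrow> real" where
  "mvc a b N = 1 + 4 * real N * (1 + ln (real N)) / (b - a)"

text \<open>Expand the square. The diagonal gives the 1 in \<open>mvc\<close>. Off the diagonal, the
  product of two coefficients is replaced by the mean of their squares, and each row is a harmonic
  sum by the spacing of the logarithms, which gives the logarithm in \<open>mvc\<close>.\<close>

lemma mean_value:
  fixes c :: "nat \<Rightarrow> complex"
  assumes ab: "a < b" and N: "1 \<le> N" and A: "A \<subseteq> {1..N}"
  shows "integral\<^sup>L (umeas a b) (\<lambda>t. (norm (\<Sum>n\<in>A. c n * cis (- t * ln (real n))))^2)
    \<le> mvc a b N * (\<Sum>n\<in>A. (norm (c n))^2)"
proof -
  interpret prob_space "umeas a b" by (rule prob_space_umeas[OF ab])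
  have fA: "finite A" using A by (rule finite_subset) simp
  define w where "w m n = ln (real n) - ln (real m)" for m n :: nat
  have sq: "complex_of_real ((norm (\<Sum>n\<in>A. c n * cis (- t * ln (real n))))^2) = (\<Sum>m\<in>A. \<Sum>n\<in>A. c m * cnj (c n) * cis (w m n * t))" for t
  proof -
    have "complex_of_real ((norm (\<Sum>n\<in>A. c n * cis (- t * ln (real n))))^2) = (\<Sum>n\<in>A. c n * cis (- t * ln (real n))) * cnj (\<Sum>n\<in>A. c n * cis (- t * ln (real n)))"
      by (rule complex_norm_square)
    also have "... = (\<Sum>m\<in>A. \<Sum>n\<in>A. (c m * cis (- t * ln (real m))) * (cnj (c n) * cnj (cis (- t * ln (real n)))))"
      by (simp only: cnj_sum complex_cnj_mult sum_product)
    also have "... = (\<Sum>m\<in>A. \<Sum>n\<in>A. c m * cnj (c n) * cis (w m n * t))"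
    proof (intro sum.cong refl)
      fix m n
      have "cis (- t * ln (real m)) * cnj (cis (- t * ln (real n))) = cis (w m n * t)"
        by (simp add: cis_cnj cis_mult w_def algebra_simps)
      then show "(c m * cis (- t * ln (real m))) * (cnj (c n) * cnj (cis (- t * ln (real n)))) = c m * cnj (c n) * cis (w m n * t)"
        by (simp only: mult_ac)
    qed
    finally show ?thesis .
  qed
  have int: "integrable (umeas a b) (\<lambda>t. cis (u * t))" for u
    by (intro integrable_const_bound[where B = 1]) auto
  define I where "I m n = integral\<^sup>L (umeas a b) (\<lambda>t. cis (w m n * t))" for m n
  have Id: "I n n = 1" for n using prob_space by (simp add: I_def w_def del: space_umeas)
  have Io: "norm (I m n) \<le> 2 * real N / (b - a) * (1 / \<bar>real m - real n\<bar>)" if mn: "m \<in> A" "n \<in> A" "m \<noteq> n" for m n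
  proof -
    have r: "1 \<le> m" "m \<le> N" "1 \<le> n" "n \<le> N" using mn A by auto
    have w: "\<bar>real m - real n\<bar> / real N \<le> \<bar>w m n\<bar>" unfolding w_def using r mn by (intro ln_diff_nat_ge) auto
    have p: "0 < \<bar>real m - real n\<bar> / real N" using mn N by auto
    then have w0: "0 < \<bar>w m n\<bar>" using w by linarith
    have "norm (I m n) \<le> 2 / ((b - a) * \<bar>w m n\<bar>)"
      unfolding I_def umeas_def using ab w0 by (intro norm_uniform_cis_le) auto
    also have "... \<le> 2 / ((b - a) * (\<bar>real m - real n\<bar> / real N))"
      using ab w p w0 by (intro divide_left_mono mult_left_mono mult_pos_pos) auto
    also have "... = 2 * real N / (b - a) * (1 / \<bar>real m - real n\<bar>)" by simp
    finally show ?thesis .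
  qed
  have row: "(\<Sum>n\<in>A. f m n) \<le> mvc a b N"
    if m: "m \<in> A" and f: "\<And>m. f m m = 1" "\<And>m n. m \<in> A \<Longrightarrow> n \<in> A \<Longrightarrow> m \<noteq> n \<Longrightarrow> f m n \<le> 2 * real N / (b - a) * (1 / \<bar>real n - real m\<bar>)" for f m
  proof -
    have "(\<Sum>n\<in>A. f m n) = f m m + (\<Sum>n\<in>A - {m}. f m n)" using fA m by (rule sum.remove)
    also have "(\<Sum>n\<in>A - {m}. f m n) \<le> (\<Sum>n\<in>A - {m}. 2 * real N / (b - a) * (1 / \<bar>real n - real m\<bar>))"
      using f(2)[OF m] by (intro sum_mono) auto
    also have "... = 2 * real N / (b - a) * (\<Sum>n\<in>A - {m}. 1 / \<bar>real n - real m\<bar>)" by (simp add: sum_distrib_left)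
    also have "... \<le> 2 * real N / (b - a) * (2 * (1 + ln (real N)))"
      using m A N ab by (intro mult_left_mono sum_inverse_diff_le) auto
    finally show ?thesis by (simp add: f(1) mvc_def mult_ac)
  qed
  have eq: "complex_of_real (integral\<^sup>L (umeas a b) (\<lambda>t. (norm (\<Sum>n\<in>A. c n * cis (- t * ln (real n))))^2)) = (\<Sum>m\<in>A. \<Sum>n\<in>A. c m * cnj (c n) * I m n)"
    unfolding integral_complex_of_real[symmetric] sq I_def using int by simp
  have "integral\<^sup>L (umeas a b) (\<lambda>t. (norm (\<Sum>n\<in>A. c n * cis (- t * ln (real n))))^2) \<le> norm (\<Sum>m\<in>A. \<Sum>n\<in>A. c m * cnj (c n) * I m n)"
    using abs_ge_self[of "integral\<^sup>L (umeas a b) (\<lambda>t. (norm (\<Sum>n\<in>A. c n * cis (- t * ln (real n))))^2)"] by (simp only: norm_of_real flip: eq)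
  also have "... \<le> (\<Sum>m\<in>A. \<Sum>n\<in>A. norm (c m) * norm (c n) * norm (I m n))"
    by (intro order_trans[OF norm_sum] sum_mono) (simp add: norm_mult)
  also have "... \<le> (\<Sum>m\<in>A. \<Sum>n\<in>A. ((norm (c m))^2 / 2 + (norm (c n))^2 / 2) * norm (I m n))"
  proof (intro sum_mono mult_right_mono)
    fix m n
    show "norm (c m) * norm (c n) \<le> (norm (c m))^2 / 2 + (norm (c n))^2 / 2"
      using sum_squares_bound[of "norm (c m)" "norm (c n)"] by simp
  qed simp
  also have "... = (\<Sum>m\<in>A. \<Sum>n\<in>A. (norm (c m))^2 / 2 * norm (I m n)) + (\<Sum>m\<in>A. \<Sum>n\<in>A. (norm (c n))^2 / 2 * norm (I m n))"
    by (simp add: distrib_right sum.distrib)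
  also have "(\<Sum>m\<in>A. \<Sum>n\<in>A. (norm (c m))^2 / 2 * norm (I m n)) \<le> (\<Sum>m\<in>A. (norm (c m))^2 / 2 * mvc a b N)"
    unfolding sum_distrib_left[symmetric]
    by (intro sum_mono mult_left_mono row[of _ "\<lambda>m n. norm (I m n)"]) (use Io Id in \<open>simp_all add: abs_minus_commute\<close>)
  also have "(\<Sum>m\<in>A. \<Sum>n\<in>A. (norm (c n))^2 / 2 * norm (I m n)) \<le> (\<Sum>n\<in>A. (norm (c n))^2 / 2 * mvc a b N)"
  proof (subst sum.swap, unfold sum_distrib_left[symmetric])
    show "(\<Sum>n\<in>A. (norm (c n))^2 / 2 * (\<Sum>m\<in>A. norm (I m n))) \<le> (\<Sum>n\<in>A. (norm (c n))^2 / 2 * mvc a b N)"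
      by (intro sum_mono mult_left_mono row[of _ "\<lambda>n m. norm (I m n)"]) (use Io Id in simp_all)
  qed
  finally show ?thesis by (simp add: sum_distrib_left sum_distrib_right sum.distrib[symmetric] mult_ac)
qed

definition dpoly :: "nat set \<Rightarrow> (nat \<Rightarrow> complex) \<Rightarrow> complex \<Rightarrow> complex" where
  "dpoly A c s = (\<Sum>n\<in>A. c n * of_nat n powr (- s))"

lemma nat_powr_split: "0 < n \<Longrightarrow> (of_nat n :: complex) powr (- Complex x t) = of_real (real n powr (- x)) * cis (- t * ln (real n))"
  by (simp add: powr_def Ln_of_nat Complex_eq cis_conv_exp exp_add[symmetric] algebra_simps flip: exp_of_real)

lemma mean_value_line:
  assumes ab: "a < b" and N: "1 \<le> N" and A: "A \<subseteq> {1..N}"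
  shows "integral\<^sup>L (umeas a b) (\<lambda>t. (norm (dpoly A c (Complex x t)))^2)
    \<le> mvc a b N * (\<Sum>n\<in>A. (norm (c n))^2 * real n powr (- 2 * x))"
proof -
  have "dpoly A c (Complex x t) = (\<Sum>n\<in>A. (c n * of_real (real n powr (- x))) * cis (- t * ln (real n)))" for t
    unfolding dpoly_def using A by (intro sum.cong refl) (auto simp: nat_powr_split Suc_le_eq subset_eq)
  then have "integral\<^sup>L (umeas a b) (\<lambda>t. (norm (dpoly A c (Complex x t)))^2)
    \<le> mvc a b N * (\<Sum>n\<in>A. (norm (c n * of_real (real n powr (- x))))^2)"
    using mean_value[OF assms, of "\<lambda>n. c n * of_real (real n powr (- x))"] by simp
  also have "(\<Sum>n\<in>A. (norm (c n * of_real (real n powr (- x))))^2) = (\<Sum>n\<in>A. (norm (c n))^2 * real n powr (- 2 * x))"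
    using A by (intro sum.cong refl) (auto simp: norm_mult power_mult_distrib powr_power subset_eq mult.commute)
  finally show ?thesis .
qed

text \<open>A supremum over \<open>x\<close> is controlled by the value at \<open>x = 2\<close> and the mean square of the
  derivative, and both are Dirichlet polynomials.\<close>

lemma exceptional_set:
  assumes ab: "a < b" and N: "1 \<le> N" and A: "A \<subseteq> {1..N}" and \<sigma>: "0 < \<sigma>" "\<sigma> < 2" and d: "0 < d"
  shows "\<exists>E\<in>sets borel. measure (umeas a b) E \<le> mvc a b N * (10 * (\<Sum>n\<in>A. (norm (c n))^2 * (1 + (ln (real n))^2) * real n powr (- 2 * \<sigma>))) / d^2
    \<and> (\<forall>t x. t \<notin> E \<longrightarrow> \<sigma> \<le> x \<longrightarrow> x \<le> 2 \<longrightarrow> norm (dpoly A c (Complex x t)) \<le> d)"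
proof -
  interpret U: prob_space "umeas a b" by (rule prob_space_umeas[OF ab])
  interpret V: prob_space "umeas \<sigma> 2" by (rule prob_space_umeas[OF \<sigma>(2)])
  interpret UV: pair_prob_space "umeas \<sigma> 2" "umeas a b" ..
  have fA: "finite A" using A by (rule finite_subset) simp
  have A0: "0 < n" if "n \<in> A" for n using A that by auto
  define c' where "c' n = - (of_real (ln (real n)) * c n)" for n
  define F where "F x t = dpoly A c (Complex x t)" for x t
  define F' where "F' x t = dpoly A c' (Complex x t)" for x t
  have Fe: "F x t = (\<Sum>n\<in>A. c n * (of_real (real n powr (- x)) * cis (- t * ln (real n))))" for x t
    unfolding F_def dpoly_def using A0 by (intro sum.cong refl) (simp add: nat_powr_split)
  have F'e: "F' x t = (\<Sum>n\<in>A. c' n * (of_real (real n powr (- x)) * cis (- t * ln (real n))))" for x t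
    unfolding F'_def dpoly_def using A0 by (intro sum.cong refl) (simp add: nat_powr_split)
  have [measurable]: "(\<lambda>t. F x t) \<in> borel_measurable borel" for x unfolding Fe by measurable
  have m2: "(\<lambda>p. F' (fst p) (snd p)) \<in> borel_measurable (umeas \<sigma> 2 \<Otimes>\<^sub>M umeas a b)"
    unfolding F'e by measurable
  have [measurable]: "(\<lambda>x. F' x t) \<in> borel_measurable borel" for t unfolding F'e by measurable
  have [measurable]: "(\<lambda>t. F' x t) \<in> borel_measurable borel" for x unfolding F'e by measurable
  define B where "B = (\<Sum>n\<in>A. norm (c' n))"
  define Bx where "Bx x = (\<Sum>n\<in>A. norm (c' n) * real n powr (- x))" for x
  have der: "((\<lambda>x. F x t) has_vector_derivative F' x t) (at x within S)" for x t S
  proof -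
    have "((\<lambda>s. dpoly A c (s + \<i> * of_real t)) has_field_derivative dpoly A c' (of_real x + \<i> * of_real t)) (at (of_real x))"
      unfolding dpoly_def c'_def
    proof (rule DERIV_sum)
      fix n assume "n \<in> A"
      then have n: "0 < n" by (rule A0)
      have "((\<lambda>s. c n * of_nat n powr (- (s + \<i> * of_real t))) has_field_derivative c n * (- (of_nat n powr (- (of_real x + \<i> * of_real t))) * Ln (of_nat n))) (at (of_real x))"
        using n unfolding powr_def by (auto intro!: derivative_eq_intros simp: algebra_simps)
      then show "((\<lambda>s. c n * of_nat n powr (- (s + \<i> * of_real t))) has_field_derivative - (of_real (ln (real n)) * c n) * of_nat n powr (- (of_real x + \<i> * of_real t))) (at (of_real x))"
        using n by (simp add: Ln_of_nat mult_ac)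
    qed
    from has_vector_derivative_real_field[OF this, of S] show ?thesis
      by (simp add: F_def F'_def Complex_eq)
  qed
  have cF': "continuous_on S (\<lambda>x. F' x t)" for t S
    unfolding F'e using A0 by (intro continuous_intros) auto
  define Q where "Q t = integral\<^sup>L (umeas \<sigma> 2) (\<lambda>x. (norm (F' x t))^2)" for t
  have bdF': "norm (F' x t) \<le> B" if "0 \<le> x" for x t
    unfolding F'e B_def
  proof (intro sum_norm_le)
    fix n assume "n \<in> A"
    then have "real n powr (- x) \<le> real n powr 0" using A0[of n] that by (intro powr_mono) auto
    then show "norm (c' n * (of_real (real n powr (- x)) * cis (- t * ln (real n)))) \<le> norm (c' n)"
      using A0[OF \<open>n \<in> A\<close>] by (simp add: norm_mult mult_left_le)
  qed
  have aeV: "AE x in umeas \<sigma> 2. 0 \<le> x"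
    unfolding umeas_def using \<sigma> by (intro AE_uniform_measureI) auto
  have intV: "integrable (umeas \<sigma> 2) (\<lambda>x. (norm (F' x t))^2)" for t
  proof (rule V.integrable_const_bound[where B = "B^2"])
    show "AE x in umeas \<sigma> 2. norm ((norm (F' x t))^2) \<le> B^2"
      using aeV by eventually_elim (auto intro!: power_mono bdF')
  qed measurable
  have intV1: "integrable (umeas \<sigma> 2) (\<lambda>x. norm (F' x t))" for t
  proof (rule V.integrable_const_bound[where B = B])
    show "AE x in umeas \<sigma> 2. norm (norm (F' x t)) \<le> B"
      using aeV by eventually_elim (auto intro!: bdF')
  qed measurable
  have diff: "norm (F x t - F 2 t) \<le> 2 * sqrt (Q t)" if x: "\<sigma> \<le> x" "x \<le> 2" for x t
  proof -
    have "(\<integral>y. indicator {x..2} y *\<^sub>R F' y t \<partial>lborel) = F 2 t - F x t"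
      using x by (intro integral_FTC_Icc der cF')
    then have "norm (F x t - F 2 t) = norm (\<integral>y. indicator {x..2} y *\<^sub>R F' y t \<partial>lborel)" by (simp add: norm_minus_commute)
    also have "... \<le> (\<integral>y. indicator {\<sigma>..2} y *\<^sub>R norm (F' y t) \<partial>lborel)"
    proof (rule norm_integral_le)
      show "integrable lborel (\<lambda>y. indicator {x..2} y *\<^sub>R F' y t)"
        by (rule borel_integrable_compact[OF _ cF']) simp
      show "integrable lborel (\<lambda>y. indicator {\<sigma>..2} y *\<^sub>R norm (F' y t))"
        by (rule borel_integrable_compact) (auto intro!: continuous_intros cF')
    qed (use x in \<open>auto simp: indicator_def\<close>)
    also have "... = (2 - \<sigma>) * integral\<^sup>L (umeas \<sigma> 2) (\<lambda>y. norm (F' y t))"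
      unfolding umeas_def using \<sigma> by (subst integral_uniform_interval) auto
    also have "... \<le> 2 * sqrt (Q t)"
    proof (intro mult_mono)
      \<comment> \<open>Cauchy-Schwarz, in the form that a variance is nonnegative.\<close>
      have "0 \<le> V.variance (\<lambda>y. norm (F' y t))" by (rule V.variance_positive)
      also have "... = Q t - (integral\<^sup>L (umeas \<sigma> 2) (\<lambda>y. norm (F' y t)))\<^sup>2"
        unfolding Q_def by (rule V.variance_eq[OF intV1 intV])
      finally show "integral\<^sup>L (umeas \<sigma> 2) (\<lambda>y. norm (F' y t)) \<le> sqrt (Q t)" by (intro real_le_rsqrt) simp
    qed (use \<sigma> in \<open>auto intro!: Bochner_Integration.integral_nonneg\<close>)
    finally show ?thesis .
  qed
  \<comment> \<open>From \<open>(a + b)^2 \<le> 2 * a^2 + 2 * b^2\<close> with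
    \<open>b = 2 * sqrt (Q t)\<close>; the weights 2 and 8 add up to the factor 10 of the
    statement.\<close>
  define G where "G t = 2 * (norm (F 2 t))^2 + 8 * Q t" for t
  have Q0: "0 \<le> Q t" for t unfolding Q_def by (intro Bochner_Integration.integral_nonneg) auto
  have FG: "(norm (F x t))^2 \<le> G t" if x: "\<sigma> \<le> x" "x \<le> 2" for x t
  proof -
    have "norm (F x t) \<le> norm (F 2 t) + 2 * sqrt (Q t)"
      using norm_triangle_sub[of "F x t" "F 2 t"] diff[OF x, of t] by linarith
    then have "(norm (F x t))^2 \<le> (norm (F 2 t) + 2 * sqrt (Q t))^2" by (intro power_mono) auto
    also have "... \<le> 2 * (norm (F 2 t))^2 + 2 * (2 * sqrt (Q t))^2"
      using sum_squares_bound[of "norm (F 2 t)" "2 * sqrt (Q t)"] by (simp add: power2_sum)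
    also have "... = G t" using Q0[of t] by (simp add: G_def power_mult_distrib)
    finally show ?thesis .
  qed
  have intP: "integrable (umeas \<sigma> 2 \<Otimes>\<^sub>M umeas a b) (\<lambda>p. (norm (F' (fst p) (snd p)))^2)"
  proof (rule UV.integrable_const_bound[where B = "B^2"])
    show "(\<lambda>p. (norm (F' (fst p) (snd p)))^2) \<in> borel_measurable (umeas \<sigma> 2 \<Otimes>\<^sub>M umeas a b)" using m2 by measurable
    have "AE p in umeas \<sigma> 2 \<Otimes>\<^sub>M umeas a b. 0 \<le> fst p"
    proof -
      have "AE x in umeas \<sigma> 2. AE t in umeas a b. 0 \<le> fst (x, t)" using aeV by eventually_elim simp
      moreover have "{p \<in> space (umeas \<sigma> 2 \<Otimes>\<^sub>M umeas a b). 0 \<le> fst p} \<in> sets (umeas \<sigma> 2 \<Otimes>\<^sub>M umeas a b)" by measurable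
      ultimately show ?thesis by (intro UV.AE_pair_measure) auto
    qed
    then show "AE p in umeas \<sigma> 2 \<Otimes>\<^sub>M umeas a b. norm ((norm (F' (fst p) (snd p)))^2) \<le> B^2"
      by eventually_elim (auto intro!: power_mono bdF')
  qed
  have intP': "integrable (umeas \<sigma> 2 \<Otimes>\<^sub>M umeas a b) (\<lambda>(x, t). (norm (F' x t))^2)" using intP by (simp add: case_prod_unfold)
  have Qm: "Q \<in> borel_measurable (umeas a b)" "integrable (umeas a b) Q"
    using UV.integrable_snd[OF intP'] unfolding Q_def[abs_def] by (auto dest: borel_measurable_integrable)
  have QF: "integral\<^sup>L (umeas a b) Q = integral\<^sup>L (umeas \<sigma> 2) (\<lambda>x. integral\<^sup>L (umeas a b) (\<lambda>t. (norm (F' x t))^2))"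
    unfolding Q_def[abs_def] by (rule UV.Fubini_integral[OF intP'])
  \<comment> \<open>The summand 1 serves the polynomial at real part 2, and the squared logarithm
    serves its derivative.\<close>
  let ?S = "\<Sum>n\<in>A. (norm (c n))^2 * (1 + (ln (real n))^2) * real n powr (- 2 * \<sigma>)"
  have mv0: "0 \<le> mvc a b N" using ab N by (simp add: mvc_def)
  have EQ: "integral\<^sup>L (umeas a b) Q \<le> mvc a b N * ?S"
  proof -
    have "integral\<^sup>L (umeas a b) Q \<le> integral\<^sup>L (umeas \<sigma> 2) (\<lambda>_. mvc a b N * ?S)"
      unfolding QF
    proof (rule integral_mono_AE)
      show "integrable (umeas \<sigma> 2) (\<lambda>x. integral\<^sup>L (umeas a b) (\<lambda>t. (norm (F' x t))^2))"
        using UV.integrable_fst[OF intP'] by simp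
      have "AE x in umeas \<sigma> 2. \<sigma> \<le> x" unfolding umeas_def by (intro AE_uniform_measureI) auto
      then show "AE x in umeas \<sigma> 2. integral\<^sup>L (umeas a b) (\<lambda>t. (norm (F' x t))^2) \<le> mvc a b N * ?S"
      proof eventually_elim
        case (elim x)
        have "integral\<^sup>L (umeas a b) (\<lambda>t. (norm (F' x t))^2) \<le> mvc a b N * (\<Sum>n\<in>A. (norm (c' n))^2 * real n powr (- 2 * x))"
          unfolding F'_def by (rule mean_value_line[OF ab N A])
        also have "... \<le> mvc a b N * ?S"
        proof (intro mult_left_mono sum_mono mv0)
          fix n assume n: "n \<in> A"
          have "(norm (c' n))^2 \<le> (norm (c n))^2 * (1 + (ln (real n))^2)"
            by (simp add: c'_def norm_mult power_mult_distrib algebra_simps)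
          moreover have "real n powr (- 2 * x) \<le> real n powr (- 2 * \<sigma>)" using elim A0[OF n] by (intro powr_mono) auto
          ultimately show "(norm (c' n))^2 * real n powr (- 2 * x) \<le> (norm (c n))^2 * (1 + (ln (real n))^2) * real n powr (- 2 * \<sigma>)"
            by (intro mult_mono) auto
        qed
        finally show ?case .
      qed
    qed simp
    then show ?thesis using V.prob_space by simp
  qed
  have E2: "integral\<^sup>L (umeas a b) (\<lambda>t. (norm (F 2 t))^2) \<le> mvc a b N * ?S"
  proof -
    have "integral\<^sup>L (umeas a b) (\<lambda>t. (norm (F 2 t))^2) \<le> mvc a b N * (\<Sum>n\<in>A. (norm (c n))^2 * real n powr (- 2 * 2))"
      unfolding F_def by (rule mean_value_line[OF ab N A])
    also have "... \<le> mvc a b N * ?S"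
    proof (intro mult_left_mono sum_mono mv0)
      fix n assume n: "n \<in> A"
      have "(norm (c n))^2 * 1 \<le> (norm (c n))^2 * (1 + (ln (real n))^2)" by (intro mult_left_mono) auto
      moreover have "real n powr (- 2 * 2) \<le> real n powr (- 2 * \<sigma>)" using \<sigma> A0[OF n] by (intro powr_mono) auto
      ultimately show "(norm (c n))^2 * real n powr (- 2 * 2) \<le> (norm (c n))^2 * (1 + (ln (real n))^2) * real n powr (- 2 * \<sigma>)"
        by (intro mult_mono) auto
    qed
    finally show ?thesis .
  qed
  have intF: "integrable (umeas a b) (\<lambda>t. (norm (F 2 t))^2)"
  proof (rule U.integrable_const_bound[where B = "(\<Sum>n\<in>A. norm (c n))^2"])
    have "norm (F 2 t) \<le> (\<Sum>n\<in>A. norm (c n))" for t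
      unfolding Fe
    proof (intro sum_norm_le)
      fix n assume "n \<in> A"
      then have "real n powr (- 2) \<le> real n powr 0" using A0[of n] by (intro powr_mono) auto
      then show "norm (c n * (of_real (real n powr (- 2)) * cis (- t * ln (real n)))) \<le> norm (c n)"
        using A0[OF \<open>n \<in> A\<close>] by (simp add: norm_mult mult_left_le)
    qed
    then show "AE t in umeas a b. norm ((norm (F 2 t))^2) \<le> (\<Sum>n\<in>A. norm (c n))^2"
      by (intro AE_I2) (auto intro!: power_mono)
  qed measurable
  have intG: "integrable (umeas a b) G" unfolding G_def[abs_def] using intF Qm by auto
  have EG: "integral\<^sup>L (umeas a b) G \<le> mvc a b N * (10 * ?S)"
    unfolding G_def[abs_def] using intF Qm EQ E2 by simp
  have Gm: "G \<in> borel_measurable borel" using borel_measurable_integrable[OF intG] by simp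
  define E where "E = {t. d^2 \<le> G t}"
  have Em: "E \<in> sets borel" unfolding E_def using Gm by measurable
  have "measure (umeas a b) {t \<in> space (umeas a b). d^2 \<le> G t} \<le> integral\<^sup>L (umeas a b) G / d^2"
    using d Q0 by (intro integral_Markov_inequality_measure[where A = "{}"] intG) (auto simp: G_def)
  also have "... \<le> mvc a b N * (10 * ?S) / d^2" using EG by (intro divide_right_mono) auto
  finally have "measure (umeas a b) E \<le> mvc a b N * (10 * ?S) / d^2" by (simp add: E_def)
  moreover have "norm (dpoly A c (Complex x t)) \<le> d" if "t \<notin> E" "\<sigma> \<le> x" "x \<le> 2" for t x
  proof -
    have "(norm (F x t))^2 \<le> d^2" using FG[OF that(2,3), of t] that(1) by (simp add: E_def)
    then show ?thesis using d unfolding F_def by (simp add: power2_le_iff_abs_le)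
  qed
  ultimately show ?thesis using Em by blast
qed

section \<open>The mollifier and its coefficients\<close>

text \<open>Primes above \<open>2 powr (1 / \<epsilon>)\<close> satisfy
  \<open>2 \<le> p powr \<epsilon>\<close>; the smaller ones contribute a bounded factor.\<close>

lemma omega_bound:
  assumes "0 < \<epsilon>"
  obtains C where "1 \<le> C" "\<And>m :: nat. 0 < m \<Longrightarrow> 2 ^ card (prime_factors m) \<le> C * real m powr \<epsilon>"
proof -
  define B where "B = nat \<lceil>2 powr (1 / \<epsilon>)\<rceil>"
  have big: "2 \<le> real p powr \<epsilon>" if "B < p" for p
  proof -
    have "2 powr (1 / \<epsilon>) \<le> real p" using that unfolding B_def by linarith
    then have "(2 powr (1 / \<epsilon>)) powr \<epsilon> \<le> real p powr \<epsilon>" using assms by (intro powr_mono2) auto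
    then show ?thesis using assms by (simp add: powr_powr)
  qed
  have "2 ^ card (prime_factors m) \<le> 2 ^ B * real m powr \<epsilon>" if m: "0 < m" for m :: nat
  proof -
    let ?F = "prime_factors m"
    have "(2::real) ^ card ?F = 2 ^ (card (?F \<inter> {..B}) + card (?F - {..B}))"
      by (subst card_Int_Diff[of ?F "{..B}"]) auto
    also have "... = 2 ^ card (?F \<inter> {..B}) * (\<Prod>p\<in>?F - {..B}. 2)" by (simp add: power_add)
    also have "... \<le> 2 ^ B * (\<Prod>p\<in>?F. real p powr \<epsilon>)"
    proof (intro mult_mono)
      have "?F \<inter> {..B} \<subseteq> {1..B}" by (auto dest!: prime_gt_0_nat simp: in_prime_factors_iff)
      from card_mono[OF _ this] have "card (?F \<inter> {..B}) \<le> B" by simp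
      then show "(2::real) ^ card (?F \<inter> {..B}) \<le> 2 ^ B" by (intro power_increasing) auto
      have "(\<Prod>p\<in>?F - {..B}. 2::real) \<le> (\<Prod>p\<in>?F - {..B}. real p powr \<epsilon>)" by (intro prod_mono) (auto intro!: big)
      also have "... \<le> (\<Prod>p\<in>?F. real p powr \<epsilon>)"
        using assms by (intro prod_mono2) (auto intro!: ge_one_powr_ge_zero dest: prime_gt_0_nat simp: in_prime_factors_iff Suc_le_eq)
      finally show "(\<Prod>p\<in>?F - {..B}. 2::real) \<le> (\<Prod>p\<in>?F. real p powr \<epsilon>)" .
    qed (auto intro!: prod_nonneg)
    also have "(\<Prod>p\<in>?F. real p powr \<epsilon>) = (\<Prod>p\<in>?F. real p) powr \<epsilon>" by (simp add: prod_powr_distrib)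
    also have "... \<le> real m powr \<epsilon>"
    proof (intro powr_mono2)
      have "(\<Prod>p\<in>?F. p) \<le> (\<Prod>p\<in>?F. p ^ multiplicity p m)"
      proof (intro prod_mono)
        fix p assume "p \<in> ?F"
        then have "1 < p" "0 < multiplicity p m" by (auto simp: prime_factors_multiplicity dest: prime_gt_1_nat)
        then show "0 \<le> p \<and> p \<le> p ^ multiplicity p m" by (simp add: self_le_power)
      qed
      also have "... = m" using m by (rule prime_factorization_nat[symmetric])
      finally have "real (\<Prod>p\<in>?F. p) \<le> real m" by (rule of_nat_mono)
      then show "(\<Prod>p\<in>?F. real p) \<le> real m" by simp
    qed (use assms in \<open>auto intro!: prod_nonneg\<close>)
    finally show ?thesis by simp
  qed
  then show ?thesis by (intro that[of "2 ^ B"]) auto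
qed

lemma sum_alternating_Pow:
  fixes F :: "'b set"
  assumes "finite F" "F \<noteq> {}"
  shows "(\<Sum>S\<in>Pow F. (- 1 :: complex) ^ card S) = 0"
proof -
  have "(\<Prod>x\<in>F. (- 1 :: complex) + 1) = (\<Sum>S\<in>Pow F. (\<Prod>x\<in>S. - 1) * (\<Prod>x\<in>F - S. 1))"
    by (rule prod_add[OF assms(1)])
  then show ?thesis using assms by (simp add: zero_power card_gt_0_iff)
qed

definition moll_sets :: "nat set \<Rightarrow> nat \<Rightarrow> nat set set" where
  "moll_sets P k = {S. S \<subseteq> P \<and> card S \<le> k}"

text \<open>The Euler product over \<open>P\<close> restricted to squarefree integers with at most
  \<open>k\<close> prime factors, each represented by its set of primes. The full product has a
  length that grows exponentially in \<open>Y\<close>, far beyond any power of \<open>T\<close>; the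
  restricted one has length at most \<open>Y ^ k\<close>.\<close>

definition moll :: "nat set \<Rightarrow> nat \<Rightarrow> complex \<Rightarrow> complex" where
  "moll P k s = (\<Sum>S\<in>moll_sets P k. (- 1) ^ card S * (\<Prod>p\<in>S. of_nat p powr (- s)))"

text \<open>The coefficient of \<open>m powr - s\<close> in the product of the truncated zeta sum
  with \<open>moll\<close>, as a signed count of pairs.\<close>

definition mcoef :: "nat set \<Rightarrow> nat \<Rightarrow> nat \<Rightarrow> nat \<Rightarrow> complex" where
  "mcoef P k N m = (\<Sum>x\<in>{x \<in> moll_sets P k \<times> {1..<N}. snd x * \<Prod>(fst x) = m}. (- 1) ^ card (fst x))"

lemma finite_moll_sets: "finite P \<Longrightarrow> finite (moll_sets P k)"
  by (rule finite_subset[of _ "Pow P"]) (auto simp: moll_sets_def)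

lemma of_nat_mult_powr: "0 < m \<Longrightarrow> 0 < n \<Longrightarrow> (of_nat (m * n) :: complex) powr z = of_nat m powr z * of_nat n powr z"
  by (simp add: powr_def Ln_of_nat ln_mult exp_add[symmetric] distrib_left del: of_nat_mult) (simp add: ln_mult distrib_left)

lemma of_nat_prod_powr:
  assumes "finite S" "\<And>p. p \<in> S \<Longrightarrow> 0 < p"
  shows "(of_nat (\<Prod>S) :: complex) powr z = (\<Prod>p\<in>S. of_nat p powr z)"
  using assms
proof (induction S rule: finite_induct)
  case (insert x S)
  then show ?case by (simp add: of_nat_mult_powr prod_pos del: of_nat_mult)
qed simp

lemma mollified_dpoly:
  assumes P: "finite P" "\<And>p. p \<in> P \<Longrightarrow> prime p" "\<And>p. p \<in> P \<Longrightarrow> p \<le> Y" and Y: "1 \<le> Y"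
  shows "(\<Sum>n=1..<N. of_nat n powr (- s)) * moll P k s = dpoly {1..N * Y ^ k} (mcoef P k N) s"
proof -
  let ?I = "moll_sets P k \<times> {1..<N}"
  have fS: "finite S" "\<And>p. p \<in> S \<Longrightarrow> 0 < p" if "S \<in> moll_sets P k" for S
    using that P prime_gt_0_nat by (auto simp: moll_sets_def intro: finite_subset)
  have "(\<Sum>n=1..<N. of_nat n powr (- s)) * moll P k s = (\<Sum>S\<in>moll_sets P k. \<Sum>n=1..<N. (- 1) ^ card S * of_nat (n * \<Prod>S) powr (- s))"
    unfolding moll_def sum_product
  proof (subst sum.swap, intro sum.cong refl)
    fix S n assume S: "S \<in> moll_sets P k" and n: "n \<in> {1..<N}"
    have "of_nat (n * \<Prod>S) powr (- s) = of_nat n powr (- s) * of_nat (\<Prod>S) powr (- s)"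
      using n fS[OF S] by (intro of_nat_mult_powr prod_pos) auto
    then show "of_nat n powr (- s) * ((- 1) ^ card S * (\<Prod>p\<in>S. of_nat p powr (- s))) = (- 1) ^ card S * of_nat (n * \<Prod>S) powr (- s)"
      using of_nat_prod_powr[of S "- s"] fS[OF S] by simp
  qed
  also have "... = (\<Sum>x\<in>?I. (- 1) ^ card (fst x) * of_nat (snd x * \<Prod>(fst x)) powr (- s))"
    by (simp add: sum.cartesian_product case_prod_unfold)
  also have "... = (\<Sum>m\<in>{1..N * Y ^ k}. \<Sum>x\<in>{x \<in> ?I. snd x * \<Prod>(fst x) = m}. (- 1) ^ card (fst x) * of_nat (snd x * \<Prod>(fst x)) powr (- s))"
  proof (rule sum.group[symmetric])
    show "finite ?I" using finite_moll_sets[OF P(1)] by simp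
    show "(\<lambda>x. snd x * \<Prod>(fst x)) ` ?I \<subseteq> {1..N * Y ^ k}"
    proof (rule image_subsetI)
      fix x assume x: "x \<in> ?I"
      define S n where "S = fst x" and "n = snd x"
      have S: "S \<in> moll_sets P k" and n: "1 \<le> n" "n < N" using x by (auto simp: S_def n_def)
      have "\<Prod>S \<le> (\<Prod>p\<in>S. Y)" using S P by (intro prod_mono) (auto simp: moll_sets_def)
      also have "... \<le> Y ^ k" using S Y by (auto simp: moll_sets_def intro!: power_increasing)
      finally have "n * \<Prod>S \<le> N * Y ^ k" using n by (intro mult_mono) auto
      moreover have "0 < \<Prod>S" using fS[OF S] by (intro prod_pos) auto
      ultimately show "snd x * \<Prod>(fst x) \<in> {1..N * Y ^ k}" using n unfolding S_def n_def by (simp add: Suc_le_eq)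
    qed
  qed simp
  also have "... = dpoly {1..N * Y ^ k} (mcoef P k N) s"
    unfolding dpoly_def mcoef_def sum_distrib_right by (intro sum.cong refl) auto
  finally show ?thesis .
qed

lemma prime_mem_prime_factors_of_prod:
  fixes S :: "nat set"
  assumes "finite S" "\<And>p. p \<in> S \<Longrightarrow> prime p" "n * \<Prod>S = m" "0 < m"
  shows "S \<subseteq> prime_factors m"
proof
  fix p assume p: "p \<in> S"
  then have "p dvd \<Prod>S" using assms(1) by (simp add: dvd_prodI[where f = "\<lambda>x. x", simplified])
  then have "p dvd m" using assms(3) by (metis dvd_triv_right dvd_trans)
  then show "p \<in> prime_factors m" using p assms by (auto simp: in_prime_factors_iff)
qed

text \<open>A pair is determined by its set of primes, which is a subset of the prime factors of
  \<open>m\<close>.\<close>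

lemma norm_mcoef_le:
  assumes P: "finite P" "\<And>p. p \<in> P \<Longrightarrow> prime p" and m: "0 < m"
  shows "norm (mcoef P k N m) \<le> 2 ^ card (prime_factors m)"
proof -
  let ?A = "{x \<in> moll_sets P k \<times> {1..<N}. snd x * \<Prod>(fst x) = m}"
  have inj: "inj_on fst ?A"
  proof (rule inj_onI)
    fix x y assume "x \<in> ?A" "y \<in> ?A" and e: "fst x = fst y"
    then have "snd x * \<Prod>(fst x) = m" "snd y * \<Prod>(fst x) = m" by auto
    then have "snd x = snd y" using m by (metis mult_cancel2 mult_is_0 less_not_refl)
    then show "x = y" using e by (simp add: prod_eq_iff)
  qed
  have sub: "fst ` ?A \<subseteq> Pow (prime_factors m)"
  proof (rule image_subsetI)
    fix x assume x: "x \<in> ?A"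
    then have "fst x \<subseteq> P" by (auto simp: moll_sets_def)
    then have "fst x \<subseteq> prime_factors m"
      using x P m finite_subset[OF _ P(1)] by (intro prime_mem_prime_factors_of_prod[of "fst x" "snd x"]) auto
    then show "fst x \<in> Pow (prime_factors m)" by simp
  qed
  have "norm (mcoef P k N m) \<le> (\<Sum>x\<in>?A. 1)"
    unfolding mcoef_def by (intro sum_norm_le) (simp add: norm_power)
  also have "... = real (card (fst ` ?A))" using inj by (simp add: card_image)
  also have "... \<le> real (card (Pow (prime_factors m)))" using sub by (intro of_nat_mono card_mono) auto
  finally show ?thesis by (simp add: card_Pow)
qed

lemma mcoef_1:
  assumes P: "finite P" "\<And>p. p \<in> P \<Longrightarrow> prime p" and N: "1 < N"
  shows "mcoef P k N 1 = 1"
proof -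
  have "{x \<in> moll_sets P k \<times> {1..<N}. snd x * \<Prod>(fst x) = 1} = {({}, 1)}"
  proof (intro equalityI subsetI)
    fix x assume x: "x \<in> {x \<in> moll_sets P k \<times> {1..<N}. snd x * \<Prod>(fst x) = 1}"
    then have "fst x \<subseteq> prime_factors 1"
      using P by (intro prime_mem_prime_factors_of_prod[of "fst x" "snd x"]) (auto simp: moll_sets_def finite_subset[OF _ P(1)])
    then show "x \<in> {({}, 1)}" using x by (auto simp: prod_eq_iff)
  qed (use N in \<open>auto simp: moll_sets_def\<close>)
  then show ?thesis by (simp add: mcoef_def)
qed

lemma two_power_card_prime_factors_le:
  assumes "0 < (m::nat)"
  shows "2 ^ card (prime_factors m) \<le> m"
proof -
  have "2 ^ card (prime_factors m) = (\<Prod>p\<in>prime_factors m. 2::nat)" by simp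
  also have "... \<le> (\<Prod>p\<in>prime_factors m. p ^ multiplicity p m)"
  proof (intro prod_mono)
    fix p assume "p \<in> prime_factors m"
    then have "2 \<le> p" "0 < multiplicity p m" by (auto simp: prime_factors_multiplicity dest: prime_ge_2_nat)
    then show "0 \<le> (2::nat) \<and> 2 \<le> p ^ multiplicity p m" using self_le_power[of p "multiplicity p m"] by simp
  qed
  also have "... = m" using assms by (rule prime_factorization_nat[symmetric])
  finally show ?thesis .
qed

text \<open>The product of zeta and mollifier has no terms between 1 and \<open>Y\<close>. Such an
  \<open>m\<close> has all its prime factors in \<open>P\<close>, and at most \<open>k\<close> of
  them because \<open>2\<close> to their number is at most \<open>m < 2 ^ Suc k\<close>. Hence
  neither truncation is felt, and the alternating sum over all subsets vanishes.\<close>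

lemma mcoef_small:
  assumes P: "P = primes_in 0 (real Y)" and m: "1 < m" "m \<le> Y" and N: "Y < N" and k: "Y < 2 ^ Suc k"
  shows "mcoef P k N m = 0"
proof -
  let ?F = "prime_factors m"
  let ?A = "{x \<in> moll_sets P k \<times> {1..<N}. snd x * \<Prod>(fst x) = m}"
  have "(2::nat) ^ card ?F < 2 ^ Suc k" using two_power_card_prime_factors_le[of m] m k by simp
  then have ck: "card ?F \<le> k" by (simp del: power_Suc)
  have FP: "?F \<subseteq> P"
  proof
    fix p assume "p \<in> ?F"
    then have "prime p" "p dvd m" by auto
    then show "p \<in> P" using dvd_imp_le[of p m] m by (auto simp: P primes_in_def prime_gt_0_nat)
  qed
  have "mcoef P k N m = (\<Sum>S\<in>Pow ?F. (- 1) ^ card S)"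
    unfolding mcoef_def
  proof (rule sum.reindex_bij_witness[of _ "\<lambda>S. (S, m div \<Prod>S)" fst])
    fix x assume x: "x \<in> ?A"
    have xp: "\<And>p. p \<in> fst x \<Longrightarrow> prime p" "finite (fst x)"
      using x finite_subset[OF _ finite_primes_in] by (auto simp: moll_sets_def P dest: primes_inD)
    have "0 < \<Prod>(fst x)" using x m by (intro gr0I) auto
    then show "(fst x, m div \<Prod>(fst x)) = x" using x by (auto simp: prod_eq_iff)
    have "fst x \<subseteq> ?F" using x xp m by (intro prime_mem_prime_factors_of_prod[of "fst x" "snd x"]) auto
    then show "fst x \<in> Pow ?F" by simp
  next
    fix S assume S: "S \<in> Pow ?F"
    have fS: "finite S" using S by (auto intro: finite_subset)
    have "\<Prod>S dvd m"
    proof -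
      have "\<Prod>S dvd \<Prod>?F" using S by (intro prod_dvd_prod_subset) auto
      also have "\<Prod>?F dvd (\<Prod>p\<in>?F. p ^ multiplicity p m)"
        by (intro prod_dvd_prod) (auto simp: prime_factors_multiplicity intro!: dvd_power)
      also have "... = m" using m by (intro prime_factorization_nat[symmetric]) auto
      finally show ?thesis .
    qed
    then have e: "m div \<Prod>S * \<Prod>S = m" by simp
    then have "0 < m div \<Prod>S" using m by (intro gr0I) auto
    moreover have "m div \<Prod>S < N" using m N by (meson div_le_dividend le_less_trans le_trans)
    moreover have "card S \<le> k" using S ck card_mono[of ?F S] by auto
    ultimately show "(S, m div \<Prod>S) \<in> ?A" using e S FP by (auto simp: moll_sets_def)
  qed auto
  also have "... = 0"
    using m by (intro sum_alternating_Pow) (auto simp: prime_factorization_empty_iff)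
  finally show ?thesis .
qed

section \<open>Truncating the Euler product\<close>

text \<open>Cauchy's estimate, with the contour integral replaced by the mean over
  \<open>n + 1\<close> equally spaced points of the circle, which is exact for polynomials of degree
  at most \<open>n\<close>.\<close>

lemma coefficient_bound:
  fixes a :: "nat \<Rightarrow> complex"
  assumes "\<And>y. norm y = r \<Longrightarrow> norm (\<Sum>i\<le>n. a i * y ^ i) \<le> B" "0 < r" "j \<le> n"
  shows "norm (a j) * r ^ j \<le> B"
proof -
  define Q where "Q = Suc n"
  let ?K = "{0..<0 + int Q}"
  have Q: "0 < real Q" by (simp add: Q_def)
  have sumQ: "(\<Sum>k\<in>?K. ee (of_int (int j - int i) * (0 - of_int k / real Q))) = (if i = j then of_nat Q else 0)" if "i \<le> n" for i
    using that assms(3) sum_ee_grid[of "int j - int i" Q 0 0] by (auto simp: Q_def ee_def)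
  have pw: "ee (- of_int k / real Q) ^ i = ee (of_int (- int i) * (of_int k / real Q))" for i k
    by (simp add: ee_def Complex.DeMoivre mult_ac)
  have "of_nat Q * (a j * of_real r ^ j) = (\<Sum>i\<le>n. a i * of_real r ^ i * (if i = j then of_nat Q else 0))"
    using assms(3) by (simp add: if_distrib[of "\<lambda>x. _ * x"] sum.delta cong: if_cong)
  also have "... = (\<Sum>i\<le>n. a i * of_real r ^ i * (\<Sum>k\<in>?K. ee (of_int (int j - int i) * (0 - of_int k / real Q))))"
    using sumQ by (intro sum.cong refl) auto
  also have "... = (\<Sum>k\<in>?K. \<Sum>i\<le>n. a i * of_real r ^ i * ee (of_int (int j - int i) * (0 - of_int k / real Q)))"
    unfolding sum_distrib_left by (rule sum.swap)
  also have "... = (\<Sum>k\<in>?K. ee (- of_int (int j) * (of_int k / real Q)) * (\<Sum>i\<le>n. a i * (of_real r * ee (of_int k / real Q)) ^ i))"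
    unfolding sum_distrib_left
  proof (intro sum.cong refl)
    fix k i
    have "ee (of_int k / real Q) ^ i = ee (of_int (int i) * (of_int k / real Q))"
      by (simp add: ee_def Complex.DeMoivre mult_ac)
    moreover have "ee (of_int (int j - int i) * (0 - of_int k / real Q)) = ee (- of_int (int j) * (of_int k / real Q)) * ee (of_int (int i) * (of_int k / real Q))"
      unfolding ee_add[symmetric] by (rule arg_cong[where f = ee]) (simp add: algebra_simps diff_divide_distrib)
    ultimately show "a i * of_real r ^ i * ee (of_int (int j - int i) * (0 - of_int k / real Q)) = ee (- of_int (int j) * (of_int k / real Q)) * (a i * (of_real r * ee (of_int k / real Q)) ^ i)"
      by (simp only: power_mult_distrib mult_ac)
  qed
  finally have "norm (of_nat Q * (a j * of_real r ^ j)) \<le> (\<Sum>k\<in>?K. B)"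
  proof (elim ssubst, intro sum_norm_le)
    fix k
    have "norm (\<Sum>i\<le>n. a i * (of_real r * ee (of_int k / real Q)) ^ i) \<le> B"
      using assms(2) by (intro assms(1)) (simp add: norm_mult ee_def)
    then show "norm (ee (- of_int (int j) * (of_int k / real Q)) * (\<Sum>i\<le>n. a i * (of_real r * ee (of_int k / real Q)) ^ i)) \<le> B"
      by (simp add: norm_mult ee_def)
  qed
  then have "real Q * (norm (a j) * r ^ j) \<le> real Q * B" using assms(2) by (simp add: norm_mult norm_power)
  then show ?thesis using Q by (simp only: mult_le_cancel_left_pos)
qed

lemma norm_1_plus_le: "norm (1 + u :: complex) \<le> exp (Re u + (norm u)^2 / 2)"
proof -
  have "(norm (1 + u))^2 = 1 + (2 * Re u + (norm u)^2)"
    unfolding cmod_power2 by (simp add: power2_eq_square algebra_simps)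
  also have "... \<le> exp (2 * Re u + (norm u)^2)" by (rule exp_ge_add_one_self)
  also have "... = (exp (Re u + (norm u)^2 / 2))^2" by (simp flip: exp_double)
  finally show ?thesis by (rule power2_le_imp_le) simp
qed

text \<open>The first order terms enter only through the modulus of their sum. For
  \<open>u p = - p powr - s\<close> that sum is small at typical heights, although the sum of the
  absolute values is large.\<close>

lemma norm_prod_1_plus_le:
  fixes u :: "'b \<Rightarrow> complex"
  shows "norm (\<Prod>p\<in>P. 1 + u p) \<le> exp (norm (\<Sum>p\<in>P. u p) + (\<Sum>p\<in>P. (norm (u p))^2) / 2)"
proof (cases "finite P")
  case True
  have "norm (\<Prod>p\<in>P. 1 + u p) \<le> (\<Prod>p\<in>P. exp (Re (u p) + (norm (u p))^2 / 2))"
    unfolding prod_norm[symmetric] by (intro prod_mono) (auto intro: norm_1_plus_le)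
  also have "... = exp (Re (\<Sum>p\<in>P. u p) + (\<Sum>p\<in>P. (norm (u p))^2) / 2)"
    using True by (simp add: exp_sum[symmetric] sum.distrib sum_divide_distrib)
  also have "... \<le> exp (norm (\<Sum>p\<in>P. u p) + (\<Sum>p\<in>P. (norm (u p))^2) / 2)"
    using complex_Re_le_cmod[of "\<Sum>p\<in>P. u p"] by simp
  finally show ?thesis .
qed simp

text \<open>The matching lower bound, from the linear approximation of the logarithm; the 4 is
  \<open>1 / (1 - 3/4)\<close>.\<close>

lemma norm_prod_1_minus_ge:
  fixes z :: "'b \<Rightarrow> complex"
  assumes "\<And>p. p \<in> P \<Longrightarrow> norm (z p) \<le> 3/4"
  shows "1 \<le> exp (norm (\<Sum>p\<in>P. z p) + 4 * (\<Sum>p\<in>P. (norm (z p))^2)) * norm (\<Prod>p\<in>P. 1 - z p)"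
proof (cases "finite P")
  case True
  have each: "1 \<le> exp (Re (z p) + 4 * (norm (z p))^2) * norm (1 - z p)" if "p \<in> P" for p
  proof -
    define w where "w = - z p"
    have w: "norm w \<le> 3/4" using assms[OF that] by (simp add: w_def)
    have "norm (ln (1 + w) - w) \<le> (norm w)^2 / (1 - norm w)" using w by (intro Ln_approx_linear) auto
    also have "... \<le> (norm w)^2 / (1/4)" using w by (intro divide_left_mono) auto
    finally have "\<bar>Re (ln (1 + w) - w)\<bar> \<le> 4 * (norm w)^2" using abs_Re_le_cmod[of "ln (1 + w) - w"] by simp
    then have ge: "Re w - 4 * (norm w)^2 \<le> Re (ln (1 + w))" by (simp add: abs_le_iff)
    have "1 + w \<noteq> 0"
    proof
      assume "1 + w = 0"
      then have "w = - 1" by (simp add: add_eq_0_iff)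
      then show False using w by simp
    qed
    then have "norm (1 + w) = exp (Re (ln (1 + w)))" by (metis exp_Ln norm_exp_eq_Re)
    then have "exp (Re w - 4 * (norm w)^2) \<le> norm (1 + w)" using ge by (simp only: exp_le_cancel_iff)
    then have "exp (Re (z p) + 4 * (norm (z p))^2) * exp (Re w - 4 * (norm w)^2) \<le> exp (Re (z p) + 4 * (norm (z p))^2) * norm (1 - z p)"
      by (intro mult_left_mono) (auto simp: w_def)
    then show ?thesis by (simp add: exp_add[symmetric] w_def)
  qed
  have "1 \<le> (\<Prod>p\<in>P. exp (Re (z p) + 4 * (norm (z p))^2) * norm (1 - z p))"
    using each by (intro prod_ge_1) auto
  also have "... = exp (Re (\<Sum>p\<in>P. z p) + 4 * (\<Sum>p\<in>P. (norm (z p))^2)) * norm (\<Prod>p\<in>P. 1 - z p)"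
    using True by (simp add: prod.distrib exp_sum[symmetric] sum.distrib sum_distrib_left prod_norm)
  also have "... \<le> exp (norm (\<Sum>p\<in>P. z p) + 4 * (\<Sum>p\<in>P. (norm (z p))^2)) * norm (\<Prod>p\<in>P. 1 - z p)"
    using complex_Re_le_cmod[of "\<Sum>p\<in>P. z p"] by (intro mult_right_mono) auto
  finally show ?thesis .
qed simp

text \<open>Cauchy's estimate on the circle of radius \<open>exp 1\<close>, applied to the generating polynomial
  \<open>\<Prod>p. 1 - y * z p\<close> of the elementary symmetric functions, avoids the loss that absolute values
  would cause.\<close>

lemma prod_truncation:
  fixes z :: "'b \<Rightarrow> complex"
  assumes P: "finite P"
  shows "norm ((\<Prod>p\<in>P. 1 - z p) - (\<Sum>S\<in>{S. S \<subseteq> P \<and> card S \<le> k}. (- 1) ^ card S * (\<Prod>p\<in>S. z p)))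
    \<le> exp (- real k) * exp (exp 1 * norm (\<Sum>p\<in>P. z p) + exp 2 * (\<Sum>p\<in>P. (norm (z p))^2) / 2)"
proof -
  define n where "n = card P"
  define B where "B = exp (exp 1 * norm (\<Sum>p\<in>P. z p) + exp 2 * (\<Sum>p\<in>P. (norm (z p))^2) / 2)"
  define a where "a j = (\<Sum>S\<in>{S \<in> Pow P. card S = j}. (- 1) ^ card S * (\<Prod>p\<in>S. z p))" for j
  have gen: "(\<Prod>p\<in>P. 1 + (- (y * z p))) = (\<Sum>j\<le>n. a j * y ^ j)" for y
  proof -
    have "(\<Prod>p\<in>P. 1 + (- (y * z p))) = (\<Prod>p\<in>P. - (y * z p) + 1)" by (simp add: add.commute)
    also have "... = (\<Sum>S\<in>Pow P. (\<Prod>p\<in>S. - (y * z p)) * (\<Prod>p\<in>P - S. 1))" by (rule prod_add[OF P])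
    also have "... = (\<Sum>S\<in>Pow P. (- 1) ^ card S * (\<Prod>p\<in>S. z p) * y ^ card S)"
    proof (intro sum.cong refl)
      fix S assume "S \<in> Pow P"
      then have "finite S" using P by (auto intro: finite_subset)
      then have "(\<Prod>p\<in>S. - (y * z p)) = (\<Prod>p\<in>S. (- 1) * (y * z p))" by simp
      also have "... = (- 1) ^ card S * (y ^ card S * (\<Prod>p\<in>S. z p))" by (simp only: prod.distrib prod_constant)
      finally show "(\<Prod>p\<in>S. - (y * z p)) * (\<Prod>p\<in>P - S. 1) = (- 1) ^ card S * (\<Prod>p\<in>S. z p) * y ^ card S" by simp
    qed
    also have "... = (\<Sum>j\<le>n. \<Sum>S\<in>{S \<in> Pow P. card S = j}. (- 1) ^ card S * (\<Prod>p\<in>S. z p) * y ^ card S)"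
      using P by (intro sum.group[symmetric]) (auto simp: n_def card_mono)
    also have "... = (\<Sum>j\<le>n. a j * y ^ j)" unfolding a_def sum_distrib_right by (intro sum.cong refl) auto
    finally show ?thesis .
  qed
  have aj: "norm (a j) \<le> B * exp (- 1) ^ j" if "j \<le> n" for j
  proof -
    have "norm (a j) * exp 1 ^ j \<le> B"
    proof (rule coefficient_bound[OF _ _ that])
      fix y :: complex assume y: "norm y = exp 1"
      have "norm (\<Sum>j\<le>n. a j * y ^ j) \<le> exp (norm (\<Sum>p\<in>P. - (y * z p)) + (\<Sum>p\<in>P. (norm (- (y * z p)))^2) / 2)"
        unfolding gen[symmetric] by (rule norm_prod_1_plus_le)
      also have "(\<Sum>p\<in>P. - (y * z p)) = - y * (\<Sum>p\<in>P. z p)" by (simp add: sum_distrib_left sum_negf)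
      also have "(\<Sum>p\<in>P. (norm (- (y * z p)))^2) = exp 2 * (\<Sum>p\<in>P. (norm (z p))^2)"
        by (simp add: norm_mult y power_mult_distrib sum_distrib_left exp_double[symmetric])
      finally show "norm (\<Sum>j\<le>n. a j * y ^ j) \<le> B" by (simp add: B_def norm_mult y)
    qed simp
    then have "norm (a j) * exp 1 ^ j * exp (- 1) ^ j \<le> B * exp (- 1) ^ j" by (intro mult_right_mono) auto
    then show ?thesis by (simp add: mult.assoc power_mult_distrib[symmetric] exp_minus)
  qed
  have "(\<Sum>S\<in>{S. S \<subseteq> P \<and> card S \<le> k}. (- 1) ^ card S * (\<Prod>p\<in>S. z p)) = (\<Sum>j\<in>{..n} \<inter> {..k}. a j)"
  proof -
    have "(\<Sum>S\<in>{S. S \<subseteq> P \<and> card S \<le> k}. (- 1) ^ card S * (\<Prod>p\<in>S. z p)) =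
      (\<Sum>j\<in>{..n} \<inter> {..k}. \<Sum>S\<in>{S \<in> {S. S \<subseteq> P \<and> card S \<le> k}. card S = j}. (- 1) ^ card S * (\<Prod>p\<in>S. z p))"
      using P by (intro sum.group[symmetric]) (auto simp: n_def card_mono intro: finite_subset[of _ "Pow P"])
    also have "... = (\<Sum>j\<in>{..n} \<inter> {..k}. a j)" unfolding a_def by (intro sum.cong refl) auto
    finally show ?thesis .
  qed
  moreover have "(\<Prod>p\<in>P. 1 - z p) = (\<Sum>j\<in>{..n} \<inter> {..k}. a j) + (\<Sum>j\<in>{..n} - {..k}. a j)"
    using gen[of 1] sum.Int_Diff[of "{..n}" a "{..k}"] by simp
  ultimately have "norm ((\<Prod>p\<in>P. 1 - z p) - (\<Sum>S\<in>{S. S \<subseteq> P \<and> card S \<le> k}. (- 1) ^ card S * (\<Prod>p\<in>S. z p))) = norm (\<Sum>j\<in>{..n} - {..k}. a j)"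
    by simp
  also have "... \<le> (\<Sum>j\<in>{..n} - {..k}. B * exp (- 1) ^ j)" using aj by (intro sum_norm_le) auto
  also have "... \<le> (\<Sum>j\<in>{Suc k..k + n}. B * exp (- 1) ^ j)" by (intro sum_mono2) (auto simp: B_def)
  also have "... \<le> B * exp (- real k)"
  proof -
    have e: "exp (- 1 :: real) \<le> 1/2" using exp_ge_add_one_self[of "1::real"] by (simp add: exp_minus inverse_eq_divide field_simps)
    have "(\<Sum>j\<in>{Suc k..k + n}. B * exp (- 1) ^ j) = B * exp (- 1) ^ k * (\<Sum>i\<in>{1..n}. exp (- 1) ^ i)"
      unfolding sum_distrib_left by (rule sum.reindex_bij_witness[of _ "\<lambda>i. k + i" "\<lambda>j. j - k"]) (auto simp flip: power_add)
    also have "(\<Sum>i\<in>{1..n}. exp (- 1 :: real) ^ i) \<le> (\<Sum>i\<in>{1..n}. (1/2) ^ i)" using e by (intro sum_mono power_mono) auto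
    also have "(\<Sum>i\<in>{1..n}. (1/2 :: real) ^ i) = 1 - (1/2) ^ n" by (induction n) (auto simp: field_simps)
    also have "... \<le> 1" by simp
    finally show ?thesis by (simp add: B_def exp_of_nat_mult[symmetric] mult_left_mono)
  qed
  finally show ?thesis by (simp add: B_def mult.commute)
qed

text \<open>\<open>W\<close> is the Euler product, \<open>M\<close> its truncation and
  \<open>Z\<close> the truncated zeta sum. With \<open>M = W * (1 - q)\<close> and \<open>q\<close>
  of modulus at most \<open>1/2\<close>, passing from \<open>Z * M\<close> to \<open>Z * W\<close>
  costs a factor 2.\<close>

lemma mollify:
  fixes \<zeta> Z M W :: complex
  assumes "norm (\<zeta> - Z) \<le> e0" "norm (Z * M - 1) \<le> e1" "norm (W - M) \<le> e2" "norm W \<le> B" "1 \<le> B * norm W" "e2 * B \<le> 1/2"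
  shows "norm (\<zeta> * W - 1) \<le> e0 * B + 2 * (e1 + e2 * B)"
proof -
  have P0: "W \<noteq> 0" using assms(5) by auto
  have B0: "0 \<le> B" using assms(4) norm_ge_zero[of W] by linarith
  define q where "q = (W - M) / W"
  have q: "norm q \<le> e2 * B"
  proof -
    have "norm q = norm (W - M) * (1 / norm W)" by (simp add: q_def norm_divide)
    also have "... \<le> e2 * B"
      using assms(3,5) P0 order_trans[OF norm_ge_zero assms(3)] by (intro mult_mono) (auto simp: field_simps)
    finally show ?thesis .
  qed
  have "1 - norm q \<le> norm (1 - q)" using norm_triangle_ineq2[of 1 q] by simp
  then have q2: "1/2 \<le> norm (1 - q)" using q assms(6) by linarith
  have M: "M = W * (1 - q)" using P0 by (simp add: q_def field_simps)
  have "(Z * W - 1) * (1 - q) = (Z * M - 1) + q" by (simp add: M algebra_simps)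
  then have "norm (Z * W - 1) * norm (1 - q) \<le> e1 + e2 * B"
    using norm_triangle_ineq[of "Z * M - 1" q] q assms(2) by (simp add: norm_mult[symmetric])
  moreover have "norm (Z * W - 1) * (1/2) \<le> norm (Z * W - 1) * norm (1 - q)" using q2 by (intro mult_left_mono) auto
  ultimately have 1: "norm (Z * W - 1) \<le> 2 * (e1 + e2 * B)" by argo
  have "norm ((\<zeta> - Z) * W) \<le> e0 * B"
    unfolding norm_mult using assms(1,4) B0 order_trans[OF norm_ge_zero assms(1)] by (intro mult_mono) auto
  then have "norm ((\<zeta> - Z) * W + (Z * W - 1)) \<le> e0 * B + 2 * (e1 + e2 * B)"
    using norm_triangle_ineq[of "(\<zeta> - Z) * W" "Z * W - 1"] 1 by linarith
  moreover have "\<zeta> * W - 1 = (\<zeta> - Z) * W + (Z * W - 1)" by (simp add: algebra_simps)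
  ultimately show ?thesis by (simp only:)
qed

section \<open>Typical size of zeta times its small Euler factors\<close>

definition weight_bound :: "real \<Rightarrow> real \<Rightarrow> bool" where
  "weight_bound \<sigma> K \<longleftrightarrow> 0 < K \<and> (\<forall>A a c. finite A \<longrightarrow> A \<subseteq> {a..} \<longrightarrow> 1 \<le> a \<longrightarrow>
     (\<forall>n\<in>A. norm (c n :: complex) \<le> 2 ^ card (prime_factors n)) \<longrightarrow>
     (\<Sum>n\<in>A. (norm (c n))^2 * (1 + (ln (real n))^2) * real n powr (- 2 * \<sigma>)) \<le> K * real a powr (1/2 - \<sigma>))"

text \<open>With \<open>\<epsilon> = (2 * \<sigma> - 1) / 6\<close> the coefficients cost
  \<open>2 * \<epsilon>\<close> and the squared logarithm another \<open>\<epsilon>\<close> in the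
  exponent. That is half of the excess of \<open>2 * \<sigma>\<close> over 1; the other half is the
  saving \<open>a powr (1/2 - \<sigma>)\<close>.\<close>

lemma weighted_coefficient_sum:
  assumes \<sigma>: "1/2 < \<sigma>"
  shows "\<exists>K. weight_bound \<sigma> K"
proof -
  define \<epsilon> where "\<epsilon> = (2 * \<sigma> - 1) / 6"
  define \<beta> where "\<beta> = 2 * \<sigma> - 3 * \<epsilon>"
  have \<epsilon>: "0 < \<epsilon>" and \<beta>: "1 < \<beta>" "1 - \<beta> = 1/2 - \<sigma>" using \<sigma> by (auto simp: \<epsilon>_def \<beta>_def field_simps)
  obtain C where C: "1 \<le> C" "\<And>m :: nat. 0 < m \<Longrightarrow> 2 ^ card (prime_factors m) \<le> C * real m powr \<epsilon>"
    using omega_bound[OF \<epsilon>] by blast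
  define C' where "C' = 1 + 4 / \<epsilon>^2"
  have C': "0 < C'" using \<epsilon> by (simp add: C'_def add_pos_pos)
  have "(\<Sum>n\<in>A. (norm (c n))^2 * (1 + (ln (real n))^2) * real n powr (- 2 * \<sigma>)) \<le> C^2 * C' * (\<beta> / (\<beta> - 1)) * real a powr (1/2 - \<sigma>)"
    if A: "finite A" "A \<subseteq> {a..}" "1 \<le> a" and c: "\<And>n. n \<in> A \<Longrightarrow> norm (c n :: complex) \<le> 2 ^ card (prime_factors n)" for A a c
  proof -
    have each: "(norm (c n))^2 * (1 + (ln (real n))^2) * real n powr (- 2 * \<sigma>) \<le> C^2 * C' * real n powr (- \<beta>)" if n: "n \<in> A" for n
    proof -
      have n1: "1 \<le> n" using n A by auto
      have "(norm (c n))^2 \<le> (C * real n powr \<epsilon>)^2" using c[OF n] C(2)[of n] n1 by (intro power_mono) auto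
      also have "... = C^2 * real n powr (2 * \<epsilon>)" using n1 by (simp add: power_mult_distrib powr_power[of "real n" \<epsilon> 2])
      finally have 1: "(norm (c n))^2 \<le> C^2 * real n powr (2 * \<epsilon>)" .
      have "ln (real n) \<le> real n powr (\<epsilon> / 2) / (\<epsilon> / 2)" using n1 \<epsilon> by (intro ln_powr_bound) auto
      then have "(ln (real n))^2 \<le> (real n powr (\<epsilon> / 2) / (\<epsilon> / 2))^2" using n1 by (intro power_mono) auto
      also have "... = 4 / \<epsilon>^2 * real n powr \<epsilon>" using n1 powr_power[of "real n" "\<epsilon> / 2" 2] by (simp add: power_divide power_mult_distrib)
      finally have 2: "1 + (ln (real n))^2 \<le> C' * real n powr \<epsilon>"
        using ge_one_powr_ge_zero[of "real n" \<epsilon>] n1 \<epsilon> by (simp add: C'_def distrib_right)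
      have "(norm (c n))^2 * (1 + (ln (real n))^2) * real n powr (- 2 * \<sigma>) \<le> (C^2 * real n powr (2 * \<epsilon>)) * (C' * real n powr \<epsilon>) * real n powr (- 2 * \<sigma>)"
        using 1 2 C' by (intro mult_right_mono mult_mono) auto
      also have "... = C^2 * C' * (real n powr (2 * \<epsilon>) * real n powr \<epsilon> * real n powr (- 2 * \<sigma>))" by (simp only: mult_ac)
      also have "real n powr (2 * \<epsilon>) * real n powr \<epsilon> * real n powr (- 2 * \<sigma>) = real n powr (- \<beta>)"
        by (simp add: \<beta>_def flip: powr_add)
      finally show ?thesis .
    qed
    have "(\<Sum>n\<in>A. (norm (c n))^2 * (1 + (ln (real n))^2) * real n powr (- 2 * \<sigma>)) \<le> (\<Sum>n\<in>A. C^2 * C' * real n powr (- \<beta>))"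
      using each by (rule sum_mono)
    also have "... = C^2 * C' * (\<Sum>n\<in>A. real n powr (- \<beta>))" by (simp add: sum_distrib_left)
    also have "... \<le> C^2 * C' * (\<Sum>n=a..Max (insert a A). real n powr (- \<beta>))"
      using C C' A by (intro mult_left_mono sum_mono2) (auto intro: Max_ge)
    also have "... \<le> C^2 * C' * (\<beta> / (\<beta> - 1) * real a powr (1 - \<beta>))"
      using C' A \<beta> by (intro mult_left_mono sum_powr_tail_le) auto
    finally show ?thesis by (simp add: \<beta>(2) mult.assoc)
  qed
  moreover have "0 < C^2 * C' * (\<beta> / (\<beta> - 1))" using C C' \<beta> by auto
  ultimately show ?thesis unfolding weight_bound_def by (intro exI[of _ "C^2 * C' * (\<beta> / (\<beta> - 1))"]) blast
qed

lemma mvc_le: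
  assumes "a < b" "1 \<le> N" "real N \<le> x"
  shows "mvc a b N \<le> 1 + 4 * x * (1 + ln x) / (b - a)"
proof -
  have "ln (real N) \<le> ln x" using assms by simp
  then have "4 * real N * (1 + ln (real N)) \<le> 4 * x * (1 + ln x)" using assms by (intro mult_mono) auto
  then show ?thesis unfolding mvc_def using assms(1) by (intro add_left_mono divide_right_mono) auto
qed

lemma dpoly_Un: "finite A \<Longrightarrow> finite B \<Longrightarrow> A \<inter> B = {} \<Longrightarrow> dpoly (A \<union> B) c s = dpoly A c s + dpoly B c s"
  unfolding dpoly_def by (rule sum.union_disjoint)

text \<open>Three exceptional sets. The part of the mollified sum from \<open>Y\<close> to
  \<open>N1\<close> is to be kept short, so that its mean value constant is bounded and the small
  saving at \<open>Y\<close> is enough. The part beyond \<open>N1\<close> has a large constant,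
  which the power saving at \<open>N1\<close> must beat. The third set is where the prime sum
  exceeds \<open>R\<close>; outside it the Euler product and its truncation are under
  control.\<close>

lemma mollified_zeta_exceptional:
  fixes \<sigma> T R d :: real and Y N N1 k :: nat
  defines "V \<equiv> 2 * \<sigma> / (2 * \<sigma> - 1)"
  defines "B \<equiv> exp (R + 4 * V)" and "D \<equiv> exp (- real k) * exp (exp 1 * R + exp 2 * V / 2)" and "\<mu> \<equiv> mvc (T / 2) (3 * T)"
  assumes \<sigma>: "1/2 < \<sigma>" "\<sigma> < 1" and K: "weight_bound \<sigma> K"
    and T: "4 \<le> T" "3 * T \<le> real N" "real N \<le> 4 * T"
    and Y: "1 \<le> Y" "Y < N" "Y < 2 ^ Suc k" "Y \<le> N1" "N1 \<le> N * Y ^ k"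
    and Rd: "0 < R" "0 < d" and small: "D * B \<le> 1/2"
  shows "\<exists>E\<in>sets borel. measure (umeas (T / 2) (3 * T)) E \<le> 10 * K * (\<mu> N1 * real Y powr (1/2 - \<sigma>) / d^2
       + \<mu> (N * Y ^ k) * real N1 powr (1/2 - \<sigma>) / d^2 + \<mu> Y / R^2)
    \<and> (\<forall>\<tau> x. T / 2 \<le> \<tau> \<longrightarrow> \<tau> \<le> 3 * T \<longrightarrow> \<tau> \<notin> E \<longrightarrow> \<sigma> \<le> x \<longrightarrow> x \<le> 2 \<longrightarrow>
         norm (sieved_zeta Y (Complex x \<tau>) - 1) \<le> 400000 / (1 - \<sigma>) * real N powr (1 - 2 * \<sigma>) * B + 2 * (2 * d + D * B))"
proof -
  define P where "P = primes_in 0 Y"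
  have P: "finite P" "\<And>p. p \<in> P \<Longrightarrow> prime p" "\<And>p. p \<in> P \<Longrightarrow> p \<le> Y" "P \<subseteq> {1..Y}"
    by (auto simp: P_def primes_in_def)
  let ?m = "mcoef P k N"
  have mc: "norm (?m n) \<le> 2 ^ card (prime_factors n)" if "0 < n" for n
    using P that by (intro norm_mcoef_le) auto
  have ab: "T / 2 < 3 * T" and \<sigma>2: "0 < \<sigma>" "\<sigma> < 2" using T \<sigma> by auto
  have mv0: "0 \<le> \<mu> n" if "1 \<le> n" for n using that T by (simp add: \<mu>_def mvc_def)
  have NY: "1 \<le> N1" "1 \<le> N * Y ^ k" using Y by auto
  have ex: "\<exists>E\<in>sets borel. measure (umeas (T / 2) (3 * T)) E \<le> 10 * K * (\<mu> n * real a powr (1/2 - \<sigma>) / e^2)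
    \<and> (\<forall>t x. t \<notin> E \<longrightarrow> \<sigma> \<le> x \<longrightarrow> x \<le> 2 \<longrightarrow> norm (dpoly A c (Complex x t)) \<le> e)"
    if A: "A \<subseteq> {1..n}" "A \<subseteq> {a..}" "1 \<le> a" and c: "\<And>n. n \<in> A \<Longrightarrow> norm (c n) \<le> 2 ^ card (prime_factors n)"
      and n: "1 \<le> n" and e: "0 < e" for A n a c e
  proof -
    have fA: "finite A" using A(1) by (rule finite_subset) simp
    obtain E where E: "E \<in> sets borel"
      "measure (umeas (T / 2) (3 * T)) E \<le> \<mu> n * (10 * (\<Sum>n\<in>A. (norm (c n))^2 * (1 + (ln (real n))^2) * real n powr (- 2 * \<sigma>))) / e^2"
      "\<forall>t x. t \<notin> E \<longrightarrow> \<sigma> \<le> x \<longrightarrow> x \<le> 2 \<longrightarrow> norm (dpoly A c (Complex x t)) \<le> e"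
      using exceptional_set[OF ab n A(1) \<sigma>2 e, of c] unfolding \<mu>_def by blast
    have "\<mu> n * (10 * (\<Sum>n\<in>A. (norm (c n))^2 * (1 + (ln (real n))^2) * real n powr (- 2 * \<sigma>))) / e^2
      \<le> \<mu> n * (10 * (K * real a powr (1/2 - \<sigma>))) / e^2"
      using mv0[OF n] K[unfolded weight_bound_def] fA A c by (intro divide_right_mono mult_left_mono) auto
    from order_trans[OF E(2) this] have "measure (umeas (T / 2) (3 * T)) E \<le> 10 * K * (\<mu> n * real a powr (1/2 - \<sigma>) / e^2)"
      by (simp add: mult_ac)
    then show ?thesis using E by blast
  qed
  have s1: "{Y<..N1} \<subseteq> {1..N1}" "{Y<..N1} \<subseteq> {Y..}" "\<And>n. n \<in> {Y<..N1} \<Longrightarrow> 0 < n" by auto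
  have s2: "{N1<..N * Y ^ k} \<subseteq> {1..N * Y ^ k}" "{N1<..N * Y ^ k} \<subseteq> {N1..}" "\<And>n. n \<in> {N1<..N * Y ^ k} \<Longrightarrow> 0 < n" by auto
  have s3: "P \<subseteq> {1..}" "\<And>n. n \<in> P \<Longrightarrow> norm (1::complex) \<le> 2 ^ card (prime_factors n)" using P(4) by auto
  obtain E1 where E1: "E1 \<in> sets borel" "measure (umeas (T / 2) (3 * T)) E1 \<le> 10 * K * (\<mu> N1 * real Y powr (1/2 - \<sigma>) / d^2)"
    "\<And>t x. t \<notin> E1 \<Longrightarrow> \<sigma> \<le> x \<Longrightarrow> x \<le> 2 \<Longrightarrow> norm (dpoly {Y<..N1} ?m (Complex x t)) \<le> d"
    using ex[of "{Y<..N1}" N1 Y ?m d, OF _ _ Y(1) _ NY(1) Rd(2)] mc s1 by blast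
  obtain E2 where E2: "E2 \<in> sets borel" "measure (umeas (T / 2) (3 * T)) E2 \<le> 10 * K * (\<mu> (N * Y ^ k) * real N1 powr (1/2 - \<sigma>) / d^2)"
    "\<And>t x. t \<notin> E2 \<Longrightarrow> \<sigma> \<le> x \<Longrightarrow> x \<le> 2 \<Longrightarrow> norm (dpoly {N1<..N * Y ^ k} ?m (Complex x t)) \<le> d"
    using ex[of "{N1<..N * Y ^ k}" "N * Y ^ k" N1 ?m d, OF _ _ NY(1) _ NY(2) Rd(2)] mc s2 by blast
  obtain E3 where E3: "E3 \<in> sets borel" "measure (umeas (T / 2) (3 * T)) E3 \<le> 10 * K * (\<mu> Y / R^2)"
    "\<And>t x. t \<notin> E3 \<Longrightarrow> \<sigma> \<le> x \<Longrightarrow> x \<le> 2 \<Longrightarrow> norm (dpoly P (\<lambda>_. 1) (Complex x t)) \<le> R"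
    using ex[of P Y 1 "\<lambda>_. 1" R, OF P(4) s3(1) _ s3(2) Y(1) Rd(1)] by auto
  define E where "E = E1 \<union> E2 \<union> E3"
  interpret U: prob_space "umeas (T / 2) (3 * T)" by (rule prob_space_umeas[OF ab])
  have "U.prob E \<le> U.prob E1 + U.prob E2 + U.prob E3"
    using measure_Un_le[of "E1 \<union> E2" "umeas (T / 2) (3 * T)" E3] measure_Un_le[of E1 "umeas (T / 2) (3 * T)" E2] E1 E2 E3
    by (simp add: E_def)
  also have "... \<le> 10 * K * (\<mu> N1 * real Y powr (1/2 - \<sigma>) / d^2)
    + 10 * K * (\<mu> (N * Y ^ k) * real N1 powr (1/2 - \<sigma>) / d^2) + 10 * K * (\<mu> Y / R^2)"
    using E1 E2 E3 by (intro add_mono)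
  finally have ms: "U.prob E \<le> 10 * K * (\<mu> N1 * real Y powr (1/2 - \<sigma>) / d^2
             + \<mu> (N * Y ^ k) * real N1 powr (1/2 - \<sigma>) / d^2 + \<mu> Y / R^2)"
    by (simp only: distrib_left)
  have main: "norm (sieved_zeta Y (Complex x \<tau>) - 1) \<le> 400000 / (1 - \<sigma>) * real N powr (1 - 2 * \<sigma>) * B + 2 * (2 * d + D * B)"
    if \<tau>: "T / 2 \<le> \<tau>" "\<tau> \<le> 3 * T" "\<tau> \<notin> E" and x: "\<sigma> \<le> x" "x \<le> 2" for \<tau> x
  proof -
    define s where "s = Complex x \<tau>"
    define z where "z p = (of_nat p :: complex) powr (- s)" for p
    have z: "norm (z p) = real p powr (- x)" if "p \<in> P" for p
      using P(2)[OF that] by (simp add: z_def s_def norm_nat_powr prime_gt_0_nat)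
    have z34: "norm (z p) \<le> 3/4" if "p \<in> P" for p
      using z[OF that] prime_powr_le[OF P(2)[OF that], of x] x \<sigma> by simp
    have V0: "0 \<le> V" using \<sigma> by (simp add: V_def)
    have zV: "(\<Sum>p\<in>P. (norm (z p))^2) \<le> V"
    proof -
      have "(\<Sum>p\<in>P. (norm (z p))^2) \<le> (\<Sum>p\<in>P. real p powr (- (2 * \<sigma>)))"
      proof (rule sum_mono)
        fix p assume p: "p \<in> P"
        have "(norm (z p))^2 = real p powr (- (2 * x))" using P(2)[OF p] by (simp add: z[OF p] powr_power prime_gt_0_nat mult.commute)
        also have "... \<le> real p powr (- (2 * \<sigma>))" using x P(4) p by (intro powr_mono) auto
        finally show "(norm (z p))^2 \<le> real p powr (- (2 * \<sigma>))" .
      qed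
      also have "... \<le> (\<Sum>n=1..Y. real n powr (- (2 * \<sigma>)))" using P(4) by (intro sum_mono2) auto
      also have "... \<le> 2 * \<sigma> / (2 * \<sigma> - 1) * real 1 powr (1 - 2 * \<sigma>)" using \<sigma> by (intro sum_powr_tail_le) auto
      finally show ?thesis by (simp add: V_def)
    qed
    have zR: "norm (\<Sum>p\<in>P. z p) \<le> R"
      using E3(3)[of \<tau> x] \<tau> x by (simp add: E_def dpoly_def z_def s_def)
    show ?thesis
      unfolding sieved_zeta_def P_def[symmetric] s_def[symmetric] z_def[symmetric]
    proof (rule mollify[where Z = "\<Sum>n=1..<N. of_nat n powr (- s)" and M = "moll P k s"])
      \<comment> \<open>Here \<open>Im s = \<tau>\<close> satisfies
        \<open>\<tau> \<le> 3 * T \<le> N \<le> 4 * T \<le> 8 * \<tau>\<close>, as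
        \<open>zeta_truncated\<close> demands.\<close>
      show "norm (zeta s - (\<Sum>n=1..<N. of_nat n powr (- s))) \<le> 400000 / (1 - \<sigma>) * real N powr (1 - 2 * \<sigma>)"
        using \<sigma> x \<tau> T by (intro zeta_truncated) (auto simp: s_def)
      have "(\<Sum>n=1..<N. of_nat n powr (- s)) * moll P k s = dpoly {1..N * Y ^ k} ?m s"
        using P Y by (intro mollified_dpoly) auto
      also have "{1..N * Y ^ k} = {1} \<union> ({1<..Y} \<union> ({Y<..N1} \<union> {N1<..N * Y ^ k}))" using Y NY by auto
      also have "dpoly ... ?m s = dpoly {1} ?m s + (dpoly {1<..Y} ?m s + (dpoly {Y<..N1} ?m s + dpoly {N1<..N * Y ^ k} ?m s))"
      proof -
        have "{1} \<inter> ({1<..Y} \<union> ({Y<..N1} \<union> {N1<..N * Y ^ k})) = {}" "{1<..Y} \<inter> ({Y<..N1} \<union> {N1<..N * Y ^ k}) = {}"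
          "{Y<..N1} \<inter> {N1<..N * Y ^ k} = {}" using Y NY by auto
        then show ?thesis by (simp only: dpoly_Un finite_Un finite.intros finite_greaterThanAtMost simp_thms)
      qed
      also have "dpoly {1} ?m s = 1" using mcoef_1[OF P(1,2), of N k] Y by (simp add: dpoly_def)
      also have "dpoly {1<..Y} ?m s = 0" unfolding dpoly_def
        using mcoef_small[OF P_def, of _ N k] Y by (intro sum.neutral) auto
      finally have "(\<Sum>n=1..<N. of_nat n powr (- s)) * moll P k s - 1 = dpoly {Y<..N1} ?m s + dpoly {N1<..N * Y ^ k} ?m s" by simp
      moreover have "norm (dpoly {Y<..N1} ?m s) \<le> d" "norm (dpoly {N1<..N * Y ^ k} ?m s) \<le> d"
        using E1(3)[of \<tau> x] E2(3)[of \<tau> x] \<tau> x by (auto simp: E_def s_def)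
      ultimately show "norm ((\<Sum>n=1..<N. of_nat n powr (- s)) * moll P k s - 1) \<le> 2 * d"
        using norm_triangle_ineq[of "dpoly {Y<..N1} ?m s" "dpoly {N1<..N * Y ^ k} ?m s"] by simp
      have "norm ((\<Prod>p\<in>P. 1 - z p) - moll P k s) \<le> exp (- real k) * exp (exp 1 * norm (\<Sum>p\<in>P. z p) + exp 2 * (\<Sum>p\<in>P. (norm (z p))^2) / 2)"
        unfolding moll_def moll_sets_def z_def[symmetric] by (rule prod_truncation[OF P(1)])
      also have "... \<le> D"
      proof -
        have "exp 1 * norm (\<Sum>p\<in>P. z p) \<le> exp 1 * R" "exp 2 * (\<Sum>p\<in>P. (norm (z p))^2) \<le> exp 2 * V"
          by (intro mult_left_mono zR zV; simp)+
        then have "exp 1 * norm (\<Sum>p\<in>P. z p) + exp 2 * (\<Sum>p\<in>P. (norm (z p))^2) / 2 \<le> exp 1 * R + exp 2 * V / 2"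
          by (intro add_mono divide_right_mono) auto
        then show ?thesis unfolding D_def by (intro mult_left_mono) auto
      qed
      finally show "norm ((\<Prod>p\<in>P. 1 - z p) - moll P k s) \<le> D" .
      have "norm (\<Prod>p\<in>P. 1 + - z p) \<le> exp (norm (\<Sum>p\<in>P. - z p) + (\<Sum>p\<in>P. (norm (- z p))^2) / 2)" by (rule norm_prod_1_plus_le)
      also have "... \<le> B" using zR zV V0 by (simp add: B_def sum_negf)
      finally show "norm (\<Prod>p\<in>P. 1 - z p) \<le> B" by simp
      have "1 \<le> exp (norm (\<Sum>p\<in>P. z p) + 4 * (\<Sum>p\<in>P. (norm (z p))^2)) * norm (\<Prod>p\<in>P. 1 - z p)"
        using z34 by (rule norm_prod_1_minus_ge)
      also have "... \<le> B * norm (\<Prod>p\<in>P. 1 - z p)" unfolding B_def using zR zV by (intro mult_right_mono) auto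
      finally show "1 \<le> B * norm (\<Prod>p\<in>P. 1 - z p)" .
    qed (rule small)
  qed
  have "E \<in> sets borel" unfolding E_def using E1(1) E2(1) E3(1) by auto
  then show ?thesis using ms main by blast
qed

text \<open>The exponent makes \<open>Y powr (1/2 - \<sigma>)\<close> at most
  \<open>L powr (- 6)\<close>, enough against the factor \<open>L^2\<close> from the precision
  \<open>1 / L\<close> in mean square, and makes the truncation error
  \<open>Y powr (- (2 * \<sigma> - 1) / 4)\<close> at most \<open>L powr (- 3)\<close>.\<close>

definition sieve_level :: "real \<Rightarrow> real \<Rightarrow> nat" where
  "sieve_level \<sigma> L = nat \<lceil>L powr (12 / (2 * \<sigma> - 1))\<rceil>"

lemma sieve_level_ge: "L powr (12 / (2 * \<sigma> - 1)) \<le> real (sieve_level \<sigma> L)"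
  unfolding sieve_level_def by linarith

lemma sieve_level_le: "1 \<le> L \<Longrightarrow> 1/2 < \<sigma> \<Longrightarrow> real (sieve_level \<sigma> L) \<le> 2 * L powr (12 / (2 * \<sigma> - 1))"
  using ge_one_powr_ge_zero[of L "12 / (2 * \<sigma> - 1)"] unfolding sieve_level_def by (simp add: le_divide_eq) linarith

lemma sieve_level_powr:
  assumes "0 < L" "a \<le> 0"
  shows "real (sieve_level \<sigma> L) powr a \<le> L powr (12 * a / (2 * \<sigma> - 1))"
  using powr_mono2'[OF assms(2) _ sieve_level_ge[of L \<sigma>]] assms(1) by (simp add: powr_powr)

text \<open>The heights from \<open>T / 2\<close> to \<open>3 * T\<close> contain all translates of
  \<open>[T, 2 T]\<close> by imaginary parts of size at most \<open>T / 2\<close>, so one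
  exceptional set serves every \<open>s j\<close> after translation.\<close>

definition sieve_close :: "real \<Rightarrow> real \<Rightarrow> real \<Rightarrow> bool" where
  "sieve_close \<sigma> C L \<longleftrightarrow> (\<exists>E\<in>sets borel. measure (umeas (exp L / 2) (3 * exp L)) E \<le> C / L
    \<and> (\<forall>\<tau> x. exp L / 2 \<le> \<tau> \<longrightarrow> \<tau> \<le> 3 * exp L \<longrightarrow> \<tau> \<notin> E \<longrightarrow> \<sigma> \<le> x \<longrightarrow>
         norm (sieved_zeta (sieve_level \<sigma> L) (Complex x \<tau>) - 1) \<le> C / L))"

text \<open>The prime sum is allowed the size \<open>R = sqrt L\<close>: Chebyshev's inequality then
  loses \<open>1 / L\<close> in measure. The Euler product and its inverse have size at most
  \<open>exp (O(sqrt L))\<close>, which the truncation error \<open>exp (- k)\<close> with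
  \<open>k\<close> about \<open>L / ln L\<close> still beats.\<close>

lemma zeta_sieve_typical:
  fixes \<sigma> :: real
  assumes \<sigma>: "1/2 < \<sigma>" "\<sigma> < 1"
  shows "\<exists>C>0. \<forall>\<^sub>F L in at_top. sieve_close \<sigma> C L"
proof -
  define A where "A = 12 / (2 * \<sigma> - 1)"
  define \<delta> where "\<delta> = (2 * \<sigma> - 1) / 8"
  \<comment> \<open>Makes the mollifier length \<open>Y ^ k\<close> at most
    \<open>T powr \<delta>\<close>, while \<open>N1 = sqrt T\<close> up to rounding saves
    \<open>T powr (- 2 * \<delta>)\<close>.\<close>
  define c where "c = \<delta> / (2 * A)"
  define V where "V = 2 * \<sigma> / (2 * \<sigma> - 1)"
  have pos: "0 < A" "0 < \<delta>" "0 < c" "0 < V" using \<sigma> by (auto simp: A_def \<delta>_def c_def V_def)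
  have A1: "1 \<le> A" using \<sigma> by (simp add: A_def)
  obtain K where KW: "weight_bound \<sigma> K" using weighted_coefficient_sum[OF \<sigma>(1)] by blast
  then have K: "0 < K" by (simp add: weight_bound_def)
  \<comment> \<open>\<open>50 * K\<close> is \<open>10 * K * (2 + 1 + 2)\<close> from the three
    exceptional sets; the other summands bound the distance from 1, with
    \<open>6 = 2 * (2 + 1)\<close> from \<open>mollify\<close>.\<close>
  define C where "C = 50 * K + 400000 / (1 - \<sigma>) + 6"
  have C: "0 < C" "50 * K \<le> C" "400000 / (1 - \<sigma>) + 6 \<le> C" "2 \<le> C" using K \<sigma> by (auto simp: C_def add_pos_pos)
  have ev1: "\<forall>\<^sub>F L in at_top. exp (1 - c * L / ln L) * exp (exp 1 * sqrt L + exp 2 * V / 2) * exp (sqrt L + 4 * V) \<le> 1 / (L::real)"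
    using pos by real_asymp
  have "0 < 2 * \<sigma> - 1" using \<sigma> by simp
  then have ev2: "\<forall>\<^sub>F L in at_top. exp (L * (- (2 * \<sigma> - 1))) * exp (sqrt L + 4 * V) \<le> 1 / (L::real)"
    using pos by real_asymp
  have ev3: "\<forall>\<^sub>F L in at_top. 1 + 4 * (2 * exp (L / 2)) * (1 + ln (2 * exp (L / 2))) / (5/2 * exp L) \<le> (2::real)" by real_asymp
  have ev4: "\<forall>\<^sub>F L in at_top. (1 + 8 * exp (L * \<delta>) * (1 + ln 4 + L * (1 + \<delta>))) * exp (- (2 * \<delta>) * L) * L^2 \<le> (1::real) / L"
    using pos by real_asymp
  have ev5: "\<forall>\<^sub>F L in at_top. L powr A + 1 < (exp (L / 2)::real)" using pos by real_asymp
  have ev6: "\<forall>\<^sub>F L in at_top. ln 2 + A * ln L < (c * L / ln L) * ln (2::real)" using pos by real_asymp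
  have ev7: "\<forall>\<^sub>F L in at_top. ln 2 \<le> A * ln (L::real)" using pos by real_asymp
  have "\<forall>\<^sub>F L in at_top. sieve_close \<sigma> C L"
    using ev1 ev2 ev3 ev4 ev5 ev6 ev7 eventually_ge_at_top[of 3]
  proof eventually_elim
    case (elim L)
    define T where "T = exp L"
    define Y where "Y = sieve_level \<sigma> L"
    define k where "k = nat \<lfloor>c * L / ln L\<rfloor>"
    define N where "N = nat \<lceil>3 * T\<rceil>"
    define N1 where "N1 = nat \<lceil>exp (L / 2)\<rceil>"
    have L: "3 \<le> L" "0 < L" "1 \<le> L" using elim by auto
    have lL: "0 < ln L" using L by simp
    have LA: "1 \<le> L powr A" "L \<le> L powr A" using L A1 powr_mono[of 1 A L] by (auto intro!: ge_one_powr_ge_zero)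
    have T: "4 \<le> T" using exp_ge_add_one_self[of L] L unfolding T_def by linarith
    have Yb: "L powr A \<le> real Y" "real Y \<le> 2 * L powr A" "real Y \<le> L powr A + 1"
      using sieve_level_ge[of L \<sigma>] sieve_level_le[OF L(3) \<sigma>(1)] by (auto simp: Y_def A_def sieve_level_def)
    have Y1: "1 \<le> Y" "L \<le> real Y" using Yb LA by auto
    have N: "3 * T \<le> real N" "real N \<le> 4 * T" using T by (auto simp: N_def) linarith+
    have eh: "exp (L / 2) * exp (L / 2) = T" by (simp add: T_def flip: exp_add)
    have e1: "1 \<le> exp (L / 2)" using L by simp
    have ehT: "exp (L / 2) \<le> T" unfolding eh[symmetric] using e1 by (simp add: mult_le_cancel_left1)
    have N1: "exp (L / 2) \<le> real N1" "real N1 \<le> exp (L / 2) + 1" by (auto simp: N1_def)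
    have N1': "real N1 \<le> 2 * exp (L / 2)" using N1 e1 by linarith
    have cL: "0 \<le> c * L / ln L" using pos L lL by auto
    have k: "c * L / ln L - 1 \<le> real k" "real k \<le> c * L / ln L" using cL by (auto simp: k_def)
    have YN1: "Y \<le> N1" using Yb(3) elim(5) N1(1) by linarith
    have "real N1 \<le> real N" using N1 ehT N T by linarith
    then have N1N: "N1 \<le> N" by simp
    have "real Y < real N" using Yb(3) elim(5) ehT N T by linarith
    then have YN: "Y < N" by simp
    have Yk1: "1 \<le> Y ^ k" using Y1 by simp
    have N1NY: "N1 \<le> N * Y ^ k" using order_trans[OF N1N, of "N * Y ^ k"] mult_le_mono2[OF Yk1, of N] unfolding mult_1_right by blast
    have lnY: "ln (real Y) \<le> ln 2 + A * ln L"
    proof -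
      have "ln (real Y) \<le> ln (2 * L powr A)" using Yb(2) Y1 L by (intro ln_mono) auto
      also have "... = ln 2 + A * ln L" using L by (simp add: ln_mult ln_powr)
      finally show ?thesis .
    qed
    have "ln (real Y) < ln (2 ^ Suc k)"
    proof -
      have "(c * L / ln L) * ln 2 \<le> (real k + 1) * ln 2" using k by (intro mult_right_mono) auto
      also have "... = ln (2 ^ Suc k)" using ln_realpow[of "2::real" "Suc k"] by (simp add: algebra_simps)
      finally show ?thesis using lnY elim(6) by linarith
    qed
    then have "real Y < 2 ^ Suc k" using Y1 by (subst (asm) ln_less_cancel_iff) auto
    then have Y2: "Y < 2 ^ Suc k" by (metis of_nat_less_iff of_nat_numeral of_nat_power)
    have ek: "exp (- real k) \<le> exp (1 - c * L / ln L)" using k by simp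
    have sm: "exp (- real k) * exp (exp 1 * sqrt L + exp 2 * V / 2) * exp (sqrt L + 4 * V) \<le> 1 / L"
      using order_trans[OF mult_right_mono[OF ek, of "exp (exp 1 * sqrt L + exp 2 * V / 2) * exp (sqrt L + 4 * V)"]] elim(1) by (simp only: mult.assoc exp_ge_zero mult_nonneg_nonneg)
    have "1 / L \<le> 1/2" using L by (simp add: field_simps)
    then have sm2: "exp (- real k) * exp (exp 1 * sqrt L + exp 2 * V / 2) * exp (sqrt L + 4 * V) \<le> 1/2" using sm by linarith
    have sL: "0 < sqrt L" "0 < 1 / L" using L by auto
    note ex = mollified_zeta_exceptional[OF \<sigma> KW T N Y1(1) YN Y2 YN1 N1NY sL, folded V_def, OF sm2]
    obtain E where E: "E \<in> sets borel"
      "measure (umeas (T / 2) (3 * T)) E \<le> 10 * K * (mvc (T / 2) (3 * T) N1 * real Y powr (1/2 - \<sigma>) / (1 / L)^2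
         + mvc (T / 2) (3 * T) (N * Y ^ k) * real N1 powr (1/2 - \<sigma>) / (1 / L)^2 + mvc (T / 2) (3 * T) Y / (sqrt L)^2)"
      "\<And>\<tau> x. T / 2 \<le> \<tau> \<Longrightarrow> \<tau> \<le> 3 * T \<Longrightarrow> \<tau> \<notin> E \<Longrightarrow> \<sigma> \<le> x \<Longrightarrow> x \<le> 2 \<Longrightarrow>
         norm (sieved_zeta Y (Complex x \<tau>) - 1) \<le> 400000 / (1 - \<sigma>) * real N powr (1 - 2 * \<sigma>) * exp (sqrt L + 4 * V)
           + 2 * (2 * (1 / L) + exp (- real k) * exp (exp 1 * sqrt L + exp 2 * V / 2) * exp (sqrt L + 4 * V))"
      using ex by blast
    have ab: "T / 2 < 3 * T" "3 * T - T / 2 = 5/2 * T" using T by auto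
    have m1: "mvc (T / 2) (3 * T) n \<le> 2" if "1 \<le> n" "n \<le> N1" for n
    proof -
      have "real n \<le> 2 * exp (L / 2)" using that N1' by (meson of_nat_le_iff order_trans)
      from order_trans[OF mvc_le[OF ab(1) that(1) this, unfolded ab(2)]] show ?thesis using elim(3) unfolding T_def by blast
    qed
    have t1: "mvc (T / 2) (3 * T) N1 * real Y powr (1/2 - \<sigma>) / (1 / L)^2 \<le> 2 / L"
    proof -
      have "12 * (1/2 - \<sigma>) / (2 * \<sigma> - 1) = - 6" using \<sigma> by (simp add: field_simps)
      then have "real Y powr (1/2 - \<sigma>) \<le> L powr (- 6)"
        using sieve_level_powr[of L "1/2 - \<sigma>" \<sigma>] L \<sigma> unfolding Y_def by simp
      also have "... = 1 / L ^ 6" using L by (simp add: powr_minus powr_numeral divide_inverse)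
      finally have "mvc (T / 2) (3 * T) N1 * real Y powr (1/2 - \<sigma>) / (1 / L)^2 \<le> 2 * (1 / L ^ 6) / (1 / L)^2"
        using m1[of N1] Y1 YN1 by (intro divide_right_mono mult_mono) auto
      also have "... = 2 / L ^ 4" using L by (simp add: field_simps flip: power_add)
      also have "... \<le> 2 / L" using L self_le_power[of L 4] by (intro divide_left_mono) auto
      finally show ?thesis .
    qed
    have t2: "mvc (T / 2) (3 * T) (N * Y ^ k) * real N1 powr (1/2 - \<sigma>) / (1 / L)^2 \<le> 1 / L"
    proof -
      have "real (Y ^ k) = exp (real k * ln (real Y))" using Y1 by (simp add: exp_of_nat_mult)
      also have "... \<le> exp (L * \<delta>)"
      proof -
        have "real k * ln (real Y) \<le> (c * L / ln L) * (2 * A * ln L)"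
          using k lnY elim(7) Y1 cL by (intro mult_mono) auto
        also have "... = L * \<delta>" using lL pos by (simp add: c_def)
        finally show ?thesis by simp
      qed
      finally have "real N * real (Y ^ k) \<le> (4 * T) * exp (L * \<delta>)" using N T by (intro mult_mono) auto
      then have "real (N * Y ^ k) \<le> 4 * (T * exp (L * \<delta>))" by simp
      then have "mvc (T / 2) (3 * T) (N * Y ^ k) \<le> 1 + 4 * (4 * (T * exp (L * \<delta>))) * (1 + ln (4 * (T * exp (L * \<delta>)))) / (3 * T - T / 2)"
        using ab(1) Yk1 Y1 YN by (intro mvc_le) auto
      also have "ln (4 * (T * exp (L * \<delta>))) = ln 4 + L * (1 + \<delta>)" by (simp add: ln_mult T_def algebra_simps)
      also have "1 + 4 * (4 * (T * exp (L * \<delta>))) * (1 + (ln 4 + L * (1 + \<delta>))) / (3 * T - T / 2) = 1 + 32/5 * exp (L * \<delta>) * (1 + ln 4 + L * (1 + \<delta>))"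
        unfolding ab(2) using T by (simp add: field_simps)
      also have "... \<le> 1 + 8 * exp (L * \<delta>) * (1 + ln 4 + L * (1 + \<delta>))"
        using L pos by (intro add_left_mono mult_right_mono) auto
      finally have mv: "mvc (T / 2) (3 * T) (N * Y ^ k) \<le> 1 + 8 * exp (L * \<delta>) * (1 + ln 4 + L * (1 + \<delta>))" .
      have "real N1 powr (1/2 - \<sigma>) \<le> exp (L / 2) powr (1/2 - \<sigma>)"
        using N1 \<sigma> by (intro powr_mono2') auto
      also have "... = exp (- (2 * \<delta>) * L)" by (simp add: powr_def \<delta>_def field_simps)
      finally have "mvc (T / 2) (3 * T) (N * Y ^ k) * real N1 powr (1/2 - \<sigma>) \<le> (1 + 8 * exp (L * \<delta>) * (1 + ln 4 + L * (1 + \<delta>))) * exp (- (2 * \<delta>) * L)"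
        using mv L pos by (intro mult_mono) auto
      then have "mvc (T / 2) (3 * T) (N * Y ^ k) * real N1 powr (1/2 - \<sigma>) * L^2 \<le> (1 + 8 * exp (L * \<delta>) * (1 + ln 4 + L * (1 + \<delta>))) * exp (- (2 * \<delta>) * L) * L^2"
        by (intro mult_right_mono) auto
      then show ?thesis using elim(4) by (simp add: power_divide)
    qed
    have t3: "mvc (T / 2) (3 * T) Y / (sqrt L)^2 \<le> 2 / L"
      using m1[OF Y1(1) YN1] L by (simp add: divide_right_mono)
    note E(2)
    also have "10 * K * (mvc (T / 2) (3 * T) N1 * real Y powr (1/2 - \<sigma>) / (1 / L)^2
         + mvc (T / 2) (3 * T) (N * Y ^ k) * real N1 powr (1/2 - \<sigma>) / (1 / L)^2 + mvc (T / 2) (3 * T) Y / (sqrt L)^2)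
      \<le> 10 * K * (2 / L + 1 / L + 2 / L)"
      using K t1 t2 t3 by (intro mult_left_mono add_mono) auto
    also have "... = 50 * K / L" by (simp add: field_simps)
    also have "... \<le> C / L" using C L by (intro divide_right_mono) auto
    finally have ms: "measure (umeas (T / 2) (3 * T)) E \<le> C / L" .
    have "norm (sieved_zeta Y (Complex x \<tau>) - 1) \<le> C / L"
      if \<tau>: "T / 2 \<le> \<tau>" "\<tau> \<le> 3 * T" "\<tau> \<notin> E" "\<sigma> \<le> x" for \<tau> x
    proof (cases "x \<le> 2")
      case True
      have "real N powr (1 - 2 * \<sigma>) \<le> T powr (1 - 2 * \<sigma>)" using N T \<sigma> by (intro powr_mono2') auto
      also have "... = exp (L * (- (2 * \<sigma> - 1)))" by (simp add: powr_def T_def algebra_simps)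
      finally have "real N powr (1 - 2 * \<sigma>) * exp (sqrt L + 4 * V) \<le> exp (L * (- (2 * \<sigma> - 1))) * exp (sqrt L + 4 * V)"
        by (intro mult_right_mono) auto
      then have "real N powr (1 - 2 * \<sigma>) * exp (sqrt L + 4 * V) \<le> 1 / L" using elim(2) by (rule order_trans)
      then have "400000 / (1 - \<sigma>) * (real N powr (1 - 2 * \<sigma>) * exp (sqrt L + 4 * V)) \<le> 400000 / (1 - \<sigma>) * (1 / L)"
        using \<sigma> by (intro mult_left_mono) auto
      then have "norm (sieved_zeta Y (Complex x \<tau>) - 1)
          \<le> 400000 / (1 - \<sigma>) * (1 / L) + 2 * (2 * (1 / L) + 1 / L)"
        using sm by (intro order_trans[OF E(3)[OF \<tau> True]] add_mono mult_left_mono) (simp_all only: mult.assoc order_refl zero_le_numeral)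
      also have "... = (400000 / (1 - \<sigma>) + 6) / L" by (simp add: add_divide_distrib)
      also have "... \<le> C / L" using C L by (intro divide_right_mono) auto
      finally show ?thesis .
    next
      case False
      \<comment> \<open>To the right of 2 absolute convergence takes over, and no height is
        exceptional.\<close>
      have "norm (sieved_zeta Y (Complex x \<tau>) - 1) \<le> 2 / (2 - 1) * real Y powr (1 - 2)"
        using False Y1 by (intro zeta_sieve_bound) auto
      also have "... = 2 / real Y" using Y1 by (simp add: powr_minus powr_one divide_inverse)
      also have "... \<le> 2 / L" using Y1 L by (intro divide_left_mono) auto
      also have "... \<le> C / L" using C L by (intro divide_right_mono) auto
      finally show ?thesis .
    qed
    then show ?case using ms E(1) unfolding sieve_close_def T_def Y_def by blast
  qed
  then show ?thesis using C(1) by blast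
qed

section \<open>Joint characteristic functions\<close>

lemma sum_coeff_le:
  assumes b: "\<And>p m. prime p \<Longrightarrow> 1 \<le> m \<Longrightarrow> norm (b p m) \<le> U * real p powr (- (real m * \<sigma>))" and "0 \<le> U" "0 \<le> \<sigma>"
  shows "(\<Sum>p\<in>primes_in 0 Y. \<Sum>m\<in>ppow Y p. norm (b p m :: complex)) \<le> U * (real Y)^2"
proof -
  have sub: "ppow Y p \<subseteq> {1..Y}" if "prime p" for p
  proof
    fix m assume m: "m \<in> ppow Y p"
    have "m < p ^ m" using prime_ge_2_nat[OF that] by (intro power_gt_expt) auto
    then show "m \<in> {1..Y}" using m by (auto simp: ppow_def)
  qed
  have "(\<Sum>p\<in>primes_in 0 Y. \<Sum>m\<in>ppow Y p. norm (b p m)) \<le> (\<Sum>p\<in>primes_in 0 Y. \<Sum>m\<in>ppow Y p. U)"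
  proof (intro sum_mono)
    fix p m assume p: "p \<in> primes_in 0 Y" and m: "m \<in> ppow Y p"
    have pr: "prime p" using p by (rule primes_inD)
    have "real p powr (- (real m * \<sigma>)) \<le> real p powr 0"
      using prime_gt_0_nat[OF pr] assms by (intro powr_mono) auto
    then have "U * real p powr (- (real m * \<sigma>)) \<le> U * 1" using assms prime_gt_0_nat[OF pr] by (intro mult_left_mono) auto
    then show "norm (b p m) \<le> U" using b[OF pr, of m] m by (simp add: ppow_def)
  qed
  also have "... \<le> (\<Sum>p\<in>primes_in 0 Y. U * real Y)"
  proof (intro sum_mono)
    fix p assume "p \<in> primes_in 0 Y"
    then have "card (ppow Y p) \<le> card {1..Y}" using sub by (intro card_mono) (auto dest: primes_inD)
    then show "(\<Sum>m\<in>ppow Y p. U) \<le> U * real Y" using assms by (simp add: mult.commute mult_left_mono)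
  qed
  also have "... \<le> U * (real Y)^2"
  proof -
    have "card (primes_in 0 Y) \<le> card {1..Y}" by (intro card_mono) (auto simp: primes_in_def)
    then have "real (card (primes_in 0 Y)) * (U * real Y) \<le> real Y * (U * real Y)" using assms by (intro mult_right_mono) auto
    then show ?thesis by (simp add: power2_eq_square mult_ac)
  qed
  finally show ?thesis .
qed

lemma gpoly_Dpoly_square:
  assumes "\<And>p m. prime p \<Longrightarrow> 1 \<le> m \<Longrightarrow> norm (b p m) \<le> U * real p powr (- (real m * \<sigma>))" "0 \<le> U" "0 \<le> \<sigma>" "1 \<le> Y"
  shows "gpoly Y (U * (real Y)^2) (Dpoly b Y)"
  using gpoly_weaken[OF gpoly_Dpoly[OF assms(4)] order_refl sum_coeff_le[OF assms(1-3)]] .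

lemma Dpoly_sum: "Dpoly (\<lambda>p m. \<Sum>j\<in>K. c j * b j p m) Y \<xi> = (\<Sum>j\<in>K. c j * Dpoly (b j) Y \<xi>)"
proof -
  have "Dpoly (\<lambda>p m. \<Sum>j\<in>K. c j * b j p m) Y \<xi> = (\<Sum>p\<in>primes_in 0 Y. \<Sum>m\<in>ppow Y p. \<Sum>j\<in>K. c j * (b j p m * \<xi> p ^ m))"
    unfolding Dpoly_def by (simp only: sum_distrib_right mult.assoc)
  also have "... = (\<Sum>p\<in>primes_in 0 Y. \<Sum>j\<in>K. \<Sum>m\<in>ppow Y p. c j * (b j p m * \<xi> p ^ m))"
    by (intro sum.cong refl sum.swap)
  also have "... = (\<Sum>j\<in>K. \<Sum>p\<in>primes_in 0 Y. \<Sum>m\<in>ppow Y p. c j * (b j p m * \<xi> p ^ m))" by (rule sum.swap)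
  finally show ?thesis unfolding Dpoly_def by (simp add: sum_distrib_left)
qed

lemma Dpoly_scale: "Dpoly (\<lambda>p m. c * b p m) Y \<xi> = c * Dpoly b Y \<xi>"
  using Dpoly_sum[where K = "{()}" and c = "\<lambda>_. c" and b = "\<lambda>_. b"] by simp

text \<open>The phase of a joint characteristic function. It is the real part of a single
  \<open>Dpoly\<close> with coefficients the sum over \<open>j\<close> of
  \<open>(u j - \<i> * v j) * zc (s j)\<close>, so the comparison for one prime sum applies to all
  \<open>2 * J\<close> coordinates at once.\<close>

definition lform :: "(nat \<Rightarrow> real) \<Rightarrow> (nat \<Rightarrow> real) \<Rightarrow> (nat \<Rightarrow> complex) \<Rightarrow> nat \<Rightarrow> nat \<Rightarrow> (nat \<Rightarrow> complex) \<Rightarrow> real" where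
  "lform u v s J Y \<xi> = (\<Sum>j=1..J. u j * Re (Dpoly (zc (s j)) Y \<xi>) + v j * Im (Dpoly (zc (s j)) Y \<xi>))"

lemma power_le_exp:
  fixes y :: real
  assumes "0 \<le> y"
  shows "y ^ n / fact n \<le> exp y"
proof -
  have s: "(\<lambda>n. y ^ n / fact n) sums exp y" using exp_converges[of y] by (simp add: divide_inverse mult.commute)
  have "(\<Sum>i\<in>{n}. y ^ i / fact i) \<le> (\<Sum>i. y ^ i / fact i)"
    using s assms by (intro sum_le_suminf) (auto simp: sums_iff)
  then show ?thesis using s by (simp add: sums_iff)
qed

text \<open>Scaling the argument by \<open>exp 1\<close> extracts the factor
  \<open>exp (- 2 * k)\<close> at the price of a slightly larger exponential moment.\<close>

lemma even_power_le_exp: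
  "x ^ (2 * k) / fact (2 * k) \<le> exp (- 2 * real k) * (exp (exp 1 * x) + exp (- (exp 1 * x)))" for x :: real
proof -
  have "x ^ (2 * k) / fact (2 * k) = exp (- 2 * real k) * ((exp 1 * \<bar>x\<bar>) ^ (2 * k) / fact (2 * k))"
  proof -
    have "(exp 1 * \<bar>x\<bar>) ^ (2 * k) = exp (2 * real k) * x ^ (2 * k)"
      by (simp add: power_mult_distrib exp_of_nat_mult[symmetric] power_even_abs mult.commute)
    then show ?thesis by (simp add: exp_minus)
  qed
  also have "... \<le> exp (- 2 * real k) * exp (exp 1 * \<bar>x\<bar>)"
    by (intro mult_left_mono power_le_exp) auto
  also have "... \<le> exp (- 2 * real k) * (exp (exp 1 * x) + exp (- (exp 1 * x)))"
    by (intro mult_left_mono) (auto simp: abs_if)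
  finally show ?thesis .
qed

context rmodel begin

text \<open>Coefficients of size \<open>U\<close> become at most \<open>3 * U\<close> because the
  argument is scaled by \<open>exp 1 \<le> 3\<close>; the two signs in
  \<open>even_power_le_exp\<close> give the factor 2.\<close>

lemma even_moment_le:
  assumes b: "\<And>p m. prime p \<Longrightarrow> 1 \<le> m \<Longrightarrow> norm (b p m) \<le> U * real p powr (- (real m * \<sigma>))"
    and "1/2 \<le> \<sigma>" "0 \<le> U" "1 \<le> Y"
  shows "expectation (\<lambda>w. Re (Dpoly b Y (Xs w)) ^ (2 * k)) / fact (2 * k) \<le> 2 * exp (- 2 * real k) *
    exp (4 * (3 * U) * (\<Sum>p\<in>primes_in 0 z. real p powr (- \<sigma>)) + (4 * (3 * U) + (3 * U)^2) * (\<Sum>p\<in>primes_in z Y. real p powr (- (2 * \<sigma>))))"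
proof -
  let ?D = "\<lambda>w. Dpoly b Y (Xs w)"
  let ?S = "4 * (3 * U) * (\<Sum>p\<in>primes_in 0 z. real p powr (- \<sigma>)) + (4 * (3 * U) + (3 * U)^2) * (\<Sum>p\<in>primes_in z Y. real p powr (- (2 * \<sigma>)))"
  have g: "gpoly Y (U * (real Y)^2) (Dpoly b Y)" using assms by (intro gpoly_Dpoly_square[where \<sigma> = \<sigma>]) auto
  have [measurable]: "?D \<in> borel_measurable M" using gpoly_measurable[OF g measurable_X] .
  define B where "B = U * (real Y)^2"
  have DB: "\<bar>Re (?D w)\<bar> \<le> B" for w
    using gpoly_bound[OF g, of "\<lambda>p. X p w"] norm_X abs_Re_le_cmod[of "?D w"] by (simp add: B_def)
  have B0: "0 \<le> B" using assms by (simp add: B_def)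
  have i1: "integrable M (\<lambda>w. Re (?D w) ^ (2 * k))"
  proof (rule integrable_const_bound[where B = "B ^ (2 * k)"])
    have "norm (Re (?D w) ^ (2 * k)) \<le> B ^ (2 * k)" for w unfolding norm_power using DB[of w] by (intro power_mono) auto
    then show "AE w in M. norm (Re (?D w) ^ (2 * k)) \<le> B ^ (2 * k)" by simp
  qed measurable
  have i2: "integrable M (\<lambda>w. exp (c * Re (?D w)))" for c
  proof (rule integrable_const_bound[where B = "exp (\<bar>c\<bar> * B)"])
    have "c * Re (?D w) \<le> \<bar>c\<bar> * B" for w
      using mult_left_mono[OF DB[of w], of "\<bar>c\<bar>"] abs_ge_self[of "c * Re (?D w)"] by (simp add: abs_mult)
    then show "AE w in M. norm (exp (c * Re (?D w))) \<le> exp (\<bar>c\<bar> * B)" by simp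
  qed measurable
  have e: "expectation (\<lambda>w. exp (c * Re (?D w))) \<le> exp ?S" if c: "\<bar>c\<bar> = exp 1" for c
  proof -
    have "expectation (\<lambda>w. exp (Re (Dpoly (\<lambda>p m. of_real c * b p m) Y (Xs w)))) \<le> exp ?S"
    proof (rule expect_exp_Dpoly)
      fix p m :: nat assume p: "prime p" "1 \<le> m"
      have "norm (of_real c * b p m) \<le> 3 * (U * real p powr (- (real m * \<sigma>)))"
        unfolding norm_mult norm_of_real c using b[OF p] exp_le by (intro mult_mono) auto
      then show "norm (of_real c * b p m) \<le> 3 * U * real p powr (- (real m * \<sigma>))" by simp
    qed (use assms in auto)
    then show ?thesis by (simp add: Dpoly_scale)
  qed
  have "expectation (\<lambda>w. Re (?D w) ^ (2 * k)) / fact (2 * k) = expectation (\<lambda>w. Re (?D w) ^ (2 * k) / fact (2 * k))" by simp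
  also have "... \<le> expectation (\<lambda>w. exp (- 2 * real k) * (exp (exp 1 * Re (?D w)) + exp (- exp 1 * Re (?D w))))"
  proof (rule integral_mono)
    show "integrable M (\<lambda>w. Re (?D w) ^ (2 * k) / fact (2 * k))" using i1 by simp
    show "integrable M (\<lambda>w. exp (- 2 * real k) * (exp (exp 1 * Re (?D w)) + exp (- exp 1 * Re (?D w))))" using i2 by (intro integrable_mult_right Bochner_Integration.integrable_add)
    show "Re (?D w) ^ (2 * k) / fact (2 * k) \<le> exp (- 2 * real k) * (exp (exp 1 * Re (?D w)) + exp (- exp 1 * Re (?D w)))" for w
      using even_power_le_exp[of "Re (?D w)" k] by simp
  qed
  also have "... = exp (- 2 * real k) * (expectation (\<lambda>w. exp (exp 1 * Re (?D w))) + expectation (\<lambda>w. exp (- exp 1 * Re (?D w))))"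
    using i2[of "exp 1"] i2[of "- exp 1"] by simp
  also have "... \<le> exp (- 2 * real k) * (exp ?S + exp ?S)"
    by (intro mult_left_mono add_mono e) auto
  finally show ?thesis by (simp add: mult_ac)
qed

definition cf_close :: "real \<Rightarrow> real \<Rightarrow> real \<Rightarrow> real \<Rightarrow> bool" where
  "cf_close \<sigma> c0 \<kappa> L \<longleftrightarrow> (\<forall>J s u v H. (\<forall>j\<in>{1..J}. \<sigma> \<le> Re (s j)) \<longrightarrow> (\<forall>j\<in>{1..J}. \<bar>u j\<bar> \<le> H \<and> \<bar>v j\<bar> \<le> H) \<longrightarrow>
    0 \<le> H \<longrightarrow> real J * H \<le> c0 * L powr \<sigma> \<longrightarrow>
    norm (integral\<^sup>L (tmeas (exp L)) (\<lambda>t. iexp (lform u v s J (sieve_level \<sigma> L) (tchar t)))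
      - expectation (\<lambda>w. iexp (lform u v s J (sieve_level \<sigma> L) (Xs w)))) \<le> exp (- \<kappa> * L / ln L))"

lemma characteristic_comparison:
  assumes \<sigma>: "1/2 < \<sigma>" "\<sigma> < 1"
  shows "\<exists>c0>0. c0 \<le> 1 \<and> (\<exists>\<kappa>>0. \<forall>\<^sub>F L in at_top. cf_close \<sigma> c0 \<kappa> L)"
proof -
  define A where "A = 12 / (2 * \<sigma> - 1)"
  \<comment> \<open>The error term contains \<open>(Y ^ 4) ^ (2 * k)\<close>. With
    \<open>ln Y \<le> 2 * A * ln L\<close> and \<open>k \<le> \<kappa> * L / ln L\<close> this is at
    most \<open>exp (16 * A * \<kappa> * L) = exp (L / 2)\<close>, the square root of
    \<open>T\<close>.\<close>
  define \<kappa> where "\<kappa> = 1 / (32 * A)"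
  have A: "2 \<le> A" using \<sigma> by (simp add: A_def field_simps)
  have \<kappa>: "0 < \<kappa>" using A by (simp add: \<kappa>_def)
  obtain C1 where C1: "0 < C1" "\<And>z. 2 \<le> z \<Longrightarrow> (\<Sum>p\<in>primes_in 0 z. real p powr (- \<sigma>)) \<le> C1 * z powr (1 - \<sigma>) / ln z"
    using sum_primes_head[of \<sigma>] \<sigma> by auto
  define C2 where "C2 = 6 / (1 - 2 powr (1 - 2 * \<sigma>))"
  have "2 powr (1 - 2 * \<sigma>) < (1::real)" using \<sigma> by (intro powr_less_one) auto
  then have C2: "0 < C2" by (simp add: C2_def)
  \<comment> \<open>Makes the exponent of the moment bound at most
    \<open>\<kappa> / 2 * L / ln L\<close>, a quarter of what the factor
    \<open>exp (- 2 * k)\<close> supplies. The 24 and 60 come from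
    \<open>U = 2 * c0 * L powr \<sigma>\<close>: \<open>24 = 4 * 3 * 2\<close>, and
    \<open>60 = 24 + 36\<close> with \<open>36 = (3 * 2)^2\<close>.\<close>
  define c0 where "c0 = min 1 (\<kappa> / (2 * (24 * C1 + 60 * C2)))"
  have c0: "0 < c0" "c0 \<le> 1" using \<kappa> C1 C2 by (auto simp: c0_def)
  have "c0 \<le> \<kappa> / (2 * (24 * C1 + 60 * C2))" by (simp add: c0_def)
  then have c0': "c0 * (24 * C1 + 60 * C2) \<le> \<kappa> / 2" using C1 C2 by (simp add: field_simps)
  have ev1: "\<forall>\<^sub>F L in at_top. 4 * exp (2 - 3/2 * \<kappa> * L / ln L) + (2 * \<kappa> * L / ln L + 1) * (2 * exp (- (L / 2))) \<le> exp (- \<kappa> * L / ln (L::real))"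
    using \<kappa> by real_asymp
  have ev2: "\<forall>\<^sub>F L in at_top. 1 \<le> \<kappa> * L / ln (L::real)" using \<kappa> by real_asymp
  have ev3: "\<forall>\<^sub>F L in at_top. ln 2 \<le> A * ln (L::real)" using A by real_asymp
  have "\<forall>\<^sub>F L in at_top. cf_close \<sigma> c0 \<kappa> L"
    using ev1 ev2 ev3 eventually_ge_at_top[of 3]
  proof eventually_elim
    case (elim L)
    note el = elim
    show ?case unfolding cf_close_def
    proof (intro allI impI, goal_cases)
    case (1 J s u v H)
    note s = 1(1) and uv = 1(2) and H = 1(3) and JH = 1(4)
    define Y where "Y = sieve_level \<sigma> L"
    define b where "b p m = (\<Sum>j=1..J. (of_real (u j) - \<i> * of_real (v j)) * zc (s j) p m)" for p m
    define U where "U = 2 * c0 * L powr \<sigma>"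
    define k where "k = nat \<lfloor>\<kappa> * L / ln L\<rfloor>"
    have L: "1 \<le> L" "0 < L" "0 < ln L" "2 \<le> L" using el by auto
    have Yb: "L powr A \<le> real Y" "real Y \<le> 2 * L powr A"
      using sieve_level_ge[of L \<sigma>] sieve_level_le[OF L(1) \<sigma>(1)] by (auto simp: Y_def A_def)
    have "L powr 2 \<le> L powr A" using L A by (intro powr_mono) auto
    then have LY: "L^2 \<le> real Y" using L Yb by (simp add: powr_numeral)
    have L2: "2 * L \<le> L^2" using L by (simp add: power2_eq_square)
    have Y1: "1 \<le> real Y" using LY L2 L by linarith
    have U0: "0 \<le> U" using c0 by (simp add: U_def)
    have Ls: "L powr \<sigma> \<le> L" using powr_mono[of \<sigma> 1 L] L \<sigma> by simp
    have "U \<le> 2 * 1 * L" unfolding U_def using c0 Ls L by (intro mult_mono) auto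
    then have UY: "U \<le> real Y" using L2 LY by linarith
    have bb: "norm (b p m) \<le> U * real p powr (- (real m * \<sigma>))" if p: "prime p" "1 \<le> m" for p m
    proof -
      have "norm (b p m) \<le> (\<Sum>j=1..J. (2 * H) * real p powr (- (real m * \<sigma>)))"
        unfolding b_def
      proof (intro sum_norm_le)
        fix j assume j: "j \<in> {1..J}"
        have "norm (of_real (u j) - \<i> * of_real (v j)) \<le> \<bar>u j\<bar> + \<bar>v j\<bar>"
          using norm_triangle_ineq4[of "of_real (u j)" "\<i> * of_real (v j)"] by (simp add: norm_mult)
        also have "... \<le> 2 * H" using uv j by fastforce
        finally show "norm ((of_real (u j) - \<i> * of_real (v j)) * zc (s j) p m) \<le> (2 * H) * real p powr (- (real m * \<sigma>))"
          unfolding norm_mult using s j p H by (intro mult_mono norm_zc_le) auto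
      qed
      also have "... = 2 * (real J * H) * real p powr (- (real m * \<sigma>))" by simp
      also have "... \<le> U * real p powr (- (real m * \<sigma>))" using JH unfolding U_def by (intro mult_right_mono) auto
      finally show ?thesis .
    qed
    have Re_D: "Re (Dpoly b Y \<xi>) = lform u v s J Y \<xi>" for \<xi>
      unfolding b_def Dpoly_sum lform_def by (simp add: algebra_simps)
    have Yn: "1 \<le> Y" using Y1 by simp
    have Y3: "U * (real Y)^2 \<le> real Y ^ 3" using UY U0 by (simp add: power3_eq_cube power2_eq_square mult_right_mono mult.assoc)
    have g: "gpoly Y (real Y ^ 3) (Dpoly b Y)"
      using gpoly_weaken[OF gpoly_Dpoly_square[OF bb U0 _ Yn] order_refl Y3] \<sigma> by auto
    have k: "\<kappa> * L / ln L - 1 \<le> real k" "real k \<le> \<kappa> * L / ln L" "0 < k" using el(2) by (auto simp: k_def)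
    have "norm (integral\<^sup>L (tmeas (exp L)) (\<lambda>t. iexp (Re (Dpoly b Y (tchar t)))) - expectation (\<lambda>w. iexp (Re (Dpoly b Y (Xs w)))))
      \<le> 2 * expectation (\<lambda>w. Re (Dpoly b Y (Xs w)) ^ (2 * k)) / fact (2 * k) + (2 * real k + 1) * (2 * (real Y ^ 3 * Y) ^ (2 * k) / exp L)"
      using iexp_compare[OF g, of "exp L" k] Y1 k by (simp add: of_nat_mult)
    also have "... \<le> 4 * exp (2 - 3/2 * \<kappa> * L / ln L) + (2 * \<kappa> * L / ln L + 1) * (2 * exp (- (L / 2)))"
    proof (intro add_mono)
      let ?S = "4 * (3 * U) * (\<Sum>p\<in>primes_in 0 L. real p powr (- \<sigma>)) + (4 * (3 * U) + (3 * U)^2) * (\<Sum>p\<in>primes_in L Y. real p powr (- (2 * \<sigma>)))"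
      have S1: "4 * (3 * U) * (\<Sum>p\<in>primes_in 0 L. real p powr (- \<sigma>)) \<le> c0 * (24 * C1) * (L / ln L)"
      proof -
        have "4 * (3 * U) * (\<Sum>p\<in>primes_in 0 L. real p powr (- \<sigma>)) \<le> 4 * (3 * U) * (C1 * L powr (1 - \<sigma>) / ln L)"
          using U0 C1 L by (intro mult_left_mono) auto
        also have "... = c0 * (24 * C1) * (L powr \<sigma> * L powr (1 - \<sigma>) / ln L)" by (simp add: U_def)
        also have "L powr \<sigma> * L powr (1 - \<sigma>) = L" using L by (simp flip: powr_add)
        finally show ?thesis .
      qed
      have S2: "(4 * (3 * U) + (3 * U)^2) * (\<Sum>p\<in>primes_in L Y. real p powr (- (2 * \<sigma>))) \<le> c0 * (60 * C2) * (L / ln L)"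
      proof -
        have "L powr \<sigma> \<le> L powr (2 * \<sigma>)" using L \<sigma> by (intro powr_mono) auto
        then have a: "4 * (3 * U) \<le> 24 * c0 * L powr (2 * \<sigma>)" using c0 by (simp add: U_def)
        have "(3 * U)^2 = 36 * c0 * c0 * L powr (2 * \<sigma>)" using L by (simp add: U_def power2_eq_square flip: powr_add)
        also have "... \<le> 36 * c0 * 1 * L powr (2 * \<sigma>)" using c0 by (intro mult_right_mono mult_left_mono) auto
        finally have "4 * (3 * U) + (3 * U)^2 \<le> 60 * c0 * L powr (2 * \<sigma>)" using a by simp
        moreover have "(\<Sum>p\<in>primes_in L Y. real p powr (- (2 * \<sigma>))) \<le> C2 * L powr (1 - 2 * \<sigma>) / ln L"
          unfolding C2_def using \<sigma> L by (intro sum_primes_tail) auto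
        ultimately have "(4 * (3 * U) + (3 * U)^2) * (\<Sum>p\<in>primes_in L Y. real p powr (- (2 * \<sigma>))) \<le> (60 * c0 * L powr (2 * \<sigma>)) * (C2 * L powr (1 - 2 * \<sigma>) / ln L)"
          using c0 by (intro mult_mono) (auto intro!: sum_nonneg)
        also have "... = c0 * (60 * C2) * (L powr (2 * \<sigma>) * L powr (1 - 2 * \<sigma>) / ln L)" by simp
        also have "L powr (2 * \<sigma>) * L powr (1 - 2 * \<sigma>) = L" using L by (simp flip: powr_add)
        finally show ?thesis .
      qed
      have "?S \<le> c0 * (24 * C1) * (L / ln L) + c0 * (60 * C2) * (L / ln L)" using S1 S2 by (rule add_mono)
      also have "... = (c0 * (24 * C1 + 60 * C2)) * (L / ln L)" by (simp add: algebra_simps)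
      also have "... \<le> \<kappa> / 2 * (L / ln L)" using c0' L by (intro mult_right_mono) auto
      finally have S: "?S \<le> \<kappa> / 2 * (L / ln L)" .
      have "2 * (expectation (\<lambda>w. Re (Dpoly b Y (Xs w)) ^ (2 * k)) / fact (2 * k)) \<le> 2 * (2 * exp (- 2 * real k) * exp ?S)"
        using \<sigma> U0 Yn by (intro mult_left_mono even_moment_le bb) auto
      also have "... = 4 * exp (- 2 * real k + ?S)" unfolding exp_add[of "- 2 * real k" ?S] by simp
      also have "... \<le> 4 * exp (2 - 3/2 * \<kappa> * L / ln L)"
      proof -
        have "- 2 * real k + ?S \<le> 2 - 2 * (\<kappa> * L / ln L) + \<kappa> / 2 * (L / ln L)" using S k(1) by linarith
        also have "... = 2 - 3/2 * \<kappa> * L / ln L" by (simp add: field_simps)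
        finally show ?thesis by simp
      qed
      finally show "2 * expectation (\<lambda>w. Re (Dpoly b Y (Xs w)) ^ (2 * k)) / fact (2 * k) \<le> 4 * exp (2 - 3/2 * \<kappa> * L / ln L)" by simp
      have lnY: "ln (real Y) \<le> 2 * A * ln L"
      proof -
        have "ln (real Y) \<le> ln (2 * L powr A)" using Yb(2) Y1 L by (intro ln_mono) auto
        also have "... = ln 2 + A * ln L" using L by (simp add: ln_mult ln_powr)
        finally show ?thesis using el(3) by linarith
      qed
      have "(real Y ^ 3 * real Y) ^ (2 * k) = real Y ^ (8 * k)" by (simp flip: power_Suc2 power_mult)
      also have "... = exp (8 * (real k * ln (real Y)))" using Y1 exp_of_nat_mult[of "8 * k" "ln (real Y)"] by (simp add: mult.assoc)
      also have "... \<le> exp (L / 2)"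
      proof -
        have "real k * ln (real Y) \<le> (\<kappa> * L / ln L) * (2 * A * ln L)" using k lnY Y1 el(2) by (intro mult_mono) auto
        also have "... = L / 16" using L A by (simp add: \<kappa>_def)
        finally show ?thesis by simp
      qed
      finally have "2 * (real Y ^ 3 * real Y) ^ (2 * k) / exp L \<le> 2 * exp (L / 2) / exp L" by (intro divide_right_mono) auto
      also have "... = 2 * exp (- (L / 2))"
      proof -
        have "exp L = exp (L / 2) * exp (L / 2)" by (simp flip: exp_add)
        then show ?thesis by (simp add: exp_minus inverse_eq_divide)
      qed
      finally have "(2 * real k + 1) * (2 * (real Y ^ 3 * real Y) ^ (2 * k) / exp L) \<le> (2 * \<kappa> * L / ln L + 1) * (2 * exp (- (L / 2)))"
        using k(2) el(2) by (intro mult_mono) auto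
      then show "(2 * real k + 1) * (2 * (real Y ^ 3 * real Y) ^ (2 * k) / exp L) \<le> (2 * \<kappa> * L / ln L + 1) * (2 * exp (- (L / 2)))" .
    qed
    also note el(1)
    finally show ?case unfolding Re_D unfolding Y_def .
    qed
  qed
  then show ?thesis using c0 \<kappa> by blast
qed

end

section \<open>Replacing the logarithms by prime sums at typical points\<close>

lemma measure_umeas: "a < b \<Longrightarrow> B \<in> sets borel \<Longrightarrow> measure (umeas a b) B = measure lborel ({a..b} \<inter> B) / (b - a)"
  unfolding umeas_def by (subst measure_uniform_measure) auto

lemma measure_tmeas: "0 < T \<Longrightarrow> B \<in> sets borel \<Longrightarrow> measure (tmeas T) B = measure lborel ({T..2 * T} \<inter> B) / T"
  by (simp add: measure_umeas)

text \<open>The translate of \<open>[T, 2 T]\<close> stays inside the interval from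
  \<open>T / 2\<close> to \<open>3 * T\<close>, which is \<open>5/2\<close> times as long.\<close>

lemma measure_tmeas_translate_le:
  assumes T: "0 < T" and h: "\<bar>h\<bar> \<le> T / 2" and E: "E \<in> sets borel"
  shows "measure (tmeas T) {t. h + t \<in> E} \<le> 3 * measure (umeas (T / 2) (3 * T)) E"
proof -
  have [measurable]: "E \<in> sets borel" by fact
  have fin: "emeasure lborel ({T / 2..3 * T} \<inter> E) < \<infinity>"
    by (rule le_less_trans[OF emeasure_mono[of _ "{T / 2..3 * T}"]]) (use T in \<open>auto simp: top.not_eq_extremum\<close>)
  have m: "{t. h + t \<in> E} \<in> sets borel" by measurable
  have "measure lborel ({T..2 * T} \<inter> {t. h + t \<in> E}) = measure lborel ((\<lambda>t. h + t) -` ({T + h..2 * T + h} \<inter> E) \<inter> space lborel)"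
    by (intro arg_cong[where f = "measure lborel"]) auto
  also have "... = measure (distr lborel borel ((+) h)) ({T + h..2 * T + h} \<inter> E)"
    by (subst measure_distr) auto
  also have "... = measure lborel ({T + h..2 * T + h} \<inter> E)" by (simp add: lborel_distr_plus)
  also have "... \<le> measure lborel ({T / 2..3 * T} \<inter> E)"
    using h fin by (intro measure_mono_fmeasurable) (auto simp: fmeasurable_def)
  finally have "measure (tmeas T) {t. h + t \<in> E} \<le> measure lborel ({T / 2..3 * T} \<inter> E) / T"
    using T m by (simp add: measure_tmeas divide_right_mono)
  also have "... \<le> 3 * (measure lborel ({T / 2..3 * T} \<inter> E) / (3 * T - T / 2))"
    using T measure_nonneg[of lborel "{T / 2..3 * T} \<inter> E"] by (simp add: field_simps)
  also have "... = 3 * measure (umeas (T / 2) (3 * T)) E" using T E by (subst measure_umeas) auto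
  finally show ?thesis .
qed

lemma zc_shift:
  assumes "prime p"
  shows "zc (s + \<i> * of_real t) p m = zc s p m * tchar t p ^ m"
proof -
  have p: "0 < p" using prime_gt_0_nat[OF assms] .
  have "(of_nat p :: complex) powr (- (s + \<i> * of_real t)) = of_nat p powr (- s) * tchar t p"
    unfolding tchar_def powr_conv_cis[OF p, symmetric] powr_add[symmetric] by (simp add: algebra_simps)
  then show ?thesis using assms by (simp add: zc_eq_power power_mult_distrib)
qed

lemma Dpoly_shift: "Dpoly (zc (s + \<i> * of_real t)) Y (\<lambda>_. 1) = Dpoly (zc s) Y (tchar t)"
  unfolding Dpoly_def by (intro sum.cong refl) (simp add: zc_shift primes_inD)

definition zeta_typical :: "real \<Rightarrow> real \<Rightarrow> real \<Rightarrow> bool" where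
  "zeta_typical \<sigma> C L \<longleftrightarrow> (\<forall>J s. (\<forall>j\<in>{1..J}. \<sigma> \<le> Re (s j)) \<longrightarrow> (\<forall>j\<in>{1..J}. \<bar>Im (s j)\<bar> \<le> exp L / 2) \<longrightarrow>
    (\<exists>E\<in>sets borel. measure (tmeas (exp L)) E \<le> C * real J / L \<and> (\<forall>t. t \<notin> E \<longrightarrow> exp L \<le> t \<and> t \<le> 2 * exp L \<and>
      (\<forall>j\<in>{1..J}. norm (log_zeta (s j + \<i> * of_real t) - Dpoly (zc (s j)) (sieve_level \<sigma> L) (tchar t)) \<le> C / L))))"

lemma log_zeta_typical:
  fixes \<sigma> :: real
  assumes \<sigma>: "1/2 < \<sigma>" "\<sigma> < 1"
  shows "\<exists>C>0. \<forall>\<^sub>F L in at_top. zeta_typical \<sigma> C L"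
proof -
  obtain C1 where C1: "0 < C1" and ev: "\<forall>\<^sub>F L in at_top. sieve_close \<sigma> C1 L"
    using zeta_sieve_typical[OF \<sigma>] by blast
  define C2 where "C2 = 4 * ((\<sigma> + 1/2) / (\<sigma> - 1/2))"
  have C2: "0 < C2" using \<sigma> by (simp add: C2_def)
  define A where "A = 12 / (2 * \<sigma> - 1)"
  have A: "2 \<le> A" using \<sigma> by (simp add: A_def field_simps)
  \<comment> \<open>The measure needs \<open>3 * C1\<close> because of the translation; the distance
    needs \<open>2 * C1 + C2\<close>, from the branch and from the prime powers.\<close>
  define C where "C = 3 * C1 + C2"
  have C: "0 < C" using C1 C2 by (simp add: C_def)
  have evC: "\<forall>\<^sub>F L in at_top. C1 / L < (1/2 :: real)" by real_asymp
  have "\<forall>\<^sub>F L in at_top. zeta_typical \<sigma> C L"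
    using ev evC eventually_ge_at_top[of 4]
  proof eventually_elim
    case (elim L)
    note d = elim(2) and L = elim(3)
    show ?case unfolding zeta_typical_def
    proof (intro allI impI, goal_cases)
    case (1 J s)
    note s = 1(1) and Ims = 1(2)
    obtain E where E: "E \<in> sets borel" "measure (umeas (exp L / 2) (3 * exp L)) E \<le> C1 / L"
      "\<And>\<tau> x. exp L / 2 \<le> \<tau> \<Longrightarrow> \<tau> \<le> 3 * exp L \<Longrightarrow> \<tau> \<notin> E \<Longrightarrow> \<sigma> \<le> x \<Longrightarrow>
         norm (sieved_zeta (sieve_level \<sigma> L) (Complex x \<tau>) - 1) \<le> C1 / L"
      using elim(1) unfolding sieve_close_def by blast
    define T where "T = exp L"
    define Y where "Y = sieve_level \<sigma> L"
    have T: "0 < T" by (simp add: T_def)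
    have Yb: "L powr A \<le> real Y" using sieve_level_ge[of L \<sigma>] by (simp add: Y_def A_def)
    have "L powr 2 \<le> L powr A" using L A by (intro powr_mono) auto
    then have "L^2 \<le> real Y" using L Yb by (simp add: powr_numeral)
    moreover have "(4::real)^2 \<le> L^2" using L by (intro power_mono) auto
    ultimately have Y: "10 \<le> Y" by simp
    have "12 * (- ((2 * \<sigma> - 1) / 4)) / (2 * \<sigma> - 1) = - 3" using \<sigma> by (simp add: field_simps)
    then have "real Y powr (- ((2 * \<sigma> - 1) / 4)) \<le> L powr (- 3)"
      using sieve_level_powr[of L "- ((2 * \<sigma> - 1) / 4)" \<sigma>] L \<sigma> unfolding Y_def by simp
    also have "... \<le> L powr (- 1)" using L by (intro powr_mono) auto
    also have "... = 1 / L" using L by (simp add: powr_minus divide_inverse)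
    finally have Ypow: "real Y powr (- ((2 * \<sigma> - 1) / 4)) \<le> 1 / L" .
    interpret U: prob_space "tmeas T" by (rule prob_space_tmeas[OF T])
    define F where "F j = {t. Im (s j) + t \<in> E}" for j
    have [measurable]: "E \<in> sets borel" by (rule E(1))
    have F: "F j \<in> sets borel" for j unfolding F_def by measurable
    \<comment> \<open>The complement of \<open>[T, 2 T]\<close> is a null set for
      \<open>tmeas T\<close>; including it confines every unexceptional \<open>t\<close> to that
      interval.\<close>
    define E1 where "E1 = - {T..2 * T} \<union> (\<Union>j\<in>{1..J}. F j)"
    have E1: "E1 \<in> sets borel" unfolding E1_def using F by (intro sets.Un sets.finite_UN) auto
    have "U.prob E1 \<le> U.prob (- {T..2 * T}) + U.prob (\<Union>j\<in>{1..J}. F j)"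
      unfolding E1_def using F by (intro measure_Un_le sets.finite_UN) auto
    also have "U.prob (- {T..2 * T}) = 0" using T by (subst measure_tmeas) auto
    also have "U.prob (\<Union>j\<in>{1..J}. F j) \<le> (\<Sum>j\<in>{1..J}. U.prob (F j))"
      using F by (intro measure_UNION_le) auto
    also have "... \<le> (\<Sum>j\<in>{1..J}. 3 * (C1 / L))"
    proof (intro sum_mono)
      fix j assume "j \<in> {1..J}"
      then have "U.prob (F j) \<le> 3 * measure (umeas (T / 2) (3 * T)) E"
        unfolding F_def using Ims T E by (intro measure_tmeas_translate_le) (auto simp: T_def)
      then show "U.prob (F j) \<le> 3 * (C1 / L)" using E(2) unfolding T_def by linarith
    qed
    also have "... = 3 * C1 * real J / L" by simp
    also have "... \<le> C * real J / L" using C2 L by (intro divide_right_mono mult_right_mono) (auto simp: C_def)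
    finally have m: "U.prob E1 \<le> C * real J / L" by simp
    have "T \<le> t \<and> t \<le> 2 * T \<and> (\<forall>j\<in>{1..J}. norm (log_zeta (s j + \<i> * of_real t) - Dpoly (zc (s j)) Y (tchar t)) \<le> C / L)"
      if t: "t \<notin> E1" for t
    proof (intro conjI ballI)
      show tT: "T \<le> t" "t \<le> 2 * T" using t by (auto simp: E1_def)
      fix j assume j: "j \<in> {1..J}"
      define z where "z = s j + \<i> * of_real t"
      have Imz: "T / 2 \<le> Im z" "Im z \<le> 3 * T" using Ims j tT unfolding T_def z_def by (auto dest!: bspec simp: abs_le_iff)
      have Rez: "\<sigma> \<le> Re z" using s j by (simp add: z_def)
      have nE: "Im z \<notin> E" using t j by (auto simp: E1_def F_def z_def)
      have 1: "norm (log_zeta z - euler_log z (real Y) (\<lambda>_. 1)) \<le> 2 * (C1 / L)"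
      proof (rule log_zeta_approx)
        show "norm (sieved_zeta Y (Complex x (Im z)) - 1) \<le> C1 / L"
          if "Re z \<le> x" for x
          using E(3)[of "Im z" x] Imz nE Rez that unfolding T_def Y_def by auto
      qed (use Rez \<sigma> Imz T Y d in auto)
      have "norm (euler_log z (real Y) (\<lambda>_. 1) - Dpoly (zc z) Y (\<lambda>_. 1)) \<le> C2 * real Y powr (- ((2 * \<sigma> - 1) / 4))"
        unfolding euler_log_def C2_def using \<sigma> Rez Y by (intro euler_log_truncate) auto
      also have "... \<le> C2 * (1 / L)" using C2 Ypow by (intro mult_left_mono) auto
      finally have 2: "norm (euler_log z (real Y) (\<lambda>_. 1) - Dpoly (zc z) Y (\<lambda>_. 1)) \<le> C2 / L" by simp
      have "norm (log_zeta z - Dpoly (zc z) Y (\<lambda>_. 1)) \<le> 2 * (C1 / L) + C2 / L"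
        using norm_triangle_ineq[of "log_zeta z - euler_log z (real Y) (\<lambda>_. 1)" "euler_log z (real Y) (\<lambda>_. 1) - Dpoly (zc z) Y (\<lambda>_. 1)"] 1 2 by simp
      also have "... = (2 * C1 + C2) / L" by (simp add: add_divide_distrib)
      also have "... \<le> C / L" using C1 L by (intro divide_right_mono) (auto simp: C_def)
      finally show "norm (log_zeta (s j + \<i> * of_real t) - Dpoly (zc (s j)) Y (tchar t)) \<le> C / L"
        unfolding z_def Dpoly_shift .
    qed
    then show ?case
      using m E1 unfolding T_def Y_def by (intro bexI[of _ E1]) auto
    qed
  qed
  then show ?thesis using C by blast
qed

context rmodel begin

definition model_typical :: "real \<Rightarrow> real \<Rightarrow> real \<Rightarrow> bool" where
  "model_typical \<sigma> C L \<longleftrightarrow> (\<forall>J s. (\<forall>j\<in>{1..J}. \<sigma> \<le> Re (s j)) \<longrightarrow>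
    (\<exists>E\<in>sets M. prob E \<le> real J / L \<and> (\<forall>w\<in>space M - E. \<forall>j\<in>{1..J}.
      norm (log_zeta_random (s j) X w - Dpoly (zc (s j)) (sieve_level \<sigma> L) (Xs w)) \<le> C / L)))"

lemma log_zeta_random_typical:
  fixes \<sigma> :: real
  assumes \<sigma>: "1/2 < \<sigma>" "\<sigma> < 1"
  shows "\<exists>C>0. \<forall>\<^sub>F L in at_top. model_typical \<sigma> C L"
proof -
  obtain C c where C: "0 < C" and c: "0 < c" and ra: "\<And>Y s. 1 \<le> Y \<Longrightarrow> \<sigma> \<le> Re s \<Longrightarrow>
    prob {w \<in> space M. C * real Y powr (- ((2 * \<sigma> - 1) / 4)) \<le> norm (log_zeta_random s X w - Dpoly (zc s) Y (Xs w))}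
      \<le> 4 * exp (- (c * real Y powr ((2 * \<sigma> - 1) / 2)))"
    using random_approximation[OF \<sigma>(1)] by blast
  define A where "A = 12 / (2 * \<sigma> - 1)"
  have A: "2 \<le> A" using \<sigma> by (simp add: A_def field_simps)
  have ev: "\<forall>\<^sub>F L in at_top. 4 * exp (- (c * L ^ 6)) \<le> 1 / (L::real)" using c by real_asymp
  have "\<forall>\<^sub>F L in at_top. model_typical \<sigma> C L"
    using ev eventually_ge_at_top[of 2]
  proof eventually_elim
    case (elim L)
    note el = elim(1) and L = elim(2)
    show ?case unfolding model_typical_def
    proof (intro allI impI, goal_cases)
    case (1 J s)
    note s = 1(1)
    define Y where "Y = sieve_level \<sigma> L"
    have Yb: "L powr A \<le> real Y" using sieve_level_ge[of L \<sigma>] by (simp add: Y_def A_def)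
    have "1 \<le> L powr A" using L A by (intro ge_one_powr_ge_zero) auto
    then have Y1: "1 \<le> Y" using Yb by simp
    have "12 * (- ((2 * \<sigma> - 1) / 4)) / (2 * \<sigma> - 1) = - 3" using \<sigma> by (simp add: field_simps)
    then have "real Y powr (- ((2 * \<sigma> - 1) / 4)) \<le> L powr (- 3)"
      using sieve_level_powr[of L "- ((2 * \<sigma> - 1) / 4)" \<sigma>] L \<sigma> unfolding Y_def by simp
    also have "... \<le> L powr (- 1)" using L by (intro powr_mono) auto
    also have "... = 1 / L" using L by (simp add: powr_minus divide_inverse)
    finally have Ypow: "real Y powr (- ((2 * \<sigma> - 1) / 4)) \<le> 1 / L" .
    have Y6: "L ^ 6 \<le> real Y powr ((2 * \<sigma> - 1) / 2)"
    proof -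
      have "A * ((2 * \<sigma> - 1) / 2) = 6" using \<sigma> by (simp add: A_def field_simps)
      then have "(L powr A) powr ((2 * \<sigma> - 1) / 2) = L powr 6" by (simp only: powr_powr)
      moreover have "(L powr A) powr ((2 * \<sigma> - 1) / 2) \<le> real Y powr ((2 * \<sigma> - 1) / 2)"
        using Yb \<sigma> by (intro powr_mono2) auto
      ultimately show ?thesis using L by (simp add: powr_numeral)
    qed
    define F where "F j = {w \<in> space M. C * real Y powr (- ((2 * \<sigma> - 1) / 4)) \<le> norm (log_zeta_random (s j) X w - Dpoly (zc (s j)) Y (Xs w))}" for j
    have [measurable]: "(\<lambda>w. Dpoly (zc z) Y (Xs w)) \<in> borel_measurable M" for z
      using gpoly_measurable[OF gpoly_Dpoly[OF Y1] measurable_X] .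
    have F: "F j \<in> sets M" for j unfolding F_def by measurable
    have "prob (\<Union>j\<in>{1..J}. F j) \<le> (\<Sum>j\<in>{1..J}. prob (F j))" using F by (intro measure_UNION_le) auto
    also have "... \<le> (\<Sum>j\<in>{1..J}. 1 / L)"
    proof (intro sum_mono)
      fix j assume "j \<in> {1..J}"
      then have "prob (F j) \<le> 4 * exp (- (c * real Y powr ((2 * \<sigma> - 1) / 2)))" unfolding F_def using s Y1 by (intro ra) auto
      also have "... \<le> 4 * exp (- (c * L ^ 6))" using Y6 c by simp
      finally show "prob (F j) \<le> 1 / L" using el by simp
    qed
    finally have pr: "prob (\<Union>j\<in>{1..J}. F j) \<le> real J / L" by simp
    have "norm (log_zeta_random (s j) X w - Dpoly (zc (s j)) Y (Xs w)) \<le> C / L"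
      if "w \<in> space M - (\<Union>j\<in>{1..J}. F j)" "j \<in> {1..J}" for w j
    proof -
      have "norm (log_zeta_random (s j) X w - Dpoly (zc (s j)) Y (Xs w)) \<le> C * real Y powr (- ((2 * \<sigma> - 1) / 4))"
        using that by (auto simp: F_def not_le intro: less_imp_le)
      also have "... \<le> C * (1 / L)" using C Ypow by (intro mult_left_mono) auto
      finally show ?thesis by simp
    qed
    then show ?case
      using pr F unfolding Y_def by (intro bexI[of _ "\<Union>j\<in>{1..J}. F j"]) auto
    qed
  qed
  then show ?thesis using C by blast
qed

end

section \<open>The bound for the discrepancy\<close>

context rmodel begin

definition discrepancy_small :: "real \<Rightarrow> real \<Rightarrow> real \<Rightarrow> bool" where
  "discrepancy_small \<sigma> C L \<longleftrightarrow> (\<forall>J s. 1 \<le> J \<longrightarrow> real J \<le> L powr (\<sigma> / 2) \<longrightarrow>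
    (\<forall>j\<in>{1..J}. \<sigma> \<le> Re (s j) \<and> Re (s j) \<le> 1 \<and> \<bar>Im (s j)\<bar> \<le> exp (L * ((\<sigma> - 1/2) / 4))) \<longrightarrow>
    discrepancy M X (exp L) J s \<le> C * (real J)^2 / L powr \<sigma>)"

text \<open>The period \<open>P\<close> is dictated by the size of the prime sums and the degree
  \<open>n\<close> by the frequency budget. Then \<open>P / n\<close> is of order
  \<open>J / L powr \<sigma>\<close>, which for large \<open>L\<close> exceeds the approximation
  errors \<open>O(1 / L)\<close> because \<open>\<sigma> < 1\<close>.\<close>

lemma discrepancy_bound:
  fixes \<sigma> :: real
  assumes \<sigma>: "1/2 < \<sigma>" "\<sigma> < 1"
  shows "\<exists>C. \<forall>\<^sub>F L in at_top. discrepancy_small \<sigma> C L"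
proof -
  define A where "A = 12 / (2 * \<sigma> - 1)"
  have A: "12 \<le> A" using \<sigma> by (simp add: A_def field_simps)
  obtain c0 \<kappa> where c0: "0 < c0" "c0 \<le> 1" and \<kappa>: "0 < \<kappa>" and evch: "\<forall>\<^sub>F L in at_top. cf_close \<sigma> c0 \<kappa> L"
    using characteristic_comparison[OF \<sigma>] by blast
  obtain Cz where Cz: "0 < Cz" and evz: "\<forall>\<^sub>F L in at_top. zeta_typical \<sigma> Cz L"
    using log_zeta_typical[OF \<sigma>] by blast
  obtain Cr where Cr: "0 < Cr" and evr: "\<forall>\<^sub>F L in at_top. model_typical \<sigma> Cr L"
    using log_zeta_random_typical[OF \<sigma>] by blast
  obtain Cd where Cd: "0 < Cd" and dec: "\<And>Y u s w. norm w = 1 \<Longrightarrow> 1/2 \<le> Re s \<Longrightarrow> Re s \<le> 1 \<Longrightarrow> 40 * u^2 \<le> real Y \<Longrightarrow>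
     norm (expectation (\<lambda>\<omega>. iexp (u * Re (w * Dpoly (zc s) Y (Xs \<omega>))))) \<le> Cd / (1 + u^2)"
    using char_decay by blast
  define Cm where "Cm = max Cz Cr"
  define C where "C = Cz + 1 + 2 * (600 * pi^2 * (72 * Cd * (8 * pi / c0) + 12)) + 1"
  have "1 - \<sigma> > 0" using \<sigma> by simp
  then have e5: "\<forall>\<^sub>F L in at_top. Cm / L \<le> 4 * pi / (c0 * L powr \<sigma>)"
    using c0 pi_gt_zero by real_asymp
  have e4: "\<forall>\<^sub>F L in at_top. 9 \<le> c0 * (8 * (L^2)^2) / (4 * pi * (L::real))" using c0 pi_gt_zero by real_asymp
  have "2 < A" using A by simp
  then have e6: "\<forall>\<^sub>F L in at_top. 40 * L^2 \<le> L powr A" by real_asymp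
  have e7: "\<forall>\<^sub>F L in at_top. exp (- \<kappa> * L / ln L) \<le> 1 / (L::real)" using \<kappa> by real_asymp
  have "0 < 2 * A + 2" using A by simp
  then have e9: "\<forall>\<^sub>F L in at_top. exp (2 * sqrt L * ((2 * A + 2) * ln L)) * exp (- \<kappa> * L / ln L) \<le> 1 / (L::real)"
    using \<kappa> A by real_asymp
  define r where "r = 1 - (\<sigma> - 1/2) / 4"
  have "0 < r" using \<sigma> by (simp add: r_def)
  then have "\<forall>\<^sub>F L in at_top. exp (- (r * L)) \<le> (1/2 :: real)" by real_asymp
  then have e10: "\<forall>\<^sub>F L in at_top. exp (L * ((\<sigma> - 1/2) / 4)) \<le> exp L / 2"
  proof eventually_elim
    case (elim L)
    have "L * ((\<sigma> - 1/2) / 4) = L + - (r * L)" by (simp add: r_def algebra_simps)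
    then have "exp (L * ((\<sigma> - 1/2) / 4)) = exp L * exp (- (r * L))" by (simp only: exp_add)
    then show ?case using mult_left_mono[OF elim, of "exp L"] by simp
  qed
  have "\<forall>\<^sub>F L in at_top. discrepancy_small \<sigma> C L"
    using evch evz evr e4 e5 e6 e7 e9 e10 eventually_ge_at_top[of 640]
  proof eventually_elim
    case (elim L)
    note ch = elim(1) and zt = elim(2) and rt = elim(3) and f4 = elim(4) and f5 = elim(5) and f6 = elim(6) and f7 = elim(7)
      and f9 = elim(8) and f10 = elim(9) and L640 = elim(10)
    show ?case unfolding discrepancy_small_def
    proof (intro allI impI, goal_cases)
    case (1 J s)
    note J = 1(1,2) and s = 1(3)
    define T where "T = exp L"
    define Y where "Y = sieve_level \<sigma> L"
    define \<eta> where "\<eta> = exp (- \<kappa> * L / ln L)"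
    \<comment> \<open>The prime sums are at most \<open>Y^2\<close>, an eighth of the
      period.\<close>
    define P where "P = 8 * (real Y)^2"
    \<comment> \<open>The largest real degree for which \<open>J\<close> times the top frequency
      \<open>4 * pi * x / P\<close> stays within \<open>c0 * L powr \<sigma>\<close>.\<close>
    define x where "x = c0 * P * L powr \<sigma> / (4 * pi * real J)"
    define n where "n = nat \<lfloor>x\<rfloor>"
    define H where "H = 4 * pi * real n / P"
    have T: "0 < T" by (simp add: T_def)
    have L: "1 \<le> L" "0 < L" using L640 by auto
    have Yb: "L powr A \<le> real Y" "real Y \<le> 2 * L powr A"
      using sieve_level_ge[of L \<sigma>] sieve_level_le[OF L(1) \<sigma>(1)] by (auto simp: Y_def A_def)
    have Y40: "40 * L^2 \<le> real Y" using Yb f6 by linarith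
    have YL: "L^2 \<le> real Y" using Y40 zero_le_power2[of L] by linarith
    have "1 \<le> L^2" using L by (simp add: one_le_power)
    then have Y1: "1 \<le> real Y" "1 \<le> Y" using YL by auto
    have P1: "1 \<le> P" using one_le_power[OF Y1(1), of 2] unfolding P_def by linarith
    have Ls: "1 \<le> L powr \<sigma>" "L powr \<sigma> \<le> L" using L \<sigma> powr_mono[of \<sigma> 1 L] by (auto intro!: ge_one_powr_ge_zero)
    have Js: "real J \<le> sqrt L" "real J \<le> L"
    proof -
      have "L powr (\<sigma> / 2) \<le> L powr (1/2)" using L \<sigma> by (intro powr_mono) auto
      then show "real J \<le> sqrt L" using J L by (simp add: powr_half_sqrt)
      also have "sqrt L \<le> L" using L by (simp add: sqrt_le_D real_le_lsqrt power2_eq_square)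
      finally show "real J \<le> L" .
    qed
    have J0: "0 < real J" "1 \<le> real J" using J by auto
    have x9: "9 \<le> x"
    proof -
      have "(L^2)^2 \<le> (real Y)^2" using YL by (intro power_mono) auto
      then have "c0 * (8 * (L^2)^2) / (4 * pi * L) \<le> c0 * P / (4 * pi * real J)"
        unfolding P_def using c0 J0 Js by (intro frac_le mult_left_mono) auto
      also have "... \<le> c0 * P * L powr \<sigma> / (4 * pi * real J)"
        using mult_left_mono[OF Ls(1), of "c0 * P"] c0 P1 J0 by (intro divide_right_mono) auto
      finally show ?thesis using f4 unfolding x_def by linarith
    qed
    have n: "8 \<le> n" "real n \<le> x" "x / 2 \<le> real n"
    proof -
      show nx: "real n \<le> x" unfolding n_def using x9 by simp
      have "x - 1 \<le> real n" unfolding n_def using x9 by linarith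
      then show "x / 2 \<le> real n" "8 \<le> n" using x9 by linarith+
    qed
    have n0: "0 < real n" using n by simp
    have x0: "0 < x" using x9 by simp
    have JH: "real J * H \<le> c0 * L powr \<sigma>"
    proof -
      have "real J * H = (4 * pi * real J / P) * real n" by (simp add: H_def)
      also have "... \<le> (4 * pi * real J / P) * x" using n P1 J0 by (intro mult_left_mono) auto
      also have "... = c0 * L powr \<sigma>" using P1 J0 by (simp add: x_def)
      finally show ?thesis .
    qed
    have H0: "0 \<le> H" using P1 by (simp add: H_def)
    have HL: "H \<le> L"
    proof -
      have "1 * H \<le> real J * H" using J0 H0 by (intro mult_right_mono) auto
      moreover have "c0 * L powr \<sigma> \<le> 1 * L" using c0 Ls by (intro mult_mono) auto
      ultimately show ?thesis using JH by linarith
    qed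
    have Pn: "P / real n \<le> 8 * pi / c0 * (real J / L powr \<sigma>)"
    proof -
      have "P / real n \<le> P / (x / 2)" using n x0 P1 by (intro divide_left_mono) auto
      also have "... = 8 * pi / c0 * (real J / L powr \<sigma>)" using c0 P1 J0 Ls by (simp add: x_def field_simps)
      finally show ?thesis .
    qed
    have CmP: "Cm / L \<le> P / real n"
    proof -
      have "4 * pi / (c0 * L powr \<sigma>) \<le> 4 * pi * real J / (c0 * L powr \<sigma>)"
        using J0 c0 Ls by (intro divide_right_mono) auto
      also have "... = P / x" using c0 P1 J0 Ls by (simp add: x_def field_simps)
      also have "... \<le> P / real n" using n n0 x0 P1 by (intro divide_left_mono) auto
      finally show ?thesis using f5 by linarith
    qed
    have sR: "\<forall>j\<in>{1..J}. \<sigma> \<le> Re (s j)" and sI: "\<forall>j\<in>{1..J}. \<bar>Im (s j)\<bar> \<le> T / 2"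
      using s f10 by (auto simp: T_def intro: order_trans[OF _ f10])
    obtain E1 where E1: "E1 \<in> sets borel" "measure (tmeas T) E1 \<le> Cz * real J / L"
      "\<And>t. t \<notin> E1 \<Longrightarrow> T \<le> t \<and> t \<le> 2 * T" "\<And>t j. t \<notin> E1 \<Longrightarrow> j \<in> {1..J} \<Longrightarrow> norm (log_zeta (s j + \<i> * of_real t) - Dpoly (zc (s j)) Y (tchar t)) \<le> Cz / L"
      using zt[unfolded zeta_typical_def, rule_format, of J s] sR sI unfolding T_def Y_def by blast
    obtain E2 where E2: "E2 \<in> sets M" "prob E2 \<le> real J / L"
      "\<And>\<omega> j. \<omega> \<in> space M - E2 \<Longrightarrow> j \<in> {1..J} \<Longrightarrow> norm (log_zeta_random (s j) X \<omega> - Dpoly (zc (s j)) Y (Xs \<omega>)) \<le> Cr / L"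
      using rt[unfolded model_typical_def, rule_format, of J s] sR unfolding Y_def by blast
    define part where "part c z = (if c then Re z else Im z)" for c :: bool and z :: complex
    have part_le: "\<bar>part c z\<bar> \<le> norm z" and part_diff: "part c z - part c w = part c (z - w)" for c z w
      by (auto simp: part_def abs_Re_le_cmod abs_Im_le_cmod)
    have [measurable]: "part c \<in> borel_measurable borel" for c
      unfolding part_def[abs_def] by (cases c) auto
    \<comment> \<open>One real coordinate for each point and each choice of real or imaginary
      part.\<close>
    define K where "K = {1..J} \<times> (UNIV :: bool set)"
    define Z1 where "Z1 k t = part (snd k) (Dpoly (zc (s (fst k))) Y (tchar t))" for k t
    define Z2 where "Z2 k \<omega> = part (snd k) (Dpoly (zc (s (fst k))) Y (Xs \<omega>))" for k \<omega>
    \<comment> \<open>The value 0 outside \<open>[T, 2 T]\<close> is arbitrary: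
      \<open>tmeas T\<close> does not see it, and measurability has to be shown on the interval
      alone.\<close>
    define W1 where "W1 k t = (if t \<in> {T..2 * T} then part (snd k) (log_zeta (s (fst k) + \<i> * of_real t)) else 0)" for k t
    define W2 where "W2 k \<omega> = part (snd k) (log_zeta_random (s (fst k)) X \<omega>)" for k \<omega>
    have cK: "card K = 2 * J" by (simp add: K_def)
    have sumK: "(\<Sum>k\<in>K. u k * part (snd k) (Dpoly (zc (s (fst k))) Y \<xi>)) = lform (\<lambda>j. u (j, True)) (\<lambda>j. u (j, False)) s J Y \<xi>" for u \<xi>
    proof -
      have "(\<Sum>k\<in>K. u k * part (snd k) (Dpoly (zc (s (fst k))) Y \<xi>)) = (\<Sum>j=1..J. \<Sum>c\<in>UNIV. u (j, c) * part c (Dpoly (zc (s j)) Y \<xi>))"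
        unfolding K_def by (simp add: sum.cartesian_product case_prod_unfold)
      then show ?thesis by (simp add: lform_def UNIV_bool part_def add.commute)
    qed
    have g: "gpoly Y ((real Y)^2) (Dpoly (zc (s j)) Y)" if "j \<in> {1..J}" for j
      using gpoly_Dpoly_square[of "zc (s j)" 1 \<sigma> Y] norm_zc_le that sR \<sigma> Y1 by auto
    have Dle: "norm (Dpoly (zc (s j)) Y \<xi>) \<le> P / 8" if "j \<in> {1..J}" "\<And>p. prime p \<Longrightarrow> norm (\<xi> p) = 1" for j \<xi>
      using gpoly_bound[OF g[OF that(1)] that(2)] by (simp add: P_def)
    have main: "\<bar>1 / T * measure lebesgue {t \<in> {T..2 * T}. \<forall>j\<in>{1..J}. log_zeta (s j + \<i> * of_real t) \<in> R j}
         - measure M {\<omega> \<in> space M. \<forall>j\<in>{1..J}. log_zeta_random (s j) X \<omega> \<in> R j}\<bar> \<le> C * (real J)^2 / L powr \<sigma>"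
      if R: "\<forall>j\<in>{1..J}. rectangle (R j)" for R
    proof -
      have "\<forall>j\<in>{1..J}. \<exists>AB. is_interval (fst AB) \<and> is_interval (snd AB) \<and> R j = {z. Re z \<in> fst AB \<and> Im z \<in> snd AB}"
        using R unfolding rectangle_def by fastforce
      then obtain AB where AB: "\<And>j. j \<in> {1..J} \<Longrightarrow> is_interval (fst (AB j)) \<and> is_interval (snd (AB j)) \<and> R j = {z. Re z \<in> fst (AB j) \<and> Im z \<in> snd (AB j)}"
        by metis
      define S where "S k = (if snd k then fst (AB (fst k)) else snd (AB (fst k)))" for k :: "nat \<times> bool"
      have S_iv: "is_interval (S k)" if "k \<in> K" for k using AB that by (auto simp: S_def K_def)
      have S_R: "(\<forall>k\<in>K. part (snd k) (f (fst k)) \<in> S k) \<longleftrightarrow> (\<forall>j\<in>{1..J}. f j \<in> R j)" for f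
      proof -
        have "(\<forall>k\<in>K. part (snd k) (f (fst k)) \<in> S k) \<longleftrightarrow> (\<forall>j\<in>{1..J}. \<forall>c. part c (f j) \<in> S (j, c))"
          by (auto simp: K_def)
        also have "... \<longleftrightarrow> (\<forall>j\<in>{1..J}. f j \<in> R j)"
          using AB by (intro ball_cong refl) (auto simp: all_bool_eq part_def S_def)
        finally show ?thesis .
      qed
      define G where "G = {t \<in> {T..2 * T}. \<forall>j\<in>{1..J}. log_zeta (s j + \<i> * of_real t) \<in> R j}"
      have sp: "0 < T + Im (s j)" if "j \<in> {1..J}" for j using bspec[OF sI that] T by (auto simp: abs_le_iff)
      have "0 < Re (s j)" if "j \<in> {1..J}" for j using bspec[OF sR that] \<sigma> by linarith
      then have G: "G \<in> sets borel" unfolding G_def using sp R by (intro log_zeta_set_borel) auto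
      define EV where "EV = {t \<in> space (tmeas T). \<forall>k\<in>K. W1 k t \<in> S k}"
      have EV_eq: "EV = G \<union> (if \<forall>k\<in>K. 0 \<in> S k then - {T..2 * T} else {})"
      proof (rule Set.set_eqI)
        fix t
        show "t \<in> EV \<longleftrightarrow> t \<in> G \<union> (if \<forall>k\<in>K. 0 \<in> S k then - {T..2 * T} else {})"
        proof (cases "t \<in> {T..2 * T}")
          case True
          then have "t \<in> EV \<longleftrightarrow> (\<forall>k\<in>K. part (snd k) (log_zeta (s (fst k) + \<i> * of_real t)) \<in> S k)"
            unfolding EV_def W1_def by simp
          also have "... \<longleftrightarrow> t \<in> G" using True unfolding S_R[of "\<lambda>j. log_zeta (s j + \<i> * of_real t)"] G_def by simp
          finally show ?thesis using True by simp
        next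
          case False
          then have "t \<in> EV \<longleftrightarrow> (\<forall>k\<in>K. 0 \<in> S k)" unfolding EV_def W1_def by auto
          moreover have "t \<notin> G" using False unfolding G_def by auto
          ultimately show ?thesis using False by auto
        qed
      qed
      have EVm: "EV \<in> sets (tmeas T)" unfolding EV_eq using G by auto
      have "{T..2 * T} \<inter> EV = G" unfolding EV_eq by (auto simp: G_def)
      then have mEV: "measure (tmeas T) EV = 1 / T * measure lebesgue G"
        using T EVm G by (simp add: measure_tmeas)
      define EW where "EW = {\<omega> \<in> space M. \<forall>k\<in>K. W2 k \<omega> \<in> S k}"
      have EW_eq: "EW = {\<omega> \<in> space M. \<forall>j\<in>{1..J}. log_zeta_random (s j) X \<omega> \<in> R j}"
      proof -
        have "(\<forall>k\<in>K. W2 k \<omega> \<in> S k) \<longleftrightarrow> (\<forall>j\<in>{1..J}. log_zeta_random (s j) X \<omega> \<in> R j)" for \<omega>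
          unfolding W2_def by (rule S_R)
        then show ?thesis unfolding EW_def by simp
      qed
      have EWm: "EW \<in> sets M"
      proof -
        have "W2 k -` S k \<inter> space M \<in> sets M" if "k \<in> K" for k
        proof (rule measurable_sets[of _ _ borel])
          show "W2 k \<in> borel_measurable M" unfolding W2_def[abs_def] by measurable
          show "S k \<in> sets borel" using S_iv[OF that] by (rule real_interval_borel_measurable)
        qed
        then have "{\<omega> \<in> space M. \<forall>k\<in>K. W2 k \<omega> \<in> S k} \<in> sets M"
          unfolding K_def by (intro sets.sets_Collect_finite_All) (auto simp: vimage_def Int_def conj_commute)
        then show ?thesis by (simp add: EW_def)
      qed
      have "\<bar>measure (tmeas T) {t \<in> space (tmeas T). \<forall>k\<in>K. W1 k t \<in> S k} - measure M {\<omega> \<in> space M. \<forall>k\<in>K. W2 k \<omega> \<in> S k}\<bar>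
        \<le> measure (tmeas T) E1 + measure M E2 + card K * (600 * pi^2 * (72 * Cd * P / n + 12 * \<eta>)) + (4 * (4 * n + 1)) ^ card K * \<eta>"
      proof (rule rectangle_comparison[where ?Z1.0 = Z1 and ?Z2.0 = Z2])
        show "prob_space (tmeas T)" by (rule prob_space_tmeas[OF T])
        show "prob_space M" by (rule prob_space_axioms)
        show "finite K" by (simp add: K_def)
        show "Z1 k \<in> borel_measurable (tmeas T)" if k: "k \<in> K" for k
        proof -
          have "fst k \<in> {1..J}" using k by (auto simp: K_def)
          from g[OF this] have [measurable]: "(\<lambda>t. Dpoly (zc (s (fst k))) Y (tchar t)) \<in> borel_measurable (tmeas T)"
            by (rule gpoly_measurable[of _ _ _ "\<lambda>p t. tchar t p"]) auto
          show ?thesis unfolding Z1_def[abs_def] by measurable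
        qed
        show "Z2 k \<in> borel_measurable M" if k: "k \<in> K" for k
        proof -
          have "fst k \<in> {1..J}" using k by (auto simp: K_def)
          from g[OF this] have [measurable]: "(\<lambda>\<omega>. Dpoly (zc (s (fst k))) Y (Xs \<omega>)) \<in> borel_measurable M"
            by (rule gpoly_measurable) (rule measurable_X)
          show ?thesis unfolding Z2_def[abs_def] by measurable
        qed
        show "8 \<le> n" by fact
        show "1 \<le> P" by fact
        show "\<bar>Z1 k t\<bar> \<le> P / 8" if "k \<in> K" for k t
          unfolding Z1_def using that by (intro order_trans[OF part_le] Dle) (auto simp: K_def)
        show "\<bar>Z2 k \<omega>\<bar> \<le> P / 8" if "k \<in> K" for k \<omega>
          unfolding Z2_def using that norm_X by (intro order_trans[OF part_le] Dle) (auto simp: K_def)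
        show "E1 \<in> sets (tmeas T)" using E1(1) by simp
        show "\<bar>W1 k t - Z1 k t\<bar> \<le> P / n" if t: "t \<in> space (tmeas T) - E1" and k: "k \<in> K" for t k
        proof -
          have tE: "t \<notin> E1" using t by simp
          have j: "fst k \<in> {1..J}" using k by (auto simp: K_def)
          have "\<bar>W1 k t - Z1 k t\<bar> = \<bar>part (snd k) (log_zeta (s (fst k) + \<i> * of_real t) - Dpoly (zc (s (fst k))) Y (tchar t))\<bar>"
            using E1(3)[OF tE] by (simp add: W1_def Z1_def part_diff)
          also have "... \<le> Cz / L" using part_le E1(4)[OF tE j] by (rule order_trans)
          also have "... \<le> Cm / L" using L by (intro divide_right_mono) (auto simp: Cm_def)
          finally show ?thesis using CmP by linarith
        qed
        show "E2 \<in> sets M" by fact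
        show "\<bar>W2 k \<omega> - Z2 k \<omega>\<bar> \<le> P / n" if t: "\<omega> \<in> space M - E2" and k: "k \<in> K" for \<omega> k
        proof -
          have j: "fst k \<in> {1..J}" using k by (auto simp: K_def)
          have "\<bar>W2 k \<omega> - Z2 k \<omega>\<bar> = \<bar>part (snd k) (log_zeta_random (s (fst k)) X \<omega> - Dpoly (zc (s (fst k))) Y (Xs \<omega>))\<bar>"
            by (simp add: W2_def Z2_def part_diff)
          also have "... \<le> Cr / L" using part_le E2(3)[OF t j] by (rule order_trans)
          also have "... \<le> Cm / L" using L by (intro divide_right_mono) (auto simp: Cm_def)
          finally show ?thesis using CmP by linarith
        qed
        show "{t \<in> space (tmeas T). \<forall>k\<in>K. W1 k t \<in> S k} \<in> sets (tmeas T)" using EVm by (simp add: EV_def)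
        show "{\<omega> \<in> space M. \<forall>k\<in>K. W2 k \<omega> \<in> S k} \<in> sets M" using EWm by (simp add: EW_def)
        show "is_interval (S k)" if "k \<in> K" for k by (rule S_iv[OF that])
        show "norm (integral\<^sup>L (tmeas T) (\<lambda>\<omega>. iexp (\<Sum>k\<in>K. u k * Z1 k \<omega>)) - integral\<^sup>L M (\<lambda>\<omega>. iexp (\<Sum>k\<in>K. u k * Z2 k \<omega>))) \<le> \<eta>"
          if u: "\<And>k. k \<in> K \<Longrightarrow> \<bar>u k\<bar> \<le> 4 * pi * n / P" for u
        proof -
          have uH: "\<forall>j\<in>{1..J}. \<bar>u (j, True)\<bar> \<le> H \<and> \<bar>u (j, False)\<bar> \<le> H" using u by (auto simp: H_def K_def)
          show ?thesis unfolding Z1_def Z2_def sumK unfolding T_def Y_def \<eta>_def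
            using ch[unfolded cf_close_def, rule_format, of J s "\<lambda>j. u (j, True)" H "\<lambda>j. u (j, False)"] sR uH H0 JH by blast
        qed
        show "norm (integral\<^sup>L M (\<lambda>\<omega>. iexp (u * Z2 k \<omega>))) \<le> Cd / (1 + u^2)" if k: "k \<in> K" and u: "\<bar>u\<bar> \<le> 4 * pi * n / P" for k u
        proof -
          have j: "fst k \<in> {1..J}" using k by (auto simp: K_def)
          have "\<bar>u\<bar>^2 \<le> L^2" using u HL by (intro power_mono) (auto simp: H_def)
          then have uY: "40 * u^2 \<le> real Y" using Y40 by simp
          have "Z2 k \<omega> = Re ((if snd k then 1 else - \<i>) * Dpoly (zc (s (fst k))) Y (Xs \<omega>))" for \<omega>
            by (simp add: Z2_def part_def)
          then show ?thesis
            using dec[of "if snd k then 1 else - \<i>" "s (fst k)" u Y] bspec[OF s j] \<sigma> uY by simp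
        qed
        show "0 \<le> Cd" using Cd by simp
      qed
      also have "... \<le> Cz * (real J)^2 / L powr \<sigma> + (real J)^2 / L powr \<sigma>
         + 2 * (600 * pi^2 * (72 * Cd * (8 * pi / c0) + 12)) * (real J)^2 / L powr \<sigma> + (real J)^2 / L powr \<sigma>"
      proof (intro add_mono)
        have JL: "real J / L \<le> (real J)^2 / L powr \<sigma>"
          using J0 Ls self_le_power[of "real J" 2] by (intro frac_le) auto
        then have "Cz * (real J / L) \<le> Cz * ((real J)^2 / L powr \<sigma>)" using Cz by (intro mult_left_mono) auto
        then show "measure (tmeas T) E1 \<le> Cz * (real J)^2 / L powr \<sigma>" using E1(2) by simp
        show "prob E2 \<le> (real J)^2 / L powr \<sigma>" using E2(2) JL by linarith
        have \<eta>L: "\<eta> \<le> 1 / L" using f7 by (simp add: \<eta>_def)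
        have "1 / L \<le> real J / L powr \<sigma>" using J0 Ls by (intro frac_le) auto
        then have \<eta>J: "12 * \<eta> \<le> 12 * (real J / L powr \<sigma>)" using \<eta>L by linarith
        have "72 * Cd * (P / real n) \<le> 72 * Cd * (8 * pi / c0 * (real J / L powr \<sigma>))"
          using Pn Cd by (intro mult_left_mono) auto
        then have "72 * Cd * (P / real n) + 12 * \<eta> \<le> 72 * Cd * (8 * pi / c0 * (real J / L powr \<sigma>)) + 12 * (real J / L powr \<sigma>)"
          using \<eta>J by (rule add_mono)
        then have "72 * Cd * (P / real n) + 12 * \<eta> \<le> (72 * Cd * (8 * pi / c0) + 12) * (real J / L powr \<sigma>)"
          by (simp only: distrib_right mult.assoc)
        moreover have "72 * Cd * P / real n = 72 * Cd * (P / real n)" by simp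
        ultimately have "72 * Cd * P / real n + 12 * \<eta> \<le> (72 * Cd * (8 * pi / c0) + 12) * (real J / L powr \<sigma>)"
          by (simp only:)
        then have "real (card K) * (600 * pi^2 * (72 * Cd * P / real n + 12 * \<eta>)) \<le> (2 * real J) * (600 * pi^2 * ((72 * Cd * (8 * pi / c0) + 12) * (real J / L powr \<sigma>)))"
          unfolding cK of_nat_mult of_nat_numeral by (intro mult_left_mono) auto
        also have "... = 2 * (600 * pi^2 * (72 * Cd * (8 * pi / c0) + 12)) * (real J)^2 / L powr \<sigma>"
          by (simp add: power2_eq_square)
        finally show "real (card K) * (600 * pi^2 * (72 * Cd * P / real n + 12 * \<eta>)) \<le> 2 * (600 * pi^2 * (72 * Cd * (8 * pi / c0) + 12)) * (real J)^2 / L powr \<sigma>" .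
        \<comment> \<open>The number of frequencies per coordinate is bounded by a fixed power of
          \<open>L\<close>; with \<open>2 * J \<le> 2 * sqrt L\<close> coordinates the total is
          \<open>exp (O(sqrt L * ln L))\<close>, which \<open>\<eta>\<close> beats.\<close>
        have nb: "4 * (4 * real n + 1) \<le> L powr (2 * A + 2)"
        proof -
          have "x \<le> c0 * P * L powr \<sigma> / 1"
            unfolding x_def using J0 c0 P1 pi_gt3 mult_mono[of 1 "4 * pi" 1 "real J"] by (intro divide_left_mono) auto
          also have "... \<le> 1 * P * L" unfolding div_by_1 using c0 P1 Ls by (intro mult_mono) auto
          finally have "real n \<le> P * L" using n by linarith
          also have "... \<le> (8 * (2 * L powr A)^2) * L"
            unfolding P_def using Yb L by (intro mult_right_mono mult_left_mono power_mono) auto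
          also have "... = 32 * L powr (2 * A + 1)"
          proof -
            have "(L powr A)^2 = L powr (2 * A)" using L by (simp add: powr_power)
            moreover have "L powr (2 * A + 1) = L powr (2 * A) * L" using L unfolding powr_add by simp
            ultimately show ?thesis by (simp only: power_mult_distrib) simp
          qed
          finally have "real n \<le> 32 * L powr (2 * A + 1)" .
          then have "20 * real n \<le> 640 * L powr (2 * A + 1)" by simp
          \<comment> \<open>This is where \<open>L \<ge> 640 = 20 * 32\<close> enters.\<close>
          also have "... \<le> L * L powr (2 * A + 1)" using L640 by (intro mult_right_mono) auto
          also have "... = L powr (2 * A + 2)"
          proof -
            have "L powr (2 * A + 1 + 1) = L powr (2 * A + 1) * L" using L unfolding powr_add[of L "2 * A + 1" 1] by simp
            moreover have "2 * A + 1 + 1 = 2 * A + 2" by simp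
            ultimately show ?thesis by (simp only: mult.commute)
          qed
          finally show ?thesis using n by simp
        qed
        have "real ((4 * (4 * n + 1)) ^ card K) = (4 * (4 * real n + 1)) ^ (2 * J)" by (simp add: cK add.commute)
        also have "... \<le> (L powr (2 * A + 2)) ^ (2 * J)" using nb by (intro power_mono) auto
        also have "... = exp (2 * real J * ((2 * A + 2) * ln L))"
          using L exp_of_nat_mult[of "2 * J" "(2 * A + 2) * ln L"] by (simp add: powr_def mult_ac)
        also have "... \<le> exp (2 * sqrt L * ((2 * A + 2) * ln L))"
        proof -
          have "2 * real J * ((2 * A + 2) * ln L) \<le> 2 * sqrt L * ((2 * A + 2) * ln L)" using Js L A by (intro mult_right_mono) auto
          then show ?thesis by simp
        qed
        finally have "real ((4 * (4 * n + 1)) ^ card K) * \<eta> \<le> exp (2 * sqrt L * ((2 * A + 2) * ln L)) * \<eta>"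
          by (intro mult_right_mono) (auto simp: \<eta>_def)
        also have "... \<le> 1 / L" using f9 by (simp add: \<eta>_def)
        also have "... \<le> real J / L" using J0 L by (intro divide_right_mono) auto
        also note JL
        finally show "real ((4 * (4 * n + 1)) ^ card K) * \<eta> \<le> (real J)^2 / L powr \<sigma>" .
      qed
      also have "... = C * (real J)^2 / L powr \<sigma>" by (simp add: C_def add_divide_distrib[symmetric] distrib_right)
      finally show ?thesis unfolding EV_def[symmetric] EW_def[symmetric] mEV unfolding G_def EW_eq .
    qed
    \<comment> \<open>A bound on each member bounds the supremum only of a nonempty family; empty
      rectangles provide a member.\<close>
    have "{R :: nat \<Rightarrow> complex set. \<forall>j\<in>{1..J}. rectangle (R j)} \<noteq> {}"
    proof -
      have "rectangle {}" unfolding rectangle_def by (intro exI[of _ "{}"]) auto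
      then show ?thesis unfolding ex_in_conv[symmetric] by (intro exI[of _ "\<lambda>_. {}"] CollectI ballI)
    qed
    then show ?case
      unfolding discrepancy_def T_def[symmetric] using main by (intro cSUP_least) auto
    qed
  qed
  then show ?thesis by blast
qed

end

section \<open>From almost sure to pointwise modulus 1, and the conclusion\<close>

text \<open>There are countably many primes, so off one null set all variables agree and with them
  every value of the random logarithm.\<close>

lemma discrepancy_cong_AE:
  assumes X: "\<And>p. prime p \<Longrightarrow> X p \<in> borel_measurable M" and X': "\<And>p. prime p \<Longrightarrow> X' p \<in> borel_measurable M"
    and ae: "\<And>p. prime p \<Longrightarrow> AE w in M. X p w = X' p w"
  shows "discrepancy M X T J s = discrepancy M X' T J s"
proof -
  let ?A = "\<lambda>R X. {w \<in> space M. \<forall>j\<in>{1..J}. log_zeta_random (s j) X w \<in> R j}"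
  have "measure M (?A R X) = measure M (?A R X')"
    if R: "\<forall>j\<in>{1..J}. rectangle (R j)" for R
  proof (rule measure_eq_AE)
    have "AE w in M. \<forall>p\<in>{p. prime p}. X p w = X' p w"
      using ae by (subst AE_ball_countable) (auto intro: countableI_type)
    then show "AE w in M. (w \<in> ?A R X) = (w \<in> ?A R X')"
    proof eventually_elim
      case (elim w)
      then have "log_zeta_random z X w = log_zeta_random z X' w" for z
        unfolding log_zeta_random_def by (simp cong: if_cong)
      then show ?case by simp
    qed
    have "?A R Z \<in> sets M" if "\<And>p. prime p \<Longrightarrow> Z p \<in> borel_measurable M" for Z
    proof (intro sets.sets_Collect_finite_All)
      fix j assume "j \<in> {1..J}"
      then have [measurable]: "R j \<in> sets borel" using R rectangle_borel by auto
      have [measurable]: "log_zeta_random (s j) Z \<in> borel_measurable M" using that by (rule measurable_log_zeta_random)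
      show "{w \<in> space M. log_zeta_random (s j) Z w \<in> R j} \<in> sets M" by measurable
    qed simp
    then show "?A R X \<in> sets M"
      "?A R X' \<in> sets M" using X X' by auto
  qed
  then show ?thesis unfolding discrepancy_def by (intro SUP_cong refl) simp
qed

theorem theorem2p5:
  fixes M :: "'a measure" and X :: "nat \<Rightarrow> 'a \<Rightarrow> complex" and \<sigma> :: real
  assumes "prob_space M"
    and "prob_space.indep_vars M (\<lambda>_. borel) X {p. prime p}"
    and "\<And>p. prime p \<Longrightarrow> distr M borel (X p) = uniform_circle"
    and "1 / 2 < \<sigma>" and "\<sigma> < 1"
  shows "\<exists>C. \<forall>\<^sub>F T in at_top. \<forall>(J :: nat) (s :: nat \<Rightarrow> complex).
    1 \<le> J \<longrightarrow> real J \<le> ln T powr (\<sigma> / 2) \<longrightarrow>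
    Min ((\<lambda>j. Re (s j)) ` {1..J}) = \<sigma> \<longrightarrow>
    Max ((\<lambda>j. Re (s j)) ` {1..J}) < 1 \<longrightarrow>
    Max ((\<lambda>j. \<bar>Im (s j)\<bar>) ` {1..J}) < T powr ((\<sigma> - 1 / 2) / 4) \<longrightarrow>
    discrepancy M X T J s \<le> C * (real J)\<^sup>2 / ln T powr \<sigma>"
proof -
  interpret M: prob_space M by fact
  have Xm: "X p \<in> borel_measurable M" if "prime p" for p
    using assms(2) that by (auto simp: M.indep_vars_def)
  \<comment> \<open>The distribution gives modulus 1 only almost surely. Replacing the other values
    by 1 keeps independence and moments, makes the modulus 1 everywhere as \<open>rmodel\<close>
    asks, and leaves the discrepancy unchanged.\<close>
  define g :: "complex \<Rightarrow> complex" where "g z = (if norm z = 1 then z else 1)" for z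
  have gm [measurable]: "g \<in> borel_measurable borel" unfolding g_def[abs_def] by measurable
  define X' where "X' p w = g (X p w)" for p w
  have X'm: "X' p \<in> borel_measurable M" if "prime p" for p
    unfolding X'_def[abs_def] using Xm[OF that] by measurable
  have ae: "AE w in M. X p w = X' p w" if p: "prime p" for p
  proof -
    have "AE z in distr M borel (X p). norm z = 1" unfolding assms(3)[OF p] by (rule AE_uniform_circle)
    then have "AE w in M. norm (X p w) = 1" by (subst (asm) AE_distr_iff) (use Xm[OF p] in auto)
    then show ?thesis by eventually_elim (simp add: X'_def g_def)
  qed
  interpret rmodel M X'
  proof
    have "M.indep_vars (\<lambda>_. borel) (\<lambda>p w. g (X p w)) {p. prime p}"
      by (rule M.indep_vars_compose2[OF assms(2)]) (rule gm)
    then show "M.indep_vars (\<lambda>_. borel) X' {p. prime p}" unfolding X'_def[abs_def] .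
    show "norm (X' p w) = 1" for p w by (simp add: X'_def g_def)
    fix p m :: nat assume p: "prime p" and m: "0 < m"
    have "M.expectation (\<lambda>w. X' p w ^ m) = M.expectation (\<lambda>w. X p w ^ m)"
      using ae[OF p] X'm[OF p] Xm[OF p] by (intro integral_cong_AE) auto
    also have "... = integral\<^sup>L (distr M borel (X p)) (\<lambda>z. z ^ m)"
      using Xm[OF p] by (subst integral_distr) auto
    also have "... = 0" unfolding assms(3)[OF p] by (rule uniform_circle_power[OF m])
    finally show "M.expectation (\<lambda>w. X' p w ^ m) = 0" .
  qed
  obtain C where C: "\<forall>\<^sub>F L in at_top. discrepancy_small \<sigma> C L"
    using discrepancy_bound[OF assms(4,5)] by blast
  have ev: "\<forall>\<^sub>F T in at_top. discrepancy_small \<sigma> C (ln T)"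
    by (rule eventually_compose_filterlim[OF C ln_at_top])
  show ?thesis
  proof (intro exI[of _ C] eventually_mono[OF eventually_conj[OF ev eventually_gt_at_top[of 0]]] allI impI, goal_cases)
    case (1 T J s)
    then have H: "discrepancy_small \<sigma> C (ln T)" and T: "0 < T" by auto
    note J = 1(2,3) and mn = 1(4) and mx = 1(5) and im = 1(6)
    have "\<forall>j\<in>{1..J}. \<sigma> \<le> Re (s j) \<and> Re (s j) \<le> 1 \<and> \<bar>Im (s j)\<bar> \<le> exp (ln T * ((\<sigma> - 1/2) / 4))"
    proof
      fix j assume j: "j \<in> {1..J}"
      have "\<sigma> \<le> Re (s j)" unfolding mn[symmetric] using j by (intro Min_le) auto
      moreover have "Re (s j) \<le> Max ((\<lambda>j. Re (s j)) ` {1..J})" using j by (intro Max_ge) auto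
      moreover have "\<bar>Im (s j)\<bar> \<le> Max ((\<lambda>j. \<bar>Im (s j)\<bar>) ` {1..J})" using j by (intro Max_ge) auto
      moreover have "T powr ((\<sigma> - 1 / 2) / 4) = exp (ln T * ((\<sigma> - 1/2) / 4))" using T by (simp add: powr_def mult.commute)
      ultimately show "\<sigma> \<le> Re (s j) \<and> Re (s j) \<le> 1 \<and> \<bar>Im (s j)\<bar> \<le> exp (ln T * ((\<sigma> - 1/2) / 4))" using mx im by auto
    qed
    with H[unfolded discrepancy_small_def] J have "discrepancy M X' (exp (ln T)) J s \<le> C * (real J)^2 / ln T powr \<sigma>" by blast
    then show ?case
      using T discrepancy_cong_AE[of X M X' T J s, OF Xm X'm ae] by simp
  qed
qed

end
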